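(* Let $V$ be a diffeological vector space. Then there is a natural isomorphism (natural in the diffeological space $B$) $$\mathrm{assoc} : \mathrm{Prin}_{\mathrm{GL}(V)}(B) \to \mathrm{VB}_V(B), \qquad [E \to B] \mapsto [E \times_{\mathrm{GL}(V)} V \to B],$$ which restricts to a natural isomorphism $\mathrm{assoc} : \mathrm{Prin}_{\mathrm{GL}(V)}^D(B) \to \mathrm{VB}_V^D(B)$.
   Context: A diffeological space is a set $X$ with a specified set of functions $U \to X$ (plots) for each open $U \subseteq \mathbb{R}^n$, $n \in \mathbb{N}$, such that constant functions are plots, precomposing a plot $U\to X$ with a smooth map $U' \to U$ between open subsets of Euclidean spaces gives a plot, and a function $U\to X$ that is locally a plot is a plot. A map $f : X \to Y$ is smooth if $f\circ p$ is a plot of $Y$ for every plot $p$ of $X$; a diffeomorphism is an invertible smooth map with smooth inverse. $\mathbb{R}$ carries the standard diffeology (plots are the usual smooth maps). A function into a product is a plot iff its components are; subsets carry the sub-diffeology (plots of the ambient space landing in the subset); a quotient $X/{\sim}$ has the quotient diffeology (functions that locally lift to plots of $X$). A subset $A \subseteq X$ is $D$-open if $p^{-1}(A)$ is open for every plot $p$; these sets form the $D$-topology. A diffeological group is a diffeological space with a group structure whose operations are smooth. Let $G$ be a diffeological group, $\pi : E \to B$ a smooth map, and let $G$ act smoothly on $E$ from the right with $\pi(x\cdot g)=\pi(x)$. Then $\pi$ is a trivial principal $G$-bundle if there is a $G$-equivariant diffeomorphism $E \to B \times G$ over $B$ (with $(b,g)\cdot g' = (b,gg')$); locally trivial if $B$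 has a $D$-open cover $\{B_i\}$ such that each $\pi^{-1}(B_i) \to B_i$ is trivial; and a principal $G$-bundle if its pullback along every plot of $B$ is a locally trivial principal $G$-bundle. Isomorphisms are $G$-equivariant diffeomorphisms over $B$. A diffeological vector space is a diffeological space with an $\mathbb{R}$-vector space structure whose addition and scalar multiplication are smooth. A diffeological vector space over $B$ is a smooth map $\pi : E \to B$ with a vector space structure on each fiber $\pi^{-1}(b)$ such that addition $E \times_B E \to E$, scalar multiplication $\mathbb{R} \times E \to E$ and the zero section $B \to E$ are smooth. It is trivial of fiber type $V$ if there is a diffeomorphism $E \to B \times V$ over $B$ restricting on each fiber to an isomorphism $\pi^{-1}(b) \to V$ of diffeological vector spaces; locally trivial of fiber type $V$ if this holds over each member of some $D$-open cover of $B$; and a vector bundle of fiber type $V$ if its pullback along every plot of $B$ is locally trivial of fiber type $V$. Isomorphisms of vector bundles over $B$ are diffeomorphisms of total spaces over $B$ that are linear on fibers. A smooth partition of unity on $X$ is a family of smooth functions $\mu_i : X \to \mathbb{R}$, $i \in I$, with $\mu_i \geq 0$, with $\{\operatorname{supp}(\mu_i)\}$ locally finite (each point has a $D$-open neighbourhood meeting only finitely many of them) and $\sum_i \mu_i = 1$, where $\operatorname{supp}(\mu_i)$ is the closure of $\mu_i^{-1}((0,\infty))$ in the $D$-topology. It is subordinate to $\{X_i\}_{i\in I}$ if $\operatorname{supp}(\mu_i) \subseteq X_i$ for each $i$. A principal $G$-bundle (resp. vector bundle of fiber type $V$) over $B$ is $D$-numerable if there is a smooth partition of unity subordinate to a $D$-open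 cover $\{B_i\}$ of $B$ such that its restriction to each $B_i$ is a trivial principal $G$-bundle (resp. trivial of fiber type $V$). $\mathrm{Prin}_G(B)$ and $\mathrm{Prin}_G^D(B)$ are the sets of isomorphism classes of all, resp. $D$-numerable, principal $G$-bundles over $B$; $\mathrm{VB}_V(B)$ and $\mathrm{VB}_V^D(B)$ are the sets of isomorphism classes of all, resp. $D$-numerable, vector bundles of fiber type $V$ over $B$. All are contravariantly functorial in $B$ via pullback. $\mathrm{GL}(V)$ is the diffeological group of smooth linear isomorphisms $V \to V$ with smooth inverse, in which $p : U \to \mathrm{GL}(V)$ is a plot iff $(u,v) \mapsto p(u)(v)$ and $(u,v) \mapsto (p(u))^{-1}(v)$ are smooth maps $U \times V \to V$. Given a principal $\mathrm{GL}(V)$-bundle $r : E \to B$, $E \times_{\mathrm{GL}(V)} V = (E \times V)/{\sim}$, where $(y,v) \sim (y \cdot g, g^{-1}(v))$ for all $g \in \mathrm{GL}(V)$, with projection $[y,v] \mapsto r(y)$, scalar multiplication $\alpha[y,v] = [y,\alpha v]$, addition $[y,v] + [y',v'] = [y, v + g(v')]$ where $y' = y \cdot g$, and zero section $b \mapsto [y,0]$ for any $y \in r^{-1}(b)$. This is a vector bundle of fiber type $V$, $D$-numerable if $r$ is. *)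

theory Defs
  imports
    "HOL-Analysis.Analysis"
    "HOL-Algebra.Module"
    "HOL-Algebra.Bij"
begin

section \<open>Smooth maps between open subsets of Euclidean spaces\<close>

text \<open>
  Since the dimension varies, a point of $R^n$ is a sequence that vanishes from index n on; this
  is the carrier of the library's Euclidean space topology.
\<close>

type_synonym coords = "nat \<Rightarrow> real"

definition partial_deriv :: "nat \<Rightarrow> (coords \<Rightarrow> real) \<Rightarrow> coords \<Rightarrow> real" where
  "partial_deriv i f x = deriv (\<lambda>t. f (x(i := t))) (x i)"

primrec Ck_on :: "nat \<Rightarrow> nat \<Rightarrow> coords set \<Rightarrow> (coords \<Rightarrow> real) \<Rightarrow> bool" where
  "Ck_on 0 n U f \<longleftrightarrow>
     continuous_map (subtopology (Euclidean_space n) U) euclideanreal f"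
| "Ck_on (Suc k) n U f \<longleftrightarrow>
     continuous_map (subtopology (Euclidean_space n) U) euclideanreal f \<and>
     (\<forall>i<n. (\<forall>x\<in>U. (\<lambda>t. f (x(i := t))) differentiable (at (x i))) \<and>
            Ck_on k n U (partial_deriv i f))"

definition smooth_fun :: "nat \<Rightarrow> coords set \<Rightarrow> (coords \<Rightarrow> real) \<Rightarrow> bool" where
  "smooth_fun n U f \<longleftrightarrow> openin (Euclidean_space n) U \<and> (\<forall>k. Ck_on k n U f)"

definition smooth_between ::
  "nat \<Rightarrow> coords set \<Rightarrow> nat \<Rightarrow> coords set \<Rightarrow> (coords \<Rightarrow> coords) \<Rightarrow> bool" where
  "smooth_between m W n U h \<longleftrightarrow>
     openin (Euclidean_space m) W \<and> openin (Euclidean_space n) U \<and> h ` W \<subseteq> U \<and>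
     (\<forall>j<n. smooth_fun m W (\<lambda>x. h x j))"


section \<open>Diffeological spaces\<close>

text \<open>
  The set of plots with domain U, an open subset of $R^n$, is given by total functions of which
  only the values on U are relevant.
\<close>

record 'a diffspace =
  points :: "'a set"
  plots :: "nat \<Rightarrow> coords set \<Rightarrow> (coords \<Rightarrow> 'a) set"

text \<open>
  The locality axiom asks for local agreement with plots rather than for restrictions being
  plots, so it also says that being a plot depends only on the values on the domain.
\<close>

definition diffeological_space :: "'a diffspace \<Rightarrow> bool" where
  "diffeological_space X \<longleftrightarrow>
     (\<forall>n U p. p \<in> plots X n U \<longrightarrow> openin (Euclidean_space n) U \<and> p ` U \<subseteq> points X) \<and>
     (\<forall>n U x. openin (Euclidean_space n) U \<longrightarrow> x \<in> points X \<longrightarrow> (\<lambda>_. x) \<in> plots X n U) \<and>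
     (\<forall>n U p m W h. p \<in> plots X n U \<longrightarrow> smooth_between m W n U h \<longrightarrow> p \<circ> h \<in> plots X m W) \<and>
     (\<forall>n U p. openin (Euclidean_space n) U \<longrightarrow>
        (\<forall>u\<in>U. \<exists>W. openin (Euclidean_space n) W \<and> u \<in> W \<and> W \<subseteq> U \<and>
                    (\<exists>q\<in>plots X n W. \<forall>w\<in>W. p w = q w)) \<longrightarrow>
        p \<in> plots X n U)"

definition smooth_map :: "'a diffspace \<Rightarrow> 'b diffspace \<Rightarrow> ('a \<Rightarrow> 'b) \<Rightarrow> bool" where
  "smooth_map X Y f \<longleftrightarrow>
     f ` points X \<subseteq> points Y \<and> (\<forall>n U. \<forall>p\<in>plots X n U. f \<circ> p \<in> plots Y n U)"

definition diffeomorphism :: "'a diffspace \<Rightarrow> 'b diffspace \<Rightarrow> ('a \<Rightarrow> 'b) \<Rightarrow> bool" where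
  "diffeomorphism X Y f \<longleftrightarrow>
     smooth_map X Y f \<and>
     (\<exists>g. smooth_map Y X g \<and> (\<forall>x\<in>points X. g (f x) = x) \<and> (\<forall>y\<in>points Y. f (g y) = y))"

definition real_space :: "real diffspace" where
  "real_space = \<lparr>points = UNIV, plots = (\<lambda>n U. {f. smooth_fun n U f})\<rparr>"

definition domain_space :: "nat \<Rightarrow> coords set \<Rightarrow> coords diffspace" where
  "domain_space n U = \<lparr>points = U, plots = (\<lambda>m W. {h. smooth_between m W n U h})\<rparr>"

definition prod_space :: "'a diffspace \<Rightarrow> 'b diffspace \<Rightarrow> ('a \<times> 'b) diffspace" where
  "prod_space X Y =
     \<lparr>points = points X \<times> points Y,
      plots = (\<lambda>n U. {p. fst \<circ> p \<in> plots X n U \<and> snd \<circ> p \<in> plots Y n U})\<rparr>"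

definition sub_space :: "'a diffspace \<Rightarrow> 'a set \<Rightarrow> 'a diffspace" where
  "sub_space X A =
     \<lparr>points = points X \<inter> A, plots = (\<lambda>n U. {p \<in> plots X n U. p ` U \<subseteq> A})\<rparr>"

definition quotient_space :: "'a diffspace \<Rightarrow> ('a \<times> 'a) set \<Rightarrow> 'a set diffspace" where
  "quotient_space X R =
     \<lparr>points = points X // R,
      plots = (\<lambda>n U. {p. openin (Euclidean_space n) U \<and>
         (\<forall>u\<in>U. \<exists>W. openin (Euclidean_space n) W \<and> u \<in> W \<and> W \<subseteq> U \<and>
                     (\<exists>q\<in>plots X n W. \<forall>w\<in>W. p w = R `` {q w}))})\<rparr>"

definition D_open :: "'a diffspace \<Rightarrow> 'a set \<Rightarrow> bool" where
  "D_open X A \<longleftrightarrow>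
     A \<subseteq> points X \<and> (\<forall>n U. \<forall>p\<in>plots X n U. openin (Euclidean_space n) {u \<in> U. p u \<in> A})"

definition D_topology :: "'a diffspace \<Rightarrow> 'a topology" where
  "D_topology X = topology (D_open X)"

lemma openin_D_topology: "openin (D_topology X) = D_open X"
proof -
  have "istopology (D_open X)"
    unfolding istopology_def
  proof (intro conjI allI impI)
    fix S T assume "D_open X S" "D_open X T"
    moreover have "{u \<in> U. p u \<in> S \<inter> T} = {u \<in> U. p u \<in> S} \<inter> {u \<in> U. p u \<in> T}"
      for U :: "coords set" and p by auto
    ultimately show "D_open X (S \<inter> T)"
      unfolding D_open_def by auto
  next
    fix K assume K: "\<forall>S\<in>K. D_open X S"
    have "{u \<in> U. p u \<in> \<Union>K} = (\<Union>S\<in>K. {u \<in> U. p u \<in> S})"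
      for U :: "coords set" and p by auto
    with K show "D_open X (\<Union>K)"
      unfolding D_open_def by (auto intro!: openin_Union)
  qed
  then show ?thesis
    by (simp add: D_topology_def topology_inverse')
qed


section \<open>Partitions of unity\<close>

definition D_support :: "'a diffspace \<Rightarrow> ('a \<Rightarrow> real) \<Rightarrow> 'a set" where
  "D_support X \<mu> = D_topology X closure_of {x \<in> points X. 0 < \<mu> x}"

definition smooth_partition_of_unity :: "'a diffspace \<Rightarrow> 'i set \<Rightarrow> ('i \<Rightarrow> 'a \<Rightarrow> real) \<Rightarrow> bool" where
  "smooth_partition_of_unity X I \<mu> \<longleftrightarrow>
     (\<forall>i\<in>I. smooth_map X real_space (\<mu> i) \<and> (\<forall>x\<in>points X. 0 \<le> \<mu> i x)) \<and>
     (\<forall>x\<in>points X. \<exists>W. D_open X W \<and> x \<in> W \<and> finite {i \<in> I. W \<inter> D_support X (\<mu> i) \<noteq> {}}) \<and>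
     (\<forall>x\<in>points X. (\<Sum>i | i \<in> I \<and> \<mu> i x \<noteq> 0. \<mu> i x) = 1)"

text \<open>
  Common form of the two notions of D-numerability: Triv A says that the bundle is trivial over A.
  Index sets are taken inside \<^typ>\<open>'a \<times> nat\<close>, which is no loss: after discarding the indices with
  zero function, map each index to a point where its function is positive; by local finiteness
  this is finite-to-one.
\<close>

definition D_numerable_cover :: "'a diffspace \<Rightarrow> ('a set \<Rightarrow> bool) \<Rightarrow> bool" where
  "D_numerable_cover X Triv \<longleftrightarrow>
     (\<exists>(I :: ('a \<times> nat) set) A \<mu>.
        (\<forall>i\<in>I. D_open X (A i)) \<and> (\<Union>i\<in>I. A i) = points X \<and>
        smooth_partition_of_unity X I \<mu> \<and>
        (\<forall>i\<in>I. D_support X (\<mu> i) \<subseteq> A i) \<and>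
        (\<forall>i\<in>I. Triv (A i)))"


section \<open>Principal bundles\<close>

record 'g diffgroup = "'g monoid" +
  gspace :: "'g diffspace"

definition diffeological_group :: "'g diffgroup \<Rightarrow> bool" where
  "diffeological_group G \<longleftrightarrow>
     group G \<and> diffeological_space (gspace G) \<and> points (gspace G) = carrier G \<and>
     smooth_map (prod_space (gspace G) (gspace G)) (gspace G) (\<lambda>(g, h). g \<otimes>\<^bsub>G\<^esub> h) \<and>
     smooth_map (gspace G) (gspace G) (\<lambda>g. inv\<^bsub>G\<^esub> g)"

record ('b, 'e, 'g) gbundle =
  gtotal :: "'e diffspace"
  gproj :: "'e \<Rightarrow> 'b"
  gact :: "'e \<Rightarrow> 'g \<Rightarrow> 'e"

definition gspace_over :: "'g diffgroup \<Rightarrow> 'b diffspace \<Rightarrow> ('b, 'e, 'g) gbundle \<Rightarrow> bool" where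
  "gspace_over G B P \<longleftrightarrow>
     diffeological_group G \<and> diffeological_space B \<and> diffeological_space (gtotal P) \<and>
     smooth_map (gtotal P) B (gproj P) \<and>
     smooth_map (prod_space (gtotal P) (gspace G)) (gtotal P) (\<lambda>(x, g). gact P x g) \<and>
     (\<forall>x\<in>points (gtotal P). gact P x \<one>\<^bsub>G\<^esub> = x) \<and>
     (\<forall>x\<in>points (gtotal P). \<forall>g\<in>carrier G. \<forall>h\<in>carrier G.
        gact P (gact P x g) h = gact P x (g \<otimes>\<^bsub>G\<^esub> h)) \<and>
     (\<forall>x\<in>points (gtotal P). \<forall>g\<in>carrier G. gproj P (gact P x g) = gproj P x)"

definition gbundle_iso ::
  "'g diffgroup \<Rightarrow> ('b, 'e, 'g) gbundle \<Rightarrow> ('b, 'f, 'g) gbundle \<Rightarrow> bool" where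
  "gbundle_iso G P Q \<longleftrightarrow>
     (\<exists>\<phi>. diffeomorphism (gtotal P) (gtotal Q) \<phi> \<and>
          (\<forall>x\<in>points (gtotal P). gproj Q (\<phi> x) = gproj P x) \<and>
          (\<forall>x\<in>points (gtotal P). \<forall>g\<in>carrier G. \<phi> (gact P x g) = gact Q (\<phi> x) g))"

definition product_gbundle :: "'g diffgroup \<Rightarrow> 'b diffspace \<Rightarrow> ('b, 'b \<times> 'g, 'g) gbundle" where
  "product_gbundle G B =
     \<lparr>gtotal = prod_space B (gspace G), gproj = fst, gact = (\<lambda>(b, g) h. (b, g \<otimes>\<^bsub>G\<^esub> h))\<rparr>"

definition trivial_gbundle :: "'g diffgroup \<Rightarrow> 'b diffspace \<Rightarrow> ('b, 'e, 'g) gbundle \<Rightarrow> bool" where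
  "trivial_gbundle G B P \<longleftrightarrow> gbundle_iso G P (product_gbundle G B)"

definition restrict_gbundle :: "'b set \<Rightarrow> ('b, 'e, 'g) gbundle \<Rightarrow> ('b, 'e, 'g) gbundle" where
  "restrict_gbundle A P = P\<lparr>gtotal := sub_space (gtotal P) {x. gproj P x \<in> A}\<rparr>"

definition pullback_gbundle ::
  "'c diffspace \<Rightarrow> ('c \<Rightarrow> 'b) \<Rightarrow> ('b, 'e, 'g) gbundle \<Rightarrow> ('c, 'c \<times> 'e, 'g) gbundle" where
  "pullback_gbundle C f P =
     \<lparr>gtotal = sub_space (prod_space C (gtotal P)) {(c, x). f c = gproj P x},
      gproj = fst,
      gact = (\<lambda>(c, x) g. (c, gact P x g))\<rparr>"

definition trivial_gbundle_over ::
  "'g diffgroup \<Rightarrow> 'b diffspace \<Rightarrow> ('b, 'e, 'g) gbundle \<Rightarrow> 'b set \<Rightarrow> bool" where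
  "trivial_gbundle_over G B P A \<longleftrightarrow> trivial_gbundle G (sub_space B A) (restrict_gbundle A P)"

definition locally_trivial_gbundle ::
  "'g diffgroup \<Rightarrow> 'b diffspace \<Rightarrow> ('b, 'e, 'g) gbundle \<Rightarrow> bool" where
  "locally_trivial_gbundle G B P \<longleftrightarrow>
     (\<exists>\<A>. (\<forall>A\<in>\<A>. D_open B A) \<and> \<Union>\<A> = points B \<and> (\<forall>A\<in>\<A>. trivial_gbundle_over G B P A))"

definition principal_bundle :: "'g diffgroup \<Rightarrow> 'b diffspace \<Rightarrow> ('b, 'e, 'g) gbundle \<Rightarrow> bool" where
  "principal_bundle G B P \<longleftrightarrow>
     gspace_over G B P \<and>
     (\<forall>n U. \<forall>p\<in>plots B n U.
        locally_trivial_gbundle G (domain_space n U) (pullback_gbundle (domain_space n U) p P))"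

definition D_numerable_gbundle ::
  "'g diffgroup \<Rightarrow> 'b diffspace \<Rightarrow> ('b, 'e, 'g) gbundle \<Rightarrow> bool" where
  "D_numerable_gbundle G B P \<longleftrightarrow> D_numerable_cover B (trivial_gbundle_over G B P)"

text \<open>
  To form the set of isomorphism classes, total spaces must range over one type. The total space
  of a principal G-bundle over B has the cardinality of the product of B and G, so every
  isomorphism class is represented on the type \<^typ>\<open>'b \<times> 'g\<close>. The class of a bundle P whose
  total space has any type is the set of bundles on \<^typ>\<open>'b \<times> 'g\<close> isomorphic to P.
\<close>

definition prin_class ::
  "'g diffgroup \<Rightarrow> 'b diffspace \<Rightarrow> ('b, 'e, 'g) gbundle \<Rightarrow> ('b, 'b \<times> 'g, 'g) gbundle set" where
  "prin_class G B P = {Q. principal_bundle G B Q \<and> gbundle_iso G P Q}"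

definition Prin :: "'g diffgroup \<Rightarrow> 'b diffspace \<Rightarrow> ('b, 'b \<times> 'g, 'g) gbundle set set" where
  "Prin G B = {prin_class G B P | P :: ('b, 'b \<times> 'g, 'g) gbundle. principal_bundle G B P}"

definition Prin_D :: "'g diffgroup \<Rightarrow> 'b diffspace \<Rightarrow> ('b, 'b \<times> 'g, 'g) gbundle set set" where
  "Prin_D G B = {prin_class G B P | P :: ('b, 'b \<times> 'g, 'g) gbundle.
     principal_bundle G B P \<and> D_numerable_gbundle G B P}"

text \<open>
  The map on classes induced by an operation on bundles that respects isomorphism is given by the
  union over all representatives (all the classes in the union then coincide).
\<close>

definition Prin_pullback ::
  "'g diffgroup \<Rightarrow> 'c diffspace \<Rightarrow> ('c \<Rightarrow> 'b) \<Rightarrow>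
   ('b, 'b \<times> 'g, 'g) gbundle set \<Rightarrow> ('c, 'c \<times> 'g, 'g) gbundle set" where
  "Prin_pullback G C f K = (\<Union>P\<in>K. prin_class G C (pullback_gbundle C f P))"


section \<open>Diffeological vector spaces and vector bundles\<close>

definition real_ring :: "real ring" where
  "real_ring = \<lparr>carrier = UNIV, mult = (*), one = 1, zero = 0, add = (+)\<rparr>"

text \<open>
  A real vector space is a module over the ring of reals; the multiplicative fields that the
  library's module record inherits from rings are irrelevant.
\<close>

definition real_vector_space_on ::
  "'a set \<Rightarrow> ('a \<Rightarrow> 'a \<Rightarrow> 'a) \<Rightarrow> (real \<Rightarrow> 'a \<Rightarrow> 'a) \<Rightarrow> 'a \<Rightarrow> bool" where
  "real_vector_space_on S pls scl z \<longleftrightarrow>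
     Module.module real_ring
       \<lparr>carrier = S, mult = undefined, one = undefined, zero = z, add = pls, smult = scl\<rparr>"

record 'v dvs =
  vspace :: "'v diffspace"
  vadd :: "'v \<Rightarrow> 'v \<Rightarrow> 'v"
  vscale :: "real \<Rightarrow> 'v \<Rightarrow> 'v"
  vzero :: 'v

definition diffeological_vector_space :: "'v dvs \<Rightarrow> bool" where
  "diffeological_vector_space V \<longleftrightarrow>
     diffeological_space (vspace V) \<and>
     real_vector_space_on (points (vspace V)) (vadd V) (vscale V) (vzero V) \<and>
     smooth_map (prod_space (vspace V) (vspace V)) (vspace V) (\<lambda>(v, w). vadd V v w) \<and>
     smooth_map (prod_space real_space (vspace V)) (vspace V) (\<lambda>(a, v). vscale V a v)"

definition dvs_linear :: "'v dvs \<Rightarrow> 'w dvs \<Rightarrow> ('v \<Rightarrow> 'w) \<Rightarrow> bool" where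
  "dvs_linear V W f \<longleftrightarrow>
     (\<forall>v\<in>points (vspace V). \<forall>w\<in>points (vspace V). f (vadd V v w) = vadd W (f v) (f w)) \<and>
     (\<forall>a. \<forall>v\<in>points (vspace V). f (vscale V a v) = vscale W a (f v))"

definition dvs_isomorphism :: "'v dvs \<Rightarrow> 'w dvs \<Rightarrow> ('v \<Rightarrow> 'w) \<Rightarrow> bool" where
  "dvs_isomorphism V W f \<longleftrightarrow> diffeomorphism (vspace V) (vspace W) f \<and> dvs_linear V W f"

text \<open>As in the library's group of bijections, elements are functions extensional on V.\<close>

definition GL :: "'v dvs \<Rightarrow> ('v \<Rightarrow> 'v) diffgroup" where
  "GL V =
    (let S = points (vspace V); A = {g \<in> Bij S. dvs_isomorphism V V g}
     in \<lparr>carrier = A, mult = mult (BijGroup S), one = one (BijGroup S),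
         gspace =
          \<lparr>points = A,
           plots = (\<lambda>n U. {p. openin (Euclidean_space n) U \<and> p ` U \<subseteq> A \<and>
              smooth_map (prod_space (domain_space n U) (vspace V)) (vspace V)
                (\<lambda>(u, v). p u v) \<and>
              smooth_map (prod_space (domain_space n U) (vspace V)) (vspace V)
                (\<lambda>(u, v). inv_into S (p u) v)})\<rparr>\<rparr>)"

record ('b, 'e) vbundle =
  btotal :: "'e diffspace"
  bproj :: "'e \<Rightarrow> 'b"
  badd :: "'e \<Rightarrow> 'e \<Rightarrow> 'e"
  bscale :: "real \<Rightarrow> 'e \<Rightarrow> 'e"
  bzero :: "'b \<Rightarrow> 'e"

definition fiber :: "('b, 'e) vbundle \<Rightarrow> 'b \<Rightarrow> 'e dvs" where
  "fiber F b =
     \<lparr>vspace = sub_space (btotal F) {x. bproj F x = b},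
      vadd = badd F, vscale = bscale F, vzero = bzero F b\<rparr>"

definition dvs_over :: "'b diffspace \<Rightarrow> ('b, 'e) vbundle \<Rightarrow> bool" where
  "dvs_over B F \<longleftrightarrow>
     diffeological_space B \<and> diffeological_space (btotal F) \<and>
     smooth_map (btotal F) B (bproj F) \<and>
     (\<forall>b\<in>points B. real_vector_space_on (points (vspace (fiber F b)))
                      (badd F) (bscale F) (bzero F b)) \<and>
     smooth_map (sub_space (prod_space (btotal F) (btotal F)) {(x, y). bproj F x = bproj F y})
       (btotal F) (\<lambda>(x, y). badd F x y) \<and>
     smooth_map (prod_space real_space (btotal F)) (btotal F) (\<lambda>(a, x). bscale F a x) \<and>
     smooth_map B (btotal F) (bzero F)"

definition vbundle_iso :: "'b diffspace \<Rightarrow> ('b, 'e) vbundle \<Rightarrow> ('b, 'f) vbundle \<Rightarrow> bool" where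
  "vbundle_iso B F F' \<longleftrightarrow>
     (\<exists>\<phi>. diffeomorphism (btotal F) (btotal F') \<phi> \<and>
          (\<forall>x\<in>points (btotal F). bproj F' (\<phi> x) = bproj F x) \<and>
          (\<forall>b\<in>points B. dvs_linear (fiber F b) (fiber F' b) \<phi>))"

definition trivial_vbundle :: "'v dvs \<Rightarrow> 'b diffspace \<Rightarrow> ('b, 'e) vbundle \<Rightarrow> bool" where
  "trivial_vbundle V B F \<longleftrightarrow>
     (\<exists>\<phi>. diffeomorphism (btotal F) (prod_space B (vspace V)) \<phi> \<and>
          (\<forall>x\<in>points (btotal F). fst (\<phi> x) = bproj F x) \<and>
          (\<forall>b\<in>points B. dvs_isomorphism (fiber F b) V (snd \<circ> \<phi>)))"

definition restrict_vbundle :: "'b set \<Rightarrow> ('b, 'e) vbundle \<Rightarrow> ('b, 'e) vbundle" where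
  "restrict_vbundle A F = F\<lparr>btotal := sub_space (btotal F) {x. bproj F x \<in> A}\<rparr>"

definition pullback_vbundle ::
  "'c diffspace \<Rightarrow> ('c \<Rightarrow> 'b) \<Rightarrow> ('b, 'e) vbundle \<Rightarrow> ('c, 'c \<times> 'e) vbundle" where
  "pullback_vbundle C f F =
     \<lparr>btotal = sub_space (prod_space C (btotal F)) {(c, x). f c = bproj F x},
      bproj = fst,
      badd = (\<lambda>(c, x) (c', y). (c, badd F x y)),
      bscale = (\<lambda>a (c, x). (c, bscale F a x)),
      bzero = (\<lambda>c. (c, bzero F (f c)))\<rparr>"

definition trivial_vbundle_over ::
  "'v dvs \<Rightarrow> 'b diffspace \<Rightarrow> ('b, 'e) vbundle \<Rightarrow> 'b set \<Rightarrow> bool" where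
  "trivial_vbundle_over V B F A \<longleftrightarrow> trivial_vbundle V (sub_space B A) (restrict_vbundle A F)"

definition locally_trivial_vbundle :: "'v dvs \<Rightarrow> 'b diffspace \<Rightarrow> ('b, 'e) vbundle \<Rightarrow> bool" where
  "locally_trivial_vbundle V B F \<longleftrightarrow>
     (\<exists>\<A>. (\<forall>A\<in>\<A>. D_open B A) \<and> \<Union>\<A> = points B \<and> (\<forall>A\<in>\<A>. trivial_vbundle_over V B F A))"

definition vector_bundle :: "'v dvs \<Rightarrow> 'b diffspace \<Rightarrow> ('b, 'e) vbundle \<Rightarrow> bool" where
  "vector_bundle V B F \<longleftrightarrow>
     dvs_over B F \<and>
     (\<forall>n U. \<forall>p\<in>plots B n U.
        locally_trivial_vbundle V (domain_space n U) (pullback_vbundle (domain_space n U) p F))"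

definition D_numerable_vbundle :: "'v dvs \<Rightarrow> 'b diffspace \<Rightarrow> ('b, 'e) vbundle \<Rightarrow> bool" where
  "D_numerable_vbundle V B F \<longleftrightarrow> D_numerable_cover B (trivial_vbundle_over V B F)"

text \<open>
  As for principal bundles, every isomorphism class of vector bundles of fiber type V over B is
  represented on the type \<^typ>\<open>'b \<times> 'v\<close>.
\<close>

definition vb_class ::
  "'v dvs \<Rightarrow> 'b diffspace \<Rightarrow> ('b, 'e) vbundle \<Rightarrow> ('b, 'b \<times> 'v) vbundle set" where
  "vb_class V B F = {F'. vector_bundle V B F' \<and> vbundle_iso B F F'}"

definition VB :: "'v dvs \<Rightarrow> 'b diffspace \<Rightarrow> ('b, 'b \<times> 'v) vbundle set set" where
  "VB V B = {vb_class V B F | F :: ('b, 'b \<times> 'v) vbundle. vector_bundle V B F}"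

definition VB_D :: "'v dvs \<Rightarrow> 'b diffspace \<Rightarrow> ('b, 'b \<times> 'v) vbundle set set" where
  "VB_D V B = {vb_class V B F | F :: ('b, 'b \<times> 'v) vbundle.
     vector_bundle V B F \<and> D_numerable_vbundle V B F}"

definition VB_pullback ::
  "'v dvs \<Rightarrow> 'c diffspace \<Rightarrow> ('c \<Rightarrow> 'b) \<Rightarrow>
   ('b, 'b \<times> 'v) vbundle set \<Rightarrow> ('c, 'c \<times> 'v) vbundle set" where
  "VB_pullback V C f K = (\<Union>F\<in>K. vb_class V C (pullback_vbundle C f F))"


section \<open>The associated vector bundle\<close>

definition assoc_rel ::
  "'v dvs \<Rightarrow> ('b, 'e, 'v \<Rightarrow> 'v) gbundle \<Rightarrow> (('e \<times> 'v) \<times> ('e \<times> 'v)) set" where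
  "assoc_rel V P =
     {((y, v), (gact P y g, inv_into (points (vspace V)) g v)) | y v g.
        y \<in> points (gtotal P) \<and> v \<in> points (vspace V) \<and> g \<in> carrier (GL V)}"

text \<open>
  Points of the total space are equivalence classes. Each operation is the image under the relation
  of the set of all values obtained from representatives; all these values are equivalent, so the
  image is a single class.
\<close>

definition assoc_bundle ::
  "'v dvs \<Rightarrow> ('b, 'e, 'v \<Rightarrow> 'v) gbundle \<Rightarrow> ('b, ('e \<times> 'v) set) vbundle" where
  "assoc_bundle V P =
     \<lparr>btotal = quotient_space (prod_space (gtotal P) (vspace V)) (assoc_rel V P),
      bproj = (\<lambda>c. the_elem ((\<lambda>(y, v). gproj P y) ` c)),
      badd = (\<lambda>c c'. assoc_rel V P ``
        {(y, vadd V v (g v')) | y v g v'.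
           (y, v) \<in> c \<and> g \<in> carrier (GL V) \<and> (gact P y g, v') \<in> c'}),
      bscale = (\<lambda>a c. assoc_rel V P `` {(y, vscale V a v) | y v. (y, v) \<in> c}),
      bzero = (\<lambda>b. assoc_rel V P `` {(y, vzero V) | y. y \<in> points (gtotal P) \<and> gproj P y = b})\<rparr>"

definition assoc ::
  "'v dvs \<Rightarrow> 'b diffspace \<Rightarrow>
   ('b, 'b \<times> ('v \<Rightarrow> 'v), 'v \<Rightarrow> 'v) gbundle set \<Rightarrow> ('b, 'b \<times> 'v) vbundle set" where
  "assoc V B K = (\<Union>P\<in>K. vb_class V B (assoc_bundle V P))"

end

theory Submission
  imports Defs
begin

text \<open>
  Principal GL(V)-bundles and vector bundles of fiber type V determine each other because a vector
  bundle is determined by its frames. A frame of a vector bundle F over a point b is a linear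
  isomorphism from V to the fiber over b; all frames of F form a bundle on which GL(V) acts by
  precomposition, and a vector is recovered from a frame and its coordinates in that frame.

  The proof compares P and F through a pairing (\<open>frame_pairing\<close>): a map ev that sends each point y of
  P to a frame ev y of F over the same base point, smoothly and with smooth inverse, such that
  ev (y g) is the composite of ev y with g, and such that P represents smooth frames, that is,
  each smooth frame of F along a plot p of the base is ev composed with a unique lift of p to P. The
  universal property in the last condition carries the argument.

  \<^item> Uniqueness. The universal property determines P from F up to isomorphism
    (\<open>frame_pairing_gbundle_unique\<close>). Conversely F is determined by P, since each vector of F has the
    form ev y v with y in P and v in V, and plots of the base lift locally to a principal bundle
    (\<open>frame_pairing_vbundle_unique\<close>).
  \<^item> Existence. A vector bundle is paired with its frame bundle (\<open>frame_bundle_pairing\<close>), and a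
    principal bundle P with the associated bundle, the frame at y being v \<mapsto> [y, v]
    (\<open>assoc_bundle_pairing\<close>).
  \<^item> Trivializations. If P and F are paired, smooth sections of P over A correspond to smooth frames
    of F over A, so P is trivial over A if and only if F is (\<open>frame_pairing_trivial_iff\<close>). Hence local
    triviality along plots and D-numerability are the same condition on both sides.
  \<^item> Base change. Pairings pull back (\<open>frame_pairing_pullback\<close>).

  The bijections and naturality are formal consequences: assoc sends the class of P to the class of
  any F paired with P (\<open>assoc_prin_class\<close>).

  Trivializations are awkward to handle along plots, so principal bundles are used in the following
  form (\<open>principal_bundleI\<close>, \<open>principal_bundle_torsor\<close>, \<open>principal_bundle_local_lifts\<close>): the action is
  free, two plots over the same plot of the base differ by a plot of G, and plots of the base lift
  locally. Under these conditions a trivialization is the same thing as a smooth section.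

  Two ingredients are independent of bundles. That GL(V) is a diffeological group requires
  composites of smooth maps between open sets of Euclidean spaces to be smooth; as smoothness is
  defined by iterated partial derivatives, this is the chain rule in coordinates (\<open>Ck_on_compose\<close>).
  And a pulled back partition of unity has to be reindexed by points of the new base
  (\<open>D_numerable_cover_pullback\<close>).
\<close>

section \<open>Smooth maps between open subsets of Euclidean spaces\<close>

abbreviation flat :: "nat \<Rightarrow> coords set" where
  "flat n \<equiv> topspace (Euclidean_space n)"

lemma openin_flat_subset: "openin (Euclidean_space n) U \<Longrightarrow> U \<subseteq> flat n"
  by (rule openin_subset)

lemma Euclidean_space_top_of_set: "Euclidean_space n = top_of_set (flat n)"
  by (simp add: Euclidean_space_def euclidean_product_topology)

lemma continuous_map_flat:
  "U \<subseteq> flat n \<Longrightarrow> continuous_map (subtopology (Euclidean_space n) U) euclideanreal f \<longleftrightarrow> continuous_on U f"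
  by (subst Euclidean_space_top_of_set) (simp add: subtopology_subtopology Int_absorb1)

lemma openin_Euclidean_space_open:
  "openin (Euclidean_space n) U \<longleftrightarrow> (\<exists>T. open T \<and> U = flat n \<inter> T)"
  by (subst Euclidean_space_top_of_set) (simp add: openin_open)

text \<open>
  The topology of $R^n$ is induced from a product topology, but only the first n coordinates can
  vary, so boxes of a single side length form a neighbourhood basis.
\<close>

lemma open_box:
  assumes "openin (Euclidean_space n) U" "x \<in> U"
  shows "\<exists>d>0. \<forall>z\<in>flat n. (\<forall>j<n. \<bar>z j - x j\<bar> < d) \<longrightarrow> z \<in> U"
proof -
  obtain T where T: "openin (powertop_real UNIV) T" "U = T \<inter> flat n"
    using assms(1) by (auto simp: Euclidean_space_def openin_subtopology)
  from assms(2) T have xT: "x \<in> T" and xf: "x \<in> flat n" by auto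
  from product_topology_open_contains_basis[OF T(1) xT] obtain X where
    X: "x \<in> (\<Pi>\<^sub>E i\<in>UNIV. X i)" "\<And>i. open (X i)" "(\<Pi>\<^sub>E i\<in>UNIV. X i) \<subseteq> T" by auto
  have "\<exists>e>0. \<forall>y. \<bar>y - x i\<bar> < e \<longrightarrow> y \<in> X i" for i
    using X(1) X(2)[of i] by (auto simp: open_dist dist_real_def PiE_iff)
  then obtain e where e: "\<And>i. e i > 0" "\<And>i y. \<bar>y - x i\<bar> < e i \<Longrightarrow> y \<in> X i" by metis
  define d where "d = Min (insert 1 (e ` {..<n}))"
  have "d > 0" unfolding d_def using e(1) by (subst Min_gr_iff) auto
  moreover have "z \<in> U" if z: "z \<in> flat n" "\<And>j. j < n \<Longrightarrow> \<bar>z j - x j\<bar> < d" for z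
  proof -
    have "z i \<in> X i" for i
    proof (cases "i < n")
      case True
      then have "d \<le> e i" unfolding d_def by (intro Min_le) auto
      with z(2)[OF True] show ?thesis by (intro e(2)) auto
    next
      case False
      then have "z i = x i" using z(1) xf by (auto simp: topspace_Euclidean_space)
      then show ?thesis by (intro e(2)) (use e(1) in auto)
    qed
    then show ?thesis using X(3) z(1) T(2) by auto
  qed
  ultimately show ?thesis by blast
qed

lemma update_flat: "x \<in> flat n \<Longrightarrow> i < n \<Longrightarrow> x(i := t) \<in> flat n"
  by (auto simp: topspace_Euclidean_space)

lemma eventually_update_in:
  assumes "openin (Euclidean_space n) U" "x \<in> U" "i < n"
  shows "eventually (\<lambda>t. x(i := t) \<in> U) (nhds (x i))"
proof -
  obtain d where
    d: "d > 0" "\<And>z. z \<in> flat n \<Longrightarrow> (\<And>j. j < n \<Longrightarrow> \<bar>z j - x j\<bar> < d) \<Longrightarrow> z \<in> U"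
    using open_box[OF assms(1,2)] by metis
  have "x \<in> flat n" using assms openin_flat_subset by blast
  then have "x(i := t) \<in> U" if "dist t (x i) < d" for t
    using that d(1) by (intro d(2) update_flat assms) (auto simp: dist_real_def)
  with d(1) show ?thesis by (auto simp: eventually_nhds_metric)
qed

lemma Ck_on_SucI:
  assumes "openin (Euclidean_space n) U" "continuous_on U f"
    "\<And>i x. i < n \<Longrightarrow> x \<in> U \<Longrightarrow> DERIV (\<lambda>t. f (x(i := t))) (x i) :> partial_deriv i f x"
    "\<And>i. i < n \<Longrightarrow> Ck_on k n U (partial_deriv i f)"
  shows "Ck_on (Suc k) n U f"
proof -
  have "(\<lambda>t. f (x(i := t))) differentiable at (x i)" if "i < n" "x \<in> U" for i x
    using assms(3)[OF that] unfolding real_differentiable_def by blast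
  then show ?thesis
    using assms(2,4) unfolding Ck_on.simps continuous_map_flat[OF openin_flat_subset[OF assms(1)]]
    by blast
qed

lemma Ck_on_SucD:
  assumes "Ck_on (Suc k) n U f" "i < n"
  shows Ck_on_SucD_deriv: "x \<in> U \<Longrightarrow> DERIV (\<lambda>t. f (x(i := t))) (x i) :> partial_deriv i f x"
    and Ck_on_SucD_partial: "Ck_on k n U (partial_deriv i f)"
proof -
  have *: "(\<forall>x\<in>U. (\<lambda>t. f (x(i := t))) differentiable (at (x i))) \<and> Ck_on k n U (partial_deriv i f)"
    by (rule mp[OF spec[OF conjunct2[OF assms(1)[unfolded Ck_on.simps]]] assms(2)])
  then show "Ck_on k n U (partial_deriv i f)" ..
  assume "x \<in> U"
  from bspec[OF conjunct1[OF *] this] show "DERIV (\<lambda>t. f (x(i := t))) (x i) :> partial_deriv i f x"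
    unfolding partial_deriv_def by (rule DERIV_deriv_iff_real_differentiable[THEN iffD2])
qed

declare Ck_on.simps(2) [simp del]

lemma Ck_on_continuous:
  assumes "Ck_on k n U f" "openin (Euclidean_space n) U"
  shows "continuous_on U f"
proof -
  have "continuous_map (subtopology (Euclidean_space n) U) euclideanreal f"
  proof (cases k)
    case (Suc l)
    from assms(1)[unfolded Suc Ck_on.simps(2)] show ?thesis ..
  qed (use assms in simp)
  with assms(2) show ?thesis by (simp add: continuous_map_flat openin_flat_subset)
qed

lemma Ck_on_cong:
  assumes "openin (Euclidean_space n) U" "\<And>x. x \<in> U \<Longrightarrow> f x = g x" "Ck_on k n U f"
  shows "Ck_on k n U g"
  using assms(2,3)
proof (induction k arbitrary: f g)
  case 0
  have "continuous_on U g" by (rule continuous_on_eq[OF Ck_on_continuous[OF 0(2) assms(1)] 0(1)])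
  then show ?case using assms(1) by (simp add: continuous_map_flat openin_flat_subset)
next
  case (Suc k)
  have ev: "eventually (\<lambda>t. f (x(i := t)) = g (x(i := t))) (nhds (x i))" if "x \<in> U" "i < n" for x i
    using eventually_update_in[OF assms(1) that] by (rule eventually_mono) (rule Suc.prems)
  have pd: "partial_deriv i f x = partial_deriv i g x" if "x \<in> U" "i < n" for x i
    unfolding partial_deriv_def using ev[OF that] by (rule deriv_cong_ev) simp
  have "continuous_on U g"
    by (rule continuous_on_eq[OF Ck_on_continuous[OF Suc.prems(2) assms(1)] Suc.prems(1)])
  moreover have "DERIV (\<lambda>t. g (x(i := t))) (x i) :> partial_deriv i g x" if "i < n" "x \<in> U" for x i
    using Ck_on_SucD_deriv[OF Suc.prems(2) that]
    by (rule DERIV_cong_ev[OF refl ev[OF that(2,1)] pd[OF that(2,1)], THEN iffD1])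
  moreover have "Ck_on k n U (partial_deriv i g)" if "i < n" for i
    by (rule Suc.IH[OF pd[OF _ that] Ck_on_SucD_partial[OF Suc.prems(2) that]])
  ultimately show ?case
    by (rule Ck_on_SucI[OF assms(1)])
qed

text \<open>
  A function f' that agrees on U with a partial derivative is as good as the partial derivative
  itself, because being continuously differentiable depends only on the values on the open set U.
\<close>

lemma Ck_on_SucI':
  assumes "openin (Euclidean_space n) U" "continuous_on U f"
    "\<And>i x. i < n \<Longrightarrow> x \<in> U \<Longrightarrow> DERIV (\<lambda>t. f (x(i := t))) (x i) :> f' i x"
    "\<And>i. i < n \<Longrightarrow> Ck_on k n U (f' i)"
  shows "Ck_on (Suc k) n U f"
proof -
  have eq: "f' i x = partial_deriv i f x" if "i < n" "x \<in> U" for i x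
    using DERIV_imp_deriv[OF assms(3)[OF that]] by (simp add: partial_deriv_def)
  show ?thesis
  proof (rule Ck_on_SucI[OF assms(1,2)])
    fix i assume i: "i < n"
    show "DERIV (\<lambda>t. f (x(i := t))) (x i) :> partial_deriv i f x" if "x \<in> U" for x
      using assms(3)[OF i that] unfolding eq[OF i that] .
    show "Ck_on k n U (partial_deriv i f)"
      by (rule Ck_on_cong[OF assms(1) eq[OF i] assms(4)[OF i]])
  qed
qed

lemma Ck_on_Suc: "Ck_on (Suc k) n U f \<Longrightarrow> Ck_on k n U f"
proof (induction k arbitrary: f)
  case 0
  then show ?case by (simp add: Ck_on.simps(2))
next
  case (Suc k)
  from Suc.prems have "Ck_on (Suc k) n U (partial_deriv i f)" if "i < n" for i
    using Ck_on_SucD(2) that by blast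
  then have "Ck_on k n U (partial_deriv i f)" if "i < n" for i
    using Suc.IH that by blast
  with Suc.prems show ?case by (subst (asm) Ck_on.simps) (subst Ck_on.simps, blast)
qed

lemma continuous_on_local:
  fixes f :: "coords \<Rightarrow> real"
  assumes "openin (Euclidean_space n) U"
    "\<And>x. x \<in> U \<Longrightarrow> \<exists>W. openin (Euclidean_space n) W \<and> x \<in> W \<and> W \<subseteq> U \<and> continuous_on W f"
  shows "continuous_on U f"
  unfolding continuous_on_eq_continuous_within
proof
  fix x assume "x \<in> U"
  from assms(2)[OF this] obtain W where
    W: "openin (Euclidean_space n) W" "x \<in> W" "W \<subseteq> U" "continuous_on W f" by auto
  obtain T where T: "open T" "W = flat n \<inter> T"
    using W(1)[unfolded openin_Euclidean_space_open] by blast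
  have "U \<inter> T = W" using T W(3) openin_flat_subset[OF assms(1)] by auto
  moreover have "x \<in> T" using T W(2) by auto
  ultimately have "at x within W = at x within U"
    using T(1) W(3) by (intro at_within_nhd[of x T]) auto
  then show "continuous (at x within U) f"
    using W(2,4) by (auto simp: continuous_on_eq_continuous_within continuous_within)
qed

lemma Ck_on_local:
  assumes "openin (Euclidean_space n) U"
    "\<And>x. x \<in> U \<Longrightarrow> \<exists>W. openin (Euclidean_space n) W \<and> x \<in> W \<and> W \<subseteq> U \<and> Ck_on k n W f"
  shows "Ck_on k n U f"
  using assms(2)
proof (induction k arbitrary: f)
  case 0
  have "\<exists>W. openin (Euclidean_space n) W \<and> x \<in> W \<and> W \<subseteq> U \<and> continuous_on W f" if "x \<in> U" for x
    using 0[OF that] by (auto simp: continuous_map_flat openin_flat_subset)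
  then have "continuous_on U f" by (rule continuous_on_local[OF assms(1)])
  then show ?case using assms(1) by (simp add: continuous_map_flat openin_flat_subset)
next
  case (Suc k)
  have W: "\<exists>W. openin (Euclidean_space n) W \<and> x \<in> W \<and> W \<subseteq> U \<and> continuous_on W f \<and>
      (\<forall>i<n. DERIV (\<lambda>t. f (x(i := t))) (x i) :> partial_deriv i f x \<and> Ck_on k n W (partial_deriv i f))"
    if x: "x \<in> U" for x
  proof -
    obtain W where W: "openin (Euclidean_space n) W" "x \<in> W" "W \<subseteq> U" "Ck_on (Suc k) n W f"
      using Suc.prems[OF x] by auto
    show ?thesis
      using W Ck_on_continuous[OF W(4,1)] Ck_on_SucD_deriv[OF W(4) _ W(2)] Ck_on_SucD_partial[OF W(4)]
      by (intro exI[of _ W] conjI allI impI)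
  qed
  show ?case
  proof (rule Ck_on_SucI[OF assms(1)])
    show "continuous_on U f"
      by (rule continuous_on_local[OF assms(1)]) (use W in metis)
  next
    fix i x assume "i < n" "x \<in> U"
    then show "DERIV (\<lambda>t. f (x(i := t))) (x i) :> partial_deriv i f x"
      using W[of x] by metis
  next
    fix i assume "i < n"
    then show "Ck_on k n U (partial_deriv i f)"
      by (intro Suc.IH) (use W in metis)
  qed
qed

lemma Ck_on_const: "openin (Euclidean_space n) U \<Longrightarrow> Ck_on k n U (\<lambda>_. c)"
proof (induction k arbitrary: c)
  case 0
  then show ?case by simp
next
  case (Suc k)
  then show ?case by (intro Ck_on_SucI'[where f' = "\<lambda>_ _. 0"]) auto
qed

lemma Ck_on_coord:
  assumes U: "openin (Euclidean_space n) U"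
  shows "Ck_on k n U (\<lambda>x. x j)"
proof (cases k)
  case 0
  have "continuous_on U (\<lambda>x. x j)"
    by (rule continuous_on_subset[OF continuous_on_product_coordinates]) simp
  with 0 U show ?thesis by (simp add: continuous_map_flat openin_flat_subset)
next
  case (Suc l)
  have "Ck_on (Suc l) n U (\<lambda>x. x j)"
  proof (rule Ck_on_SucI'[OF U, where f' = "\<lambda>i _. if i = j then 1 else 0"])
    show "continuous_on U (\<lambda>x. x j)"
      by (rule continuous_on_subset[OF continuous_on_product_coordinates]) simp
    show "DERIV (\<lambda>t. (x(i := t)) j) (x i) :> (if i = j then 1 else 0)" for i x
      by (cases "i = j") auto
  qed (use U Ck_on_const in auto)
  with Suc show ?thesis by simp
qed

lemma Ck_on_add:
  assumes U: "openin (Euclidean_space n) U" and "Ck_on k n U f" "Ck_on k n U g"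
  shows "Ck_on k n U (\<lambda>x. f x + g x)"
  using assms(2,3)
proof (induction k arbitrary: f g)
  case 0
  then show ?case using U by (auto simp: continuous_map_flat openin_flat_subset intro: continuous_intros)
next
  case (Suc k)
  show ?case
  proof (rule Ck_on_SucI'[OF U, where f' = "\<lambda>i x. partial_deriv i f x + partial_deriv i g x"])
    show "continuous_on U (\<lambda>x. f x + g x)"
      using Suc.prems U Ck_on_continuous by (intro continuous_intros) blast+
  next
    fix i x assume "i < n" "x \<in> U"
    then show "DERIV (\<lambda>t. f (x(i := t)) + g (x(i := t))) (x i) :> partial_deriv i f x + partial_deriv i g x"
      by (intro DERIV_add Ck_on_SucD_deriv[OF Suc.prems(1)] Ck_on_SucD_deriv[OF Suc.prems(2)])
  next
    fix i assume "i < n"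
    then show "Ck_on k n U (\<lambda>x. partial_deriv i f x + partial_deriv i g x)"
      by (intro Suc.IH Ck_on_SucD_partial Suc.prems)
  qed
qed

lemma Ck_on_sum:
  assumes U: "openin (Euclidean_space n) U" and "\<And>i. i \<in> I \<Longrightarrow> Ck_on k n U (f i)"
  shows "Ck_on k n U (\<lambda>x. \<Sum>i\<in>I. f i x)"
  using assms(2)
  by (induction I rule: infinite_finite_induct) (simp_all add: Ck_on_add Ck_on_const U del: Ck_on.simps(2))

lemma Ck_on_mult:
  assumes U: "openin (Euclidean_space n) U" and "Ck_on k n U f" "Ck_on k n U g"
  shows "Ck_on k n U (\<lambda>x. f x * g x)"
  using assms(2,3)
proof (induction k arbitrary: f g)
  case 0
  then have "continuous_on U (\<lambda>x. f x * g x)"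
    using U Ck_on_continuous by (intro continuous_on_mult) blast+
  then show ?case using U by (simp add: continuous_map_flat openin_flat_subset)
next
  case (Suc k)
  note D = Ck_on_SucD[OF Suc.prems(1)] Ck_on_SucD[OF Suc.prems(2)]
  show ?case
  proof (rule Ck_on_SucI'[OF U, where f' = "\<lambda>i x. partial_deriv i f x * g x + partial_deriv i g x * f x"])
    show "continuous_on U (\<lambda>x. f x * g x)"
      using Suc.prems U Ck_on_continuous by (intro continuous_intros) blast+
  next
    fix i x assume "i < n" "x \<in> U"
    then show "DERIV (\<lambda>t. f (x(i := t)) * g (x(i := t))) (x i) :>
        partial_deriv i f x * g x + partial_deriv i g x * f x"
      using DERIV_mult[OF D(1)[of i x] D(3)[of i x]] by (simp only: fun_upd_triv)
  next
    fix i assume "i < n"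
    then show "Ck_on k n U (\<lambda>x. partial_deriv i f x * g x + partial_deriv i g x * f x)"
      by (intro Ck_on_add[OF U] Suc.IH D Ck_on_Suc[OF Suc.prems(1)] Ck_on_Suc[OF Suc.prems(2)])
  qed
qed

text \<open>
  The mean value theorem on the i-th coordinate line through z. Continuity of the partial derivative
  makes the estimate uniform in z: difference quotients in direction i are close to the partial
  derivative at y not only on the line through y, but on all nearby lines. The chain rule needs
  this because it changes the coordinates one at a time.
\<close>

lemma strict_partial_derivative:
  assumes U: "openin (Euclidean_space n) U" and f: "Ck_on (Suc k) n U f"
    and y: "y \<in> U" and i: "i < n" and "\<epsilon> > 0"
  shows "\<exists>\<delta>>0. \<forall>z\<in>flat n. \<forall>s. (\<forall>j<n. \<bar>z j - y j\<bar> < \<delta>) \<longrightarrow> \<bar>s - y i\<bar> < \<delta> \<longrightarrow>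
       (\<exists>\<xi>. \<bar>\<xi> - partial_deriv i f y\<bar> < \<epsilon> \<and> f (z(i := s)) - f z = \<xi> * (s - z i))"
proof -
  let ?f' = "partial_deriv i f"
  have c: "continuous_on U ?f'" using Ck_on_continuous[OF Ck_on_SucD(2)[OF f i] U] .
  define U' where "U' = {x \<in> U. \<bar>?f' x - ?f' y\<bar> < \<epsilon>}"
  have "U' = U \<inter> ?f' -` ball (?f' y) \<epsilon>" by (auto simp: U'_def dist_real_def)
  moreover have "openin (top_of_set U) (U \<inter> ?f' -` ball (?f' y) \<epsilon>)"
    using c by (intro continuous_openin_preimage_gen) auto
  ultimately have U': "openin (Euclidean_space n) U'"
    using U by (metis Euclidean_space_top_of_set openin_trans)
  have "y \<in> U'" using y \<open>\<epsilon> > 0\<close> by (simp add: U'_def)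
  obtain \<delta> where
    \<delta>: "\<delta> > 0" "\<And>z. z \<in> flat n \<Longrightarrow> (\<And>j. j < n \<Longrightarrow> \<bar>z j - y j\<bar> < \<delta>) \<Longrightarrow> z \<in> U'"
    using open_box[OF U' \<open>y \<in> U'\<close>] by metis
  have "\<exists>\<xi>. \<bar>\<xi> - ?f' y\<bar> < \<epsilon> \<and> f (z(i := s)) - f z = \<xi> * (s - z i)"
    if z: "z \<in> flat n" "\<And>j. j < n \<Longrightarrow> \<bar>z j - y j\<bar> < \<delta>" "\<bar>s - y i\<bar> < \<delta>" for z s
  proof -
    have in': "z(i := r) \<in> U'" if "min s (z i) \<le> r" "r \<le> max s (z i)" for r
    proof (rule \<delta>(2))
      fix j assume "j < n"
      then show "\<bar>(z(i := r)) j - y j\<bar> < \<delta>" using z(2)[of j] z(2)[OF i] z(3) that by (cases "j = i") auto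
    qed (use update_flat z i in auto)
    have der: "DERIV (\<lambda>t. f (z(i := t))) r :> ?f' (z(i := r))" if "z(i := r) \<in> U'" for r
      using Ck_on_SucD(1)[OF f i, of "z(i := r)"] that by (simp add: U'_def del: Ck_on.simps)
    consider "s = z i" | "s < z i" | "z i < s" by linarith
    then show ?thesis
    proof cases
      case 1
      then show ?thesis using \<open>\<epsilon> > 0\<close> by (auto intro!: exI[of _ "?f' y"])
    next
      case 2
      then obtain r where "r > s" "r < z i" "f (z(i := z i)) - f (z(i := s)) = (z i - s) * ?f' (z(i := r))"
        using MVT2[OF 2 der[OF in']] by auto
      then show ?thesis using in'[of r] by (intro exI[of _ "?f' (z(i := r))"]) (auto simp: U'_def algebra_simps)
    next
      case 3
      then obtain r where "r > z i" "r < s" "f (z(i := s)) - f (z(i := z i)) = (s - z i) * ?f' (z(i := r))"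
        using MVT2[OF 3 der[OF in']] by auto
      then show ?thesis using in'[of r] by (intro exI[of _ "?f' (z(i := r))"]) (auto simp: U'_def algebra_simps)
    qed
  qed
  with \<delta>(1) show ?thesis by blast
qed

text \<open>
  The difference of the values of f at two points of the curve is a telescoping sum in which the
  k-th summand changes only the k-th coordinate, so each summand is controlled by
  \<open>strict_partial_derivative\<close>.
\<close>

lemma chain_rule_curve:
  fixes \<gamma> :: "real \<Rightarrow> coords"
  assumes U: "openin (Euclidean_space n) U" and f: "Ck_on (Suc k) n U f"
    and y: "\<gamma> t0 \<in> U" and flat: "eventually (\<lambda>t. \<gamma> t \<in> flat n) (nhds t0)"
    and \<gamma>: "\<And>j. j < n \<Longrightarrow> DERIV (\<lambda>t. \<gamma> t j) t0 :> D j"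
  shows "DERIV (\<lambda>t. f (\<gamma> t)) t0 :> (\<Sum>j<n. partial_deriv j f (\<gamma> t0) * D j)"
proof -
  define y where "y = \<gamma> t0"
  \<comment> \<open>The curve with only its first m coordinates moving; the others stay at their values at t0.\<close>
  define mix where "mix m t = (\<lambda>j. if j < m then \<gamma> t j else y j)" for m t
  have yU: "y \<in> U" and yf: "y \<in> flat n" using y openin_flat_subset[OF U] by (auto simp: y_def)
  have mf: "mix m t \<in> flat n" if "m \<le> n" for m t
    using yf that by (auto simp: mix_def topspace_Euclidean_space)
  have m0: "mix m t0 = y" for m by (auto simp: mix_def y_def)
  have near: "eventually (\<lambda>t. \<forall>j<n. \<bar>\<gamma> t j - y j\<bar> < \<delta>) (at t0)" if "\<delta> > 0" for \<delta>
  proof -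
    have "eventually (\<lambda>t. \<bar>\<gamma> t j - y j\<bar> < \<delta>) (at t0)" if "j < n" for j
    proof -
      have "((\<lambda>t. \<gamma> t j) \<longlongrightarrow> y j) (at t0)"
        using DERIV_isCont[OF \<gamma>[OF that]] by (simp add: isCont_def y_def)
      from tendstoD[OF this \<open>\<delta> > 0\<close>] show ?thesis by (simp add: dist_real_def)
    qed
    then have "eventually (\<lambda>t. \<forall>j\<in>{..<n}. \<bar>\<gamma> t j - y j\<bar> < \<delta>) (at t0)"
      by (subst eventually_ball_finite_distrib) auto
    then show ?thesis by (rule eventually_mono) auto
  qed
  have step: "DERIV (\<lambda>t. f (mix (Suc m) t) - f (mix m t)) t0 :> partial_deriv m f y * D m" if m: "m < n" for m
  proof -
    \<comment> \<open>The difference quotient in the m-th coordinate, extended by its limit where that coordinate does not move.\<close>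
    define R where "R t = (if \<gamma> t m = y m then partial_deriv m f y
      else (f (mix (Suc m) t) - f (mix m t)) / (\<gamma> t m - y m))" for t
    have mixS: "mix (Suc m) t = (mix m t)(m := \<gamma> t m)" and mixm: "mix m t m = y m" for t
      by (auto simp: mix_def less_Suc_eq)
    have "(R \<longlongrightarrow> partial_deriv m f y) (at t0)"
    proof (rule tendstoI)
      fix e :: real assume "e > 0"
      obtain \<delta> where \<delta>: "\<delta> > 0"
        "\<And>z s. z \<in> flat n \<Longrightarrow> (\<And>j. j < n \<Longrightarrow> \<bar>z j - y j\<bar> < \<delta>) \<Longrightarrow> \<bar>s - y m\<bar> < \<delta> \<Longrightarrow>
         \<exists>\<xi>. \<bar>\<xi> - partial_deriv m f y\<bar> < e \<and> f (z(m := s)) - f z = \<xi> * (s - z m)"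
        using strict_partial_derivative[OF U f yU m \<open>e > 0\<close>] by metis
      show "eventually (\<lambda>t. dist (R t) (partial_deriv m f y) < e) (at t0)"
        using near[OF \<delta>(1)]
      proof (rule eventually_mono)
        fix t assume t: "\<forall>j<n. \<bar>\<gamma> t j - y j\<bar> < \<delta>"
        have "\<exists>\<xi>. \<bar>\<xi> - partial_deriv m f y\<bar> < e \<and>
            f ((mix m t)(m := \<gamma> t m)) - f (mix m t) = \<xi> * (\<gamma> t m - mix m t m)"
          using t m \<delta>(1) by (intro \<delta>(2) mf) (auto simp: mix_def)
        then show "dist (R t) (partial_deriv m f y) < e"
          using \<open>e > 0\<close> by (auto simp: R_def dist_real_def mixS mixm)
      qed
    qed
    moreover have "((\<lambda>t. (\<gamma> t m - \<gamma> t0 m) / (t - t0)) \<longlongrightarrow> D m) (at t0)"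
      using \<gamma>[OF m] by (simp add: has_field_derivative_iff)
    ultimately have "((\<lambda>t. R t * ((\<gamma> t m - \<gamma> t0 m) / (t - t0))) \<longlongrightarrow> partial_deriv m f y * D m) (at t0)"
      by (rule tendsto_mult)
    moreover have eq: "R t * ((\<gamma> t m - \<gamma> t0 m) / (t - t0)) =
        ((f (mix (Suc m) t) - f (mix m t)) - (f (mix (Suc m) t0) - f (mix m t0))) / (t - t0)" for t
    proof (cases "\<gamma> t m = y m")
      case True
      then have "(mix m t)(m := \<gamma> t m) = mix m t" using mixm by (metis fun_upd_triv)
      with True show ?thesis by (simp add: R_def m0 mixS y_def)
    qed (simp add: R_def m0 y_def)
    ultimately show ?thesis by (simp only: has_field_derivative_iff)
  qed
  have "DERIV (\<lambda>t. f (mix m t)) t0 :> (\<Sum>j<m. partial_deriv j f y * D j)" if "m \<le> n" for m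
    using that
  proof (induction m)
    case 0
    have "mix 0 t = y" for t by (simp add: mix_def)
    then show ?case by simp
  next
    case (Suc m)
    then show ?case using DERIV_add[OF Suc.IH step, of m] by (simp del: fun_upd_apply)
  qed
  then have "DERIV (\<lambda>t. f (mix n t)) t0 :> (\<Sum>j<n. partial_deriv j f y * D j)" by simp
  moreover have "eventually (\<lambda>t. f (mix n t) = f (\<gamma> t)) (nhds t0)"
    using flat
  proof (rule eventually_mono)
    fix t assume "\<gamma> t \<in> flat n"
    then have "mix n t = \<gamma> t" using yf by (auto simp: mix_def topspace_Euclidean_space)
    then show "f (mix n t) = f (\<gamma> t)" by simp
  qed
  ultimately show ?thesis using DERIV_cong_ev[OF refl _ refl] by (fastforce simp: y_def)
qed

lemma continuous_on_coords:
  fixes h :: "coords \<Rightarrow> coords"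
  assumes "h ` W \<subseteq> flat n" "\<And>j. j < n \<Longrightarrow> continuous_on W (\<lambda>x. h x j)"
  shows "continuous_on W h"
proof (rule continuous_on_coordinatewise_then_product)
  fix j
  show "continuous_on W (\<lambda>x. h x j)"
  proof (cases "j < n")
    case False
    then have "h x j = 0" if "x \<in> W" for x using assms(1) that by (auto simp: topspace_Euclidean_space)
    then show ?thesis by (simp cong: continuous_on_cong)
  qed (use assms in auto)
qed

text \<open>
  Induction on the order of differentiability: by the chain rule a partial derivative of the
  composite is a sum of products of partial derivatives of f composed with h and of partial
  derivatives of h. The induction is over all f, as it is applied to the partial derivatives of f.
\<close>

lemma Ck_on_compose:
  assumes U: "openin (Euclidean_space n) U" and W: "openin (Euclidean_space m) W" and h: "h ` W \<subseteq> U"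
  shows "Ck_on k n U f \<Longrightarrow> (\<And>j. j < n \<Longrightarrow> Ck_on k m W (\<lambda>x. h x j)) \<Longrightarrow> Ck_on k m W (\<lambda>x. f (h x))"
proof (induction k arbitrary: f)
  case 0
  have "continuous_on W h"
    using h openin_flat_subset[OF U] Ck_on_continuous[OF 0(2) W] by (intro continuous_on_coords) auto
  then have "continuous_on W (f \<circ> h)"
    using Ck_on_continuous[OF 0(1) U] h by (meson continuous_on_compose continuous_on_subset)
  then show ?case using W by (simp add: continuous_map_flat openin_flat_subset o_def)
next
  case (Suc k)
  show ?case
  proof (rule Ck_on_SucI'[OF W, where f' = "\<lambda>i x. \<Sum>j<n. partial_deriv j f (h x) * partial_deriv i (\<lambda>x. h x j) x"])
    have "continuous_on W h"
      using h openin_flat_subset[OF U] Ck_on_continuous[OF Suc.prems(2) W] by (intro continuous_on_coords) auto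
    then show "continuous_on W (\<lambda>x. f (h x))"
      using Ck_on_continuous[OF Suc.prems(1) U] h by (intro continuous_on_compose2[OF _ \<open>continuous_on W h\<close>]) auto
  next
    fix i x assume ix: "i < m" "x \<in> W"
    have "eventually (\<lambda>t. h (x(i := t)) \<in> flat n) (nhds (x i))"
      using eventually_update_in[OF W ix(2,1)]
      by (rule eventually_mono) (use h openin_flat_subset[OF U] in auto)
    then show "DERIV (\<lambda>t. f (h (x(i := t)))) (x i) :> (\<Sum>j<n. partial_deriv j f (h x) * partial_deriv i (\<lambda>x. h x j) x)"
      using chain_rule_curve[OF U Suc.prems(1), of "\<lambda>t. h (x(i := t))" "x i" "\<lambda>j. partial_deriv i (\<lambda>x. h x j) x"]
        Ck_on_SucD(1)[OF Suc.prems(2)] ix h by auto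
  next
    fix i assume i: "i < m"
    show "Ck_on k m W (\<lambda>x. \<Sum>j<n. partial_deriv j f (h x) * partial_deriv i (\<lambda>x. h x j) x)"
    proof (intro Ck_on_sum[OF W] Ck_on_mult[OF W])
      fix j assume "j \<in> {..<n}"
      then have j: "j < n" by simp
      show "Ck_on k m W (\<lambda>x. partial_deriv j f (h x))"
        by (rule Suc.IH[OF Ck_on_SucD_partial[OF Suc.prems(1) j] Ck_on_Suc[OF Suc.prems(2)]])
      show "Ck_on k m W (\<lambda>x. partial_deriv i (\<lambda>x. h x j) x)"
        by (rule Ck_on_SucD_partial[OF Suc.prems(2)[OF j] i])
    qed
  qed
qed

lemma smooth_fun_compose:
  assumes "smooth_fun n U f" "smooth_between m W n U h"
  shows "smooth_fun m W (\<lambda>x. f (h x))"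
proof -
  have "Ck_on k m W (\<lambda>x. f (h x))" for k
    using assms unfolding smooth_fun_def smooth_between_def
    by (rule_tac Ck_on_compose[of n U m W h]) auto
  then show ?thesis using assms(2) by (simp add: smooth_fun_def smooth_between_def)
qed

lemma smooth_fun_const: "openin (Euclidean_space n) U \<Longrightarrow> smooth_fun n U (\<lambda>_. c)"
  by (simp add: smooth_fun_def Ck_on_const)

lemma smooth_between_inclusion:
  assumes "openin (Euclidean_space n) U" "openin (Euclidean_space n) W" "W \<subseteq> U"
  shows "smooth_between n W n U (\<lambda>x. x)"
  using assms by (auto simp: smooth_between_def smooth_fun_def Ck_on_coord)

lemma smooth_between_const:
  assumes "openin (Euclidean_space m) W" "openin (Euclidean_space n) U" "x \<in> U"
  shows "smooth_between m W n U (\<lambda>_. x)"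
  using assms by (auto simp: smooth_between_def smooth_fun_const)

lemma smooth_between_compose:
  assumes "smooth_between n U k T g" "smooth_between m W n U h"
  shows "smooth_between m W k T (\<lambda>x. g (h x))"
proof -
  have "smooth_fun m W (\<lambda>x. g (h x) j)" if "j < k" for j
    using assms(1) that by (intro smooth_fun_compose[OF _ assms(2)]) (simp add: smooth_between_def)
  moreover have "g (h x) \<in> T" if "x \<in> W" for x
    using assms that by (auto simp: smooth_between_def)
  ultimately show ?thesis using assms by (auto simp: smooth_between_def)
qed

lemma smooth_between_openD:
  assumes "smooth_between m W n U h"
  shows "openin (Euclidean_space m) W" "openin (Euclidean_space n) U" "w \<in> W \<Longrightarrow> h w \<in> U"
  using assms by (auto simp: smooth_between_def)

lemma smooth_between_preimage:
  assumes h: "smooth_between m W n U h" and T: "openin (Euclidean_space n) T"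
  shows "openin (Euclidean_space m) {w \<in> W. h w \<in> T}"
proof -
  have W: "openin (Euclidean_space m) W" and U: "openin (Euclidean_space n) U" and im: "h ` W \<subseteq> U"
    using h by (auto simp: smooth_between_def)
  have "continuous_on W (\<lambda>x. h x j)" if "j < n" for j
    using h that Ck_on_continuous[OF _ W] by (auto simp: smooth_between_def smooth_fun_def)
  then have c: "continuous_on W h"
    using im openin_flat_subset[OF U] by (intro continuous_on_coords) auto
  obtain O' where O': "open O'" "T = flat n \<inter> O'"
    using T by (auto simp: openin_Euclidean_space_open)
  have "openin (top_of_set W) (W \<inter> h -` O')"
    using c O'(1) by (rule continuous_openin_preimage_gen)
  then obtain O2 where O2: "open O2" "W \<inter> h -` O' = W \<inter> O2"
    unfolding openin_open by blast
  obtain O1 where O1: "open O1" "W = flat m \<inter> O1"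
    using W unfolding openin_Euclidean_space_open by blast
  have "{w \<in> W. h w \<in> T} = W \<inter> h -` O'"
    using O'(2) im openin_flat_subset[OF U] by auto
  also have "\<dots> = flat m \<inter> (O1 \<inter> O2)" using O2(2) O1(2) by blast
  finally show ?thesis
    unfolding openin_Euclidean_space_open using open_Int[OF O1(1) O2(1)] by blast
qed

lemma smooth_between_range:
  assumes "smooth_between m W n U h" "openin (Euclidean_space n) T" "h ` W \<subseteq> T"
  shows "smooth_between m W n T h"
  using assms by (simp add: smooth_between_def)

lemma smooth_between_restrict:
  assumes "smooth_between m W n U h" "openin (Euclidean_space m) W'" "W' \<subseteq> W"
  shows "smooth_between m W' n U h"
  using smooth_between_compose[OF assms(1) smooth_between_inclusion[OF smooth_between_openD(1)[OF assms(1)] assms(2,3)]] .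

lemma smooth_between_local:
  assumes W: "openin (Euclidean_space m) W" and U: "openin (Euclidean_space n) U"
    and loc: "\<And>w. w \<in> W \<Longrightarrow> \<exists>T g. openin (Euclidean_space m) T \<and> w \<in> T \<and> T \<subseteq> W \<and>
      smooth_between m T n U g \<and> (\<forall>t\<in>T. h t = g t)"
  shows "smooth_between m W n U h"
proof -
  have "Ck_on k m W (\<lambda>x. h x j)" if j: "j < n" for k j
  proof (rule Ck_on_local[OF W])
    fix w assume "w \<in> W"
    from loc[OF this] obtain T g where T: "openin (Euclidean_space m) T" "w \<in> T" "T \<subseteq> W"
      "smooth_between m T n U g" and eq: "\<forall>t\<in>T. h t = g t" by blast
    have "Ck_on k m T (\<lambda>x. g x j)"
      using T(4) j by (simp add: smooth_between_def smooth_fun_def)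
    then have "Ck_on k m T (\<lambda>x. h x j)"
      by (rule Ck_on_cong[OF T(1), rotated]) (simp add: eq)
    with T(1-3) show "\<exists>T. openin (Euclidean_space m) T \<and> w \<in> T \<and> T \<subseteq> W \<and> Ck_on k m T (\<lambda>x. h x j)"
      by (intro exI[of _ T] conjI)
  qed
  moreover have "h w \<in> U" if "w \<in> W" for w
    using loc[OF that] by (auto simp: smooth_between_def)
  ultimately show ?thesis using W U by (auto simp: smooth_between_def smooth_fun_def)
qed


section \<open>Diffeological spaces\<close>

lemma diffeological_spaceI:
  assumes "\<And>n U p. p \<in> plots X n U \<Longrightarrow> openin (Euclidean_space n) U"
    "\<And>n U p u. p \<in> plots X n U \<Longrightarrow> u \<in> U \<Longrightarrow> p u \<in> points X"
    "\<And>n U x. openin (Euclidean_space n) U \<Longrightarrow> x \<in> points X \<Longrightarrow> (\<lambda>_. x) \<in> plots X n U"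
    "\<And>n U p m W h. p \<in> plots X n U \<Longrightarrow> smooth_between m W n U h \<Longrightarrow> (\<lambda>w. p (h w)) \<in> plots X m W"
    "\<And>n U p. openin (Euclidean_space n) U \<Longrightarrow>
        (\<And>u. u \<in> U \<Longrightarrow> \<exists>W. openin (Euclidean_space n) W \<and> u \<in> W \<and> W \<subseteq> U \<and>
                    (\<exists>q\<in>plots X n W. \<forall>w\<in>W. p w = q w)) \<Longrightarrow> p \<in> plots X n U"
  shows "diffeological_space X"
  unfolding diffeological_space_def o_def
proof (intro conjI allI impI)
  show "p \<in> plots X n U" if "openin (Euclidean_space n) U"
    "\<forall>u\<in>U. \<exists>W. openin (Euclidean_space n) W \<and> u \<in> W \<and> W \<subseteq> U \<and> (\<exists>q\<in>plots X n W. \<forall>w\<in>W. p w = q w)"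
    for n U p
    by (rule assms(5)[OF that(1)]) (rule that(2)[rule_format])
  show "(\<lambda>x. p (h x)) \<in> plots X m W" if "p \<in> plots X n U" "smooth_between m W n U h" for n U p m W h
    by (rule assms(4)[OF that])
  show "(\<lambda>_. x) \<in> plots X n U" if "openin (Euclidean_space n) U" "x \<in> points X" for n U x
    by (rule assms(3)[OF that])
  show "openin (Euclidean_space n) U" "p ` U \<subseteq> points X" if "p \<in> plots X n U" for n U p
    using assms(1,2)[OF that] by auto
qed

context
  fixes X :: "'a diffspace"
  assumes X: "diffeological_space X"
begin

lemma plot_open: "p \<in> plots X n U \<Longrightarrow> openin (Euclidean_space n) U"
  by (rule X[unfolded diffeological_space_def, THEN conjunct1, rule_format, THEN conjunct1])

lemma plot_point: "p \<in> plots X n U \<Longrightarrow> u \<in> U \<Longrightarrow> p u \<in> points X"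
  using X[unfolded diffeological_space_def, THEN conjunct1, rule_format, THEN conjunct2, of p n U]
  by auto

lemma plot_const: "openin (Euclidean_space n) U \<Longrightarrow> x \<in> points X \<Longrightarrow> (\<lambda>_. x) \<in> plots X n U"
  by (rule X[unfolded diffeological_space_def, THEN conjunct2, THEN conjunct1, rule_format])

lemma plot_compose: "p \<in> plots X n U \<Longrightarrow> smooth_between m W n U h \<Longrightarrow> (\<lambda>w. p (h w)) \<in> plots X m W"
  by (rule X[unfolded diffeological_space_def o_def, THEN conjunct2, THEN conjunct2, THEN conjunct1, rule_format])

lemma plot_local:
  assumes "openin (Euclidean_space n) U"
    "\<And>u. u \<in> U \<Longrightarrow> \<exists>W q. openin (Euclidean_space n) W \<and> u \<in> W \<and> W \<subseteq> U \<and> q \<in> plots X n W \<and> (\<forall>w\<in>W. p w = q w)"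
  shows "p \<in> plots X n U"
proof (rule X[unfolded diffeological_space_def, THEN conjunct2, THEN conjunct2, THEN conjunct2,
      THEN spec, THEN spec, THEN spec, THEN mp, THEN mp, OF assms(1)], rule ballI)
  fix u assume "u \<in> U"
  from assms(2)[OF this]
  show "\<exists>W. openin (Euclidean_space n) W \<and> u \<in> W \<and> W \<subseteq> U \<and> (\<exists>q\<in>plots X n W. \<forall>w\<in>W. p w = q w)"
    by (elim exE conjE) (intro exI conjI bexI)
qed

text \<open>This is the locality axiom for the cover of the domain by itself.\<close>

lemma plot_cong:
  assumes "p \<in> plots X n U" "\<And>u. u \<in> U \<Longrightarrow> q u = p u"
  shows "q \<in> plots X n U"
proof (rule plot_local[OF plot_open[OF assms(1)]])
  fix u assume "u \<in> U"
  then show "\<exists>W q'. openin (Euclidean_space n) W \<and> u \<in> W \<and> W \<subseteq> U \<and> q' \<in> plots X n W \<and> (\<forall>w\<in>W. q w = q' w)"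
    using assms plot_open[OF assms(1)] by (intro exI[of _ U] exI[of _ p]) simp
qed

lemma plot_restrict:
  assumes "p \<in> plots X n U" "openin (Euclidean_space n) W" "W \<subseteq> U"
  shows "p \<in> plots X n W"
  using plot_compose[OF assms(1) smooth_between_inclusion[OF plot_open[OF assms(1)] assms(2,3)]] .

end

lemma smooth_mapI:
  assumes "\<And>x. x \<in> points X \<Longrightarrow> f x \<in> points Y"
    "\<And>n U p. p \<in> plots X n U \<Longrightarrow> (\<lambda>u. f (p u)) \<in> plots Y n U"
  shows "smooth_map X Y f"
  using assms by (auto simp: smooth_map_def o_def)

lemma smooth_map_point: "smooth_map X Y f \<Longrightarrow> x \<in> points X \<Longrightarrow> f x \<in> points Y"
  by (auto simp: smooth_map_def)

lemma smooth_map_plot: "smooth_map X Y f \<Longrightarrow> p \<in> plots X n U \<Longrightarrow> (\<lambda>u. f (p u)) \<in> plots Y n U"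
  by (auto simp: smooth_map_def o_def)

lemma smooth_map_compose:
  "smooth_map X Y f \<Longrightarrow> smooth_map Y Z g \<Longrightarrow> smooth_map X Z (\<lambda>x. g (f x))"
  by (rule smooth_mapI) (blast dest: smooth_map_point, rule smooth_map_plot[OF _ smooth_map_plot])

lemma smooth_map_cong:
  assumes "smooth_map X Y f" "diffeological_space X" "diffeological_space Y"
    "\<And>x. x \<in> points X \<Longrightarrow> g x = f x"
  shows "smooth_map X Y g"
proof (rule smooth_mapI)
  show "g x \<in> points Y" if "x \<in> points X" for x
    using assms that by (simp add: smooth_map_point)
  show "(\<lambda>u. g (p u)) \<in> plots Y n U" if "p \<in> plots X n U" for n U p
    by (rule plot_cong[OF assms(3) smooth_map_plot[OF assms(1) that]])
      (simp add: assms(4) plot_point[OF assms(2) that])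
qed

lemma diffeomorphismE:
  assumes "diffeomorphism X Y f"
  obtains g where "smooth_map X Y f" "smooth_map Y X g"
    "\<And>x. x \<in> points X \<Longrightarrow> g (f x) = x" "\<And>y. y \<in> points Y \<Longrightarrow> f (g y) = y"
  using assms by (auto simp: diffeomorphism_def)

lemma diffeomorphismI:
  assumes "smooth_map X Y f" "smooth_map Y X g"
    "\<And>x. x \<in> points X \<Longrightarrow> g (f x) = x" "\<And>y. y \<in> points Y \<Longrightarrow> f (g y) = y"
  shows "diffeomorphism X Y f"
  using assms by (auto simp: diffeomorphism_def)


lemma points_prod_space [simp]: "points (prod_space X Y) = points X \<times> points Y"
  by (simp add: prod_space_def)

lemma plots_prod_space:
  "p \<in> plots (prod_space X Y) n U \<longleftrightarrow> (\<lambda>u. fst (p u)) \<in> plots X n U \<and> (\<lambda>u. snd (p u)) \<in> plots Y n U"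
  by (simp add: prod_space_def o_def)

lemma points_sub_space [simp]: "points (sub_space X A) = points X \<inter> A"
  by (simp add: sub_space_def)

lemma plots_sub_space: "p \<in> plots (sub_space X A) n U \<longleftrightarrow> p \<in> plots X n U \<and> (\<forall>u\<in>U. p u \<in> A)"
  by (auto simp: sub_space_def)

lemma points_domain_space [simp]: "points (domain_space n U) = U"
  by (simp add: domain_space_def)

lemma plots_domain_space [simp]: "plots (domain_space n U) m W = {h. smooth_between m W n U h}"
  by (simp add: domain_space_def)

lemma plots_real_space: "p \<in> plots real_space n U \<longleftrightarrow> smooth_fun n U p"
  by (simp add: real_space_def)

lemma points_real_space [simp]: "points real_space = UNIV"
  by (simp add: real_space_def)

lemma diffeological_prod_space:
  assumes X: "diffeological_space X" and Y: "diffeological_space Y"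
  shows "diffeological_space (prod_space X Y)"
proof (rule diffeological_spaceI)
  show "openin (Euclidean_space n) U" if "p \<in> plots (prod_space X Y) n U" for n U p
    using that plot_open[OF X] by (auto simp: plots_prod_space)
  show "p u \<in> points (prod_space X Y)" if "p \<in> plots (prod_space X Y) n U" "u \<in> U" for n U p u
    using that plot_point[OF X] plot_point[OF Y] by (fastforce simp: plots_prod_space mem_Times_iff)
  show "(\<lambda>_. x) \<in> plots (prod_space X Y) n U"
    if "openin (Euclidean_space n) U" "x \<in> points (prod_space X Y)" for n U x
    using that by (auto simp: plots_prod_space plot_const[OF X] plot_const[OF Y])
  show "(\<lambda>w. p (h w)) \<in> plots (prod_space X Y) m W"
    if "p \<in> plots (prod_space X Y) n U" "smooth_between m W n U h" for n U p m W h
    using that plot_compose[OF X _ that(2), of "\<lambda>u. fst (p u)"] plot_compose[OF Y _ that(2), of "\<lambda>u. snd (p u)"]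
    by (auto simp: plots_prod_space)
  fix n U p
  assume U: "openin (Euclidean_space n) U"
    and l: "\<And>u. u \<in> U \<Longrightarrow> \<exists>W. openin (Euclidean_space n) W \<and> u \<in> W \<and> W \<subseteq> U \<and>
                    (\<exists>q\<in>plots (prod_space X Y) n W. \<forall>w\<in>W. p w = q w)"
  have "(\<lambda>u. fst (p u)) \<in> plots X n U"
  proof (rule plot_local[OF X U])
    fix u assume "u \<in> U"
    from l[OF this] obtain W q where "openin (Euclidean_space n) W" "u \<in> W" "W \<subseteq> U"
      "q\<in>plots (prod_space X Y) n W" "\<forall>w\<in>W. p w = q w" by blast
    then show "\<exists>W q. openin (Euclidean_space n) W \<and> u \<in> W \<and> W \<subseteq> U \<and> q \<in> plots X n W \<and> (\<forall>w\<in>W. fst (p w) = q w)"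
      by (intro exI[of _ W] exI[of _ "\<lambda>u. fst (q u)"]) (auto simp: plots_prod_space)
  qed
  moreover have "(\<lambda>u. snd (p u)) \<in> plots Y n U"
  proof (rule plot_local[OF Y U])
    fix u assume "u \<in> U"
    from l[OF this] obtain W q where "openin (Euclidean_space n) W" "u \<in> W" "W \<subseteq> U"
      "q\<in>plots (prod_space X Y) n W" "\<forall>w\<in>W. p w = q w" by blast
    then show "\<exists>W q. openin (Euclidean_space n) W \<and> u \<in> W \<and> W \<subseteq> U \<and> q \<in> plots Y n W \<and> (\<forall>w\<in>W. snd (p w) = q w)"
      by (intro exI[of _ W] exI[of _ "\<lambda>u. snd (q u)"]) (auto simp: plots_prod_space)
  qed
  ultimately show "p \<in> plots (prod_space X Y) n U" by (simp add: plots_prod_space)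
qed

lemma diffeological_sub_space:
  assumes X: "diffeological_space X"
  shows "diffeological_space (sub_space X A)"
proof (rule diffeological_spaceI)
  fix n U p
  assume U: "openin (Euclidean_space n) U"
    and l: "\<And>u. u \<in> U \<Longrightarrow> \<exists>W. openin (Euclidean_space n) W \<and> u \<in> W \<and> W \<subseteq> U \<and>
                    (\<exists>q\<in>plots (sub_space X A) n W. \<forall>w\<in>W. p w = q w)"
  have "p \<in> plots X n U"
  proof (rule plot_local[OF X U])
    fix u assume "u \<in> U"
    from l[OF this] obtain W q where "openin (Euclidean_space n) W" "u \<in> W" "W \<subseteq> U"
      "q\<in>plots (sub_space X A) n W" "\<forall>w\<in>W. p w = q w" by blast
    then show "\<exists>W q. openin (Euclidean_space n) W \<and> u \<in> W \<and> W \<subseteq> U \<and> q \<in> plots X n W \<and> (\<forall>w\<in>W. p w = q w)"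
      by (intro exI[of _ W] exI[of _ q]) (simp add: plots_sub_space)
  qed
  moreover have "p u \<in> A" if "u \<in> U" for u
    using l[OF that] by (auto simp: plots_sub_space)
  ultimately show "p \<in> plots (sub_space X A) n U" by (simp add: plots_sub_space)
next
  show "(\<lambda>w. p (h w)) \<in> plots (sub_space X A) m W"
    if "p \<in> plots (sub_space X A) n U" "smooth_between m W n U h" for n U p m W h
    using that plot_compose[OF X _ that(2), of p] smooth_between_openD(3)[OF that(2)]
    by (auto simp: plots_sub_space)
qed (use plot_open[OF X] plot_point[OF X] plot_const[OF X] in \<open>auto simp: plots_sub_space\<close>)

lemma diffeological_domain_space:
  assumes "openin (Euclidean_space n) U"
  shows "diffeological_space (domain_space n U)"
proof (rule diffeological_spaceI)
  fix m W p
  assume W: "openin (Euclidean_space m) W"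
    and l: "\<And>u. u \<in> W \<Longrightarrow> \<exists>T. openin (Euclidean_space m) T \<and> u \<in> T \<and> T \<subseteq> W \<and>
                    (\<exists>q\<in>plots (domain_space n U) m T. \<forall>w\<in>T. p w = q w)"
  have "smooth_between m W n U p"
  proof (rule smooth_between_local[OF W assms])
    fix u assume "u \<in> W"
    from l[OF this] obtain T q where "openin (Euclidean_space m) T" "u \<in> T" "T \<subseteq> W"
      "q\<in>plots (domain_space n U) m T" "\<forall>w\<in>T. p w = q w" by blast
    then show "\<exists>T q. openin (Euclidean_space m) T \<and> u \<in> T \<and> T \<subseteq> W \<and> smooth_between m T n U q \<and> (\<forall>t\<in>T. p t = q t)"
      by (intro exI[of _ T] exI[of _ q]) simp
  qed
  then show "p \<in> plots (domain_space n U) m W" by simp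
qed (use assms smooth_between_openD smooth_between_const smooth_between_compose in auto)

lemma smooth_map_prodI:
  assumes "\<And>x y. x \<in> points X \<Longrightarrow> y \<in> points Y \<Longrightarrow> f x y \<in> points Z"
    "\<And>n U a b. a \<in> plots X n U \<Longrightarrow> b \<in> plots Y n U \<Longrightarrow> (\<lambda>u. f (a u) (b u)) \<in> plots Z n U"
  shows "smooth_map (prod_space X Y) Z (\<lambda>(x, y). f x y)"
proof (rule smooth_mapI)
  fix n U p assume "p \<in> plots (prod_space X Y) n U"
  then show "(\<lambda>u. case p u of (x, y) \<Rightarrow> f x y) \<in> plots Z n U"
    unfolding case_prod_beta plots_prod_space by (intro assms(2)) auto
qed (use assms(1) in auto)

lemma smooth_map_prodD:
  assumes "smooth_map (prod_space X Y) Z (\<lambda>(x, y). f x y)"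
  shows "x \<in> points X \<Longrightarrow> y \<in> points Y \<Longrightarrow> f x y \<in> points Z"
    "a \<in> plots X n U \<Longrightarrow> b \<in> plots Y n U \<Longrightarrow> (\<lambda>u. f (a u) (b u)) \<in> plots Z n U"
  using smooth_map_point[OF assms, of "(x, y)"] smooth_map_plot[OF assms, of "\<lambda>u. (a u, b u)"]
  by (simp_all add: plots_prod_space)

text \<open>
  With the converse below, plots are the smooth maps defined on open subsets of Euclidean spaces.
  Statements about smooth maps out of an arbitrary space therefore contain those about plots.
\<close>

lemma smooth_map_domainI:
  "diffeological_space X \<Longrightarrow> p \<in> plots X n U \<Longrightarrow> smooth_map (domain_space n U) X p"
  by (rule smooth_mapI) (simp_all add: plot_point plot_compose)

lemma smooth_map_domainD:
  assumes "smooth_map (domain_space n U) X p" "openin (Euclidean_space n) U"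
  shows "p \<in> plots X n U"
  using smooth_map_plot[OF assms(1), of "\<lambda>u. u"] smooth_between_inclusion[OF assms(2,2)] by simp

text \<open>The identity of U is a plot of U, so a D-open set is open; conversely smooth maps are continuous.\<close>

lemma D_open_domain_space:
  assumes U: "openin (Euclidean_space n) U"
  shows "D_open (domain_space n U) A \<longleftrightarrow> openin (Euclidean_space n) A \<and> A \<subseteq> U"
proof
  assume A: "D_open (domain_space n U) A"
  then have "A \<subseteq> U" by (simp add: D_open_def)
  moreover from A have "openin (Euclidean_space n) {u \<in> U. u \<in> A}"
    using smooth_between_inclusion[OF U U] by (force simp: D_open_def)
  moreover have "{u \<in> U. u \<in> A} = A" using \<open>A \<subseteq> U\<close> by auto
  ultimately show "openin (Euclidean_space n) A \<and> A \<subseteq> U" by simp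
next
  assume "openin (Euclidean_space n) A \<and> A \<subseteq> U"
  then show "D_open (domain_space n U) A"
    by (simp add: D_open_def smooth_between_preimage)
qed

lemma plots_sub_domain_space:
  assumes "openin (Euclidean_space n) U" "openin (Euclidean_space n) A" "A \<subseteq> U"
  shows "h \<in> plots (sub_space (domain_space n U) A) m W \<longleftrightarrow> smooth_between m W n A h"
  unfolding plots_sub_space using assms smooth_between_range[of m W n U h A]
    smooth_between_compose[OF smooth_between_inclusion[OF assms], of m W h]
  by (auto simp: smooth_between_openD(3) image_subset_iff)

lemma D_open_preimage:
  assumes f: "smooth_map C B f" and C: "diffeological_space C" and A: "D_open B A"
  shows "D_open C {c \<in> points C. f c \<in> A}"
  unfolding D_open_def
proof (intro conjI allI ballI)
  fix n U p assume p: "p \<in> plots C n U"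
  have "openin (Euclidean_space n) {u \<in> U. f (p u) \<in> A}"
    using A smooth_map_plot[OF f p] by (simp add: D_open_def)
  moreover have "{u \<in> U. f (p u) \<in> A} = {u \<in> U. p u \<in> {c \<in> points C. f c \<in> A}}"
    using plot_point[OF C p] by auto
  ultimately show "openin (Euclidean_space n) {u \<in> U. p u \<in> {c \<in> points C. f c \<in> A}}" by simp
qed auto

text \<open>
  Isomorphism classes consist of bundles on one fixed type; bundles are moved to that type along an
  injection, and this is the diffeology that the injection carries over.
\<close>

definition image_space :: "('a \<Rightarrow> 'b) \<Rightarrow> 'a diffspace \<Rightarrow> 'b diffspace" where
  "image_space \<phi> X = \<lparr>points = \<phi> ` points X,
     plots = (\<lambda>n U. {p. p ` U \<subseteq> \<phi> ` points X \<and> (\<lambda>u. inv_into (points X) \<phi> (p u)) \<in> plots X n U})\<rparr>"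

lemma points_image_space [simp]: "points (image_space \<phi> X) = \<phi> ` points X"
  by (simp add: image_space_def)

context
  fixes X :: "'a diffspace" and \<phi> :: "'a \<Rightarrow> 'b"
  assumes X: "diffeological_space X" and inj: "inj_on \<phi> (points X)"
begin

lemma diffeological_image_space: "diffeological_space (image_space \<phi> X)"
proof (rule diffeological_spaceI)
  fix n U p
  assume U: "openin (Euclidean_space n) U"
    and l: "\<And>u. u \<in> U \<Longrightarrow> \<exists>W. openin (Euclidean_space n) W \<and> u \<in> W \<and> W \<subseteq> U \<and>
                    (\<exists>q\<in>plots (image_space \<phi> X) n W. \<forall>w\<in>W. p w = q w)"
  have "(\<lambda>u. inv_into (points X) \<phi> (p u)) \<in> plots X n U"
  proof (rule plot_local[OF X U])
    fix u assume "u \<in> U"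
    from l[OF this] obtain W q where "openin (Euclidean_space n) W" "u \<in> W" "W \<subseteq> U"
      "q\<in>plots (image_space \<phi> X) n W" "\<forall>w\<in>W. p w = q w" by blast
    then show "\<exists>W q. openin (Euclidean_space n) W \<and> u \<in> W \<and> W \<subseteq> U \<and> q \<in> plots X n W \<and>
        (\<forall>w\<in>W. inv_into (points X) \<phi> (p w) = q w)"
      by (intro exI[of _ W] exI[of _ "\<lambda>u. inv_into (points X) \<phi> (q u)"]) (auto simp: image_space_def)
  qed
  moreover have "p u \<in> \<phi> ` points X" if "u \<in> U" for u
    using l[OF that] by (auto simp: image_space_def)
  ultimately show "p \<in> plots (image_space \<phi> X) n U" by (auto simp: image_space_def)
next
  show "(\<lambda>w. p (h w)) \<in> plots (image_space \<phi> X) m W"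
    if "p \<in> plots (image_space \<phi> X) n U" "smooth_between m W n U h" for n U p m W h
    using that plot_compose[OF X _ that(2), of "\<lambda>u. inv_into (points X) \<phi> (p u)"] smooth_between_openD(3)[OF that(2)]
    by (auto simp: image_space_def)
qed (use inj plot_open[OF X] plot_const[OF X] in \<open>auto simp: image_space_def\<close>)

lemma smooth_map_image_space: "smooth_map X (image_space \<phi> X) \<phi>"
proof (rule smooth_mapI)
  fix n U p assume p: "p \<in> plots X n U"
  have "(\<lambda>u. inv_into (points X) \<phi> (\<phi> (p u))) \<in> plots X n U"
    by (rule plot_cong[OF X p]) (simp add: inj plot_point[OF X p])
  then show "(\<lambda>u. \<phi> (p u)) \<in> plots (image_space \<phi> X) n U"
    using plot_point[OF X p] by (auto simp: image_space_def)
qed simp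

lemma smooth_map_image_space_inv: "smooth_map (image_space \<phi> X) X (inv_into (points X) \<phi>)"
  by (rule smooth_mapI) (auto simp: image_space_def inv_into_into)

end

lemma diffeological_quotient_space:
  assumes X: "diffeological_space X" and R: "equiv (points X) R"
  shows "diffeological_space (quotient_space X R)"
proof (rule diffeological_spaceI)
  fix n U p u assume "p \<in> plots (quotient_space X R) n U" "u \<in> U"
  then obtain W q where "u \<in> W" "q \<in> plots X n W" "p u = R `` {q u}"
    by (auto simp: quotient_space_def)
  then show "p u \<in> points (quotient_space X R)"
    using plot_point[OF X] by (auto simp: quotient_space_def intro: quotientI)
next
  fix n U x assume U: "openin (Euclidean_space n) U" "x \<in> points (quotient_space X R)"
  then obtain a where a: "a \<in> points X" "x = R `` {a}" by (auto simp: quotient_space_def quotient_def)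
  have "(\<lambda>_. a) \<in> plots X n U" using plot_const[OF X U(1) a(1)] .
  then show "(\<lambda>_. x) \<in> plots (quotient_space X R) n U" using U(1) a(2) by (auto simp: quotient_space_def)
next
  fix n U p m W h
  assume p: "p \<in> plots (quotient_space X R) n U" and h: "smooth_between m W n U h"
  have "\<exists>T. openin (Euclidean_space m) T \<and> w \<in> T \<and> T \<subseteq> W \<and> (\<exists>q\<in>plots X m T. \<forall>t\<in>T. p (h t) = R `` {q t})"
    if "w \<in> W" for w
  proof -
    have "h w \<in> U" using smooth_between_openD(3)[OF h that] .
    then obtain V q where V: "openin (Euclidean_space n) V" "h w \<in> V" "V \<subseteq> U" "q \<in> plots X n V"
      "\<forall>v\<in>V. p v = R `` {q v}" using p by (auto simp: quotient_space_def)
    let ?T = "{w \<in> W. h w \<in> V}"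
    have T: "openin (Euclidean_space m) ?T" by (rule smooth_between_preimage[OF h V(1)])
    have "smooth_between m ?T n V h"
      by (rule smooth_between_range[OF smooth_between_restrict[OF h T]]) (use V in auto)
    from plot_compose[OF X V(4) this] have "(\<lambda>t. q (h t)) \<in> plots X m ?T" .
    with T V that show ?thesis by (intro exI[of _ ?T]) auto
  qed
  then show "(\<lambda>w. p (h w)) \<in> plots (quotient_space X R) m W"
    using smooth_between_openD(1)[OF h] by (simp add: quotient_space_def)
next
  fix n U p
  assume U: "openin (Euclidean_space n) U"
    and l: "\<And>u. u \<in> U \<Longrightarrow> \<exists>W. openin (Euclidean_space n) W \<and> u \<in> W \<and> W \<subseteq> U \<and>
                    (\<exists>q\<in>plots (quotient_space X R) n W. \<forall>w\<in>W. p w = q w)"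
  have "\<exists>T. openin (Euclidean_space n) T \<and> u \<in> T \<and> T \<subseteq> U \<and> (\<exists>q\<in>plots X n T. \<forall>t\<in>T. p t = R `` {q t})"
    if "u \<in> U" for u
  proof -
    from l[OF that] obtain W q where W: "openin (Euclidean_space n) W" "u \<in> W" "W \<subseteq> U"
      "q\<in>plots (quotient_space X R) n W" "\<forall>w\<in>W. p w = q w" by blast
    from W(2,4) obtain T q' where "openin (Euclidean_space n) T" "u \<in> T" "T \<subseteq> W"
      "q' \<in> plots X n T" "\<forall>t\<in>T. q t = R `` {q' t}" by (auto simp: quotient_space_def)
    with W show ?thesis by (intro exI[of _ T] conjI bexI[of _ q']) auto
  qed
  then show "p \<in> plots (quotient_space X R) n U" using U by (simp add: quotient_space_def)
qed (auto simp: quotient_space_def)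

section \<open>Vector spaces, frames and the general linear group\<close>

abbreviation vecs :: "'v dvs \<Rightarrow> 'v set" where
  "vecs V \<equiv> points (vspace V)"

lemma cring_real_ring: "cring real_ring"
proof (rule cringI)
  show "abelian_group real_ring"
  proof (rule abelian_groupI)
    fix x :: real
    show "\<exists>y\<in>carrier real_ring. y \<oplus>\<^bsub>real_ring\<^esub> x = \<zero>\<^bsub>real_ring\<^esub>"
      by (rule bexI[of _ "- x"]) (auto simp: real_ring_def)
  qed (auto simp: real_ring_def)
  show "Group.comm_monoid real_ring"
    by (rule comm_monoidI) (auto simp: real_ring_def)
qed (auto simp: real_ring_def algebra_simps)

text \<open>
  The module axioms in terms of the operations alone, which makes them easy to transport along a
  bijection.
\<close>

lemma real_vector_space_on_iff:
  "real_vector_space_on S pls scl z \<longleftrightarrow>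
     z \<in> S \<and> (\<forall>x\<in>S. \<forall>y\<in>S. pls x y \<in> S) \<and> (\<forall>a. \<forall>x\<in>S. scl a x \<in> S) \<and>
     (\<forall>x\<in>S. \<forall>y\<in>S. \<forall>w\<in>S. pls (pls x y) w = pls x (pls y w)) \<and>
     (\<forall>x\<in>S. \<forall>y\<in>S. pls x y = pls y x) \<and>
     (\<forall>x\<in>S. pls z x = x) \<and> (\<forall>x\<in>S. \<exists>y\<in>S. pls y x = z) \<and>
     (\<forall>a b. \<forall>x\<in>S. scl (a + b) x = pls (scl a x) (scl b x)) \<and>
     (\<forall>a. \<forall>x\<in>S. \<forall>y\<in>S. scl a (pls x y) = pls (scl a x) (scl a y)) \<and>
     (\<forall>a b. \<forall>x\<in>S. scl (a * b) x = scl a (scl b x)) \<and>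
     (\<forall>x\<in>S. scl 1 x = x)" (is "?L \<longleftrightarrow> ?R")
proof
  let ?M = "\<lparr>carrier = S, mult = undefined, one = undefined, zero = z, add = pls, smult = scl\<rparr>"
  assume ?L
  then interpret M: Module.module real_ring ?M by (simp add: real_vector_space_on_def)
  have inv: "\<exists>y\<in>S. pls y x = z" if "x \<in> S" for x
    using M.M.l_neg[of x] M.M.a_inv_closed[of x] that by auto
  show ?R
    using M.M.zero_closed M.M.a_closed M.smult_closed M.M.a_assoc M.M.a_comm M.M.l_zero inv
      M.smult_l_distr M.smult_r_distr M.smult_assoc1 M.smult_one
    by (simp add: real_ring_def)
next
  let ?M = "\<lparr>carrier = S, mult = undefined, one = undefined, zero = z, add = pls, smult = scl\<rparr>"
  assume R: ?R
  have "Module.module real_ring ?M"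
  proof (rule moduleI[OF cring_real_ring])
    show "abelian_group ?M" by (rule abelian_groupI) (use R in auto)
  qed (use R in \<open>auto simp: real_ring_def\<close>)
  then show ?L by (simp add: real_vector_space_on_def)
qed

lemma real_vector_space_on_zero:
  assumes "real_vector_space_on S pls scl z" "x \<in> S"
  shows "scl 0 x = z"
proof -
  interpret M: Module.module real_ring
    "\<lparr>carrier = S, mult = undefined, one = undefined, zero = z, add = pls, smult = scl\<rparr>"
    using assms(1) by (simp add: real_vector_space_on_def)
  show ?thesis using M.smult_l_null[of x] assms(2) by (simp add: real_ring_def)
qed

lemma real_vector_space_on_bij:
  assumes S: "real_vector_space_on S pls scl z" and f: "bij_betw f S T"
    and pls: "\<And>x y. x \<in> S \<Longrightarrow> y \<in> S \<Longrightarrow> f (pls x y) = pls' (f x) (f y)"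
    and scl: "\<And>a x. x \<in> S \<Longrightarrow> f (scl a x) = scl' a (f x)"
    and z: "f z = z'"
  shows "real_vector_space_on T pls' scl' z'"
proof -
  have T: "T = f ` S" using f by (simp add: bij_betw_def)
  note ax = S[unfolded real_vector_space_on_iff]
  have cl: "\<And>x y. x \<in> S \<Longrightarrow> y \<in> S \<Longrightarrow> pls x y \<in> S" "\<And>a x. x \<in> S \<Longrightarrow> scl a x \<in> S" "z \<in> S"
    using ax by simp_all
  have inv: "\<exists>y\<in>S. pls' (f y) (f x) = f z" if x: "x \<in> S" for x
  proof -
    from ax have "\<forall>x\<in>S. \<exists>y\<in>S. pls y x = z" by (elim conjE)
    then obtain y where y: "y \<in> S" "pls y x = z" using x by auto
    then show ?thesis using pls[OF y(1) x] by auto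
  qed
  have laws: "\<And>x y w. x \<in> S \<Longrightarrow> y \<in> S \<Longrightarrow> w \<in> S \<Longrightarrow> pls (pls x y) w = pls x (pls y w)"
    "\<And>x y. x \<in> S \<Longrightarrow> y \<in> S \<Longrightarrow> pls x y = pls y x" "\<And>x. x \<in> S \<Longrightarrow> pls z x = x"
    "\<And>a b x. x \<in> S \<Longrightarrow> scl (a + b) x = pls (scl a x) (scl b x)"
    "\<And>a x y. x \<in> S \<Longrightarrow> y \<in> S \<Longrightarrow> scl a (pls x y) = pls (scl a x) (scl a y)"
    "\<And>a b x. x \<in> S \<Longrightarrow> scl (a * b) x = scl a (scl b x)" "\<And>x. x \<in> S \<Longrightarrow> scl 1 x = x"
    using ax by blast+
  show ?thesis
    unfolding real_vector_space_on_iff T ball_simps bex_simps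
  proof (intro conjI ballI allI)
    fix x y assume "x \<in> S" "y \<in> S"
    then show "pls' (f x) (f y) = pls' (f y) (f x)"
      using laws(2)[of x y] pls[of x y] pls[of y x] by simp
  qed (use inv in \<open>simp_all add: cl laws(1,3-) z[symmetric] pls[symmetric] scl[symmetric]\<close>)
qed

lemma inv_into_cong:
  assumes "\<And>x. x \<in> A \<Longrightarrow> f x = g x"
  shows "inv_into A f = inv_into A g"
proof
  fix y
  have "(\<lambda>x. x \<in> A \<and> f x = y) = (\<lambda>x. x \<in> A \<and> g x = y)" using assms by auto
  then show "inv_into A f y = inv_into A g y" by (simp only: inv_into_def)
qed

lemma inv_into_compose:
  assumes f: "bij_betw f A B" and g: "bij_betw g B C" and x: "x \<in> C"
  shows "inv_into A (\<lambda>a. g (f a)) x = inv_into A f (inv_into B g x)"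
proof (rule inv_into_f_eq)
  show "inj_on (\<lambda>a. g (f a)) A"
    using bij_betw_imp_inj_on[OF bij_betw_trans[OF f g]] by (simp add: o_def)
  have y: "inv_into B g x \<in> B" using bij_betwE[OF bij_betw_inv_into[OF g]] x by blast
  then show "inv_into A f (inv_into B g x) \<in> A" using bij_betwE[OF bij_betw_inv_into[OF f]] by blast
  show "g (f (inv_into A f (inv_into B g x))) = x"
    by (simp add: bij_betw_inv_into_right[OF f y] bij_betw_inv_into_right[OF g x])
qed

text \<open>A frame of F over b, without any smoothness.\<close>

definition linear_bij :: "'v dvs \<Rightarrow> ('b, 'e) vbundle \<Rightarrow> 'b \<Rightarrow> ('v \<Rightarrow> 'e) \<Rightarrow> bool" where
  "linear_bij V F b \<phi> \<longleftrightarrow>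
     bij_betw \<phi> (vecs V) {x \<in> points (btotal F). bproj F x = b} \<and>
     (\<forall>v\<in>vecs V. \<forall>w\<in>vecs V. \<phi> (vadd V v w) = badd F (\<phi> v) (\<phi> w)) \<and>
     (\<forall>a. \<forall>v\<in>vecs V. \<phi> (vscale V a v) = bscale F a (\<phi> v))"

text \<open>
  A smooth family of frames of F, indexed by a space C that lies over the base by f. Three cases
  occur: for f the inclusion of a subset A of the base, such a family is a trivialization over A;
  for f a plot, it is a frame along this plot; for f the projection of a bundle P, it assigns to each
  point of P a frame over the same base point. The third condition is independent of the other two,
  as a smooth linear bijection of diffeological vector spaces need not have a smooth inverse.
\<close>

definition frame_along ::
  "'v dvs \<Rightarrow> 'c diffspace \<Rightarrow> ('c \<Rightarrow> 'b) \<Rightarrow> ('b, 'e) vbundle \<Rightarrow> ('c \<Rightarrow> 'v \<Rightarrow> 'e) \<Rightarrow> bool" where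
  "frame_along V C f F e \<longleftrightarrow>
     (\<forall>c\<in>points C. linear_bij V F (f c) (e c)) \<and>
     (\<forall>n U c v. c \<in> plots C n U \<longrightarrow> v \<in> plots (vspace V) n U \<longrightarrow>
        (\<lambda>u. e (c u) (v u)) \<in> plots (btotal F) n U) \<and>
     (\<forall>n U c x. c \<in> plots C n U \<longrightarrow> x \<in> plots (btotal F) n U \<longrightarrow> (\<forall>u\<in>U. bproj F (x u) = f (c u)) \<longrightarrow>
        (\<lambda>u. inv_into (vecs V) (e (c u)) (x u)) \<in> plots (vspace V) n U)"

lemma linear_bijD:
  assumes "linear_bij V F b \<phi>"
  shows "bij_betw \<phi> (vecs V) {x \<in> points (btotal F). bproj F x = b}"
    "v \<in> vecs V \<Longrightarrow> w \<in> vecs V \<Longrightarrow> \<phi> (vadd V v w) = badd F (\<phi> v) (\<phi> w)"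
    "v \<in> vecs V \<Longrightarrow> \<phi> (vscale V a v) = bscale F a (\<phi> v)"
    "v \<in> vecs V \<Longrightarrow> \<phi> v \<in> points (btotal F)"
    "v \<in> vecs V \<Longrightarrow> bproj F (\<phi> v) = b"
    "x \<in> points (btotal F) \<Longrightarrow> bproj F x = b \<Longrightarrow> inv_into (vecs V) \<phi> x \<in> vecs V"
    "x \<in> points (btotal F) \<Longrightarrow> bproj F x = b \<Longrightarrow> \<phi> (inv_into (vecs V) \<phi> x) = x"
    "v \<in> vecs V \<Longrightarrow> inv_into (vecs V) \<phi> (\<phi> v) = v"
proof -
  show b: "bij_betw \<phi> (vecs V) {x \<in> points (btotal F). bproj F x = b}"
    using assms by (simp add: linear_bij_def)
  show "v \<in> vecs V \<Longrightarrow> \<phi> v \<in> points (btotal F)" "v \<in> vecs V \<Longrightarrow> bproj F (\<phi> v) = b"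
    using bij_betwE[OF b] by auto
  show "v \<in> vecs V \<Longrightarrow> inv_into (vecs V) \<phi> (\<phi> v) = v"
    using bij_betw_inv_into_left[OF b] .
  show "x \<in> points (btotal F) \<Longrightarrow> bproj F x = b \<Longrightarrow> inv_into (vecs V) \<phi> x \<in> vecs V"
    using bij_betwE[OF bij_betw_inv_into[OF b]] by simp
  show "x \<in> points (btotal F) \<Longrightarrow> bproj F x = b \<Longrightarrow> \<phi> (inv_into (vecs V) \<phi> x) = x"
    using bij_betw_inv_into_right[OF b] by simp
qed (use assms in \<open>auto simp: linear_bij_def\<close>)

lemma linear_bij_cong:
  assumes "linear_bij V F b \<phi>" "\<And>v. v \<in> vecs V \<Longrightarrow> \<psi> v = \<phi> v"
    "\<And>v w. v \<in> vecs V \<Longrightarrow> w \<in> vecs V \<Longrightarrow> vadd V v w \<in> vecs V"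
    "\<And>a v. v \<in> vecs V \<Longrightarrow> vscale V a v \<in> vecs V"
  shows "linear_bij V F b \<psi>"
  using assms(1) unfolding linear_bij_def
  by (simp add: assms(2,3,4) cong: bij_betw_cong)

lemma frame_alongD:
  assumes "frame_along V C f F e"
  shows "c \<in> points C \<Longrightarrow> linear_bij V F (f c) (e c)"
    "k \<in> plots C n U \<Longrightarrow> v \<in> plots (vspace V) n U \<Longrightarrow> (\<lambda>u. e (k u) (v u)) \<in> plots (btotal F) n U"
    "k \<in> plots C n U \<Longrightarrow> x \<in> plots (btotal F) n U \<Longrightarrow> (\<And>u. u \<in> U \<Longrightarrow> bproj F (x u) = f (k u)) \<Longrightarrow>
        (\<lambda>u. inv_into (vecs V) (e (k u)) (x u)) \<in> plots (vspace V) n U"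
  by (rule assms[unfolded frame_along_def, THEN conjunct1, rule_format], assumption)
    (rule assms[unfolded frame_along_def, THEN conjunct2, THEN conjunct1, rule_format], assumption, assumption,
      rule assms[unfolded frame_along_def, THEN conjunct2, THEN conjunct2, rule_format], assumption, assumption)

lemma frame_alongI:
  assumes "\<And>c. c \<in> points C \<Longrightarrow> linear_bij V F (f c) (e c)"
    "\<And>n U k v. k \<in> plots C n U \<Longrightarrow> v \<in> plots (vspace V) n U \<Longrightarrow> (\<lambda>u. e (k u) (v u)) \<in> plots (btotal F) n U"
    "\<And>n U k x. k \<in> plots C n U \<Longrightarrow> x \<in> plots (btotal F) n U \<Longrightarrow> (\<And>u. u \<in> U \<Longrightarrow> bproj F (x u) = f (k u)) \<Longrightarrow>
        (\<lambda>u. inv_into (vecs V) (e (k u)) (x u)) \<in> plots (vspace V) n U"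
  shows "frame_along V C f F e"
  unfolding frame_along_def
proof (intro conjI ballI allI impI)
  show "linear_bij V F (f c) (e c)" if "c \<in> points C" for c by (rule assms(1)[OF that])
  show "(\<lambda>u. e (k u) (v u)) \<in> plots (btotal F) n U"
    if "k \<in> plots C n U" "v \<in> plots (vspace V) n U" for n U k v by (rule assms(2)[OF that])
  show "(\<lambda>u. inv_into (vecs V) (e (k u)) (x u)) \<in> plots (vspace V) n U"
    if "k \<in> plots C n U" "x \<in> plots (btotal F) n U" "\<forall>u\<in>U. bproj F (x u) = f (k u)" for n U k x
    by (rule assms(3)[OF that(1,2)]) (rule bspec[OF that(3)])
qed

lemma frame_along_compose:
  assumes "frame_along V C f F e" "smooth_map D C k"
  shows "frame_along V D (\<lambda>d. f (k d)) F (\<lambda>d. e (k d))"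
proof (rule frame_alongI)
  show "linear_bij V F (f (k d)) (e (k d))" if "d \<in> points D" for d
    by (rule frame_alongD(1)[OF assms(1) smooth_map_point[OF assms(2) that]])
  show "(\<lambda>u. e (k (p u)) (v u)) \<in> plots (btotal F) n U" if "p \<in> plots D n U" "v \<in> plots (vspace V) n U" for n U p v
    by (rule frame_alongD(2)[OF assms(1) smooth_map_plot[OF assms(2) that(1)] that(2)])
  show "(\<lambda>u. inv_into (vecs V) (e (k (p u))) (x u)) \<in> plots (vspace V) n U"
    if "p \<in> plots D n U" "x \<in> plots (btotal F) n U" "\<And>u. u \<in> U \<Longrightarrow> bproj F (x u) = f (k (p u))" for n U p x
    by (rule frame_alongD(3)[OF assms(1) smooth_map_plot[OF assms(2) that(1)] that(2,3)])
qed

lemma carrier_BijGroup: "carrier (BijGroup S) = Bij S"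
  by (simp add: BijGroup_def)

lemma GL_simps [simp]:
  "mult (GL V) = mult (BijGroup (vecs V))" "one (GL V) = (\<lambda>x\<in>vecs V. x)"
  "points (gspace (GL V)) = carrier (GL V)"
  by (simp_all add: GL_def Let_def BijGroup_def)

context
  fixes V :: "'v dvs"
  assumes V: "diffeological_vector_space V"
begin

lemma dvs_space: "diffeological_space (vspace V)"
  using V by (simp add: diffeological_vector_space_def)

lemma dvs_real_vector_space: "real_vector_space_on (vecs V) (vadd V) (vscale V) (vzero V)"
  using V by (simp add: diffeological_vector_space_def)

lemma dvs_add: "v \<in> vecs V \<Longrightarrow> w \<in> vecs V \<Longrightarrow> vadd V v w \<in> vecs V"
  and dvs_scale: "v \<in> vecs V \<Longrightarrow> vscale V a v \<in> vecs V"
  and dvs_zero: "vzero V \<in> vecs V"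
  using dvs_real_vector_space by (auto simp: real_vector_space_on_iff)

lemma dvs_add_plot:
  "v \<in> plots (vspace V) n U \<Longrightarrow> w \<in> plots (vspace V) n U \<Longrightarrow> (\<lambda>u. vadd V (v u) (w u)) \<in> plots (vspace V) n U"
  by (rule smooth_map_prodD(2)) (use V in \<open>auto simp: diffeological_vector_space_def\<close>)

lemma dvs_scale_plot:
  "smooth_fun n U a \<Longrightarrow> v \<in> plots (vspace V) n U \<Longrightarrow> (\<lambda>u. vscale V (a u) (v u)) \<in> plots (vspace V) n U"
  by (rule smooth_map_prodD(2)[of real_space])
    (use V in \<open>auto simp: diffeological_vector_space_def plots_real_space\<close>)

lemma frame_along_cong:
  assumes e: "frame_along V C f F e" and C: "diffeological_space C" and F: "diffeological_space (btotal F)"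
    and eq: "\<And>c v. c \<in> points C \<Longrightarrow> v \<in> vecs V \<Longrightarrow> e' c v = e c v"
      "\<And>c. c \<in> points C \<Longrightarrow> f' c = f c"
  shows "frame_along V C f' F e'"
proof (rule frame_alongI)
  show "linear_bij V F (f' c) (e' c)" if "c \<in> points C" for c
    using linear_bij_cong[OF frame_alongD(1)[OF e that] eq(1) dvs_add dvs_scale] eq(2) that by simp
  show "(\<lambda>u. e' (k u) (v u)) \<in> plots (btotal F) n U"
    if "k \<in> plots C n U" "v \<in> plots (vspace V) n U" for n U k v
    by (rule plot_cong[OF F frame_alongD(2)[OF e that]])
      (simp add: eq plot_point[OF C that(1)] plot_point[OF dvs_space that(2)])
  show "(\<lambda>u. inv_into (vecs V) (e' (k u)) (x u)) \<in> plots (vspace V) n U"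
    if k: "k \<in> plots C n U" "x \<in> plots (btotal F) n U" "\<And>u. u \<in> U \<Longrightarrow> bproj F (x u) = f' (k u)" for n U k x
  proof (rule plot_cong[OF dvs_space frame_alongD(3)[OF e k(1,2)]])
    fix u assume "u \<in> U"
    then have ku: "k u \<in> points C" by (rule plot_point[OF C k(1)])
    then show "bproj F (x u) = f (k u)" using k(3) \<open>u \<in> U\<close> eq(2) by simp
    show "inv_into (vecs V) (e' (k u)) (x u) = inv_into (vecs V) (e (k u)) (x u)"
      by (simp add: inv_into_cong[OF eq(1)[OF ku]])
  qed
qed

lemma GL_carrier_iff:
  "g \<in> carrier (GL V) \<longleftrightarrow> g \<in> extensional (vecs V) \<and> bij_betw g (vecs V) (vecs V) \<and>
     (\<forall>v\<in>vecs V. \<forall>w\<in>vecs V. g (vadd V v w) = vadd V (g v) (g w)) \<and>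
     (\<forall>a. \<forall>v\<in>vecs V. g (vscale V a v) = vscale V a (g v)) \<and>
     smooth_map (vspace V) (vspace V) g \<and> smooth_map (vspace V) (vspace V) (inv_into (vecs V) g)"
    (is "?L \<longleftrightarrow> ?R")
proof
  assume ?L
  then have g: "g \<in> extensional (vecs V)" "bij_betw g (vecs V) (vecs V)" "dvs_linear V V g"
    "diffeomorphism (vspace V) (vspace V) g"
    by (auto simp: GL_def Let_def Bij_def dvs_isomorphism_def)
  obtain g' where g': "smooth_map (vspace V) (vspace V) g" "smooth_map (vspace V) (vspace V) g'"
    "\<And>x. x \<in> vecs V \<Longrightarrow> g' (g x) = x" "\<And>x. x \<in> vecs V \<Longrightarrow> g (g' x) = x"
    using g(4) by (rule diffeomorphismE) blast
  have "smooth_map (vspace V) (vspace V) (inv_into (vecs V) g)"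
  proof (rule smooth_map_cong[OF g'(2) dvs_space dvs_space])
    fix x assume x: "x \<in> vecs V"
    show "inv_into (vecs V) g x = g' x"
      using g(2) g'(4)[OF x] smooth_map_point[OF g'(2) x] by (metis bij_betw_inv_into_left)
  qed
  with g g'(1) show ?R by (simp add: dvs_linear_def)
next
  assume R: ?R
  then have "diffeomorphism (vspace V) (vspace V) g"
    by (intro diffeomorphismI[of _ _ _ "inv_into (vecs V) g"])
      (auto simp: bij_betw_inv_into_left bij_betw_inv_into_right)
  with R show ?L by (auto simp: GL_def Let_def Bij_def dvs_isomorphism_def dvs_linear_def)
qed

lemma GL_D:
  assumes "g \<in> carrier (GL V)"
  shows "g \<in> extensional (vecs V)" "bij_betw g (vecs V) (vecs V)"
    "v \<in> vecs V \<Longrightarrow> w \<in> vecs V \<Longrightarrow> g (vadd V v w) = vadd V (g v) (g w)"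
    "v \<in> vecs V \<Longrightarrow> g (vscale V a v) = vscale V a (g v)"
    "v \<in> vecs V \<Longrightarrow> g v \<in> vecs V"
    "v \<in> vecs V \<Longrightarrow> inv_into (vecs V) g v \<in> vecs V"
    "v \<in> vecs V \<Longrightarrow> g (inv_into (vecs V) g v) = v"
    "v \<in> vecs V \<Longrightarrow> inv_into (vecs V) g (g v) = v"
    "g \<in> Bij (vecs V)"
    "smooth_map (vspace V) (vspace V) g" "smooth_map (vspace V) (vspace V) (inv_into (vecs V) g)"
proof -
  note g = assms[unfolded GL_carrier_iff]
  from g show b: "bij_betw g (vecs V) (vecs V)" by blast
  show "v \<in> vecs V \<Longrightarrow> g v \<in> vecs V" using bij_betwE[OF b] by blast
  show "v \<in> vecs V \<Longrightarrow> inv_into (vecs V) g v \<in> vecs V" using bij_betwE[OF bij_betw_inv_into[OF b]] by blast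
  show "v \<in> vecs V \<Longrightarrow> g (inv_into (vecs V) g v) = v" using bij_betw_inv_into_right[OF b] .
  show "v \<in> vecs V \<Longrightarrow> inv_into (vecs V) g (g v) = v" using bij_betw_inv_into_left[OF b] .
  show "g \<in> Bij (vecs V)" using g by (simp add: Bij_def)
qed (use assms[unfolded GL_carrier_iff] in blast)+

lemma GL_mult: "g \<in> carrier (GL V) \<Longrightarrow> h \<in> carrier (GL V) \<Longrightarrow> g \<otimes>\<^bsub>GL V\<^esub> h = compose (vecs V) g h"
  by (simp add: BijGroup_def GL_D(9))

lemma GL_mult_apply:
  "g \<in> carrier (GL V) \<Longrightarrow> h \<in> carrier (GL V) \<Longrightarrow> v \<in> vecs V \<Longrightarrow> (g \<otimes>\<^bsub>GL V\<^esub> h) v = g (h v)"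
  using GL_mult by (simp add: compose_eq del: GL_simps)

lemma GL_ext:
  assumes "g \<in> carrier (GL V)" "h \<in> carrier (GL V)" "\<And>v. v \<in> vecs V \<Longrightarrow> g v = h v"
  shows "g = h"
  using GL_D(1)[OF assms(1)] GL_D(1)[OF assms(2)] assms(3) by (rule extensionalityI)

text \<open>
  Members of GL(V) are required to be extensional, but they are usually given by a formula that
  makes sense outside V as well.
\<close>

lemma GL_restrictI:
  assumes bij: "bij_betw g (vecs V) (vecs V)"
    and lin: "\<And>v w. v \<in> vecs V \<Longrightarrow> w \<in> vecs V \<Longrightarrow> g (vadd V v w) = vadd V (g v) (g w)"
      "\<And>a v. v \<in> vecs V \<Longrightarrow> g (vscale V a v) = vscale V a (g v)"
    and sm: "\<And>n U v. v \<in> plots (vspace V) n U \<Longrightarrow> (\<lambda>u. g (v u)) \<in> plots (vspace V) n U"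
      "\<And>n U v. v \<in> plots (vspace V) n U \<Longrightarrow> (\<lambda>u. inv_into (vecs V) g (v u)) \<in> plots (vspace V) n U"
  shows "restrict g (vecs V) \<in> carrier (GL V)"
proof -
  have im: "\<And>v. v \<in> vecs V \<Longrightarrow> g v \<in> vecs V" "\<And>v. v \<in> vecs V \<Longrightarrow> inv_into (vecs V) g v \<in> vecs V"
    using bij_betwE[OF bij] bij_betwE[OF bij_betw_inv_into[OF bij]] by blast+
  have inv: "inv_into (vecs V) (restrict g (vecs V)) = inv_into (vecs V) g"
    by (rule inv_into_cong) simp
  have s1: "smooth_map (vspace V) (vspace V) g" "smooth_map (vspace V) (vspace V) (inv_into (vecs V) g)"
    by (rule smooth_mapI, simp add: im, rule sm, assumption)+
  have "smooth_map (vspace V) (vspace V) (restrict g (vecs V))"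
    by (rule smooth_map_cong[OF s1(1) dvs_space dvs_space]) simp
  moreover have "bij_betw (restrict g (vecs V)) (vecs V) (vecs V)"
    using bij by (simp cong: bij_betw_cong)
  ultimately show ?thesis
    unfolding GL_carrier_iff inv using s1 lin im by (simp add: dvs_add dvs_scale)
qed

text \<open>The two smooth maps in the definition of plots of GL(V), tested on plots of the product of U and V.\<close>

lemma GL_plots_iff:
  "p \<in> plots (gspace (GL V)) n U \<longleftrightarrow> openin (Euclidean_space n) U \<and> (\<forall>u\<in>U. p u \<in> carrier (GL V)) \<and>
     (\<forall>m W h v. smooth_between m W n U h \<longrightarrow> v \<in> plots (vspace V) m W \<longrightarrow>
        (\<lambda>w. p (h w) (v w)) \<in> plots (vspace V) m W \<and>
        (\<lambda>w. inv_into (vecs V) (p (h w)) (v w)) \<in> plots (vspace V) m W)" (is "_ \<longleftrightarrow> ?R")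
proof -
  let ?s1 = "smooth_map (prod_space (domain_space n U) (vspace V)) (vspace V) (\<lambda>(u, v). p u v)"
  let ?s2 = "smooth_map (prod_space (domain_space n U) (vspace V)) (vspace V) (\<lambda>(u, v). inv_into (vecs V) (p u) v)"
  have "p \<in> plots (gspace (GL V)) n U \<longleftrightarrow>
      openin (Euclidean_space n) U \<and> p ` U \<subseteq> carrier (GL V) \<and> ?s1 \<and> ?s2" (is "_ \<longleftrightarrow> ?L")
    by (simp add: GL_def Let_def)
  also have "\<dots> \<longleftrightarrow> ?R"
  proof
    assume L: ?L
    note s = L[THEN conjunct2, THEN conjunct2, THEN conjunct1] L[THEN conjunct2, THEN conjunct2, THEN conjunct2]
    have "(\<lambda>w. p (h w) (v w)) \<in> plots (vspace V) m W \<and>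
        (\<lambda>w. inv_into (vecs V) (p (h w)) (v w)) \<in> plots (vspace V) m W"
      if "smooth_between m W n U h" "v \<in> plots (vspace V) m W" for m W h v
      using smooth_map_prodD(2)[OF s(1), of h m W v] smooth_map_prodD(2)[OF s(2), of h m W v] that by simp
    moreover have "openin (Euclidean_space n) U" "\<forall>u\<in>U. p u \<in> carrier (GL V)" using L by auto
    ultimately show ?R by (intro conjI allI impI) auto
  next
    assume R: ?R
    note R1 = R[THEN conjunct1] and R2 = R[THEN conjunct2, THEN conjunct1]
    note R3 = R[THEN conjunct2, THEN conjunct2, rule_format, THEN conjunct1]
      R[THEN conjunct2, THEN conjunct2, rule_format, THEN conjunct2]
    have s: ?s1
    proof (rule smooth_map_prodI)
      show "p u v \<in> vecs V" if "u \<in> points (domain_space n U)" "v \<in> vecs V" for u v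
        using R2 that GL_D(5) by simp
      show "(\<lambda>w. p (h w) (v w)) \<in> plots (vspace V) m W"
        if "h \<in> plots (domain_space n U) m W" "v \<in> plots (vspace V) m W" for m W h v
        using that by (intro R3(1)) simp_all
    qed
    have s': ?s2
    proof (rule smooth_map_prodI)
      show "inv_into (vecs V) (p u) v \<in> vecs V" if "u \<in> points (domain_space n U)" "v \<in> vecs V" for u v
        using R2 that GL_D(6) by simp
      show "(\<lambda>w. inv_into (vecs V) (p (h w)) (v w)) \<in> plots (vspace V) m W"
        if "h \<in> plots (domain_space n U) m W" "v \<in> plots (vspace V) m W" for m W h v
        using that by (intro R3(2)) simp_all
    qed
    show ?L using R1 R2 s s' by (intro conjI image_subsetI) simp_all
  qed
  finally show ?thesis .
qed

lemma GL_plotD: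
  assumes "p \<in> plots (gspace (GL V)) n U"
  shows "openin (Euclidean_space n) U" "u \<in> U \<Longrightarrow> p u \<in> carrier (GL V)"
    "smooth_between m W n U h \<Longrightarrow> v \<in> plots (vspace V) m W \<Longrightarrow> (\<lambda>w. p (h w) (v w)) \<in> plots (vspace V) m W"
    "smooth_between m W n U h \<Longrightarrow> v \<in> plots (vspace V) m W \<Longrightarrow>
       (\<lambda>w. inv_into (vecs V) (p (h w)) (v w)) \<in> plots (vspace V) m W"
    "v \<in> plots (vspace V) n U \<Longrightarrow> (\<lambda>u. p u (v u)) \<in> plots (vspace V) n U"
    "v \<in> plots (vspace V) n U \<Longrightarrow> (\<lambda>u. inv_into (vecs V) (p u) (v u)) \<in> plots (vspace V) n U"
proof -
  note p = assms[unfolded GL_plots_iff]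
  show U: "openin (Euclidean_space n) U" by (rule p[THEN conjunct1])
  show "u \<in> U \<Longrightarrow> p u \<in> carrier (GL V)" by (rule p[THEN conjunct2, THEN conjunct1, rule_format])
  show 3: "smooth_between m W n U h \<Longrightarrow> v \<in> plots (vspace V) m W \<Longrightarrow> (\<lambda>w. p (h w) (v w)) \<in> plots (vspace V) m W"
    and 4: "smooth_between m W n U h \<Longrightarrow> v \<in> plots (vspace V) m W \<Longrightarrow>
       (\<lambda>w. inv_into (vecs V) (p (h w)) (v w)) \<in> plots (vspace V) m W" for m W h v
    by (rule p[THEN conjunct2, THEN conjunct2, rule_format, THEN conjunct1]
        p[THEN conjunct2, THEN conjunct2, rule_format, THEN conjunct2], assumption, assumption)+
  note id = smooth_between_inclusion[OF U U subset_refl]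
  show "v \<in> plots (vspace V) n U \<Longrightarrow> (\<lambda>u. p u (v u)) \<in> plots (vspace V) n U"
    "v \<in> plots (vspace V) n U \<Longrightarrow> (\<lambda>u. inv_into (vecs V) (p u) (v u)) \<in> plots (vspace V) n U"
    by (rule 3[OF id], assumption) (rule 4[OF id], assumption)
qed

lemma GL_plotI:
  assumes "openin (Euclidean_space n) U" "\<And>u. u \<in> U \<Longrightarrow> p u \<in> carrier (GL V)"
    "\<And>m W h v. smooth_between m W n U h \<Longrightarrow> v \<in> plots (vspace V) m W \<Longrightarrow> (\<lambda>w. p (h w) (v w)) \<in> plots (vspace V) m W"
    "\<And>m W h v. smooth_between m W n U h \<Longrightarrow> v \<in> plots (vspace V) m W \<Longrightarrow>
       (\<lambda>w. inv_into (vecs V) (p (h w)) (v w)) \<in> plots (vspace V) m W"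
  shows "p \<in> plots (gspace (GL V)) n U"
  unfolding GL_plots_iff
proof (intro conjI ballI allI impI)
  fix m W h v assume hv: "smooth_between m W n U h" "v \<in> plots (vspace V) m W"
  show "(\<lambda>w. p (h w) (v w)) \<in> plots (vspace V) m W" by (rule assms(3)[OF hv])
  show "(\<lambda>w. inv_into (vecs V) (p (h w)) (v w)) \<in> plots (vspace V) m W" by (rule assms(4)[OF hv])
next
  show "openin (Euclidean_space n) U" by (rule assms(1))
  show "p u \<in> carrier (GL V)" if "u \<in> U" for u by (rule assms(2)[OF that])
qed

text \<open>
  Precomposition with a smooth map is where the composition of smooth maps between open subsets of
  Euclidean spaces enters.
\<close>

lemma diffeological_GL: "diffeological_space (gspace (GL V))"
proof (rule diffeological_spaceI)
  show "openin (Euclidean_space n) U" if "p \<in> plots (gspace (GL V)) n U" for n U p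
    by (rule GL_plotD[OF that])
  show "p u \<in> points (gspace (GL V))" if "p \<in> plots (gspace (GL V)) n U" "u \<in> U" for n U p u
    using GL_plotD(2)[OF that] by simp
  show "(\<lambda>_. g) \<in> plots (gspace (GL V)) n U"
    if U: "openin (Euclidean_space n) U" and "g \<in> points (gspace (GL V))" for n U g
  proof (rule GL_plotI[OF U])
    from that have g: "g \<in> carrier (GL V)" by simp
    then show "g \<in> carrier (GL V)" .
    show "(\<lambda>w. g (v w)) \<in> plots (vspace V) m W" "(\<lambda>w. inv_into (vecs V) g (v w)) \<in> plots (vspace V) m W"
      if "v \<in> plots (vspace V) m W" for m W v
      using smooth_map_plot[OF GL_D(10)[OF g] that] smooth_map_plot[OF GL_D(11)[OF g] that] by simp_all
  qed
  show "(\<lambda>w. p (h w)) \<in> plots (gspace (GL V)) m W"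
    if p: "p \<in> plots (gspace (GL V)) n U" and h: "smooth_between m W n U h" for n U p m W h
  proof (rule GL_plotI[OF smooth_between_openD(1)[OF h]])
    show "p (h w) \<in> carrier (GL V)" if "w \<in> W" for w
      by (rule GL_plotD(2)[OF p smooth_between_openD(3)[OF h that]])
    fix m' W' h' v assume "smooth_between m' W' m W h'" and v: "v \<in> plots (vspace V) m' W'"
    from smooth_between_compose[OF h this(1)] have hh: "smooth_between m' W' n U (\<lambda>w. h (h' w))" .
    show "(\<lambda>w. p (h (h' w)) (v w)) \<in> plots (vspace V) m' W'"
      "(\<lambda>w. inv_into (vecs V) (p (h (h' w))) (v w)) \<in> plots (vspace V) m' W'"
      using GL_plotD(3)[OF p hh v] GL_plotD(4)[OF p hh v] by simp_all
  qed
  fix n U p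
  assume U: "openin (Euclidean_space n) U"
    and l: "\<And>u. u \<in> U \<Longrightarrow> \<exists>W. openin (Euclidean_space n) W \<and> u \<in> W \<and> W \<subseteq> U \<and>
                    (\<exists>q\<in>plots (gspace (GL V)) n W. \<forall>w\<in>W. p w = q w)"
  show "p \<in> plots (gspace (GL V)) n U"
  proof (rule GL_plotI[OF U])
    show "p u \<in> carrier (GL V)" if u: "u \<in> U" for u
      using l[OF u] GL_plotD(2) by metis
    fix m W h v assume h: "smooth_between m W n U h" and v: "v \<in> plots (vspace V) m W"
    note W = smooth_between_openD(1)[OF h]
    have loc: "\<exists>T q. openin (Euclidean_space m) T \<and> w \<in> T \<and> T \<subseteq> W \<and> (\<forall>t\<in>T. p (h t) = q (h t)) \<and>
        (\<lambda>t. q (h t) (v t)) \<in> plots (vspace V) m T \<and>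
        (\<lambda>t. inv_into (vecs V) (q (h t)) (v t)) \<in> plots (vspace V) m T" if w: "w \<in> W" for w
    proof -
      obtain O' q where O': "openin (Euclidean_space n) O'" "h w \<in> O'" "O' \<subseteq> U"
        "q\<in>plots (gspace (GL V)) n O'" "\<forall>w\<in>O'. p w = q w"
        using l[OF smooth_between_openD(3)[OF h w]] by blast
      \<comment> \<open>A local plot of GL(V) near h w is pulled back to the preimage of its domain.\<close>
      let ?T = "{w \<in> W. h w \<in> O'}"
      have T: "openin (Euclidean_space m) ?T" by (rule smooth_between_preimage[OF h O'(1)])
      have hT: "smooth_between m ?T n O' h"
        by (rule smooth_between_range[OF smooth_between_restrict[OF h T]]) (use O' in auto)
      have vT: "v \<in> plots (vspace V) m ?T" by (rule plot_restrict[OF dvs_space v T]) auto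
      show ?thesis
        using T w O'(2,5) GL_plotD(3)[OF O'(4) hT vT] GL_plotD(4)[OF O'(4) hT vT]
        by (intro exI[of _ ?T] exI[of _ q]) simp
    qed
    show "(\<lambda>w. p (h w) (v w)) \<in> plots (vspace V) m W"
    proof (rule plot_local[OF dvs_space W])
      fix w assume "w \<in> W"
      from loc[OF this] obtain T q where T: "openin (Euclidean_space m) T" "w \<in> T" "T \<subseteq> W"
        "\<forall>t\<in>T. p (h t) = q (h t)" "(\<lambda>t. q (h t) (v t)) \<in> plots (vspace V) m T" by blast
      then show "\<exists>T q. openin (Euclidean_space m) T \<and> w \<in> T \<and> T \<subseteq> W \<and> q \<in> plots (vspace V) m T \<and>
          (\<forall>t\<in>T. p (h t) (v t) = q t)"
        by (intro exI[of _ T] exI[of _ "\<lambda>t. q (h t) (v t)"]) simp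
    qed
    show "(\<lambda>w. inv_into (vecs V) (p (h w)) (v w)) \<in> plots (vspace V) m W"
    proof (rule plot_local[OF dvs_space W])
      fix w assume "w \<in> W"
      from loc[OF this] obtain T q where T: "openin (Euclidean_space m) T" "w \<in> T" "T \<subseteq> W"
        "\<forall>t\<in>T. p (h t) = q (h t)" "(\<lambda>t. inv_into (vecs V) (q (h t)) (v t)) \<in> plots (vspace V) m T" by blast
      then show "\<exists>T q. openin (Euclidean_space m) T \<and> w \<in> T \<and> T \<subseteq> W \<and> q \<in> plots (vspace V) m T \<and>
          (\<forall>t\<in>T. inv_into (vecs V) (p (h t)) (v t) = q t)"
        by (intro exI[of _ T] exI[of _ "\<lambda>t. inv_into (vecs V) (q (h t)) (v t)"]) simp
    qed
  qed
qed

lemma GL_inverse: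
  assumes g: "g \<in> carrier (GL V)"
  shows "restrict (inv_into (vecs V) g) (vecs V) \<in> carrier (GL V)"
proof (rule GL_restrictI)
  show "bij_betw (inv_into (vecs V) g) (vecs V) (vecs V)"
    by (rule bij_betw_inv_into[OF GL_D(2)[OF g]])
  show "inv_into (vecs V) g (vadd V v w) = vadd V (inv_into (vecs V) g v) (inv_into (vecs V) g w)"
    if v: "v \<in> vecs V" "w \<in> vecs V" for v w
  proof -
    note i = GL_D(6)[OF g v(1)] GL_D(6)[OF g v(2)]
    show ?thesis
      using GL_D(8)[OF g dvs_add[OF i]] by (simp add: GL_D(3)[OF g i] GL_D(7)[OF g] v)
  qed
  show "inv_into (vecs V) g (vscale V a v) = vscale V a (inv_into (vecs V) g v)" if v: "v \<in> vecs V" for a v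
  proof -
    note i = GL_D(6)[OF g v]
    show ?thesis
      using GL_D(8)[OF g dvs_scale[OF i]] by (simp add: GL_D(4)[OF g i] GL_D(7)[OF g] v)
  qed
  show "(\<lambda>u. inv_into (vecs V) g (v u)) \<in> plots (vspace V) n U" if "v \<in> plots (vspace V) n U" for n U v
    by (rule smooth_map_plot[OF GL_D(11)[OF g] that])
  show "(\<lambda>u. inv_into (vecs V) (inv_into (vecs V) g) (v u)) \<in> plots (vspace V) n U"
    if "v \<in> plots (vspace V) n U" for n U v
  proof (rule plot_cong[OF dvs_space smooth_map_plot[OF GL_D(10)[OF g] that]])
    fix u assume "u \<in> U"
    then have "v u \<in> vecs V" by (rule plot_point[OF dvs_space that])
    then show "inv_into (vecs V) (inv_into (vecs V) g) (v u) = g (v u)"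
      by (rule inv_into_inv_into_eq[OF GL_D(2)[OF g]])
  qed
qed

lemma GL_compose:
  assumes g: "g \<in> carrier (GL V)" and h: "h \<in> carrier (GL V)"
  shows "compose (vecs V) g h \<in> carrier (GL V)"
  unfolding compose_def
proof (rule GL_restrictI)
  show "bij_betw (\<lambda>v. g (h v)) (vecs V) (vecs V)"
    using bij_betw_trans[OF GL_D(2)[OF h] GL_D(2)[OF g]] by (simp add: o_def)
  show "(\<lambda>u. g (h (v u))) \<in> plots (vspace V) n U" if "v \<in> plots (vspace V) n U" for n U v
    by (rule smooth_map_plot[OF GL_D(10)[OF g] smooth_map_plot[OF GL_D(10)[OF h] that]])
  show "(\<lambda>u. inv_into (vecs V) (\<lambda>v. g (h v)) (v u)) \<in> plots (vspace V) n U"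
    if "v \<in> plots (vspace V) n U" for n U v
    by (rule plot_cong[OF dvs_space smooth_map_plot[OF GL_D(11)[OF h] smooth_map_plot[OF GL_D(11)[OF g] that]]])
      (rule inv_into_compose[OF GL_D(2)[OF h] GL_D(2)[OF g] plot_point[OF dvs_space that]])
qed (simp_all add: GL_D[OF g] GL_D[OF h])

lemma group_GL: "group (GL V)"
proof (rule groupI)
  show "\<one>\<^bsub>GL V\<^esub> \<in> carrier (GL V)"
  proof -
    have i: "inv_into (vecs V) (\<lambda>x. x) v = v" if "v \<in> vecs V" for v
      using that by (simp add: inv_into_f_eq)
    have "(\<lambda>v\<in>vecs V. v) \<in> carrier (GL V)"
    proof (rule GL_restrictI)
      show "bij_betw (\<lambda>v. v) (vecs V) (vecs V)" by (simp add: bij_betw_def)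
      show "(\<lambda>u. inv_into (vecs V) (\<lambda>v. v) (v u)) \<in> plots (vspace V) n U"
        if v: "v \<in> plots (vspace V) n U" for n U v
        by (rule plot_cong[OF dvs_space v]) (rule i[OF plot_point[OF dvs_space v]])
    qed simp_all
    then show ?thesis by simp
  qed
next
  fix x y assume "x \<in> carrier (GL V)" "y \<in> carrier (GL V)"
  then show "x \<otimes>\<^bsub>GL V\<^esub> y \<in> carrier (GL V)" using GL_mult GL_compose by (simp del: GL_simps)
next
  fix x y z assume "x \<in> carrier (GL V)" "y \<in> carrier (GL V)" "z \<in> carrier (GL V)"
  then show "x \<otimes>\<^bsub>GL V\<^esub> y \<otimes>\<^bsub>GL V\<^esub> z = x \<otimes>\<^bsub>GL V\<^esub> (y \<otimes>\<^bsub>GL V\<^esub> z)"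
    unfolding GL_simps(1)
    by (intro monoid.m_assoc[OF group.is_monoid[OF group_BijGroup]]) (simp_all add: GL_D(9) carrier_BijGroup)
next
  fix x assume x: "x \<in> carrier (GL V)"
  then show "\<one>\<^bsub>GL V\<^esub> \<otimes>\<^bsub>GL V\<^esub> x = x"
    using monoid.l_one[OF group.is_monoid[OF group_BijGroup, of "vecs V"], of x] GL_D(9)
    by (simp add: BijGroup_def)
  let ?y = "restrict (inv_into (vecs V) x) (vecs V)"
  have "?y \<otimes>\<^bsub>GL V\<^esub> x = \<one>\<^bsub>GL V\<^esub>"
    unfolding GL_mult[OF GL_inverse[OF x] x] using Bij_compose_restrict_eq[OF GL_D(9)[OF x]] by simp
  then show "\<exists>y\<in>carrier (GL V). y \<otimes>\<^bsub>GL V\<^esub> x = \<one>\<^bsub>GL V\<^esub>"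
    using GL_inverse[OF x] by blast
qed

lemma GL_inv:
  assumes g: "g \<in> carrier (GL V)"
  shows "inv\<^bsub>GL V\<^esub> g = restrict (inv_into (vecs V) g) (vecs V)"
proof (rule group.inv_equality[OF group_GL _ g GL_inverse[OF g]])
  show "restrict (inv_into (vecs V) g) (vecs V) \<otimes>\<^bsub>GL V\<^esub> g = \<one>\<^bsub>GL V\<^esub>"
    unfolding GL_mult[OF GL_inverse[OF g] g] using Bij_compose_restrict_eq[OF GL_D(9)[OF g]] by simp
qed

lemma diffeological_group_GL: "diffeological_group (GL V)"
  unfolding diffeological_group_def
proof (intro conjI group_GL diffeological_GL)
  show "smooth_map (prod_space (gspace (GL V)) (gspace (GL V))) (gspace (GL V)) (\<lambda>(g, h). g \<otimes>\<^bsub>GL V\<^esub> h)"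
  proof (rule smooth_map_prodI)
    fix n U a b assume a: "a \<in> plots (gspace (GL V)) n U" and b: "b \<in> plots (gspace (GL V)) n U"
    show "(\<lambda>u. a u \<otimes>\<^bsub>GL V\<^esub> b u) \<in> plots (gspace (GL V)) n U"
    proof (rule GL_plotI[OF GL_plotD(1)[OF a]])
      show "a u \<otimes>\<^bsub>GL V\<^esub> b u \<in> carrier (GL V)" if "u \<in> U" for u
        unfolding GL_mult[OF GL_plotD(2)[OF a that] GL_plotD(2)[OF b that]]
        by (rule GL_compose[OF GL_plotD(2)[OF a that] GL_plotD(2)[OF b that]])
      fix m W h v assume h: "smooth_between m W n U h" and v: "v \<in> plots (vspace V) m W"
      have ah: "a (h w) \<in> carrier (GL V)" and bh: "b (h w) \<in> carrier (GL V)" and vw: "v w \<in> vecs V" if "w \<in> W" for w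
        using GL_plotD(2)[OF a] GL_plotD(2)[OF b] smooth_between_openD(3)[OF h that] plot_point[OF dvs_space v that]
        by blast+
      show "(\<lambda>w. (a (h w) \<otimes>\<^bsub>GL V\<^esub> b (h w)) (v w)) \<in> plots (vspace V) m W"
        by (rule plot_cong[OF dvs_space GL_plotD(3)[OF a h GL_plotD(3)[OF b h v]]])
          (rule GL_mult_apply[OF ah bh vw])
      show "(\<lambda>w. inv_into (vecs V) (a (h w) \<otimes>\<^bsub>GL V\<^esub> b (h w)) (v w)) \<in> plots (vspace V) m W"
      proof (rule plot_cong[OF dvs_space GL_plotD(4)[OF b h GL_plotD(4)[OF a h v]]])
        fix w assume w: "w \<in> W"
        have "inv_into (vecs V) (a (h w) \<otimes>\<^bsub>GL V\<^esub> b (h w)) = inv_into (vecs V) (\<lambda>v. a (h w) (b (h w) v))"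
          by (rule inv_into_cong) (rule GL_mult_apply[OF ah[OF w] bh[OF w]])
        then show "inv_into (vecs V) (a (h w) \<otimes>\<^bsub>GL V\<^esub> b (h w)) (v w) =
            inv_into (vecs V) (b (h w)) (inv_into (vecs V) (a (h w)) (v w))"
          by (simp only: inv_into_compose[OF GL_D(2)[OF bh[OF w]] GL_D(2)[OF ah[OF w]] vw[OF w]])
      qed
    qed
  qed (simp_all only: GL_simps(3) GL_mult GL_compose)
  show "smooth_map (gspace (GL V)) (gspace (GL V)) (\<lambda>g. inv\<^bsub>GL V\<^esub> g)"
  proof (rule smooth_mapI)
    show "inv\<^bsub>GL V\<^esub> g \<in> points (gspace (GL V))" if "g \<in> points (gspace (GL V))" for g
      using that by (simp add: GL_inv GL_inverse)
    fix n U a assume a: "a \<in> plots (gspace (GL V)) n U"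
    show "(\<lambda>u. inv\<^bsub>GL V\<^esub> a u) \<in> plots (gspace (GL V)) n U"
    proof (rule GL_plotI[OF GL_plotD(1)[OF a]])
      show "inv\<^bsub>GL V\<^esub> a u \<in> carrier (GL V)" if "u \<in> U" for u
        using GL_inverse[OF GL_plotD(2)[OF a that]] GL_inv[OF GL_plotD(2)[OF a that]] by simp
      fix m W h v assume h: "smooth_between m W n U h" and v: "v \<in> plots (vspace V) m W"
      have ah: "a (h w) \<in> carrier (GL V)" and vw: "v w \<in> vecs V" if "w \<in> W" for w
        using GL_plotD(2)[OF a] smooth_between_openD(3)[OF h that] plot_point[OF dvs_space v that] by blast+
      show "(\<lambda>w. (inv\<^bsub>GL V\<^esub> a (h w)) (v w)) \<in> plots (vspace V) m W"
        by (rule plot_cong[OF dvs_space GL_plotD(4)[OF a h v]]) (simp add: GL_inv ah vw)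
      show "(\<lambda>w. inv_into (vecs V) (inv\<^bsub>GL V\<^esub> a (h w)) (v w)) \<in> plots (vspace V) m W"
      proof (rule plot_cong[OF dvs_space GL_plotD(3)[OF a h v]])
        fix w assume w: "w \<in> W"
        have "inv_into (vecs V) (inv\<^bsub>GL V\<^esub> a (h w)) = inv_into (vecs V) (inv_into (vecs V) (a (h w)))"
          by (rule inv_into_cong) (simp add: GL_inv ah w)
        then show "inv_into (vecs V) (inv\<^bsub>GL V\<^esub> a (h w)) (v w) = a (h w) (v w)"
          by (simp add: inv_into_inv_into_eq[OF GL_D(2)[OF ah[OF w]]] vw w)
      qed
    qed
  qed
qed simp

text \<open>
  Two smooth frames of the same bundle differ by a smooth map to GL(V). The diffeology of GL(V) is
  made for this statement: that (u, v) \<mapsto> p(u)(v) and the corresponding map for the inverses are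
  smooth is here the smoothness of passing from one frame to the other, in both directions.
\<close>

lemma frame_change:
  assumes e: "frame_along V C f F e" and e': "frame_along V C f F e'"
    and C: "diffeological_space C" and F: "diffeological_space (btotal F)"
  shows "smooth_map C (gspace (GL V)) (\<lambda>c. restrict (\<lambda>v. inv_into (vecs V) (e c) (e' c v)) (vecs V))"
proof -
  have bij: "bij_betw (\<lambda>v. inv_into (vecs V) (e c) (e' c v)) (vecs V) (vecs V)" if c: "c \<in> points C" for c
    using bij_betw_trans[OF linear_bijD(1)[OF frame_alongD(1)[OF e' c]]
        bij_betw_inv_into[OF linear_bijD(1)[OF frame_alongD(1)[OF e c]]]] by (simp add: o_def)
  have sm: "(\<lambda>u. inv_into (vecs V) (e (k u)) (e' (k u) (v u))) \<in> plots (vspace V) n U"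
    if k: "k \<in> plots C n U" and v: "v \<in> plots (vspace V) n U" for n U k v
    by (rule frame_alongD(3)[OF e k frame_alongD(2)[OF e' k v]])
      (rule linear_bijD(5)[OF frame_alongD(1)[OF e' plot_point[OF C k]] plot_point[OF dvs_space v]])
  have ii: "inv_into (vecs V) (\<lambda>v. inv_into (vecs V) (e c) (e' c v)) v = inv_into (vecs V) (e' c) (e c v)"
    if c: "c \<in> points C" and v: "v \<in> vecs V" for c v
  proof -
    note L = linear_bijD[OF frame_alongD(1)[OF e c]] and L' = linear_bijD[OF frame_alongD(1)[OF e' c]]
    show ?thesis
      by (rule inv_into_f_eq[OF bij_betw_imp_inj_on[OF bij[OF c]]])
        (simp_all add: v L(4,5,8) L'(6,7))
  qed
  have sm': "(\<lambda>u. inv_into (vecs V) (\<lambda>v. inv_into (vecs V) (e (k u)) (e' (k u) v)) (v u)) \<in> plots (vspace V) n U"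
    if k: "k \<in> plots C n U" and v: "v \<in> plots (vspace V) n U" for n U k v
  proof (rule plot_cong[OF dvs_space])
    show "(\<lambda>u. inv_into (vecs V) (e' (k u)) (e (k u) (v u))) \<in> plots (vspace V) n U"
      by (rule frame_alongD(3)[OF e' k frame_alongD(2)[OF e k v]])
        (rule linear_bijD(5)[OF frame_alongD(1)[OF e plot_point[OF C k]] plot_point[OF dvs_space v]])
  qed (rule ii[OF plot_point[OF C k] plot_point[OF dvs_space v]])
  have car: "restrict (\<lambda>v. inv_into (vecs V) (e c) (e' c v)) (vecs V) \<in> carrier (GL V)" if c: "c \<in> points C" for c
  proof (rule GL_restrictI)
    show "bij_betw (\<lambda>v. inv_into (vecs V) (e c) (e' c v)) (vecs V) (vecs V)" by (rule bij[OF c])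
    note L = linear_bijD[OF frame_alongD(1)[OF e c]] and L' = linear_bijD[OF frame_alongD(1)[OF e' c]]
    show "inv_into (vecs V) (e c) (e' c (vadd V v w)) =
        vadd V (inv_into (vecs V) (e c) (e' c v)) (inv_into (vecs V) (e c) (e' c w))"
      if v: "v \<in> vecs V" "w \<in> vecs V" for v w
    proof -
      have i: "inv_into (vecs V) (e c) (e' c v) \<in> vecs V" "inv_into (vecs V) (e c) (e' c w) \<in> vecs V"
        by (rule L(6)[OF L'(4,5)], rule v, rule v)+
      have "e' c (vadd V v w) = e c (vadd V (inv_into (vecs V) (e c) (e' c v)) (inv_into (vecs V) (e c) (e' c w)))"
        unfolding L(2)[OF i] L'(2)[OF v] by (simp add: L(7) L'(4,5) v)
      then show ?thesis using L(8)[OF dvs_add[OF i]] by simp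
    qed
    show "inv_into (vecs V) (e c) (e' c (vscale V a v)) = vscale V a (inv_into (vecs V) (e c) (e' c v))"
      if v: "v \<in> vecs V" for a v
    proof -
      have i: "inv_into (vecs V) (e c) (e' c v) \<in> vecs V"
        by (rule L(6)[OF L'(4,5)], rule v, rule v)
      have "e' c (vscale V a v) = e c (vscale V a (inv_into (vecs V) (e c) (e' c v)))"
        unfolding L(3)[OF i] L'(3)[OF v] by (simp add: L(7) L'(4,5) v)
      then show ?thesis using L(8)[OF dvs_scale[OF i]] by simp
    qed
    fix n U v assume v: "v \<in> plots (vspace V) n U"
    note k = plot_const[OF C plot_open[OF dvs_space v] c]
    show "(\<lambda>u. inv_into (vecs V) (e c) (e' c (v u))) \<in> plots (vspace V) n U" by (rule sm[OF k v])
    show "(\<lambda>u. inv_into (vecs V) (\<lambda>v. inv_into (vecs V) (e c) (e' c v)) (v u)) \<in> plots (vspace V) n U"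
      by (rule sm'[OF k v])
  qed
  show ?thesis
  proof (rule smooth_mapI)
    show "restrict (\<lambda>v. inv_into (vecs V) (e c) (e' c v)) (vecs V) \<in> points (gspace (GL V))" if "c \<in> points C" for c
      using car[OF that] by simp
    fix n U k assume k: "k \<in> plots C n U"
    show "(\<lambda>u. restrict (\<lambda>v. inv_into (vecs V) (e (k u)) (e' (k u) v)) (vecs V)) \<in> plots (gspace (GL V)) n U"
    proof (rule GL_plotI[OF plot_open[OF C k]])
      show "restrict (\<lambda>v. inv_into (vecs V) (e (k u)) (e' (k u) v)) (vecs V) \<in> carrier (GL V)" if "u \<in> U" for u
        by (rule car[OF plot_point[OF C k that]])
      fix m W h v assume h: "smooth_between m W n U h" and v: "v \<in> plots (vspace V) m W"
      note kh = plot_compose[OF C k h]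
      show "(\<lambda>w. restrict (\<lambda>v. inv_into (vecs V) (e (k (h w))) (e' (k (h w)) v)) (vecs V) (v w)) \<in> plots (vspace V) m W"
        by (rule plot_cong[OF dvs_space sm[OF kh v]]) (simp add: plot_point[OF dvs_space v])
      show "(\<lambda>w. inv_into (vecs V) (restrict (\<lambda>v. inv_into (vecs V) (e (k (h w))) (e' (k (h w)) v)) (vecs V)) (v w))
          \<in> plots (vspace V) m W"
        by (rule plot_cong[OF dvs_space sm'[OF kh v]])
          (rule arg_cong[where f = "\<lambda>f. f _"], rule inv_into_cong, simp)
    qed
  qed
qed

lemma frame_along_act:
  assumes e: "frame_along V C f F e" and k: "smooth_map C (gspace (GL V)) k"
    and C: "diffeological_space C" and F: "diffeological_space (btotal F)"
  shows "frame_along V C f F (\<lambda>c v. e c (k c v))"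
proof -
  have kc: "k c \<in> carrier (GL V)" if "c \<in> points C" for c
    using smooth_map_point[OF k that] by simp
  show ?thesis
  proof (rule frame_alongI)
    show "linear_bij V F (f c) (\<lambda>v. e c (k c v))" if c: "c \<in> points C" for c
      unfolding linear_bij_def
    proof (intro conjI ballI allI)
      note L = linear_bijD[OF frame_alongD(1)[OF e c]] and K = GL_D[OF kc[OF c]]
      show "bij_betw (\<lambda>v. e c (k c v)) (vecs V) {x \<in> points (btotal F). bproj F x = f c}"
        using bij_betw_trans[OF K(2) L(1)] by (simp add: o_def)
    qed (use linear_bijD[OF frame_alongD(1)[OF e c]] GL_D[OF kc[OF c]] in simp_all)
    show "(\<lambda>u. e (p u) (k (p u) (v u))) \<in> plots (btotal F) n U"
      if "p \<in> plots C n U" "v \<in> plots (vspace V) n U" for n U p v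
      by (rule frame_alongD(2)[OF e that(1) GL_plotD(5)[OF smooth_map_plot[OF k that(1)] that(2)]])
    show "(\<lambda>u. inv_into (vecs V) (\<lambda>v. e (p u) (k (p u) v)) (x u)) \<in> plots (vspace V) n U"
      if p: "p \<in> plots C n U" and x: "x \<in> plots (btotal F) n U" "\<And>u. u \<in> U \<Longrightarrow> bproj F (x u) = f (p u)" for n U p x
    proof (rule plot_cong[OF dvs_space GL_plotD(6)[OF smooth_map_plot[OF k p] frame_alongD(3)[OF e p x]]])
      fix u assume u: "u \<in> U"
      then have pu: "p u \<in> points C" by (rule plot_point[OF C p])
      show "inv_into (vecs V) (\<lambda>v. e (p u) (k (p u) v)) (x u) =
          inv_into (vecs V) (k (p u)) (inv_into (vecs V) (e (p u)) (x u))"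
        by (rule inv_into_compose[OF GL_D(2)[OF kc[OF pu]] linear_bijD(1)[OF frame_alongD(1)[OF e pu]]])
          (simp add: x(2)[OF u] plot_point[OF F x(1) u])
    qed
  qed
qed

end

section \<open>Principal bundles\<close>

lemma diffeological_groupD:
  assumes "diffeological_group G"
  shows "group G" "diffeological_space (gspace G)" "points (gspace G) = carrier G"
    "a \<in> plots (gspace G) n U \<Longrightarrow> b \<in> plots (gspace G) n U \<Longrightarrow> (\<lambda>u. a u \<otimes>\<^bsub>G\<^esub> b u) \<in> plots (gspace G) n U"
    "a \<in> plots (gspace G) n U \<Longrightarrow> (\<lambda>u. inv\<^bsub>G\<^esub> a u) \<in> plots (gspace G) n U"
  using assms unfolding diffeological_group_def
  by (auto intro: smooth_map_prodD(2) smooth_map_plot)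

lemma gspace_overD:
  assumes "gspace_over G B P"
  shows "diffeological_group G" "diffeological_space B" "diffeological_space (gtotal P)"
    "smooth_map (gtotal P) B (gproj P)"
    "x \<in> points (gtotal P) \<Longrightarrow> gproj P x \<in> points B"
    "x \<in> points (gtotal P) \<Longrightarrow> g \<in> carrier G \<Longrightarrow> gact P x g \<in> points (gtotal P)"
    "y \<in> plots (gtotal P) n U \<Longrightarrow> k \<in> plots (gspace G) n U \<Longrightarrow> (\<lambda>u. gact P (y u) (k u)) \<in> plots (gtotal P) n U"
    "x \<in> points (gtotal P) \<Longrightarrow> gact P x \<one>\<^bsub>G\<^esub> = x"
    "x \<in> points (gtotal P) \<Longrightarrow> g \<in> carrier G \<Longrightarrow> h \<in> carrier G \<Longrightarrow>
       gact P (gact P x g) h = gact P x (g \<otimes>\<^bsub>G\<^esub> h)"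
    "x \<in> points (gtotal P) \<Longrightarrow> g \<in> carrier G \<Longrightarrow> gproj P (gact P x g) = gproj P x"
proof -
  note a = assms[unfolded gspace_over_def]
  show G: "diffeological_group G" using a by blast
  show "diffeological_space B" "diffeological_space (gtotal P)" using a by blast+
  show p: "smooth_map (gtotal P) B (gproj P)" using a by blast
  show "x \<in> points (gtotal P) \<Longrightarrow> gproj P x \<in> points B" using smooth_map_point[OF p] .
  have act: "smooth_map (prod_space (gtotal P) (gspace G)) (gtotal P) (\<lambda>(x, g). gact P x g)" using a by blast
  show "x \<in> points (gtotal P) \<Longrightarrow> g \<in> carrier G \<Longrightarrow> gact P x g \<in> points (gtotal P)"
    using smooth_map_prodD(1)[OF act] diffeological_groupD(3)[OF G] by simp
  show "y \<in> plots (gtotal P) n U \<Longrightarrow> k \<in> plots (gspace G) n U \<Longrightarrow> (\<lambda>u. gact P (y u) (k u)) \<in> plots (gtotal P) n U"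
    by (rule smooth_map_prodD(2)[OF act])
  show "x \<in> points (gtotal P) \<Longrightarrow> gact P x \<one>\<^bsub>G\<^esub> = x" using a by blast
  show "x \<in> points (gtotal P) \<Longrightarrow> g \<in> carrier G \<Longrightarrow> h \<in> carrier G \<Longrightarrow>
       gact P (gact P x g) h = gact P x (g \<otimes>\<^bsub>G\<^esub> h)" using a by blast
  show "x \<in> points (gtotal P) \<Longrightarrow> g \<in> carrier G \<Longrightarrow> gproj P (gact P x g) = gproj P x" using a by blast
qed

lemma gspace_overI:
  assumes "diffeological_group G" "diffeological_space B" "diffeological_space (gtotal P)"
    "\<And>x. x \<in> points (gtotal P) \<Longrightarrow> gproj P x \<in> points B"
    "\<And>n U y. y \<in> plots (gtotal P) n U \<Longrightarrow> (\<lambda>u. gproj P (y u)) \<in> plots B n U"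
    "\<And>x g. x \<in> points (gtotal P) \<Longrightarrow> g \<in> carrier G \<Longrightarrow> gact P x g \<in> points (gtotal P)"
    "\<And>n U y k. y \<in> plots (gtotal P) n U \<Longrightarrow> k \<in> plots (gspace G) n U \<Longrightarrow> (\<lambda>u. gact P (y u) (k u)) \<in> plots (gtotal P) n U"
    "\<And>x. x \<in> points (gtotal P) \<Longrightarrow> gact P x \<one>\<^bsub>G\<^esub> = x"
    "\<And>x g h. x \<in> points (gtotal P) \<Longrightarrow> g \<in> carrier G \<Longrightarrow> h \<in> carrier G \<Longrightarrow>
       gact P (gact P x g) h = gact P x (g \<otimes>\<^bsub>G\<^esub> h)"
    "\<And>x g. x \<in> points (gtotal P) \<Longrightarrow> g \<in> carrier G \<Longrightarrow> gproj P (gact P x g) = gproj P x"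
  shows "gspace_over G B P"
proof -
  have "smooth_map (prod_space (gtotal P) (gspace G)) (gtotal P) (\<lambda>(x, g). gact P x g)"
    by (rule smooth_map_prodI) (use assms(6) diffeological_groupD(3)[OF assms(1)] in simp, rule assms(7))
  moreover have "smooth_map (gtotal P) B (gproj P)"
    by (rule smooth_mapI[OF assms(4,5)])
  ultimately show ?thesis
    unfolding gspace_over_def using assms(1,2,3,8,9,10) by blast
qed

text \<open>
  The action is free, and two plots with the same projection differ by a plot of G. Applied to
  constant plots the second condition says that G acts transitively on fibers.
\<close>

definition torsor_action :: "'g diffgroup \<Rightarrow> ('b, 'e, 'g) gbundle \<Rightarrow> bool" where
  "torsor_action G P \<longleftrightarrow>
     (\<forall>y\<in>points (gtotal P). \<forall>g\<in>carrier G. \<forall>h\<in>carrier G. gact P y g = gact P y h \<longrightarrow> g = h) \<and>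
     (\<forall>n U y y'. y \<in> plots (gtotal P) n U \<longrightarrow> y' \<in> plots (gtotal P) n U \<longrightarrow>
        (\<forall>u\<in>U. gproj P (y u) = gproj P (y' u)) \<longrightarrow>
        (\<exists>k\<in>plots (gspace G) n U. \<forall>u\<in>U. gact P (y u) (k u) = y' u))"

text \<open>The projection is a subduction onto the base.\<close>

definition local_lifts :: "'b diffspace \<Rightarrow> ('b, 'e, 'g) gbundle \<Rightarrow> bool" where
  "local_lifts B P \<longleftrightarrow>
     (\<forall>n U p. p \<in> plots B n U \<longrightarrow> (\<forall>u\<in>U. \<exists>W y. openin (Euclidean_space n) W \<and> u \<in> W \<and> W \<subseteq> U \<and>
        y \<in> plots (gtotal P) n W \<and> (\<forall>w\<in>W. gproj P (y w) = p w)))"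

definition smooth_section :: "'b diffspace \<Rightarrow> ('b, 'e, 'g) gbundle \<Rightarrow> 'b set \<Rightarrow> ('b \<Rightarrow> 'e) \<Rightarrow> bool" where
  "smooth_section B P A s \<longleftrightarrow>
     smooth_map (sub_space B A) (gtotal P) s \<and> (\<forall>b\<in>points B \<inter> A. gproj P (s b) = b)"

text \<open>The element of the group that moves y to y'.\<close>

definition gdiv :: "'g diffgroup \<Rightarrow> ('b, 'e, 'g) gbundle \<Rightarrow> 'e \<Rightarrow> 'e \<Rightarrow> 'g" where
  "gdiv G P y y' = (THE g. g \<in> carrier G \<and> gact P y g = y')"

lemma torsor_free:
  "torsor_action G P \<Longrightarrow> y \<in> points (gtotal P) \<Longrightarrow> g \<in> carrier G \<Longrightarrow> h \<in> carrier G \<Longrightarrow>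
     gact P y g = gact P y h \<Longrightarrow> g = h"
  unfolding torsor_action_def by blast

lemma torsor_divide:
  assumes "torsor_action G P" "y \<in> plots (gtotal P) n U" "y' \<in> plots (gtotal P) n U"
    "\<And>u. u \<in> U \<Longrightarrow> gproj P (y u) = gproj P (y' u)"
  obtains k where "k \<in> plots (gspace G) n U" "\<And>u. u \<in> U \<Longrightarrow> gact P (y u) (k u) = y' u"
proof -
  have "\<exists>k\<in>plots (gspace G) n U. \<forall>u\<in>U. gact P (y u) (k u) = y' u"
    by (rule assms(1)[unfolded torsor_action_def, THEN conjunct2, rule_format, OF assms(2,3)]) (rule assms(4))
  then show ?thesis using that by blast
qed

lemma local_liftsE:
  assumes "local_lifts B P" "p \<in> plots B n U" "u \<in> U"
  obtains W y where "openin (Euclidean_space n) W" "u \<in> W" "W \<subseteq> U" "y \<in> plots (gtotal P) n W"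
    "\<And>w. w \<in> W \<Longrightarrow> gproj P (y w) = p w"
  using assms(1)[unfolded local_lifts_def, rule_format, OF assms(2,3)] by blast

lemma gdiv_eq:
  assumes "torsor_action G P" "y \<in> points (gtotal P)" "g \<in> carrier G" "gact P y g = y'"
  shows "gdiv G P y y' = g"
  unfolding gdiv_def using assms(3,4) torsor_free[OF assms(1,2)] by (intro the_equality) auto

text \<open>
  The one-point space $R^0$. Plots defined on it are points, so statements about plots specialize to
  pointwise statements.
\<close>

definition origin_space :: "coords set" where "origin_space = flat 0"

lemma origin_space: "openin (Euclidean_space 0) origin_space" "(\<lambda>_. 0) \<in> origin_space"
  unfolding origin_space_def by (rule openin_topspace) (simp add: topspace_Euclidean_space)

lemma gdiv:
  assumes P: "gspace_over G B P" and t: "torsor_action G P"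
    and y: "y \<in> points (gtotal P)" "y' \<in> points (gtotal P)" "gproj P y = gproj P y'"
  shows "gdiv G P y y' \<in> carrier G" "gact P y (gdiv G P y y') = y'"
proof -
  note E = gspace_overD(3)[OF P]
  obtain k where k: "k \<in> plots (gspace G) 0 origin_space"
      "\<And>u. u \<in> origin_space \<Longrightarrow> gact P y (k u) = y'"
    by (rule torsor_divide[OF t plot_const[OF E origin_space(1) y(1)] plot_const[OF E origin_space(1) y(2)]])
      (use y(3) in auto)
  have g: "k (\<lambda>_. 0) \<in> carrier G"
    using plot_point[OF diffeological_groupD(2)[OF gspace_overD(1)[OF P]] k(1) origin_space(2)]
      diffeological_groupD(3)[OF gspace_overD(1)[OF P]] by simp
  have "gdiv G P y y' = k (\<lambda>_. 0)" by (rule gdiv_eq[OF t y(1) g k(2)[OF origin_space(2)]])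
  then show "gdiv G P y y' \<in> carrier G" "gact P y (gdiv G P y y') = y'"
    using g k(2)[OF origin_space(2)] by simp_all
qed

lemma gdiv_plot:
  assumes P: "gspace_over G B P" and t: "torsor_action G P"
    and y: "y \<in> plots (gtotal P) n U" "y' \<in> plots (gtotal P) n U"
      "\<And>u. u \<in> U \<Longrightarrow> gproj P (y u) = gproj P (y' u)"
  shows "(\<lambda>u. gdiv G P (y u) (y' u)) \<in> plots (gspace G) n U"
proof -
  note E = gspace_overD(3)[OF P] and G = gspace_overD(1)[OF P]
  obtain k where k: "k \<in> plots (gspace G) n U" "\<And>u. u \<in> U \<Longrightarrow> gact P (y u) (k u) = y' u"
    by (rule torsor_divide[OF t y]) auto
  show ?thesis
  proof (rule plot_cong[OF diffeological_groupD(2)[OF G] k(1)])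
    fix u assume u: "u \<in> U"
    show "gdiv G P (y u) (y' u) = k u"
      using plot_point[OF diffeological_groupD(2)[OF G] k(1) u] diffeological_groupD(3)[OF G]
      by (intro gdiv_eq[OF t plot_point[OF E y(1) u] _ k(2)[OF u]]) simp
  qed
qed

text \<open>
  It suffices to divide plots locally: as the action is free, local quotients are unique and
  glue.
\<close>

lemma torsorI:
  assumes P: "gspace_over G B P"
    and free: "\<And>y g h. y \<in> points (gtotal P) \<Longrightarrow> g \<in> carrier G \<Longrightarrow> h \<in> carrier G \<Longrightarrow>
      gact P y g = gact P y h \<Longrightarrow> g = h"
    and div: "\<And>n U y y' u. y \<in> plots (gtotal P) n U \<Longrightarrow> y' \<in> plots (gtotal P) n U \<Longrightarrow>
      (\<And>u. u \<in> U \<Longrightarrow> gproj P (y u) = gproj P (y' u)) \<Longrightarrow> u \<in> U \<Longrightarrow>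
      \<exists>W k. openin (Euclidean_space n) W \<and> u \<in> W \<and> W \<subseteq> U \<and> k \<in> plots (gspace G) n W \<and>
        (\<forall>w\<in>W. gact P (y w) (k w) = y' w)"
  shows "torsor_action G P"
  unfolding torsor_action_def
proof (intro conjI ballI allI impI)
  show "g = h" if "y \<in> points (gtotal P)" "g \<in> carrier G" "h \<in> carrier G" "gact P y g = gact P y h" for y g h
    by (rule free[OF that])
next
  fix n U y y' assume y: "y \<in> plots (gtotal P) n U" "y' \<in> plots (gtotal P) n U"
    and pr: "\<forall>u\<in>U. gproj P (y u) = gproj P (y' u)"
  note G = gspace_overD(1)[OF P] and E = gspace_overD(3)[OF P]
  define k where "k u = gdiv G P (y u) (y' u)" for u
  have loc: "\<exists>W q. openin (Euclidean_space n) W \<and> u \<in> W \<and> W \<subseteq> U \<and> q \<in> plots (gspace G) n W \<and>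
      (\<forall>w\<in>W. k w = q w \<and> gact P (y w) (k w) = y' w)" if u: "u \<in> U" for u
  proof -
    from div[OF y bspec[OF pr] u] obtain W q where W: "openin (Euclidean_space n) W" "u \<in> W" "W \<subseteq> U"
      "q \<in> plots (gspace G) n W" "\<forall>w\<in>W. gact P (y w) (q w) = y' w" by blast
    have "k w = q w" if w: "w \<in> W" for w
      unfolding k_def gdiv_def
    proof (rule the_equality)
      have q: "q w \<in> carrier G"
        using plot_point[OF diffeological_groupD(2)[OF G] W(4) w] diffeological_groupD(3)[OF G] by simp
      then show "q w \<in> carrier G \<and> gact P (y w) (q w) = y' w" using W(5) w by blast
      show "g = q w" if "g \<in> carrier G \<and> gact P (y w) g = y' w" for g
        using that q W(3,5) w by (intro free[OF plot_point[OF E y(1), of w]]) auto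
    qed
    with W show ?thesis by (intro exI[of _ W] exI[of _ q]) simp
  qed
  have "k \<in> plots (gspace G) n U"
  proof (rule plot_local[OF diffeological_groupD(2)[OF G] plot_open[OF E y(1)]])
    fix u assume "u \<in> U"
    from loc[OF this] show "\<exists>W q. openin (Euclidean_space n) W \<and> u \<in> W \<and> W \<subseteq> U \<and>
        q \<in> plots (gspace G) n W \<and> (\<forall>w\<in>W. k w = q w)" by blast
  qed
  moreover have "gact P (y u) (k u) = y' u" if "u \<in> U" for u
    using loc[OF that] by blast
  ultimately show "\<exists>k\<in>plots (gspace G) n U. \<forall>u\<in>U. gact P (y u) (k u) = y' u" by blast
qed

lemma restrict_gbundle_simps [simp]:
  "gtotal (restrict_gbundle A P) = sub_space (gtotal P) {x. gproj P x \<in> A}"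
  "gproj (restrict_gbundle A P) = gproj P" "gact (restrict_gbundle A P) = gact P"
  by (simp_all add: restrict_gbundle_def)

lemma product_gbundle_simps [simp]:
  "gtotal (product_gbundle G B) = prod_space B (gspace G)"
  "gproj (product_gbundle G B) = fst" "gact (product_gbundle G B) x h = (fst x, snd x \<otimes>\<^bsub>G\<^esub> h)"
  by (simp_all add: product_gbundle_def case_prod_beta)

lemma pullback_gbundle_simps [simp]:
  "gtotal (pullback_gbundle C f P) = sub_space (prod_space C (gtotal P)) {(c, x). f c = gproj P x}"
  "gproj (pullback_gbundle C f P) = fst" "gact (pullback_gbundle C f P) z g = (fst z, gact P (snd z) g)"
  by (simp_all add: pullback_gbundle_def case_prod_beta)

lemma plots_pullback_gbundle:
  "p \<in> plots (gtotal (pullback_gbundle C f P)) n U \<longleftrightarrow>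
     (\<lambda>u. fst (p u)) \<in> plots C n U \<and> (\<lambda>u. snd (p u)) \<in> plots (gtotal P) n U \<and>
     (\<forall>u\<in>U. f (fst (p u)) = gproj P (snd (p u)))"
  by (auto simp: plots_sub_space plots_prod_space case_prod_beta)

lemma trivial_gbundle_overE:
  assumes "trivial_gbundle_over G B P A"
  obtains \<phi> \<psi> where "smooth_map (sub_space (gtotal P) {x. gproj P x \<in> A}) (prod_space (sub_space B A) (gspace G)) \<phi>"
    "smooth_map (prod_space (sub_space B A) (gspace G)) (sub_space (gtotal P) {x. gproj P x \<in> A}) \<psi>"
    "\<And>x. x \<in> points (gtotal P) \<Longrightarrow> gproj P x \<in> A \<Longrightarrow> \<psi> (\<phi> x) = x"
    "\<And>b g. b \<in> points B \<Longrightarrow> b \<in> A \<Longrightarrow> g \<in> points (gspace G) \<Longrightarrow> \<phi> (\<psi> (b, g)) = (b, g)"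
    "\<And>x. x \<in> points (gtotal P) \<Longrightarrow> gproj P x \<in> A \<Longrightarrow> fst (\<phi> x) = gproj P x"
    "\<And>x g. x \<in> points (gtotal P) \<Longrightarrow> gproj P x \<in> A \<Longrightarrow> g \<in> carrier G \<Longrightarrow>
      snd (\<phi> (gact P x g)) = snd (\<phi> x) \<otimes>\<^bsub>G\<^esub> g"
proof -
  obtain \<phi> where \<phi>: "diffeomorphism (gtotal (restrict_gbundle A P)) (gtotal (product_gbundle G (sub_space B A))) \<phi>"
    "\<forall>x\<in>points (gtotal (restrict_gbundle A P)). fst (\<phi> x) = gproj P x"
    "\<forall>x\<in>points (gtotal (restrict_gbundle A P)). \<forall>g\<in>carrier G.
       \<phi> (gact P x g) = gact (product_gbundle G (sub_space B A)) (\<phi> x) g"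
    using assms unfolding trivial_gbundle_over_def trivial_gbundle_def gbundle_iso_def
    by (auto simp del: product_gbundle_simps(3))
  from \<phi>(1) obtain \<psi> where \<psi>: "smooth_map (gtotal (restrict_gbundle A P)) (gtotal (product_gbundle G (sub_space B A))) \<phi>"
    "smooth_map (gtotal (product_gbundle G (sub_space B A))) (gtotal (restrict_gbundle A P)) \<psi>"
    "\<And>x. x \<in> points (gtotal (restrict_gbundle A P)) \<Longrightarrow> \<psi> (\<phi> x) = x"
    "\<And>x. x \<in> points (gtotal (product_gbundle G (sub_space B A))) \<Longrightarrow> \<phi> (\<psi> x) = x"
    by (rule diffeomorphismE) blast
  show ?thesis by (rule that[of \<phi> \<psi>]) (use \<phi> \<psi> in simp_all)
qed

lemma trivial_gbundle_over_section:
  assumes P: "gspace_over G B P" and tr: "trivial_gbundle_over G B P A"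
  obtains s where "smooth_section B P A s"
  using tr
proof (rule trivial_gbundle_overE)
  fix \<phi> \<psi>
  assume \<psi>: "smooth_map (prod_space (sub_space B A) (gspace G)) (sub_space (gtotal P) {x. gproj P x \<in> A}) \<psi>"
    and inv: "\<And>b g. b \<in> points B \<Longrightarrow> b \<in> A \<Longrightarrow> g \<in> points (gspace G) \<Longrightarrow> \<phi> (\<psi> (b, g)) = (b, g)"
    and pr: "\<And>x. x \<in> points (gtotal P) \<Longrightarrow> gproj P x \<in> A \<Longrightarrow> fst (\<phi> x) = gproj P x"
  note G = gspace_overD(1)[OF P]
  have one: "\<one>\<^bsub>G\<^esub> \<in> points (gspace G)"
    using diffeological_groupD(1,3)[OF G] by (simp add: group.is_monoid monoid.one_closed)
  have B: "diffeological_space (sub_space B A)" by (rule diffeological_sub_space[OF gspace_overD(2)[OF P]])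
  have pt: "\<psi> (b, \<one>\<^bsub>G\<^esub>) \<in> points (gtotal P) \<and> gproj P (\<psi> (b, \<one>\<^bsub>G\<^esub>)) \<in> A" if "b \<in> points B" "b \<in> A" for b
    using smooth_map_point[OF \<psi>, of "(b, \<one>\<^bsub>G\<^esub>)"] that one by simp
  have "smooth_section B P A (\<lambda>b. \<psi> (b, \<one>\<^bsub>G\<^esub>))"
    unfolding smooth_section_def
  proof (intro conjI ballI smooth_mapI)
    fix n U p assume p: "p \<in> plots (sub_space B A) n U"
    have "(\<lambda>u. (p u, \<one>\<^bsub>G\<^esub>)) \<in> plots (prod_space (sub_space B A) (gspace G)) n U"
      using p plot_const[OF diffeological_groupD(2)[OF G] plot_open[OF B p] one] by (simp add: plots_prod_space)
    from smooth_map_plot[OF \<psi> this] show "(\<lambda>u. \<psi> (p u, \<one>\<^bsub>G\<^esub>)) \<in> plots (gtotal P) n U"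
      by (simp add: plots_sub_space)
  next
    fix b assume "b \<in> points B \<inter> A"
    then show "gproj P (\<psi> (b, \<one>\<^bsub>G\<^esub>)) = b"
      using pr[of "\<psi> (b, \<one>\<^bsub>G\<^esub>)"] pt[of b] inv[OF _ _ one, of b] by simp
  qed (use pt in simp)
  then show ?thesis by (rule that)
qed

text \<open>
  The trivialization sends x to the quotient of x by the value of the section at the projection
  of x.
\<close>

lemma section_trivial_gbundle_over:
  assumes P: "gspace_over G B P" and t: "torsor_action G P" and s: "smooth_section B P A s"
  shows "trivial_gbundle_over G B P A"
proof -
  note G = gspace_overD(1)[OF P] and E = gspace_overD(3)[OF P]
  note Gp = diffeological_groupD(3)[OF G]
  have s1: "smooth_map (sub_space B A) (gtotal P) s" and s2: "\<And>b. b \<in> points B \<Longrightarrow> b \<in> A \<Longrightarrow> gproj P (s b) = b"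
    using s by (auto simp: smooth_section_def)
  have s3: "s b \<in> points (gtotal P)" if "b \<in> points B" "b \<in> A" for b
    using smooth_map_point[OF s1] that by simp
  have pb: "gproj P x \<in> points B" if "x \<in> points (gtotal P)" for x by (rule gspace_overD(5)[OF P that])
  have d: "gdiv G P (s (gproj P x)) x \<in> carrier G" "gact P (s (gproj P x)) (gdiv G P (s (gproj P x)) x) = x"
    if "x \<in> points (gtotal P)" "gproj P x \<in> A" for x
    by (rule gdiv[OF P t s3[OF pb[OF that(1)] that(2)] that(1)], simp add: s2[OF pb[OF that(1)] that(2)])+
  have di: "gdiv G P (s b) (gact P (s b) g) = g" if "b \<in> points B" "b \<in> A" "g \<in> carrier G" for b g
    by (rule gdiv_eq[OF t s3 _ refl]) (use that in auto)
  define \<phi> where "\<phi> x = (gproj P x, gdiv G P (s (gproj P x)) x)" for x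
  have "diffeomorphism (sub_space (gtotal P) {x. gproj P x \<in> A}) (prod_space (sub_space B A) (gspace G)) \<phi>"
  proof (rule diffeomorphismI[where g = "\<lambda>z. gact P (s (fst z)) (snd z)"])
    show "smooth_map (sub_space (gtotal P) {x. gproj P x \<in> A}) (prod_space (sub_space B A) (gspace G)) \<phi>"
    proof (rule smooth_mapI)
      fix n U p assume "p \<in> plots (sub_space (gtotal P) {x. gproj P x \<in> A}) n U"
      then have p: "p \<in> plots (gtotal P) n U" and pA: "\<And>u. u \<in> U \<Longrightarrow> gproj P (p u) \<in> A"
        by (auto simp: plots_sub_space)
      have b: "(\<lambda>u. gproj P (p u)) \<in> plots (sub_space B A) n U"
        using smooth_map_plot[OF gspace_overD(4)[OF P] p] pA by (simp add: plots_sub_space)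
      have "(\<lambda>u. gdiv G P (s (gproj P (p u))) (p u)) \<in> plots (gspace G) n U"
        by (rule gdiv_plot[OF P t smooth_map_plot[OF s1 b] p])
          (rule s2[OF pb[OF plot_point[OF E p]] pA])
      with b show "(\<lambda>u. \<phi> (p u)) \<in> plots (prod_space (sub_space B A) (gspace G)) n U"
        by (simp add: \<phi>_def plots_prod_space)
    qed (use d pb Gp in \<open>auto simp: \<phi>_def\<close>)
    show "smooth_map (prod_space (sub_space B A) (gspace G)) (sub_space (gtotal P) {x. gproj P x \<in> A})
        (\<lambda>z. gact P (s (fst z)) (snd z))"
    proof (rule smooth_mapI)
      fix z assume "z \<in> points (prod_space (sub_space B A) (gspace G))"
      then show "gact P (s (fst z)) (snd z) \<in> points (sub_space (gtotal P) {x. gproj P x \<in> A})"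
        using s3 s2 gspace_overD(6,10)[OF P] Gp by auto
    next
      fix n U p assume "p \<in> plots (prod_space (sub_space B A) (gspace G)) n U"
      then have p: "(\<lambda>u. fst (p u)) \<in> plots (sub_space B A) n U" "(\<lambda>u. snd (p u)) \<in> plots (gspace G) n U"
        by (simp_all add: plots_prod_space)
      have pt: "fst (p u) \<in> points B" "fst (p u) \<in> A" "snd (p u) \<in> carrier G" if "u \<in> U" for u
        using plot_point[OF diffeological_sub_space[OF gspace_overD(2)[OF P]] p(1) that]
          plot_point[OF diffeological_groupD(2)[OF G] p(2) that] Gp by auto
      show "(\<lambda>u. gact P (s (fst (p u))) (snd (p u))) \<in> plots (sub_space (gtotal P) {x. gproj P x \<in> A}) n U"
        using gspace_overD(7)[OF P smooth_map_plot[OF s1 p(1)] p(2)] gspace_overD(10)[OF P s3[OF pt(1,2)] pt(3)] s2[OF pt(1,2)] pt(2)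
        by (simp add: plots_sub_space)
    qed
  qed (use d di Gp s3 s2 gspace_overD(10)[OF P] in \<open>auto simp: \<phi>_def\<close>)
  moreover have "\<phi> (gact P x g) = (fst (\<phi> x), snd (\<phi> x) \<otimes>\<^bsub>G\<^esub> g)"
    if x: "x \<in> points (gtotal P)" "gproj P x \<in> A" and g: "g \<in> carrier G" for x g
  proof -
    let ?s = "s (gproj P x)" and ?d = "gdiv G P (s (gproj P x)) x"
    have s: "?s \<in> points (gtotal P)" by (rule s3[OF pb[OF x(1)] x(2)])
    have "?d \<otimes>\<^bsub>G\<^esub> g \<in> carrier G"
      using d(1)[OF x] g diffeological_groupD(1)[OF G] by (simp add: group.is_monoid monoid.m_closed)
    moreover have "gact P ?s (?d \<otimes>\<^bsub>G\<^esub> g) = gact P x g"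
      using gspace_overD(9)[OF P s d(1)[OF x] g] d(2)[OF x] by simp
    ultimately have "gdiv G P ?s (gact P x g) = ?d \<otimes>\<^bsub>G\<^esub> g" by (rule gdiv_eq[OF t s])
    then show ?thesis by (simp add: \<phi>_def gspace_overD(10)[OF P x(1) g])
  qed
  ultimately show ?thesis
    unfolding trivial_gbundle_over_def trivial_gbundle_def gbundle_iso_def
    by (intro exI[of _ \<phi>] conjI ballI) (simp_all, simp add: \<phi>_def)
qed

lemma pullback_gspace_over:
  assumes P: "gspace_over G B P" and C: "diffeological_space C" and f: "smooth_map C B f"
  shows "gspace_over G C (pullback_gbundle C f P)"
proof (rule gspace_overI[OF gspace_overD(1)[OF P] C])
  show "diffeological_space (gtotal (pullback_gbundle C f P))"
    using diffeological_sub_space[OF diffeological_prod_space[OF C gspace_overD(3)[OF P]]] by simp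
next
  fix n U y k
  assume y: "y \<in> plots (gtotal (pullback_gbundle C f P)) n U" and k: "k \<in> plots (gspace G) n U"
  have kc: "k u \<in> carrier G" if "u \<in> U" for u
    using plot_point[OF diffeological_groupD(2)[OF gspace_overD(1)[OF P]] k that]
      diffeological_groupD(3)[OF gspace_overD(1)[OF P]] by simp
  show "(\<lambda>u. gact (pullback_gbundle C f P) (y u) (k u)) \<in> plots (gtotal (pullback_gbundle C f P)) n U"
  proof -
    from y have yC: "(\<lambda>u. fst (y u)) \<in> plots C n U" and yE: "(\<lambda>u. snd (y u)) \<in> plots (gtotal P) n U"
      and yf: "\<forall>u\<in>U. f (fst (y u)) = gproj P (snd (y u))"
      unfolding plots_pullback_gbundle by blast+
    have "gproj P (gact P (snd (y u)) (k u)) = gproj P (snd (y u))" if "u \<in> U" for u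
      by (rule gspace_overD(10)[OF P plot_point[OF gspace_overD(3)[OF P] yE that] kc[OF that]])
    then show ?thesis
      unfolding plots_pullback_gbundle using yC yf gspace_overD(7)[OF P yE k] by simp
  qed
next
  show "(\<lambda>u. gproj (pullback_gbundle C f P) (y u)) \<in> plots C n U"
    if "y \<in> plots (gtotal (pullback_gbundle C f P)) n U" for n U y
    using that[unfolded plots_pullback_gbundle] by simp
qed (auto simp: gspace_overD[OF P])

lemma pullback_torsor:
  assumes P: "gspace_over G B P" and t: "torsor_action G P" and C: "diffeological_space C" and f: "smooth_map C B f"
  shows "torsor_action G (pullback_gbundle C f P)"
proof (rule torsorI[OF pullback_gspace_over[OF P C f]])
  show "g = h" if "y \<in> points (gtotal (pullback_gbundle C f P))" "g \<in> carrier G" "h \<in> carrier G"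
    "gact (pullback_gbundle C f P) y g = gact (pullback_gbundle C f P) y h" for y g h
    using torsor_free[OF t, of "snd y" g h] that by auto
  fix n U y y' u
  assume y: "y \<in> plots (gtotal (pullback_gbundle C f P)) n U" "y' \<in> plots (gtotal (pullback_gbundle C f P)) n U"
    and pr: "\<And>u. u \<in> U \<Longrightarrow> gproj (pullback_gbundle C f P) (y u) = gproj (pullback_gbundle C f P) (y' u)"
    and u: "u \<in> U"
  note y' = y[unfolded plots_pullback_gbundle]
  obtain k where k: "k \<in> plots (gspace G) n U" "\<And>u. u \<in> U \<Longrightarrow> gact P (snd (y u)) (k u) = snd (y' u)"
  proof (rule torsor_divide[OF t, of "\<lambda>u. snd (y u)" n U "\<lambda>u. snd (y' u)"])
    show "gproj P (snd (y u)) = gproj P (snd (y' u))" if "u \<in> U" for u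
      using y' pr[OF that] that by (metis pullback_gbundle_simps(2))
  qed (use y' in auto)
  show "\<exists>W k. openin (Euclidean_space n) W \<and> u \<in> W \<and> W \<subseteq> U \<and> k \<in> plots (gspace G) n W \<and>
        (\<forall>w\<in>W. gact (pullback_gbundle C f P) (y w) (k w) = y' w)"
    using u k pr plot_open[OF diffeological_groupD(2)[OF gspace_overD(1)[OF P]] k(1)]
    by (intro exI[of _ U] exI[of _ k]) (auto simp: prod_eq_iff)
qed

lemma pullback_local_lifts:
  assumes P: "gspace_over G B P" and l: "local_lifts B P" and C: "diffeological_space C" and f: "smooth_map C B f"
  shows "local_lifts C (pullback_gbundle C f P)"
  unfolding local_lifts_def
proof (intro allI impI ballI)
  fix n U p u assume p: "p \<in> plots C n U" and u: "u \<in> U"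
  obtain W y where W: "openin (Euclidean_space n) W" "u \<in> W" "W \<subseteq> U" "y \<in> plots (gtotal P) n W"
    "\<And>w. w \<in> W \<Longrightarrow> gproj P (y w) = f (p w)"
    by (rule local_liftsE[OF l smooth_map_plot[OF f p] u]) blast
  have "(\<lambda>w. (p w, y w)) \<in> plots (gtotal (pullback_gbundle C f P)) n W"
    unfolding plots_pullback_gbundle using W plot_restrict[OF C p W(1,3)] by simp
  with W(1-3) show "\<exists>W y. openin (Euclidean_space n) W \<and> u \<in> W \<and> W \<subseteq> U \<and>
        y \<in> plots (gtotal (pullback_gbundle C f P)) n W \<and> (\<forall>w\<in>W. gproj (pullback_gbundle C f P) (y w) = p w)"
    by (intro exI[of _ W] exI[of _ "\<lambda>w. (p w, y w)"]) simp
qed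

lemma principal_bundle_gspace_over: "principal_bundle G B P \<Longrightarrow> gspace_over G B P"
  by (simp add: principal_bundle_def)

lemma principal_bundleE:
  assumes "principal_bundle G B P" "p \<in> plots B n U" "u \<in> U"
  obtains A where "openin (Euclidean_space n) A" "A \<subseteq> U" "u \<in> A"
    "trivial_gbundle_over G (domain_space n U) (pullback_gbundle (domain_space n U) p P) A"
proof -
  have U: "openin (Euclidean_space n) U"
    using plot_open[OF gspace_overD(2)[OF principal_bundle_gspace_over[OF assms(1)]] assms(2)] .
  have "locally_trivial_gbundle G (domain_space n U) (pullback_gbundle (domain_space n U) p P)"
    using assms(1,2) by (simp add: principal_bundle_def)
  then obtain \<A> where \<A>: "\<forall>A\<in>\<A>. D_open (domain_space n U) A" "\<Union>\<A> = U"
    "\<forall>A\<in>\<A>. trivial_gbundle_over G (domain_space n U) (pullback_gbundle (domain_space n U) p P) A"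
    unfolding locally_trivial_gbundle_def by auto
  then obtain A where "A \<in> \<A>" "u \<in> A" using assms(3) by auto
  with \<A> show ?thesis using D_open_domain_space[OF U] by (intro that[of A]) auto
qed

text \<open>
  Pull back along the common projection p of the two plots. In a local trivialization of the
  pullback they become u \<mapsto> (u, k u) and u \<mapsto> (u, k' u) for plots k and k' of G, and the plot of quotients
  is the product of the inverse of k with k'. Freeness is read off in a local trivialization of the
  pullback along a constant plot.
\<close>

lemma principal_bundle_torsor:
  assumes pb: "principal_bundle G B P"
  shows "torsor_action G P"
proof -
  note P = principal_bundle_gspace_over[OF pb]
  note G = gspace_overD(1)[OF P] and E = gspace_overD(3)[OF P]
  note Gp = diffeological_groupD(3)[OF G] and grp = diffeological_groupD(1)[OF G]
  show ?thesis
  proof (rule torsorI[OF P])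
    fix y g h assume y: "y \<in> points (gtotal P)" and g: "g \<in> carrier G" and h: "h \<in> carrier G"
      and eq: "gact P y g = gact P y h"
    let ?U = "origin_space" and ?o = "\<lambda>_::nat. 0::real"
    let ?Q = "pullback_gbundle (domain_space 0 ?U) (\<lambda>_. gproj P y) P"
    obtain A where A: "openin (Euclidean_space 0) A" "A \<subseteq> ?U" "?o \<in> A" "trivial_gbundle_over G (domain_space 0 ?U) ?Q A"
      by (rule principal_bundleE[OF pb plot_const[OF gspace_overD(2)[OF P] origin_space(1) gspace_overD(5)[OF P y]] origin_space(2)])
    from A(4) show "g = h"
    proof (rule trivial_gbundle_overE)
      fix \<phi> :: "coords \<times> _ \<Rightarrow> _"
      assume \<phi>: "smooth_map (sub_space (gtotal ?Q) {x. gproj ?Q x \<in> A}) (prod_space (sub_space (domain_space 0 ?U) A) (gspace G)) \<phi>"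
        and act: "\<And>x g. x \<in> points (gtotal ?Q) \<Longrightarrow> gproj ?Q x \<in> A \<Longrightarrow> g \<in> carrier G \<Longrightarrow>
          snd (\<phi> (gact ?Q x g)) = snd (\<phi> x) \<otimes>\<^bsub>G\<^esub> g"
      have z: "(?o, y) \<in> points (gtotal ?Q)" "gproj ?Q (?o, y) \<in> A" using y A(3) origin_space(2) by auto
      have c: "snd (\<phi> (?o, y)) \<in> carrier G"
        using smooth_map_point[OF \<phi>, of "(?o, y)"] z Gp by (auto simp: mem_Times_iff)
      have "gact ?Q (?o, y) g = gact ?Q (?o, y) h" using eq by simp
      then have "snd (\<phi> (?o, y)) \<otimes>\<^bsub>G\<^esub> g = snd (\<phi> (?o, y)) \<otimes>\<^bsub>G\<^esub> h"
        using act[OF z g] act[OF z h] by metis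
      then show "g = h" using monoid.Units_l_cancel[OF group.is_monoid[OF grp], of "snd (\<phi> (?o, y))" g h] c g h
        by (simp add: group.Units_eq[OF grp])
    qed
  next
    fix n U y y' u
    assume y: "y \<in> plots (gtotal P) n U" "y' \<in> plots (gtotal P) n U"
      and pr: "\<And>u. u \<in> U \<Longrightarrow> gproj P (y u) = gproj P (y' u)" and u: "u \<in> U"
    have p: "(\<lambda>u. gproj P (y u)) \<in> plots B n U" by (rule smooth_map_plot[OF gspace_overD(4)[OF P] y(1)])
    let ?Q = "pullback_gbundle (domain_space n U) (\<lambda>u. gproj P (y u)) P"
    have U: "openin (Euclidean_space n) U" by (rule plot_open[OF E y(1)])
    obtain A where A: "openin (Euclidean_space n) A" "A \<subseteq> U" "u \<in> A" "trivial_gbundle_over G (domain_space n U) ?Q A"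
      by (rule principal_bundleE[OF pb p u])
    from A(4) show "\<exists>W k. openin (Euclidean_space n) W \<and> u \<in> W \<and> W \<subseteq> U \<and> k \<in> plots (gspace G) n W \<and>
        (\<forall>w\<in>W. gact P (y w) (k w) = y' w)"
    proof (rule trivial_gbundle_overE)
      fix \<phi> \<psi>
      assume \<phi>: "smooth_map (sub_space (gtotal ?Q) {x. gproj ?Q x \<in> A}) (prod_space (sub_space (domain_space n U) A) (gspace G)) \<phi>"
        and \<psi>: "\<And>x. x \<in> points (gtotal ?Q) \<Longrightarrow> gproj ?Q x \<in> A \<Longrightarrow> \<psi> (\<phi> x) = x"
        and fst: "\<And>x. x \<in> points (gtotal ?Q) \<Longrightarrow> gproj ?Q x \<in> A \<Longrightarrow> fst (\<phi> x) = gproj ?Q x"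
        and act: "\<And>x g. x \<in> points (gtotal ?Q) \<Longrightarrow> gproj ?Q x \<in> A \<Longrightarrow> g \<in> carrier G \<Longrightarrow>
          snd (\<phi> (gact ?Q x g)) = snd (\<phi> x) \<otimes>\<^bsub>G\<^esub> g"
      have pl: "(\<lambda>w. snd (\<phi> (w, z w))) \<in> plots (gspace G) n A" "\<And>w. w \<in> A \<Longrightarrow> (w, z w) \<in> points (gtotal ?Q)"
        if z: "z \<in> plots (gtotal P) n U" "\<forall>u\<in>U. gproj P (y u) = gproj P (z u)" for z
      proof -
        have "(\<lambda>w. (w, z w)) \<in> plots (sub_space (gtotal ?Q) {x. gproj ?Q x \<in> A}) n A"
          unfolding plots_sub_space[of _ "gtotal ?Q"] plots_pullback_gbundle
          using smooth_between_inclusion[OF U A(1,2)] plot_restrict[OF E z(1) A(1,2)] z(2) A(2) by auto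
        from smooth_map_plot[OF \<phi> this] show "(\<lambda>w. snd (\<phi> (w, z w))) \<in> plots (gspace G) n A"
          by (simp add: plots_prod_space)
        show "(w, z w) \<in> points (gtotal ?Q)" if "w \<in> A" for w
          using plot_point[OF E z(1)] z(2) A(2) that by auto
      qed
      have pr': "\<forall>u\<in>U. gproj P (y u) = gproj P (y u)" "\<forall>u\<in>U. gproj P (y u) = gproj P (y' u)"
        using pr by simp_all
      note py = pl[OF y(1) pr'(1)] and py' = pl[OF y(2) pr'(2)]
      let ?k = "\<lambda>w. inv\<^bsub>G\<^esub> snd (\<phi> (w, y w)) \<otimes>\<^bsub>G\<^esub> snd (\<phi> (w, y' w))"
      have k: "?k \<in> plots (gspace G) n A"
        by (rule diffeological_groupD(4)[OF G diffeological_groupD(5)[OF G py(1)] py'(1)])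
      have "gact P (y w) (?k w) = y' w" if w: "w \<in> A" for w
      proof -
        have c: "snd (\<phi> (w, y w)) \<in> carrier G" "snd (\<phi> (w, y' w)) \<in> carrier G" "?k w \<in> carrier G"
          using plot_point[OF diffeological_groupD(2)[OF G]] py(1) py'(1) k w Gp by blast+
        let ?z = "gact ?Q (w, y w) (?k w)"
        have wA: "gproj ?Q (w, y w) \<in> A" "gproj ?Q (w, y' w) \<in> A" using w by auto
        have z: "?z \<in> points (gtotal ?Q)" "gproj ?Q ?z \<in> A"
          using py(2)[OF w] w gspace_overD(6)[OF P, of "y w" "?k w"] gspace_overD(10)[OF P, of "y w" "?k w"] c(3)
          by auto
        have "snd (\<phi> ?z) = snd (\<phi> (w, y w)) \<otimes>\<^bsub>G\<^esub> (?k w)" by (rule act[OF py(2)[OF w] wA(1) c(3)])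
        also have "\<dots> = snd (\<phi> (w, y' w))"
          using c grp by (simp add: group.inv_solve_left' group.inv_closed monoid.m_assoc[symmetric] group.is_monoid group.r_inv)
        finally have "snd (\<phi> ?z) = snd (\<phi> (w, y' w))" .
        moreover have "fst (\<phi> ?z) = fst (\<phi> (w, y' w))"
          using fst[OF z] fst[OF py'(2)[OF w] wA(2)] by simp
        ultimately have "\<phi> ?z = \<phi> (w, y' w)" by (simp add: prod_eq_iff)
        then have "?z = (w, y' w)" using \<psi>[OF z] \<psi>[OF py'(2)[OF w] wA(2)] by metis
        then show ?thesis by simp
      qed
      with k A(1-3) show ?thesis by (intro exI[of _ A] exI[of _ ?k]) simp
    qed
  qed
qed

lemma principal_bundle_local_lifts:
  assumes pb: "principal_bundle G B P"
  shows "local_lifts B P"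
  unfolding local_lifts_def
proof (intro allI impI ballI)
  note P = principal_bundle_gspace_over[OF pb]
  fix n U p u assume p: "p \<in> plots B n U" and u: "u \<in> U"
  have U: "openin (Euclidean_space n) U" by (rule plot_open[OF gspace_overD(2)[OF P] p])
  let ?Q = "pullback_gbundle (domain_space n U) p P"
  obtain A where A: "openin (Euclidean_space n) A" "A \<subseteq> U" "u \<in> A" "trivial_gbundle_over G (domain_space n U) ?Q A"
    by (rule principal_bundleE[OF pb p u])
  have Q: "gspace_over G (domain_space n U) ?Q"
    by (rule pullback_gspace_over[OF P diffeological_domain_space[OF U] smooth_map_domainI[OF gspace_overD(2)[OF P] p]])
  obtain s where s: "smooth_section (domain_space n U) ?Q A s"
    by (rule trivial_gbundle_over_section[OF Q A(4)])
  have "(\<lambda>w. w) \<in> plots (sub_space (domain_space n U) A) n A"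
    unfolding plots_sub_domain_space[OF U A(1,2)] by (rule smooth_between_inclusion[OF A(1,1) subset_refl])
  then have "(\<lambda>w. s w) \<in> plots (gtotal ?Q) n A"
    using s smooth_map_plot unfolding smooth_section_def by blast
  then have "(\<lambda>w. snd (s w)) \<in> plots (gtotal P) n A" "\<forall>w\<in>A. gproj P (snd (s w)) = p (fst (s w))"
    unfolding plots_pullback_gbundle by simp_all
  moreover have "fst (s w) = w" if "w \<in> A" for w
    using s that A(2) by (auto simp: smooth_section_def)
  ultimately show "\<exists>W y. openin (Euclidean_space n) W \<and> u \<in> W \<and> W \<subseteq> U \<and>
        y \<in> plots (gtotal P) n W \<and> (\<forall>w\<in>W. gproj P (y w) = p w)"
    using A(1-3) by (intro exI[of _ A] exI[of _ "\<lambda>w. snd (s w)"]) simp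
qed

text \<open>A lift of the plot p over W is a section over W of the pullback of P along p.\<close>

lemma principal_bundleI:
  assumes P: "gspace_over G B P" and t: "torsor_action G P" and l: "local_lifts B P"
  shows "principal_bundle G B P"
  unfolding principal_bundle_def
proof (intro conjI P allI ballI)
  fix n U p assume p: "p \<in> plots B n U"
  let ?D = "domain_space n U"
  let ?Q = "pullback_gbundle ?D p P"
  have U: "openin (Euclidean_space n) U" by (rule plot_open[OF gspace_overD(2)[OF P] p])
  note D = diffeological_domain_space[OF U] and ps = smooth_map_domainI[OF gspace_overD(2)[OF P] p]
  note Q = pullback_gspace_over[OF P D ps] and Qt = pullback_torsor[OF P t D ps]
  define \<A> where "\<A> = {A. openin (Euclidean_space n) A \<and> A \<subseteq> U \<and> trivial_gbundle_over G ?D ?Q A}"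
  have "\<exists>A\<in>\<A>. u \<in> A" if u: "u \<in> U" for u
  proof -
    obtain W y where W: "openin (Euclidean_space n) W" "u \<in> W" "W \<subseteq> U" "y \<in> plots (gtotal P) n W"
      "\<And>w. w \<in> W \<Longrightarrow> gproj P (y w) = p w" by (rule local_liftsE[OF l p u]) blast
    have "smooth_section ?D ?Q W (\<lambda>w. (w, y w))"
      unfolding smooth_section_def
    proof (intro conjI ballI smooth_mapI)
      show "(w, y w) \<in> points (gtotal ?Q)" if "w \<in> points (sub_space ?D W)" for w
        using that plot_point[OF gspace_overD(3)[OF P] W(4)] W(5) by simp
      fix m T h assume h: "h \<in> plots (sub_space ?D W) m T"
      then have h': "smooth_between m T n W h" "smooth_between m T n U h"
        using plots_sub_domain_space[OF U W(1,3)] by (auto simp: plots_sub_space)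
      show "(\<lambda>u. (h u, y (h u))) \<in> plots (gtotal ?Q) m T"
        unfolding plots_pullback_gbundle
        using h' plot_compose[OF gspace_overD(3)[OF P] W(4) h'(1)] W(5) smooth_between_openD(3)[OF h'(1)] by simp
    qed simp
    then have "W \<in> \<A>" using W section_trivial_gbundle_over[OF Q Qt] by (auto simp: \<A>_def)
    with W(2) show ?thesis by blast
  qed
  then have "\<Union>\<A> = U" by (auto simp: \<A>_def)
  moreover have "\<forall>A\<in>\<A>. D_open ?D A" using D_open_domain_space[OF U] by (auto simp: \<A>_def)
  ultimately show "locally_trivial_gbundle G ?D ?Q"
    unfolding locally_trivial_gbundle_def by (intro exI[of _ \<A>]) (auto simp: \<A>_def)
qed

lemma pullback_principal_bundle:
  assumes P: "principal_bundle G B P" and C: "diffeological_space C" and f: "smooth_map C B f"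
  shows "principal_bundle G C (pullback_gbundle C f P)"
  using principal_bundle_gspace_over[OF P] principal_bundle_torsor[OF P] principal_bundle_local_lifts[OF P] C f
  by (intro principal_bundleI pullback_gspace_over pullback_torsor pullback_local_lifts)

section \<open>Vector bundles paired with bundles of frames\<close>

lemma points_fiber [simp]: "points (vspace (fiber F b)) = {x \<in> points (btotal F). bproj F x = b}"
  by (auto simp: fiber_def)

lemma dvs_overD:
  assumes "dvs_over B F"
  shows "diffeological_space B" "diffeological_space (btotal F)" "smooth_map (btotal F) B (bproj F)"
    "x \<in> points (btotal F) \<Longrightarrow> bproj F x \<in> points B"
    "b \<in> points B \<Longrightarrow> real_vector_space_on {x \<in> points (btotal F). bproj F x = b} (badd F) (bscale F) (bzero F b)"
    "x \<in> points (btotal F) \<Longrightarrow> y \<in> points (btotal F) \<Longrightarrow> bproj F x = bproj F y \<Longrightarrow> badd F x y \<in> points (btotal F)"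
    "x \<in> points (btotal F) \<Longrightarrow> y \<in> points (btotal F) \<Longrightarrow> bproj F x = bproj F y \<Longrightarrow> bproj F (badd F x y) = bproj F y"
    "x \<in> points (btotal F) \<Longrightarrow> bscale F a x \<in> points (btotal F)"
    "x \<in> points (btotal F) \<Longrightarrow> bproj F (bscale F a x) = bproj F x"
    "b \<in> points B \<Longrightarrow> bzero F b \<in> points (btotal F)"
    "b \<in> points B \<Longrightarrow> bproj F (bzero F b) = b"
    "x' \<in> plots (btotal F) n U \<Longrightarrow> y' \<in> plots (btotal F) n U \<Longrightarrow> (\<And>u. u \<in> U \<Longrightarrow> bproj F (x' u) = bproj F (y' u)) \<Longrightarrow>
       (\<lambda>u. badd F (x' u) (y' u)) \<in> plots (btotal F) n U"
    "smooth_fun n U r \<Longrightarrow> x' \<in> plots (btotal F) n U \<Longrightarrow> (\<lambda>u. bscale F (r u) (x' u)) \<in> plots (btotal F) n U"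
    "smooth_map B (btotal F) (bzero F)"
proof -
  note a = assms[unfolded dvs_over_def]
  show "diffeological_space B" "diffeological_space (btotal F)" using a by blast+
  show p: "smooth_map (btotal F) B (bproj F)" using a by blast
  show pr: "x \<in> points (btotal F) \<Longrightarrow> bproj F x \<in> points B" for x by (rule smooth_map_point[OF p])
  show v: "real_vector_space_on {x \<in> points (btotal F). bproj F x = b} (badd F) (bscale F) (bzero F b)"
    if "b \<in> points B" for b using a that by simp
  show "badd F x y \<in> points (btotal F)" "bproj F (badd F x y) = bproj F y"
    if "x \<in> points (btotal F)" "y \<in> points (btotal F)" "bproj F x = bproj F y" for x y
    using v[OF pr[OF that(2)]] that unfolding real_vector_space_on_iff by auto
  show "bscale F a x \<in> points (btotal F)" "bproj F (bscale F a x) = bproj F x"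
    if "x \<in> points (btotal F)" for a x
    using v[OF pr[OF that]] that unfolding real_vector_space_on_iff by auto
  show "bzero F b \<in> points (btotal F)" "bproj F (bzero F b) = b" if "b \<in> points B" for b
    using v[OF that] unfolding real_vector_space_on_iff by auto
  show "smooth_map B (btotal F) (bzero F)" using a by blast
  have add: "smooth_map (sub_space (prod_space (btotal F) (btotal F)) {(x, y). bproj F x = bproj F y})
       (btotal F) (\<lambda>(x, y). badd F x y)" using a by blast
  show "(\<lambda>u. badd F (x' u) (y' u)) \<in> plots (btotal F) n U"
    if "x' \<in> plots (btotal F) n U" "y' \<in> plots (btotal F) n U" "\<And>u. u \<in> U \<Longrightarrow> bproj F (x' u) = bproj F (y' u)"
    using smooth_map_plot[OF add, of "\<lambda>u. (x' u, y' u)"] that by (simp add: plots_sub_space plots_prod_space)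
  have scl: "smooth_map (prod_space real_space (btotal F)) (btotal F) (\<lambda>(a, x). bscale F a x)" using a by blast
  show "smooth_fun n U r \<Longrightarrow> x' \<in> plots (btotal F) n U \<Longrightarrow> (\<lambda>u. bscale F (r u) (x' u)) \<in> plots (btotal F) n U"
    by (rule smooth_map_prodD(2)[OF scl]) (simp_all add: plots_real_space)
qed

lemma dvs_overI:
  assumes "diffeological_space B" "diffeological_space (btotal F)" "smooth_map (btotal F) B (bproj F)"
    "\<And>b. b \<in> points B \<Longrightarrow> real_vector_space_on {x \<in> points (btotal F). bproj F x = b} (badd F) (bscale F) (bzero F b)"
    "\<And>n U x y. x \<in> plots (btotal F) n U \<Longrightarrow> y \<in> plots (btotal F) n U \<Longrightarrow> (\<And>u. u \<in> U \<Longrightarrow> bproj F (x u) = bproj F (y u)) \<Longrightarrow>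
       (\<lambda>u. badd F (x u) (y u)) \<in> plots (btotal F) n U"
    "\<And>n U r x. smooth_fun n U r \<Longrightarrow> x \<in> plots (btotal F) n U \<Longrightarrow> (\<lambda>u. bscale F (r u) (x u)) \<in> plots (btotal F) n U"
    "smooth_map B (btotal F) (bzero F)"
  shows "dvs_over B F"
proof -
  have pr: "bproj F x \<in> points B" if "x \<in> points (btotal F)" for x by (rule smooth_map_point[OF assms(3) that])
  have cl: "badd F x y \<in> points (btotal F)"
    if "x \<in> points (btotal F)" "y \<in> points (btotal F)" "bproj F x = bproj F y" for x y
    using assms(4)[OF pr[OF that(2)]] that unfolding real_vector_space_on_iff by auto
  have cs: "bscale F a x \<in> points (btotal F)" if "x \<in> points (btotal F)" for a x
    using assms(4)[OF pr[OF that]] that unfolding real_vector_space_on_iff by auto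
  have "smooth_map (sub_space (prod_space (btotal F) (btotal F)) {(x, y). bproj F x = bproj F y})
       (btotal F) (\<lambda>(x, y). badd F x y)"
  proof (rule smooth_mapI)
    fix n U p assume "p \<in> plots (sub_space (prod_space (btotal F) (btotal F)) {(x, y). bproj F x = bproj F y}) n U"
    then show "(\<lambda>u. case p u of (x, y) \<Rightarrow> badd F x y) \<in> plots (btotal F) n U"
      unfolding case_prod_beta plots_sub_space plots_prod_space by (intro assms(5)) auto
  qed (use cl in auto)
  moreover have "smooth_map (prod_space real_space (btotal F)) (btotal F) (\<lambda>(a, x). bscale F a x)"
    by (rule smooth_map_prodI) (use cs in simp, rule assms(6), simp_all add: plots_real_space)
  ultimately show ?thesis
    unfolding dvs_over_def points_fiber using assms(1-4,7) by (intro conjI ballI)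
qed

lemma restrict_vbundle_simps [simp]:
  "btotal (restrict_vbundle A F) = sub_space (btotal F) {x. bproj F x \<in> A}"
  "bproj (restrict_vbundle A F) = bproj F" "badd (restrict_vbundle A F) = badd F"
  "bscale (restrict_vbundle A F) = bscale F"
  by (simp_all add: restrict_vbundle_def)

lemma fiber_simps:
  "vspace (fiber F b) = sub_space (btotal F) {x. bproj F x = b}"
  "vadd (fiber F b) = badd F" "vscale (fiber F b) = bscale F"
  by (simp_all add: fiber_def)

lemma pullback_vbundle_simps [simp]:
  "btotal (pullback_vbundle C f F) = sub_space (prod_space C (btotal F)) {(c, x). f c = bproj F x}"
  "bproj (pullback_vbundle C f F) = fst"
  "badd (pullback_vbundle C f F) z z' = (fst z, badd F (snd z) (snd z'))"
  "bscale (pullback_vbundle C f F) a z = (fst z, bscale F a (snd z))"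
  "bzero (pullback_vbundle C f F) c = (c, bzero F (f c))"
  by (simp_all add: pullback_vbundle_def case_prod_beta)

lemma plots_pullback_vbundle:
  "p \<in> plots (btotal (pullback_vbundle C f F)) n U \<longleftrightarrow>
     (\<lambda>u. fst (p u)) \<in> plots C n U \<and> (\<lambda>u. snd (p u)) \<in> plots (btotal F) n U \<and>
     (\<forall>u\<in>U. f (fst (p u)) = bproj F (snd (p u)))"
  by (auto simp: plots_sub_space plots_prod_space case_prod_beta)

lemma pullback_dvs_over:
  assumes F: "dvs_over B F" and C: "diffeological_space C" and f: "smooth_map C B f"
  shows "dvs_over C (pullback_vbundle C f F)"
proof (rule dvs_overI[OF C])
  show "diffeological_space (btotal (pullback_vbundle C f F))"
    using diffeological_sub_space[OF diffeological_prod_space[OF C dvs_overD(2)[OF F]]] by simp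
  show "smooth_map (btotal (pullback_vbundle C f F)) C (bproj (pullback_vbundle C f F))"
  proof (rule smooth_mapI)
    show "(\<lambda>u. bproj (pullback_vbundle C f F) (p u)) \<in> plots C n U"
      if "p \<in> plots (btotal (pullback_vbundle C f F)) n U" for n U p
      using that[unfolded plots_pullback_vbundle] by simp
  qed auto
  fix c assume c: "c \<in> points C"
  have b: "bij_betw (Pair c) {x \<in> points (btotal F). bproj F x = f c}
      {z \<in> points (btotal (pullback_vbundle C f F)). bproj (pullback_vbundle C f F) z = c}"
    using c by (intro bij_betw_byWitness[where f' = snd]) auto
  show "real_vector_space_on {z \<in> points (btotal (pullback_vbundle C f F)). bproj (pullback_vbundle C f F) z = c}
      (badd (pullback_vbundle C f F)) (bscale (pullback_vbundle C f F)) (bzero (pullback_vbundle C f F) c)"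
    by (rule real_vector_space_on_bij[OF dvs_overD(5)[OF F smooth_map_point[OF f c]] b]) simp_all
next
  fix n U x y
  assume x: "x \<in> plots (btotal (pullback_vbundle C f F)) n U" and y: "y \<in> plots (btotal (pullback_vbundle C f F)) n U"
    and xy: "\<And>u. u \<in> U \<Longrightarrow> bproj (pullback_vbundle C f F) (x u) = bproj (pullback_vbundle C f F) (y u)"
  note x' = x[unfolded plots_pullback_vbundle] and y' = y[unfolded plots_pullback_vbundle]
  have e: "bproj F (snd (x u)) = bproj F (snd (y u))" if "u \<in> U" for u
    using x' y' xy[OF that] that by (metis pullback_vbundle_simps(2))
  have pt: "snd (x u) \<in> points (btotal F)" "snd (y u) \<in> points (btotal F)" if "u \<in> U" for u
    using plot_point[OF dvs_overD(2)[OF F] _ that] x' y' by blast+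
  have "f (fst (x u)) = bproj F (badd F (snd (x u)) (snd (y u)))" if "u \<in> U" for u
    using dvs_overD(7)[OF F pt[OF that] e[OF that]] x' e[OF that] that by simp
  then show "(\<lambda>u. badd (pullback_vbundle C f F) (x u) (y u)) \<in> plots (btotal (pullback_vbundle C f F)) n U"
    unfolding plots_pullback_vbundle using x' y' dvs_overD(12)[OF F _ _ e] by simp
next
  fix n U r x assume r: "smooth_fun n U r" and x: "x \<in> plots (btotal (pullback_vbundle C f F)) n U"
  note x' = x[unfolded plots_pullback_vbundle]
  have "bproj F (bscale F (r u) (snd (x u))) = bproj F (snd (x u))" if "u \<in> U" for u
    using dvs_overD(9)[OF F plot_point[OF dvs_overD(2)[OF F] _ that]] x' by blast
  then show "(\<lambda>u. bscale (pullback_vbundle C f F) (r u) (x u)) \<in> plots (btotal (pullback_vbundle C f F)) n U"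
    unfolding plots_pullback_vbundle using x' dvs_overD(13)[OF F r] by simp
next
  show "smooth_map C (btotal (pullback_vbundle C f F)) (bzero (pullback_vbundle C f F))"
  proof (rule smooth_mapI)
    show "bzero (pullback_vbundle C f F) c \<in> points (btotal (pullback_vbundle C f F))" if "c \<in> points C" for c
      using that dvs_overD(10,11)[OF F smooth_map_point[OF f that]] by simp
    show "(\<lambda>u. bzero (pullback_vbundle C f F) (p u)) \<in> plots (btotal (pullback_vbundle C f F)) n U"
      if p: "p \<in> plots C n U" for n U p
      unfolding plots_pullback_vbundle
      using p smooth_map_plot[OF dvs_overD(14)[OF F] smooth_map_plot[OF f p]]
        dvs_overD(11)[OF F smooth_map_point[OF f plot_point[OF C p]]] by simp
  qed
qed

context
  fixes V :: "'v dvs"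
  assumes V: "diffeological_vector_space V"
begin

text \<open>The inverse of a trivialization, with its argument in the base kept fixed, is a frame.\<close>

lemma trivial_vbundle_over_frame:
  assumes F: "dvs_over B F" and tr: "trivial_vbundle_over V B F A"
  obtains e where "frame_along V (sub_space B A) (\<lambda>b. b) F e"
proof -
  let ?FA = "sub_space (btotal F) {x. bproj F x \<in> A}" and ?BA = "sub_space B A"
  obtain \<phi> where d: "diffeomorphism ?FA (prod_space ?BA (vspace V)) \<phi>"
    and fst: "\<And>x. x \<in> points (btotal F) \<Longrightarrow> bproj F x \<in> A \<Longrightarrow> fst (\<phi> x) = bproj F x"
    and iso: "\<And>b. b \<in> points B \<Longrightarrow> b \<in> A \<Longrightarrow> dvs_isomorphism (fiber (restrict_vbundle A F) b) V (snd \<circ> \<phi>)"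
    using tr unfolding trivial_vbundle_over_def trivial_vbundle_def by auto
  obtain \<psi> where \<phi>: "smooth_map ?FA (prod_space ?BA (vspace V)) \<phi>"
    and \<psi>: "smooth_map (prod_space ?BA (vspace V)) ?FA \<psi>"
    and \<psi>\<phi>: "\<And>x. x \<in> points ?FA \<Longrightarrow> \<psi> (\<phi> x) = x"
    and \<phi>\<psi>: "\<And>z. z \<in> points (prod_space ?BA (vspace V)) \<Longrightarrow> \<phi> (\<psi> z) = z"
    using d by (rule diffeomorphismE) blast
  have FA: "x \<in> points ?FA \<longleftrightarrow> x \<in> points (btotal F) \<and> bproj F x \<in> A" for x by simp
  have snd: "snd (\<phi> x) \<in> vecs V" if "x \<in> points ?FA" for x
    using smooth_map_point[OF \<phi> that] by (auto simp: mem_Times_iff)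
  have rec: "\<psi> (bproj F x, snd (\<phi> x)) = x" if x: "x \<in> points (btotal F)" "bproj F x \<in> A" for x
  proof -
    have "(bproj F x, snd (\<phi> x)) = \<phi> x" using fst[OF x] by (simp add: prod_eq_iff)
    then show ?thesis using \<psi>\<phi>[of x] x by simp
  qed
  have \<psi>p: "\<psi> (b, v) \<in> points ?FA" "bproj F (\<psi> (b, v)) = b" if "b \<in> points B" "b \<in> A" "v \<in> vecs V" for b v
  proof -
    show p: "\<psi> (b, v) \<in> points ?FA" using smooth_map_point[OF \<psi>, of "(b, v)"] that by simp
    show "bproj F (\<psi> (b, v)) = b"
      using fst[of "\<psi> (b, v)"] p \<phi>\<psi>[of "(b, v)"] that by simp
  qed
  have lin: "\<psi> (b, vadd V v w) = badd F (\<psi> (b, v)) (\<psi> (b, w))" "\<psi> (b, vscale V a v) = bscale F a (\<psi> (b, v))"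
    if b: "b \<in> points B" "b \<in> A" and v: "v \<in> vecs V" "w \<in> vecs V" for b v w a
  proof -
    note pv = \<psi>p[OF b v(1)] and pw = \<psi>p[OF b v(2)]
    have fv: "\<psi> (b, v) \<in> points (vspace (fiber (restrict_vbundle A F) b))"
        "\<psi> (b, w) \<in> points (vspace (fiber (restrict_vbundle A F) b))"
      using pv pw by simp_all
    note l = iso[OF b, unfolded dvs_isomorphism_def dvs_linear_def fiber_simps(2,3) restrict_vbundle_simps o_def, THEN conjunct2]
    have s: "snd (\<phi> (\<psi> (b, v))) = v" "snd (\<phi> (\<psi> (b, w))) = w" using \<phi>\<psi> b v by simp_all
    have xs: "badd F (\<psi> (b, v)) (\<psi> (b, w)) \<in> points ?FA" "bproj F (badd F (\<psi> (b, v)) (\<psi> (b, w))) = b"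
      "bscale F a (\<psi> (b, v)) \<in> points ?FA" "bproj F (bscale F a (\<psi> (b, v))) = b"
      using pv pw b dvs_overD(6,7)[OF F, of "\<psi> (b, v)" "\<psi> (b, w)"] dvs_overD(8,9)[OF F, of "\<psi> (b, v)"] by simp_all
    have eq: "\<psi> (b, snd (\<phi> x)) = x" if "x \<in> points ?FA" "bproj F x = b" for x
      using rec[of x] that by simp
    have "snd (\<phi> (badd F (\<psi> (b, v)) (\<psi> (b, w)))) = vadd V v w"
      using l[THEN conjunct1, rule_format, OF fv] s by simp
    with eq[OF xs(1,2)] show "\<psi> (b, vadd V v w) = badd F (\<psi> (b, v)) (\<psi> (b, w))" by simp
    have "snd (\<phi> (bscale F a (\<psi> (b, v)))) = vscale V a v"
      using l[THEN conjunct2, rule_format, OF fv(1)] s by simp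
    with eq[OF xs(3,4)] show "\<psi> (b, vscale V a v) = bscale F a (\<psi> (b, v))" by simp
  qed
  have bij: "bij_betw (\<lambda>v. \<psi> (b, v)) (vecs V) {x \<in> points (btotal F). bproj F x = b}" if b: "b \<in> points B" "b \<in> A" for b
  proof (rule bij_betw_byWitness[where f' = "\<lambda>x. snd (\<phi> x)"])
    show "\<forall>v\<in>vecs V. snd (\<phi> (\<psi> (b, v))) = v" using \<phi>\<psi> b by simp
    show "\<forall>x\<in>{x \<in> points (btotal F). bproj F x = b}. \<psi> (b, snd (\<phi> x)) = x"
    proof
      fix x assume "x \<in> {x \<in> points (btotal F). bproj F x = b}"
      then show "\<psi> (b, snd (\<phi> x)) = x" using rec[of x] b by simp
    qed
    show "(\<lambda>v. \<psi> (b, v)) ` vecs V \<subseteq> {x \<in> points (btotal F). bproj F x = b}" using \<psi>p[OF b] by auto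
    show "(\<lambda>x. snd (\<phi> x)) ` {x \<in> points (btotal F). bproj F x = b} \<subseteq> vecs V" using snd b by auto
  qed
  have "frame_along V ?BA (\<lambda>b. b) F (\<lambda>b v. \<psi> (b, v))"
  proof (rule frame_alongI)
    show "linear_bij V F b (\<lambda>v. \<psi> (b, v))" if "b \<in> points ?BA" for b
      using that bij lin unfolding linear_bij_def by simp
    show "(\<lambda>u. \<psi> (k u, v u)) \<in> plots (btotal F) n U"
      if "k \<in> plots ?BA n U" "v \<in> plots (vspace V) n U" for n U k v
      using smooth_map_plot[OF \<psi>, of "\<lambda>u. (k u, v u)"] that by (simp add: plots_prod_space plots_sub_space)
    fix n U k x assume k: "k \<in> plots ?BA n U" and x: "x \<in> plots (btotal F) n U"
      and kx: "\<And>u. u \<in> U \<Longrightarrow> bproj F (x u) = k u"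
    have kp: "k u \<in> points B" "k u \<in> A" if "u \<in> U" for u
      using plot_point[OF diffeological_sub_space[OF dvs_overD(1)[OF F]] k that] by auto
    have "x \<in> plots ?FA n U" using x kx kp by (simp add: plots_sub_space)
    from smooth_map_plot[OF \<phi> this] have s: "(\<lambda>u. snd (\<phi> (x u))) \<in> plots (vspace V) n U"
      by (simp add: plots_prod_space)
    show "(\<lambda>u. inv_into (vecs V) (\<lambda>v. \<psi> (k u, v)) (x u)) \<in> plots (vspace V) n U"
    proof (rule plot_cong[OF dvs_space[OF V] s])
      fix u assume u: "u \<in> U"
      have xF: "x u \<in> points ?FA" using plot_point[OF dvs_overD(2)[OF F] x u] kx[OF u] kp[OF u] by simp
      show "inv_into (vecs V) (\<lambda>v. \<psi> (k u, v)) (x u) = snd (\<phi> (x u))"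
      proof (rule inv_into_f_eq[OF bij_betw_imp_inj_on[OF bij[OF kp[OF u]]] snd[OF xF]])
        show "\<psi> (k u, snd (\<phi> (x u))) = x u"
          using rec[of "x u"] xF kx[OF u] by simp
      qed
    qed
  qed
  then show ?thesis by (rule that)
qed

lemma frame_trivial_vbundle_over:
  assumes F: "dvs_over B F" and e: "frame_along V (sub_space B A) (\<lambda>b. b) F e"
  shows "trivial_vbundle_over V B F A"
proof -
  let ?FA = "sub_space (btotal F) {x. bproj F x \<in> A}" and ?BA = "sub_space B A"
  note B = dvs_overD(1)[OF F] and E = dvs_overD(2)[OF F] and Vd = dvs_space[OF V]
  define \<phi> where "\<phi> x = (bproj F x, inv_into (vecs V) (e (bproj F x)) x)" for x
  have L: "linear_bij V F b (e b)" if "b \<in> points B" "b \<in> A" for b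
    using frame_alongD(1)[OF e] that by simp
  have FA: "bproj F x \<in> points B" if "x \<in> points (btotal F)" for x by (rule dvs_overD(4)[OF F that])
  have inv: "(\<lambda>u. inv_into (vecs V) (e (bproj F (x u))) (x u)) \<in> plots (vspace V) n U"
    if x: "x \<in> plots (btotal F) n U" and xA: "\<And>u. u \<in> U \<Longrightarrow> bproj F (x u) \<in> A" for n U x
  proof (rule frame_alongD(3)[OF e _ x refl])
    show "(\<lambda>u. bproj F (x u)) \<in> plots ?BA n U"
      using smooth_map_plot[OF dvs_overD(3)[OF F] x] xA by (simp add: plots_sub_space)
  qed
  have d: "diffeomorphism ?FA (prod_space ?BA (vspace V)) \<phi>"
  proof (rule diffeomorphismI[where g = "\<lambda>z. e (fst z) (snd z)"])
    show "smooth_map ?FA (prod_space ?BA (vspace V)) \<phi>"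
    proof (rule smooth_mapI)
      fix n U p assume "p \<in> plots ?FA n U"
      then show "(\<lambda>u. \<phi> (p u)) \<in> plots (prod_space ?BA (vspace V)) n U"
        using inv[of p n U] smooth_map_plot[OF dvs_overD(3)[OF F], of p n U]
        by (simp add: plots_prod_space plots_sub_space \<phi>_def)
    qed (use FA linear_bijD(6)[OF L] in \<open>auto simp: \<phi>_def\<close>)
    show "smooth_map (prod_space ?BA (vspace V)) ?FA (\<lambda>z. e (fst z) (snd z))"
    proof (rule smooth_mapI)
      fix n U p assume p: "p \<in> plots (prod_space ?BA (vspace V)) n U"
      then have p1: "(\<lambda>u. fst (p u)) \<in> plots ?BA n U" and p2: "(\<lambda>u. snd (p u)) \<in> plots (vspace V) n U"
        by (simp_all add: plots_prod_space)
      have "bproj F (e (fst (p u)) (snd (p u))) \<in> A" if u: "u \<in> U" for u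
        using plot_point[OF diffeological_sub_space[OF B] p1 u] plot_point[OF Vd p2 u]
          linear_bijD(5)[OF L, of "fst (p u)" "snd (p u)"] by simp
      with frame_alongD(2)[OF e p1 p2] show "(\<lambda>u. e (fst (p u)) (snd (p u))) \<in> plots ?FA n U"
        by (simp add: plots_sub_space)
    qed (use linear_bijD(4,5)[OF L] in auto)
  qed (use linear_bijD(5,7,8)[OF L] FA in \<open>auto simp: \<phi>_def\<close>)
  have iso: "dvs_isomorphism (fiber (restrict_vbundle A F) b) V (snd \<circ> \<phi>)" if b: "b \<in> points B" "b \<in> A" for b
    unfolding dvs_isomorphism_def
  proof
    let ?S = "vspace (fiber (restrict_vbundle A F) b)"
    note l = linear_bijD[OF L[OF b]]
    have S: "x \<in> points ?S \<longleftrightarrow> x \<in> points (btotal F) \<and> bproj F x = b" for x using b(2) by auto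
    have plS: "p \<in> plots ?S n U \<longleftrightarrow> p \<in> plots (btotal F) n U \<and> (\<forall>u\<in>U. bproj F (p u) = b)" for p n U
      using b(2) by (auto simp: fiber_simps plots_sub_space)
    show "diffeomorphism ?S (vspace V) (snd \<circ> \<phi>)"
    proof (rule diffeomorphismI[where g = "e b"])
      show "smooth_map ?S (vspace V) (snd \<circ> \<phi>)"
      proof (rule smooth_mapI)
        fix n U p assume p: "p \<in> plots ?S n U"
        then have "(\<lambda>u. inv_into (vecs V) (e (bproj F (p u))) (p u)) \<in> plots (vspace V) n U"
          using b(2) by (intro inv) (simp_all add: plS)
        then show "(\<lambda>u. (snd \<circ> \<phi>) (p u)) \<in> plots (vspace V) n U" by (simp add: \<phi>_def)
      qed (use l S in \<open>auto simp: \<phi>_def\<close>)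
      show "smooth_map (vspace V) ?S (e b)"
      proof (rule smooth_mapI)
        fix n U p assume p: "p \<in> plots (vspace V) n U"
        have "(\<lambda>u. e b (p u)) \<in> plots (btotal F) n U"
          using plot_const[OF diffeological_sub_space[OF B], of n U b A] plot_open[OF Vd p] b
          by (intro frame_alongD(2)[OF e _ p]) simp
        then show "(\<lambda>u. e b (p u)) \<in> plots ?S n U" using l(5) plot_point[OF Vd p] by (simp add: plS)
      qed (use l S in auto)
    qed (use l S in \<open>auto simp: \<phi>_def\<close>)
    show "dvs_linear (fiber (restrict_vbundle A F) b) V (snd \<circ> \<phi>)"
      unfolding dvs_linear_def fiber_simps(2,3) restrict_vbundle_simps S o_def
    proof (intro conjI ballI allI)
      fix x y assume x: "x \<in> points ?S" and y: "y \<in> points ?S"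
      let ?i = "inv_into (vecs V) (e b)"
      have i: "?i x \<in> vecs V" "?i y \<in> vecs V" using x y S l(6) by auto
      have "badd F x y = e b (vadd V (?i x) (?i y))" using l(2)[OF i] l(7) x y S by simp
      then have "?i (badd F x y) = vadd V (?i x) (?i y)" using l(8)[OF dvs_add[OF V i]] by simp
      then show "snd (\<phi> (badd F x y)) = vadd V (snd (\<phi> x)) (snd (\<phi> y))"
        using x y dvs_overD(7)[OF F, of x y] S by (simp add: \<phi>_def)
    next
      fix a x assume x: "x \<in> points ?S"
      let ?i = "inv_into (vecs V) (e b)"
      have i: "?i x \<in> vecs V" using x S l(6) by auto
      have "bscale F a x = e b (vscale V a (?i x))" using l(3)[OF i] l(7) x S by simp
      then have "?i (bscale F a x) = vscale V a (?i x)" using l(8)[OF dvs_scale[OF V i]] by simp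
      then show "snd (\<phi> (bscale F a x)) = vscale V a (snd (\<phi> x))"
        using x dvs_overD(9)[OF F, of x] S by (simp add: \<phi>_def)
    qed
  qed
  show ?thesis
    unfolding trivial_vbundle_over_def trivial_vbundle_def
    using d iso by (intro exI[of _ \<phi>]) (simp add: \<phi>_def)
qed

text \<open>
  P is the bundle of frames of F, the point y of P being the frame ev y. The last two conditions say
  that lifts to P of a plot of the base correspond to smooth frames of F along this plot: injectivity
  gives uniqueness of the lift, and the last condition its existence.
\<close>

definition frame_pairing ::
  "'b diffspace \<Rightarrow> ('b, 'e, 'v \<Rightarrow> 'v) gbundle \<Rightarrow> ('b, 'f) vbundle \<Rightarrow> ('e \<Rightarrow> 'v \<Rightarrow> 'f) \<Rightarrow> bool" where
  "frame_pairing B P F ev \<longleftrightarrow>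
     frame_along V (gtotal P) (gproj P) F ev \<and>
     (\<forall>y\<in>points (gtotal P). \<forall>g\<in>carrier (GL V). \<forall>v\<in>vecs V. ev (gact P y g) v = ev y (g v)) \<and>
     (\<forall>y\<in>points (gtotal P). \<forall>y'\<in>points (gtotal P). gproj P y = gproj P y' \<longrightarrow>
        (\<forall>v\<in>vecs V. ev y v = ev y' v) \<longrightarrow> y = y') \<and>
     (\<forall>n U p e. p \<in> plots B n U \<longrightarrow> frame_along V (domain_space n U) p F e \<longrightarrow>
        (\<exists>y\<in>plots (gtotal P) n U. \<forall>u\<in>U. gproj P (y u) = p u \<and> (\<forall>v\<in>vecs V. ev (y u) v = e u v)))"

lemma frame_pairingD:
  assumes "frame_pairing B P F ev"
  shows "frame_along V (gtotal P) (gproj P) F ev"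
    "y \<in> points (gtotal P) \<Longrightarrow> g \<in> carrier (GL V) \<Longrightarrow> v \<in> vecs V \<Longrightarrow> ev (gact P y g) v = ev y (g v)"
    "y \<in> points (gtotal P) \<Longrightarrow> y' \<in> points (gtotal P) \<Longrightarrow> gproj P y = gproj P y' \<Longrightarrow>
       (\<And>v. v \<in> vecs V \<Longrightarrow> ev y v = ev y' v) \<Longrightarrow> y = y'"
    "p \<in> plots B n U \<Longrightarrow> frame_along V (domain_space n U) p F e \<Longrightarrow>
       \<exists>y\<in>plots (gtotal P) n U. \<forall>u\<in>U. gproj P (y u) = p u \<and> (\<forall>v\<in>vecs V. ev (y u) v = e u v)"
proof -
  note a = assms[unfolded frame_pairing_def]
  show "frame_along V (gtotal P) (gproj P) F ev" by (rule a[THEN conjunct1])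
  show "y \<in> points (gtotal P) \<Longrightarrow> g \<in> carrier (GL V) \<Longrightarrow> v \<in> vecs V \<Longrightarrow> ev (gact P y g) v = ev y (g v)"
    by (rule a[THEN conjunct2, THEN conjunct1, rule_format])
  show "y \<in> points (gtotal P) \<Longrightarrow> y' \<in> points (gtotal P) \<Longrightarrow> gproj P y = gproj P y' \<Longrightarrow>
       (\<And>v. v \<in> vecs V \<Longrightarrow> ev y v = ev y' v) \<Longrightarrow> y = y'"
    by (rule a[THEN conjunct2, THEN conjunct2, THEN conjunct1, rule_format])
  show "p \<in> plots B n U \<Longrightarrow> frame_along V (domain_space n U) p F e \<Longrightarrow>
       \<exists>y\<in>plots (gtotal P) n U. \<forall>u\<in>U. gproj P (y u) = p u \<and> (\<forall>v\<in>vecs V. ev (y u) v = e u v)"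
    by (rule a[THEN conjunct2, THEN conjunct2, THEN conjunct2, THEN spec, THEN spec, THEN spec, THEN spec, THEN mp, THEN mp])
qed

lemma frame_pairingI:
  assumes "frame_along V (gtotal P) (gproj P) F ev"
    "\<And>y g v. y \<in> points (gtotal P) \<Longrightarrow> g \<in> carrier (GL V) \<Longrightarrow> v \<in> vecs V \<Longrightarrow> ev (gact P y g) v = ev y (g v)"
    "\<And>y y'. y \<in> points (gtotal P) \<Longrightarrow> y' \<in> points (gtotal P) \<Longrightarrow> gproj P y = gproj P y' \<Longrightarrow>
       (\<And>v. v \<in> vecs V \<Longrightarrow> ev y v = ev y' v) \<Longrightarrow> y = y'"
    "\<And>n U p e. p \<in> plots B n U \<Longrightarrow> frame_along V (domain_space n U) p F e \<Longrightarrow>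
       \<exists>y\<in>plots (gtotal P) n U. \<forall>u\<in>U. gproj P (y u) = p u \<and> (\<forall>v\<in>vecs V. ev (y u) v = e u v)"
  shows "frame_pairing B P F ev"
  unfolding frame_pairing_def
proof (intro conjI ballI allI impI)
  show "frame_along V (gtotal P) (gproj P) F ev" by (rule assms(1))
  show "ev (gact P y g) v = ev y (g v)" if "y \<in> points (gtotal P)" "g \<in> carrier (GL V)" "v \<in> vecs V" for y g v
    by (rule assms(2)[OF that])
  show "y = y'" if "y \<in> points (gtotal P)" "y' \<in> points (gtotal P)" "gproj P y = gproj P y'"
    "\<forall>v\<in>vecs V. ev y v = ev y' v" for y y'
    by (rule assms(3)[OF that(1-3)]) (rule bspec[OF that(4)])
  show "\<exists>y\<in>plots (gtotal P) n U. \<forall>u\<in>U. gproj P (y u) = p u \<and> (\<forall>v\<in>vecs V. ev (y u) v = e u v)"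
    if "p \<in> plots B n U" "frame_along V (domain_space n U) p F e" for n U p e
    by (rule assms(4)[OF that])
qed

text \<open>
  The universal property extends from plots to smooth families indexed by any space C. Constant
  plots give the map s pointwise; along a plot of C the lift given by the universal property agrees
  with s by uniqueness, so s is smooth.
\<close>

lemma frame_pairing_lift:
  assumes P: "gspace_over (GL V) B P" and ev: "frame_pairing B P F ev"
    and C: "diffeological_space C" and f: "smooth_map C B f" and e: "frame_along V C f F e"
  shows "\<exists>s. smooth_map C (gtotal P) s \<and>
    (\<forall>c\<in>points C. gproj P (s c) = f c \<and> (\<forall>v\<in>vecs V. ev (s c) v = e c v))"
proof -
  note E = gspace_overD(3)[OF P]
  have "\<exists>y\<in>points (gtotal P). gproj P y = f c \<and> (\<forall>v\<in>vecs V. ev y v = e c v)" if c: "c \<in> points C" for c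
  proof -
    have "smooth_map (domain_space 0 origin_space) C (\<lambda>_. c)"
      by (rule smooth_map_domainI[OF C plot_const[OF C origin_space(1) c]])
    from frame_along_compose[OF e this]
    have "\<exists>y\<in>plots (gtotal P) 0 origin_space. \<forall>u\<in>origin_space. gproj P (y u) = f c \<and> (\<forall>v\<in>vecs V. ev (y u) v = e c v)"
      by (rule frame_pairingD(4)[OF ev plot_const[OF gspace_overD(2)[OF P] origin_space(1) smooth_map_point[OF f c]]])
    then show ?thesis using plot_point[OF E _ origin_space(2)] origin_space(2) by blast
  qed
  then obtain s where s: "\<And>c. c \<in> points C \<Longrightarrow> s c \<in> points (gtotal P)"
    "\<And>c. c \<in> points C \<Longrightarrow> gproj P (s c) = f c"
    "\<And>c v. c \<in> points C \<Longrightarrow> v \<in> vecs V \<Longrightarrow> ev (s c) v = e c v"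
    by metis
  have "smooth_map C (gtotal P) s"
  proof (rule smooth_mapI[OF s(1)])
    fix n U k assume k: "k \<in> plots C n U"
    note kC = plot_point[OF C k]
    from frame_pairingD(4)[OF ev smooth_map_plot[OF f k] frame_along_compose[OF e smooth_map_domainI[OF C k]]]
    obtain y where y: "y \<in> plots (gtotal P) n U"
      "\<And>u. u \<in> U \<Longrightarrow> gproj P (y u) = f (k u)" "\<And>u v. u \<in> U \<Longrightarrow> v \<in> vecs V \<Longrightarrow> ev (y u) v = e (k u) v" by auto
    show "(\<lambda>u. s (k u)) \<in> plots (gtotal P) n U"
      by (rule plot_cong[OF E y(1)], rule frame_pairingD(3)[OF ev s(1)[OF kC] plot_point[OF E y(1)]])
        (simp_all add: s(2,3) y(2,3) kC)
  qed
  then show ?thesis using s(2,3) by (intro exI[of _ s] conjI ballI)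
qed

text \<open>
  The quotient of two points y and y' over the same base point is the change of frame from ev y to
  ev y'.
\<close>

lemma frame_pairing_torsor:
  assumes P: "gspace_over (GL V) B P" and F: "dvs_over B F" and ev: "frame_pairing B P F ev"
  shows "torsor_action (GL V) P"
proof (rule torsorI[OF P])
  note E = gspace_overD(3)[OF P] and fr = frame_pairingD(1)[OF ev]
  note L = linear_bijD[OF frame_alongD(1)[OF fr]]
  fix y g h assume y: "y \<in> points (gtotal P)" and g: "g \<in> carrier (GL V)" and h: "h \<in> carrier (GL V)"
    and eq: "gact P y g = gact P y h"
  show "g = h"
  proof (rule GL_ext[OF V g h])
    fix v assume v: "v \<in> vecs V"
    have "ev y (g v) = ev y (h v)"
      using frame_pairingD(2)[OF ev y g v] frame_pairingD(2)[OF ev y h v] eq by simp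
    then have "inv_into (vecs V) (ev y) (ev y (g v)) = inv_into (vecs V) (ev y) (ev y (h v))" by (rule arg_cong)
    then show "g v = h v" unfolding L(8)[OF y GL_D(5)[OF V g v]] L(8)[OF y GL_D(5)[OF V h v]] .
  qed
next
  note E = gspace_overD(3)[OF P] and fr = frame_pairingD(1)[OF ev]
  note L = linear_bijD[OF frame_alongD(1)[OF fr]]
  fix n U y y' u
  assume y: "y \<in> plots (gtotal P) n U" "y' \<in> plots (gtotal P) n U"
    and pr: "\<And>u. u \<in> U \<Longrightarrow> gproj P (y u) = gproj P (y' u)" and u: "u \<in> U"
  let ?D = "domain_space n U"
  note U = plot_open[OF E y(1)]
  note D = diffeological_domain_space[OF U]
  note e = frame_along_compose[OF fr smooth_map_domainI[OF E y(1)]]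
  have e': "frame_along V ?D (\<lambda>u. gproj P (y u)) F (\<lambda>u. ev (y' u))"
    by (rule frame_along_cong[OF V frame_along_compose[OF fr smooth_map_domainI[OF E y(2)]] D dvs_overD(2)[OF F] refl])
      (simp add: pr)
  define k where "k u = restrict (\<lambda>v. inv_into (vecs V) (ev (y u)) (ev (y' u) v)) (vecs V)" for u
  have k: "k \<in> plots (gspace (GL V)) n U"
    unfolding k_def by (rule smooth_map_domainD[OF frame_change[OF V e e' D dvs_overD(2)[OF F]] U])
  have "gact P (y u) (k u) = y' u" if u: "u \<in> U" for u
  proof -
    note yu = plot_point[OF E y(1) u] and yu' = plot_point[OF E y(2) u] and ku = GL_plotD(2)[OF V k u]
    show ?thesis
    proof (rule frame_pairingD(3)[OF ev gspace_overD(6)[OF P yu ku] yu'])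
      show "gproj P (gact P (y u) (k u)) = gproj P (y' u)"
        using gspace_overD(10)[OF P yu ku] pr[OF u] by simp
      fix v assume v: "v \<in> vecs V"
      show "ev (gact P (y u) (k u)) v = ev (y' u) v"
        unfolding frame_pairingD(2)[OF ev yu ku v]
        using L(7)[OF yu L(4)[OF yu' v]] L(5)[OF yu' v] pr[OF u] v by (simp add: k_def)
    qed
  qed
  with k u U show "\<exists>W k. openin (Euclidean_space n) W \<and> u \<in> W \<and> W \<subseteq> U \<and> k \<in> plots (gspace (GL V)) n W \<and>
        (\<forall>w\<in>W. gact P (y w) (k w) = y' w)"
    by (intro exI[of _ U] exI[of _ k]) simp
qed

text \<open>
  A section s of P gives the frame b \<mapsto> ev (s b), and the universal property turns frames back into
  sections.
\<close>

lemma frame_pairing_trivial_iff: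
  assumes P: "gspace_over (GL V) B P" and F: "dvs_over B F" and ev: "frame_pairing B P F ev"
  shows "trivial_gbundle_over (GL V) B P A \<longleftrightarrow> trivial_vbundle_over V B F A"
proof
  note B = diffeological_sub_space[OF dvs_overD(1)[OF F]]
  assume "trivial_gbundle_over (GL V) B P A"
  then obtain s where "smooth_section B P A s" by (rule trivial_gbundle_over_section[OF P])
  then have s: "smooth_map (sub_space B A) (gtotal P) s" "\<And>b. b \<in> points (sub_space B A) \<Longrightarrow> b = gproj P (s b)"
    by (auto simp: smooth_section_def)
  have "frame_along V (sub_space B A) (\<lambda>b. b) F (\<lambda>b. ev (s b))"
    by (rule frame_along_cong[OF V frame_along_compose[OF frame_pairingD(1)[OF ev] s(1)] B dvs_overD(2)[OF F] refl s(2)])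
  then show "trivial_vbundle_over V B F A" by (rule frame_trivial_vbundle_over[OF F])
next
  note B = diffeological_sub_space[OF dvs_overD(1)[OF F]]
  assume "trivial_vbundle_over V B F A"
  then obtain e where e: "frame_along V (sub_space B A) (\<lambda>b. b) F e" by (rule trivial_vbundle_over_frame[OF F])
  have "smooth_map (sub_space B A) B (\<lambda>b. b)" by (rule smooth_mapI) (auto simp: plots_sub_space)
  from frame_pairing_lift[OF P ev B this e] obtain s where
    "smooth_map (sub_space B A) (gtotal P) s" "\<And>b. b \<in> points (sub_space B A) \<Longrightarrow> gproj P (s b) = b" by auto
  then have "smooth_section B P A s" by (simp add: smooth_section_def)
  then show "trivial_gbundle_over (GL V) B P A"
    by (rule section_trivial_gbundle_over[OF P frame_pairing_torsor[OF P F ev]])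
qed

text \<open>
  The fibers of the pullback of F along f over c and of F over f c are the same, so frames of the
  pullback along k are frames of F along the composite of f and k. This gives both the smoothness of
  the pulled back pairing and its universal property.
\<close>

lemma frame_pairing_pullback:
  assumes P: "gspace_over (GL V) B P" and F: "dvs_over B F" and ev: "frame_pairing B P F ev"
    and C: "diffeological_space C" and f: "smooth_map C B f"
  shows "frame_pairing C (pullback_gbundle C f P) (pullback_vbundle C f F) (\<lambda>z v. (fst z, ev (snd z) v))"
proof (rule frame_pairingI)
  let ?P = "pullback_gbundle C f P" and ?F = "pullback_vbundle C f F"
  note E = gspace_overD(3)[OF P] and EF = dvs_overD(2)[OF F] and Vd = dvs_space[OF V]
  note fr = frame_pairingD(1)[OF ev]
  note L = linear_bijD[OF frame_alongD(1)[OF fr]]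
  have bij: "bij_betw (\<lambda>v. (fst z, ev (snd z) v)) (vecs V) {x \<in> points (btotal ?F). bproj ?F x = gproj ?P z}"
    if z: "z \<in> points (gtotal ?P)" for z
  proof (rule bij_betw_byWitness[where f' = "\<lambda>x. inv_into (vecs V) (ev (snd z)) (snd x)"])
    have y: "snd z \<in> points (gtotal P)" "f (fst z) = gproj P (snd z)" "fst z \<in> points C" using z by auto
    show "\<forall>v\<in>vecs V. inv_into (vecs V) (ev (snd z)) (snd (fst z, ev (snd z) v)) = v" using L(8)[OF y(1)] by simp
    show "\<forall>x\<in>{x \<in> points (btotal ?F). bproj ?F x = gproj ?P z}. (fst z, ev (snd z) (inv_into (vecs V) (ev (snd z)) (snd x))) = x"
      using L(7)[OF y(1)] y by auto
    show "(\<lambda>v. (fst z, ev (snd z) v)) ` vecs V \<subseteq> {x \<in> points (btotal ?F). bproj ?F x = gproj ?P z}"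
      using L(4,5)[OF y(1)] y by auto
    show "(\<lambda>x. inv_into (vecs V) (ev (snd z)) (snd x)) ` {x \<in> points (btotal ?F). bproj ?F x = gproj ?P z} \<subseteq> vecs V"
      using L(6)[OF y(1)] y by auto
  qed
  have inv: "inv_into (vecs V) (\<lambda>v. (fst z, ev (snd z) v)) x = inv_into (vecs V) (ev (snd z)) (snd x)"
    if z: "z \<in> points (gtotal ?P)" and x: "x \<in> points (btotal ?F)" "fst x = fst z" for z x
  proof (rule inv_into_f_eq[OF bij_betw_imp_inj_on[OF bij[OF z]]])
    have y: "snd z \<in> points (gtotal P)" "f (fst z) = gproj P (snd z)" using z by auto
    show "inv_into (vecs V) (ev (snd z)) (snd x) \<in> vecs V" using L(6)[OF y(1)] x y by auto
    show "(fst z, ev (snd z) (inv_into (vecs V) (ev (snd z)) (snd x))) = x"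
      using L(7)[OF y(1)] x y by (auto simp: prod_eq_iff)
  qed
  show "frame_along V (gtotal ?P) (gproj ?P) ?F (\<lambda>z v. (fst z, ev (snd z) v))"
  proof (rule frame_alongI)
    show "linear_bij V ?F (gproj ?P z) (\<lambda>v. (fst z, ev (snd z) v))" if z: "z \<in> points (gtotal ?P)" for z
      unfolding linear_bij_def
    proof (intro conjI ballI allI bij[OF z])
      have y: "snd z \<in> points (gtotal P)" using z by auto
      show "(fst z, ev (snd z) (vadd V v w)) = badd ?F (fst z, ev (snd z) v) (fst z, ev (snd z) w)"
        if "v \<in> vecs V" "w \<in> vecs V" for v w using L(2)[OF y that] by simp
      show "(fst z, ev (snd z) (vscale V a v)) = bscale ?F a (fst z, ev (snd z) v)"
        if "v \<in> vecs V" for a v using L(3)[OF y that] by simp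
    qed
    fix n U k
    assume k: "k \<in> plots (gtotal ?P) n U"
    have kp: "k u \<in> points (gtotal ?P)" "snd (k u) \<in> points (gtotal P)" if "u \<in> U" for u
      using plot_point[OF gspace_overD(3)[OF pullback_gspace_over[OF P C f]] k that] by auto
    note k' = k[unfolded plots_pullback_gbundle]
    show "(\<lambda>u. (fst (k u), ev (snd (k u)) (v u))) \<in> plots (btotal ?F) n U" if v: "v \<in> plots (vspace V) n U" for v
      unfolding plots_pullback_vbundle
      using k' frame_alongD(2)[OF fr _ v, of "\<lambda>u. snd (k u)"] L(5)[OF kp(2) plot_point[OF Vd v]] by simp
    fix x assume x: "x \<in> plots (btotal ?F) n U" and xk: "\<And>u. u \<in> U \<Longrightarrow> bproj ?F (x u) = gproj ?P (k u)"
    have xp: "x u \<in> points (btotal ?F)" if "u \<in> U" for u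
      by (rule plot_point[OF dvs_overD(2)[OF pullback_dvs_over[OF F C f]] x that])
    note x' = x[unfolded plots_pullback_vbundle]
    have "bproj F (snd (x u)) = gproj P (snd (k u))" if "u \<in> U" for u
      using x' k' xk[OF that] that by (metis pullback_vbundle_simps(2) pullback_gbundle_simps(2))
    then have "(\<lambda>u. inv_into (vecs V) (ev (snd (k u))) (snd (x u))) \<in> plots (vspace V) n U"
      using k' x' by (intro frame_alongD(3)[OF fr]) auto
    then show "(\<lambda>u. inv_into (vecs V) (\<lambda>v. (fst (k u), ev (snd (k u)) v)) (x u)) \<in> plots (vspace V) n U"
      by (rule plot_cong[OF Vd]) (rule inv[OF kp(1) xp], use xk in auto)
  qed
  show "(fst (gact ?P z g), ev (snd (gact ?P z g)) v) = (fst z, ev (snd z) (g v))"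
    if "z \<in> points (gtotal ?P)" "g \<in> carrier (GL V)" "v \<in> vecs V" for z g v
    using frame_pairingD(2)[OF ev, of "snd z" g v] that by auto
  show "z = z'" if z: "z \<in> points (gtotal ?P)" "z' \<in> points (gtotal ?P)" "gproj ?P z = gproj ?P z'"
    and eq: "\<And>v. v \<in> vecs V \<Longrightarrow> (fst z, ev (snd z) v) = (fst z', ev (snd z') v)" for z z'
  proof -
    have "snd z = snd z'"
    proof (rule frame_pairingD(3)[OF ev])
      show "gproj P (snd z) = gproj P (snd z')" using z by (auto simp: case_prod_beta)
      show "ev (snd z) v = ev (snd z') v" if "v \<in> vecs V" for v using eq[OF that] by simp
    qed (use z in auto)
    with z(3) show ?thesis by (simp add: prod_eq_iff)
  qed
  fix n U p e assume p: "p \<in> plots C n U" and e: "frame_along V (domain_space n U) p ?F e"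
  note U = plot_open[OF C p]
  note Le = linear_bijD[OF frame_alongD(1)[OF e, unfolded points_domain_space]]
  have e1: "fst (e u v) = p u" "snd (e u v) \<in> points (btotal F)" "bproj F (snd (e u v)) = f (p u)"
    if "u \<in> U" "v \<in> vecs V" for u v
    using Le(4,5)[OF that] by auto
  have bijs: "bij_betw (\<lambda>v. snd (e u v)) (vecs V) {x \<in> points (btotal F). bproj F x = f (p u)}" if u: "u \<in> U" for u
  proof -
    have "bij_betw snd {x \<in> points (btotal ?F). bproj ?F x = p u} {x \<in> points (btotal F). bproj F x = f (p u)}"
      using plot_point[OF C p u] by (intro bij_betw_byWitness[where f' = "Pair (p u)"]) auto
    from bij_betw_trans[OF Le(1)[OF u] this] show ?thesis by (simp add: o_def)
  qed
  have "frame_along V (domain_space n U) (\<lambda>u. f (p u)) F (\<lambda>u v. snd (e u v))"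
  proof (rule frame_alongI)
    show "linear_bij V F (f (p u)) (\<lambda>v. snd (e u v))" if "u \<in> points (domain_space n U)" for u
      using that bijs Le(2,3)[of u] unfolding linear_bij_def by simp
    fix m W h assume h: "h \<in> plots (domain_space n U) m W"
    have hU: "h w \<in> U" if "w \<in> W" for w using h smooth_between_openD(3) that by auto
    show "(\<lambda>w. snd (e (h w) (v w))) \<in> plots (btotal F) m W" if v: "v \<in> plots (vspace V) m W" for v
      using frame_alongD(2)[OF e h v] unfolding plots_pullback_vbundle by blast
    fix x assume x: "x \<in> plots (btotal F) m W" and xk: "\<And>w. w \<in> W \<Longrightarrow> bproj F (x w) = f (p (h w))"
    have "(\<lambda>w. (p (h w), x w)) \<in> plots (btotal ?F) m W"
      unfolding plots_pullback_vbundle using x xk plot_compose[OF C p, of m W h] h by simp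
    then have "(\<lambda>w. inv_into (vecs V) (e (h w)) (p (h w), x w)) \<in> plots (vspace V) m W"
      by (intro frame_alongD(3)[OF e h]) simp_all
    then show "(\<lambda>w. inv_into (vecs V) (\<lambda>v. snd (e (h w) v)) (x w)) \<in> plots (vspace V) m W"
    proof (rule plot_cong[OF Vd])
      fix w assume w: "w \<in> W"
      have z: "(p (h w), x w) \<in> points (btotal ?F)" "bproj ?F (p (h w), x w) = p (h w)"
        using plot_point[OF C p hU[OF w]] plot_point[OF EF x w] xk[OF w] by simp_all
      show "inv_into (vecs V) (\<lambda>v. snd (e (h w) v)) (x w) = inv_into (vecs V) (e (h w)) (p (h w), x w)"
        using Le(6,7)[OF hU[OF w] z]
        by (intro inv_into_f_eq[OF bij_betw_imp_inj_on[OF bijs[OF hU[OF w]]]]) simp_all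
    qed
  qed
  from frame_pairingD(4)[OF ev smooth_map_plot[OF f p] this] obtain y where
    y: "y \<in> plots (gtotal P) n U" "\<And>u. u \<in> U \<Longrightarrow> gproj P (y u) = f (p u)"
      "\<And>u v. u \<in> U \<Longrightarrow> v \<in> vecs V \<Longrightarrow> ev (y u) v = snd (e u v)" by auto
  have "(\<lambda>u. (p u, y u)) \<in> plots (gtotal ?P) n U"
    unfolding plots_pullback_gbundle using p y by simp
  then show "\<exists>z\<in>plots (gtotal ?P) n U. \<forall>u\<in>U. gproj ?P (z u) = p u \<and> (\<forall>v\<in>vecs V. (fst (z u), ev (snd (z u)) v) = e u v)"
    using e1(1) y(3) by (intro bexI[of _ "\<lambda>u. (p u, y u)"]) (auto simp: prod_eq_iff)
qed

text \<open>
  Pairings pull back along plots, and the two pullbacks are trivial over the same sets; so the same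
  cover witnesses local triviality of both.
\<close>

lemma frame_pairing_principal_iff:
  assumes P: "gspace_over (GL V) B P" and F: "dvs_over B F" and ev: "frame_pairing B P F ev"
  shows "principal_bundle (GL V) B P \<longleftrightarrow> vector_bundle V B F"
proof -
  have "locally_trivial_gbundle (GL V) (domain_space n U) (pullback_gbundle (domain_space n U) p P) \<longleftrightarrow>
      locally_trivial_vbundle V (domain_space n U) (pullback_vbundle (domain_space n U) p F)"
    if p: "p \<in> plots B n U" for n U p
  proof -
    note B = dvs_overD(1)[OF F]
    note D = diffeological_domain_space[OF plot_open[OF B p]] and f = smooth_map_domainI[OF B p]
    show ?thesis
      unfolding locally_trivial_gbundle_def locally_trivial_vbundle_def
        frame_pairing_trivial_iff[OF pullback_gspace_over[OF P D f] pullback_dvs_over[OF F D f]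
          frame_pairing_pullback[OF P F ev D f]] ..
  qed
  then show ?thesis unfolding principal_bundle_def vector_bundle_def using P F by simp
qed

lemma frame_pairing_numerable_iff:
  assumes P: "gspace_over (GL V) B P" and F: "dvs_over B F" and ev: "frame_pairing B P F ev"
  shows "D_numerable_gbundle (GL V) B P \<longleftrightarrow> D_numerable_vbundle V B F"
proof -
  have "trivial_gbundle_over (GL V) B P = trivial_vbundle_over V B F"
    using frame_pairing_trivial_iff[OF P F ev] by blast
  then show ?thesis by (simp add: D_numerable_gbundle_def D_numerable_vbundle_def)
qed

text \<open>
  Both bundles have the same universal property: the evaluation of P is a family of frames indexed
  by P, so it lifts to a map from P to P', and conversely.
\<close>

lemma frame_pairing_gbundle_unique:
  assumes P: "gspace_over (GL V) B P" "frame_pairing B P F ev"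
    and P': "gspace_over (GL V) B P'" "frame_pairing B P' F ev'"
  shows "gbundle_iso (GL V) P P'"
proof -
  note E = gspace_overD(3)[OF P(1)] and E' = gspace_overD(3)[OF P'(1)]
  obtain s where s: "smooth_map (gtotal P) (gtotal P') s" "\<And>y. y \<in> points (gtotal P) \<Longrightarrow> gproj P' (s y) = gproj P y"
    "\<And>y v. y \<in> points (gtotal P) \<Longrightarrow> v \<in> vecs V \<Longrightarrow> ev' (s y) v = ev y v"
    using frame_pairing_lift[OF P' E gspace_overD(4)[OF P(1)] frame_pairingD(1)[OF P(2)]] by auto
  obtain t where t: "smooth_map (gtotal P') (gtotal P) t" "\<And>y. y \<in> points (gtotal P') \<Longrightarrow> gproj P (t y) = gproj P' y"
    "\<And>y v. y \<in> points (gtotal P') \<Longrightarrow> v \<in> vecs V \<Longrightarrow> ev (t y) v = ev' y v"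
    using frame_pairing_lift[OF P E' gspace_overD(4)[OF P'(1)] frame_pairingD(1)[OF P'(2)]] by auto
  note sp = smooth_map_point[OF s(1)] and tp = smooth_map_point[OF t(1)]
  have "diffeomorphism (gtotal P) (gtotal P') s"
  proof (rule diffeomorphismI[OF s(1) t(1)])
    show "t (s y) = y" if "y \<in> points (gtotal P)" for y
      using that sp[OF that] by (intro frame_pairingD(3)[OF P(2)] tp) (simp_all add: s t)
    show "s (t y) = y" if "y \<in> points (gtotal P')" for y
      using that tp[OF that] by (intro frame_pairingD(3)[OF P'(2)] sp) (simp_all add: s t)
  qed
  moreover have "s (gact P y g) = gact P' (s y) g" if y: "y \<in> points (gtotal P)" and g: "g \<in> carrier (GL V)" for y g
  proof (rule frame_pairingD(3)[OF P'(2) sp[OF gspace_overD(6)[OF P(1) y g]] gspace_overD(6)[OF P'(1) sp[OF y] g]])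
    show "gproj P' (s (gact P y g)) = gproj P' (gact P' (s y) g)"
      using gspace_overD(10)[OF P(1) y g] gspace_overD(10)[OF P'(1) sp[OF y] g] s(2) y gspace_overD(6)[OF P(1) y g] by simp
    show "ev' (s (gact P y g)) v = ev' (gact P' (s y) g) v" if v: "v \<in> vecs V" for v
      using s(3)[OF gspace_overD(6)[OF P(1) y g] v] frame_pairingD(2)[OF P(2) y g v]
        frame_pairingD(2)[OF P'(2) sp[OF y] g v] s(3)[OF y GL_D(5)[OF V g v]] by simp
  qed
  ultimately show ?thesis unfolding gbundle_iso_def using s(2) by blast
qed

end

section \<open>Isomorphisms of bundles\<close>

lemma gbundle_isoE:
  assumes "gbundle_iso G P Q"
  obtains \<phi> \<psi> where "smooth_map (gtotal P) (gtotal Q) \<phi>" "smooth_map (gtotal Q) (gtotal P) \<psi>"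
    "\<And>x. x \<in> points (gtotal P) \<Longrightarrow> \<psi> (\<phi> x) = x" "\<And>z. z \<in> points (gtotal Q) \<Longrightarrow> \<phi> (\<psi> z) = z"
    "\<And>x. x \<in> points (gtotal P) \<Longrightarrow> gproj Q (\<phi> x) = gproj P x"
    "\<And>z. z \<in> points (gtotal Q) \<Longrightarrow> gproj P (\<psi> z) = gproj Q z"
    "\<And>x g. x \<in> points (gtotal P) \<Longrightarrow> g \<in> carrier G \<Longrightarrow> \<phi> (gact P x g) = gact Q (\<phi> x) g"
proof -
  obtain \<phi> where d: "diffeomorphism (gtotal P) (gtotal Q) \<phi>"
    and p: "\<And>x. x \<in> points (gtotal P) \<Longrightarrow> gproj Q (\<phi> x) = gproj P x"
    and a: "\<And>x g. x \<in> points (gtotal P) \<Longrightarrow> g \<in> carrier G \<Longrightarrow> \<phi> (gact P x g) = gact Q (\<phi> x) g"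
    using assms unfolding gbundle_iso_def by auto
  obtain \<psi> where \<psi>: "smooth_map (gtotal P) (gtotal Q) \<phi>" "smooth_map (gtotal Q) (gtotal P) \<psi>"
    "\<And>x. x \<in> points (gtotal P) \<Longrightarrow> \<psi> (\<phi> x) = x" "\<And>z. z \<in> points (gtotal Q) \<Longrightarrow> \<phi> (\<psi> z) = z"
    using d by (rule diffeomorphismE) blast
  have 6: "gproj P (\<psi> z) = gproj Q z" if "z \<in> points (gtotal Q)" for z
    using p[OF smooth_map_point[OF \<psi>(2) that]] \<psi>(4)[OF that] by simp
  show ?thesis by (rule that[OF \<psi> p 6 a])
qed

lemma gbundle_isoI:
  assumes "smooth_map (gtotal P) (gtotal Q) \<phi>" "smooth_map (gtotal Q) (gtotal P) \<psi>"
    "\<And>x. x \<in> points (gtotal P) \<Longrightarrow> \<psi> (\<phi> x) = x" "\<And>z. z \<in> points (gtotal Q) \<Longrightarrow> \<phi> (\<psi> z) = z"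
    "\<And>x. x \<in> points (gtotal P) \<Longrightarrow> gproj Q (\<phi> x) = gproj P x"
    "\<And>x g. x \<in> points (gtotal P) \<Longrightarrow> g \<in> carrier G \<Longrightarrow> \<phi> (gact P x g) = gact Q (\<phi> x) g"
  shows "gbundle_iso G P Q"
  unfolding gbundle_iso_def
  using diffeomorphismI[OF assms(1-4)] assms(5,6) by (intro exI[of _ \<phi>] conjI ballI)

lemma gbundle_iso_trans:
  assumes "gbundle_iso G P Q" "gbundle_iso G Q R"
  shows "gbundle_iso G P R"
  using assms(1)
proof (rule gbundle_isoE)
  fix \<phi> \<psi>
  assume 1: "smooth_map (gtotal P) (gtotal Q) \<phi>" "smooth_map (gtotal Q) (gtotal P) \<psi>"
    "\<And>x. x \<in> points (gtotal P) \<Longrightarrow> \<psi> (\<phi> x) = x" "\<And>z. z \<in> points (gtotal Q) \<Longrightarrow> \<phi> (\<psi> z) = z"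
    "\<And>x. x \<in> points (gtotal P) \<Longrightarrow> gproj Q (\<phi> x) = gproj P x"
    "\<And>x g. x \<in> points (gtotal P) \<Longrightarrow> g \<in> carrier G \<Longrightarrow> \<phi> (gact P x g) = gact Q (\<phi> x) g"
  show ?thesis
    using assms(2)
  proof (rule gbundle_isoE)
    fix \<phi>' \<psi>'
    assume 2: "smooth_map (gtotal Q) (gtotal R) \<phi>'" "smooth_map (gtotal R) (gtotal Q) \<psi>'"
      "\<And>x. x \<in> points (gtotal Q) \<Longrightarrow> \<psi>' (\<phi>' x) = x" "\<And>z. z \<in> points (gtotal R) \<Longrightarrow> \<phi>' (\<psi>' z) = z"
      "\<And>x. x \<in> points (gtotal Q) \<Longrightarrow> gproj R (\<phi>' x) = gproj Q x"
      "\<And>x g. x \<in> points (gtotal Q) \<Longrightarrow> g \<in> carrier G \<Longrightarrow> \<phi>' (gact Q x g) = gact R (\<phi>' x) g"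
    show ?thesis
      by (rule gbundle_isoI[OF smooth_map_compose[OF 1(1) 2(1)] smooth_map_compose[OF 2(2) 1(2)]])
        (simp_all add: 1 2 smooth_map_point[OF 1(1)] smooth_map_point[OF 2(2)])
  qed
qed

lemma gbundle_iso_sym:
  assumes P: "gspace_over G B P" and i: "gbundle_iso G P Q"
  shows "gbundle_iso G Q P"
  using i
proof (rule gbundle_isoE)
  fix \<phi> \<psi>
  assume 1: "smooth_map (gtotal P) (gtotal Q) \<phi>" "smooth_map (gtotal Q) (gtotal P) \<psi>"
    "\<And>x. x \<in> points (gtotal P) \<Longrightarrow> \<psi> (\<phi> x) = x" "\<And>z. z \<in> points (gtotal Q) \<Longrightarrow> \<phi> (\<psi> z) = z"
    "\<And>z. z \<in> points (gtotal Q) \<Longrightarrow> gproj P (\<psi> z) = gproj Q z"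
    "\<And>x g. x \<in> points (gtotal P) \<Longrightarrow> g \<in> carrier G \<Longrightarrow> \<phi> (gact P x g) = gact Q (\<phi> x) g"
  have 7: "\<psi> (gact Q z g) = gact P (\<psi> z) g" if z: "z \<in> points (gtotal Q)" and g: "g \<in> carrier G" for z g
  proof -
    note pz = smooth_map_point[OF 1(2) z]
    have "gact Q z g = \<phi> (gact P (\<psi> z) g)" using 1(6)[OF pz g] 1(4)[OF z] by simp
    then show ?thesis using 1(3)[OF gspace_overD(6)[OF P pz g]] by simp
  qed
  show ?thesis by (rule gbundle_isoI[OF 1(2,1,4,3,5) 7])
qed

lemma vbundle_isoE:
  assumes "vbundle_iso B F F'" and F: "dvs_over B F"
  obtains \<phi> \<psi> where "smooth_map (btotal F) (btotal F') \<phi>" "smooth_map (btotal F') (btotal F) \<psi>"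
    "\<And>x. x \<in> points (btotal F) \<Longrightarrow> \<psi> (\<phi> x) = x" "\<And>z. z \<in> points (btotal F') \<Longrightarrow> \<phi> (\<psi> z) = z"
    "\<And>x. x \<in> points (btotal F) \<Longrightarrow> bproj F' (\<phi> x) = bproj F x"
    "\<And>z. z \<in> points (btotal F') \<Longrightarrow> bproj F (\<psi> z) = bproj F' z"
    "\<And>x y. x \<in> points (btotal F) \<Longrightarrow> y \<in> points (btotal F) \<Longrightarrow> bproj F x = bproj F y \<Longrightarrow>
       \<phi> (badd F x y) = badd F' (\<phi> x) (\<phi> y)"
    "\<And>a x. x \<in> points (btotal F) \<Longrightarrow> \<phi> (bscale F a x) = bscale F' a (\<phi> x)"
proof -
  obtain \<phi> where d: "diffeomorphism (btotal F) (btotal F') \<phi>"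
    and p: "\<And>x. x \<in> points (btotal F) \<Longrightarrow> bproj F' (\<phi> x) = bproj F x"
    and l: "\<And>b. b \<in> points B \<Longrightarrow> dvs_linear (fiber F b) (fiber F' b) \<phi>"
    using assms(1) unfolding vbundle_iso_def by auto
  obtain \<psi> where \<psi>: "smooth_map (btotal F) (btotal F') \<phi>" "smooth_map (btotal F') (btotal F) \<psi>"
    "\<And>x. x \<in> points (btotal F) \<Longrightarrow> \<psi> (\<phi> x) = x" "\<And>z. z \<in> points (btotal F') \<Longrightarrow> \<phi> (\<psi> z) = z"
    using d by (rule diffeomorphismE) blast
  have 6: "bproj F (\<psi> z) = bproj F' z" if "z \<in> points (btotal F')" for z
    using p[OF smooth_map_point[OF \<psi>(2) that]] \<psi>(4)[OF that] by simp
  have l': "\<phi> (badd F x y) = badd F' (\<phi> x) (\<phi> y)" "\<phi> (bscale F a x) = bscale F' a (\<phi> x)"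
    if "x \<in> points (btotal F)" "y \<in> points (btotal F)" "bproj F x = bproj F y" for x y a
    using l[OF dvs_overD(4)[OF F that(2)]] that unfolding dvs_linear_def points_fiber fiber_simps(2,3) by simp_all
  have 8: "\<phi> (bscale F a x) = bscale F' a (\<phi> x)" if "x \<in> points (btotal F)" for x a
    by (rule l'(2)[OF that that refl])
  show ?thesis by (rule that[OF \<psi> p 6 l'(1) 8])
qed

lemma vbundle_isoI:
  assumes "smooth_map (btotal F) (btotal F') \<phi>" "smooth_map (btotal F') (btotal F) \<psi>"
    "\<And>x. x \<in> points (btotal F) \<Longrightarrow> \<psi> (\<phi> x) = x" "\<And>z. z \<in> points (btotal F') \<Longrightarrow> \<phi> (\<psi> z) = z"
    "\<And>x. x \<in> points (btotal F) \<Longrightarrow> bproj F' (\<phi> x) = bproj F x"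
    "\<And>x y. x \<in> points (btotal F) \<Longrightarrow> y \<in> points (btotal F) \<Longrightarrow> bproj F x = bproj F y \<Longrightarrow>
       \<phi> (badd F x y) = badd F' (\<phi> x) (\<phi> y)"
    "\<And>a x. x \<in> points (btotal F) \<Longrightarrow> \<phi> (bscale F a x) = bscale F' a (\<phi> x)"
  shows "vbundle_iso B F F'"
  unfolding vbundle_iso_def
proof (intro exI[of _ \<phi>] conjI ballI diffeomorphismI[OF assms(1-4)])
  show "bproj F' (\<phi> x) = bproj F x" if "x \<in> points (btotal F)" for x by (rule assms(5)[OF that])
  show "dvs_linear (fiber F b) (fiber F' b) \<phi>" if "b \<in> points B" for b
    unfolding dvs_linear_def points_fiber fiber_simps(2,3)
    using assms(6,7) by simp
qed

lemma vbundle_iso_trans: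
  assumes F: "dvs_over B F" and F': "dvs_over B F'" and "vbundle_iso B F F'" "vbundle_iso B F' F''"
  shows "vbundle_iso B F F''"
  using assms(3) F
proof (rule vbundle_isoE)
  fix \<phi> \<psi>
  assume 1: "smooth_map (btotal F) (btotal F') \<phi>" "smooth_map (btotal F') (btotal F) \<psi>"
    "\<And>x. x \<in> points (btotal F) \<Longrightarrow> \<psi> (\<phi> x) = x" "\<And>z. z \<in> points (btotal F') \<Longrightarrow> \<phi> (\<psi> z) = z"
    "\<And>x. x \<in> points (btotal F) \<Longrightarrow> bproj F' (\<phi> x) = bproj F x"
    "\<And>x y. x \<in> points (btotal F) \<Longrightarrow> y \<in> points (btotal F) \<Longrightarrow> bproj F x = bproj F y \<Longrightarrow>
       \<phi> (badd F x y) = badd F' (\<phi> x) (\<phi> y)"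
    "\<And>a x. x \<in> points (btotal F) \<Longrightarrow> \<phi> (bscale F a x) = bscale F' a (\<phi> x)"
  show ?thesis
    using assms(4) F'
  proof (rule vbundle_isoE)
    fix \<phi>' \<psi>'
    assume 2: "smooth_map (btotal F') (btotal F'') \<phi>'" "smooth_map (btotal F'') (btotal F') \<psi>'"
      "\<And>x. x \<in> points (btotal F') \<Longrightarrow> \<psi>' (\<phi>' x) = x" "\<And>z. z \<in> points (btotal F'') \<Longrightarrow> \<phi>' (\<psi>' z) = z"
      "\<And>x. x \<in> points (btotal F') \<Longrightarrow> bproj F'' (\<phi>' x) = bproj F' x"
      "\<And>x y. x \<in> points (btotal F') \<Longrightarrow> y \<in> points (btotal F') \<Longrightarrow> bproj F' x = bproj F' y \<Longrightarrow>
         \<phi>' (badd F' x y) = badd F'' (\<phi>' x) (\<phi>' y)"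
      "\<And>a x. x \<in> points (btotal F') \<Longrightarrow> \<phi>' (bscale F' a x) = bscale F'' a (\<phi>' x)"
    show ?thesis
      by (rule vbundle_isoI[OF smooth_map_compose[OF 1(1) 2(1)] smooth_map_compose[OF 2(2) 1(2)]])
        (simp_all add: 1 2 smooth_map_point[OF 1(1)] smooth_map_point[OF 2(2)])
  qed
qed

lemma vbundle_iso_sym:
  assumes F: "dvs_over B F" and i: "vbundle_iso B F F'"
  shows "vbundle_iso B F' F"
  using i F
proof (rule vbundle_isoE)
  fix \<phi> \<psi>
  assume 1: "smooth_map (btotal F) (btotal F') \<phi>" "smooth_map (btotal F') (btotal F) \<psi>"
    "\<And>x. x \<in> points (btotal F) \<Longrightarrow> \<psi> (\<phi> x) = x" "\<And>z. z \<in> points (btotal F') \<Longrightarrow> \<phi> (\<psi> z) = z"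
    "\<And>z. z \<in> points (btotal F') \<Longrightarrow> bproj F (\<psi> z) = bproj F' z"
    "\<And>x y. x \<in> points (btotal F) \<Longrightarrow> y \<in> points (btotal F) \<Longrightarrow> bproj F x = bproj F y \<Longrightarrow>
       \<phi> (badd F x y) = badd F' (\<phi> x) (\<phi> y)"
    "\<And>a x. x \<in> points (btotal F) \<Longrightarrow> \<phi> (bscale F a x) = bscale F' a (\<phi> x)"
  note p = smooth_map_point[OF 1(2)]
  show ?thesis
  proof (rule vbundle_isoI[OF 1(2,1,4,3,5)])
    fix x y assume x: "x \<in> points (btotal F')" and y: "y \<in> points (btotal F')" and e: "bproj F' x = bproj F' y"
    have e': "bproj F (\<psi> x) = bproj F (\<psi> y)" using e 1(5) x y by simp
    have "badd F' x y = \<phi> (badd F (\<psi> x) (\<psi> y))" using 1(6)[OF p[OF x] p[OF y] e'] 1(4) x y by simp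
    then show "\<psi> (badd F' x y) = badd F (\<psi> x) (\<psi> y)"
      using 1(3)[OF dvs_overD(6)[OF F p[OF x] p[OF y] e']] by simp
  next
    fix a x assume x: "x \<in> points (btotal F')"
    have "bscale F' a x = \<phi> (bscale F a (\<psi> x))" using 1(7)[OF p[OF x]] 1(4) x by simp
    then show "\<psi> (bscale F' a x) = bscale F a (\<psi> x)"
      using 1(3)[OF dvs_overD(8)[OF F p[OF x]]] by simp
  qed
qed

lemma torsor_action_iso:
  assumes P: "gspace_over G B P" and Q: "gspace_over G B Q" and i: "gbundle_iso G P Q" and t: "torsor_action G P"
  shows "torsor_action G Q"
  using gbundle_iso_sym[OF P i]
proof (rule gbundle_isoE)
  fix \<phi> \<psi>
  assume 1: "smooth_map (gtotal Q) (gtotal P) \<phi>"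
    and 3: "\<And>x. x \<in> points (gtotal Q) \<Longrightarrow> \<psi> (\<phi> x) = x"
    and 5: "\<And>x. x \<in> points (gtotal Q) \<Longrightarrow> gproj P (\<phi> x) = gproj Q x"
    and 7: "\<And>x g. x \<in> points (gtotal Q) \<Longrightarrow> g \<in> carrier G \<Longrightarrow> \<phi> (gact Q x g) = gact P (\<phi> x) g"
  show ?thesis
  proof (rule torsorI[OF Q])
    fix y g h assume y: "y \<in> points (gtotal Q)" and g: "g \<in> carrier G" and h: "h \<in> carrier G"
      and eq: "gact Q y g = gact Q y h"
    have "gact P (\<phi> y) g = gact P (\<phi> y) h" using 7[OF y g] 7[OF y h] eq by simp
    then show "g = h" by (rule torsor_free[OF t smooth_map_point[OF 1 y] g h])
  next
    fix n U y y' u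
    assume y: "y \<in> plots (gtotal Q) n U" and y': "y' \<in> plots (gtotal Q) n U"
      and pr: "\<And>u. u \<in> U \<Longrightarrow> gproj Q (y u) = gproj Q (y' u)" and u: "u \<in> U"
    note E = gspace_overD(3)[OF Q] and G = gspace_overD(1)[OF Q]
    have pr': "gproj P (\<phi> (y u)) = gproj P (\<phi> (y' u))" if "u \<in> U" for u
      using 5[OF plot_point[OF E y that]] 5[OF plot_point[OF E y' that]] pr[OF that] by simp
    obtain k where k: "k \<in> plots (gspace G) n U" "\<And>u. u \<in> U \<Longrightarrow> gact P (\<phi> (y u)) (k u) = \<phi> (y' u)"
      by (rule torsor_divide[OF t smooth_map_plot[OF 1 y] smooth_map_plot[OF 1 y'] pr']) auto
    have "gact Q (y u) (k u) = y' u" if u: "u \<in> U" for u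
    proof -
      have ku: "k u \<in> carrier G"
        using plot_point[OF diffeological_groupD(2)[OF G] k(1) u] diffeological_groupD(3)[OF G] by simp
      note yu = plot_point[OF E y u] and yu' = plot_point[OF E y' u]
      have "\<phi> (gact Q (y u) (k u)) = \<phi> (y' u)" using 7[OF yu ku] k(2)[OF u] by simp
      then have "\<psi> (\<phi> (gact Q (y u) (k u))) = \<psi> (\<phi> (y' u))" by (rule arg_cong)
      then show ?thesis unfolding 3[OF yu'] 3[OF gspace_overD(6)[OF Q yu ku]] .
    qed
    with k(1) u plot_open[OF E y] show "\<exists>W k. openin (Euclidean_space n) W \<and> u \<in> W \<and> W \<subseteq> U \<and>
        k \<in> plots (gspace G) n W \<and> (\<forall>w\<in>W. gact Q (y w) (k w) = y' w)"
      by (intro exI[of _ U] exI[of _ k]) simp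
  qed
qed

lemma local_lifts_iso:
  assumes P: "gspace_over G B P" and i: "gbundle_iso G P Q" and l: "local_lifts B P"
  shows "local_lifts B Q"
  using i
proof (rule gbundle_isoE)
  fix \<phi>
  assume 1: "smooth_map (gtotal P) (gtotal Q) \<phi>"
    and 5: "\<And>x. x \<in> points (gtotal P) \<Longrightarrow> gproj Q (\<phi> x) = gproj P x"
  show ?thesis
    unfolding local_lifts_def
  proof (intro allI impI ballI)
    fix n U p u assume p: "p \<in> plots B n U" and u: "u \<in> U"
    obtain W y where W: "openin (Euclidean_space n) W" "u \<in> W" "W \<subseteq> U" "y \<in> plots (gtotal P) n W"
      "\<And>w. w \<in> W \<Longrightarrow> gproj P (y w) = p w" by (rule local_liftsE[OF l p u]) blast
    show "\<exists>W y. openin (Euclidean_space n) W \<and> u \<in> W \<and> W \<subseteq> U \<and> y \<in> plots (gtotal Q) n W \<and>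
        (\<forall>w\<in>W. gproj Q (y w) = p w)"
      using W(1-3,5) smooth_map_plot[OF 1 W(4)] 5[OF plot_point[OF gspace_overD(3)[OF P] W(4)]]
      by (intro exI[of _ W] exI[of _ "\<lambda>w. \<phi> (y w)"]) simp
  qed
qed

lemma principal_bundle_iso:
  assumes P: "principal_bundle G B P" and Q: "gspace_over G B Q" and i: "gbundle_iso G P Q"
  shows "principal_bundle G B Q"
  by (rule principal_bundleI[OF Q torsor_action_iso[OF principal_bundle_gspace_over[OF P] Q i principal_bundle_torsor[OF P]]
      local_lifts_iso[OF principal_bundle_gspace_over[OF P] i principal_bundle_local_lifts[OF P]]])

lemma trivial_gbundle_over_iso:
  assumes P: "gspace_over G B P" "torsor_action G P" and Q: "gspace_over G B Q" and i: "gbundle_iso G P Q"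
    and tr: "trivial_gbundle_over G B P A"
  shows "trivial_gbundle_over G B Q A"
  using i
proof (rule gbundle_isoE)
  fix \<phi>
  assume 1: "smooth_map (gtotal P) (gtotal Q) \<phi>"
    and 5: "\<And>x. x \<in> points (gtotal P) \<Longrightarrow> gproj Q (\<phi> x) = gproj P x"
  obtain s where s: "smooth_section B P A s" by (rule trivial_gbundle_over_section[OF P(1) tr])
  then have s1: "smooth_map (sub_space B A) (gtotal P) s" by (simp add: smooth_section_def)
  have "gproj Q (\<phi> (s b)) = b" if "b \<in> points B" "b \<in> A" for b
    using 5[OF smooth_map_point[OF s1, of b]] s that by (simp add: smooth_section_def)
  then have "smooth_section B Q A (\<lambda>b. \<phi> (s b))"
    using smooth_map_compose[OF s1 1] by (simp add: smooth_section_def)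
  then show ?thesis by (rule section_trivial_gbundle_over[OF Q torsor_action_iso[OF P(1) Q i P(2)]])
qed

section \<open>Moving bundles to other total spaces\<close>

text \<open>The bundle structure on an image of the total space for which the injection is an isomorphism.\<close>

definition image_gbundle :: "('e \<Rightarrow> 'f) \<Rightarrow> ('b, 'e, 'g) gbundle \<Rightarrow> ('b, 'f, 'g) gbundle" where
  "image_gbundle \<phi> P = (let \<psi> = inv_into (points (gtotal P)) \<phi> in
     \<lparr>gtotal = image_space \<phi> (gtotal P), gproj = (\<lambda>z. gproj P (\<psi> z)), gact = (\<lambda>z g. \<phi> (gact P (\<psi> z) g))\<rparr>)"

lemma image_gbundle:
  assumes P: "gspace_over G B P" and inj: "inj_on \<phi> (points (gtotal P))"
  shows "gspace_over G B (image_gbundle \<phi> P)" "gbundle_iso G P (image_gbundle \<phi> P)"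
proof -
  let ?Q = "image_gbundle \<phi> P" and ?\<psi> = "inv_into (points (gtotal P)) \<phi>"
  note E = gspace_overD(3)[OF P]
  have Q: "gtotal ?Q = image_space \<phi> (gtotal P)" "\<And>z. gproj ?Q z = gproj P (?\<psi> z)"
    "\<And>z g. gact ?Q z g = \<phi> (gact P (?\<psi> z) g)"
    by (simp_all add: image_gbundle_def Let_def)
  note s = smooth_map_image_space[OF E inj] and t = smooth_map_image_space_inv[OF E inj]
  have pt: "?\<psi> z \<in> points (gtotal P)" "\<phi> (?\<psi> z) = z" if "z \<in> \<phi> ` points (gtotal P)" for z
    using that by (auto simp: inj f_inv_into_f inv_into_into)
  have i: "?\<psi> (\<phi> x) = x" if "x \<in> points (gtotal P)" for x using that inj by simp
  show "gspace_over G B ?Q"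
  proof (rule gspace_overI[OF gspace_overD(1,2)[OF P]])
    show "diffeological_space (gtotal ?Q)" unfolding Q by (rule diffeological_image_space[OF E inj])
    show "(\<lambda>u. gproj ?Q (y u)) \<in> plots B n U" if "y \<in> plots (gtotal ?Q) n U" for n U y
      unfolding Q by (rule smooth_map_plot[OF gspace_overD(4)[OF P] smooth_map_plot[OF t that[unfolded Q]]])
    show "(\<lambda>u. gact ?Q (y u) (k u)) \<in> plots (gtotal ?Q) n U"
      if "y \<in> plots (gtotal ?Q) n U" "k \<in> plots (gspace G) n U" for n U y k
      unfolding Q
      by (rule smooth_map_plot[OF s gspace_overD(7)[OF P smooth_map_plot[OF t that(1)[unfolded Q]] that(2)]])
  next
    fix x g h assume x: "x \<in> points (gtotal ?Q)" and g: "g \<in> carrier G" and h: "h \<in> carrier G"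
    have x': "?\<psi> x \<in> points (gtotal P)" using pt x by (simp add: Q)
    show "gact ?Q (gact ?Q x g) h = gact ?Q x (g \<otimes>\<^bsub>G\<^esub> h)"
      unfolding Q by (simp only: i[OF gspace_overD(6)[OF P x' g]] gspace_overD(9)[OF P x' g h])
  next
    fix x g assume x: "x \<in> points (gtotal ?Q)" and g: "g \<in> carrier G"
    have x': "?\<psi> x \<in> points (gtotal P)" using pt x by (simp add: Q)
    show "gproj ?Q (gact ?Q x g) = gproj ?Q x"
      unfolding Q by (simp only: i[OF gspace_overD(6)[OF P x' g]] gspace_overD(10)[OF P x' g])
    show "gact ?Q x g \<in> points (gtotal ?Q)"
      unfolding Q points_image_space by (rule imageI[OF gspace_overD(6)[OF P x' g]])
  next
    fix x assume x: "x \<in> points (gtotal ?Q)"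
    have x': "?\<psi> x \<in> points (gtotal P)" "\<phi> (?\<psi> x) = x" using pt x by (simp_all add: Q)
    show "gproj ?Q x \<in> points B" unfolding Q by (rule gspace_overD(5)[OF P x'(1)])
    show "gact ?Q x \<one>\<^bsub>G\<^esub> = x" unfolding Q gspace_overD(8)[OF P x'(1)] by (rule x'(2))
  qed
  show "gbundle_iso G P ?Q"
  proof (rule gbundle_isoI[where \<phi> = \<phi> and \<psi> = ?\<psi>])
    show "smooth_map (gtotal P) (gtotal ?Q) \<phi>" "smooth_map (gtotal ?Q) (gtotal P) ?\<psi>"
      unfolding Q by (rule s, rule t)
  qed (simp_all add: Q i pt)
qed

definition image_vbundle :: "('e \<Rightarrow> 'f) \<Rightarrow> ('b, 'e) vbundle \<Rightarrow> ('b, 'f) vbundle" where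
  "image_vbundle \<phi> F = (let \<psi> = inv_into (points (btotal F)) \<phi> in
     \<lparr>btotal = image_space \<phi> (btotal F), bproj = (\<lambda>z. bproj F (\<psi> z)),
      badd = (\<lambda>z z'. \<phi> (badd F (\<psi> z) (\<psi> z'))), bscale = (\<lambda>a z. \<phi> (bscale F a (\<psi> z))),
      bzero = (\<lambda>b. \<phi> (bzero F b))\<rparr>)"

lemma image_vbundle:
  assumes F: "dvs_over B F" and inj: "inj_on \<phi> (points (btotal F))"
  shows "dvs_over B (image_vbundle \<phi> F)" "vbundle_iso B F (image_vbundle \<phi> F)"
proof -
  let ?Q = "image_vbundle \<phi> F" and ?\<psi> = "inv_into (points (btotal F)) \<phi>"
  note E = dvs_overD(2)[OF F]
  have Q: "btotal ?Q = image_space \<phi> (btotal F)" "\<And>z. bproj ?Q z = bproj F (?\<psi> z)"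
    "\<And>z z'. badd ?Q z z' = \<phi> (badd F (?\<psi> z) (?\<psi> z'))" "\<And>a z. bscale ?Q a z = \<phi> (bscale F a (?\<psi> z))"
    "\<And>b. bzero ?Q b = \<phi> (bzero F b)"
    by (simp_all add: image_vbundle_def Let_def)
  note s = smooth_map_image_space[OF E inj] and t = smooth_map_image_space_inv[OF E inj]
  have pt: "?\<psi> z \<in> points (btotal F)" "\<phi> (?\<psi> z) = z" if "z \<in> \<phi> ` points (btotal F)" for z
    using that by (auto simp: inj f_inv_into_f inv_into_into)
  have i: "?\<psi> (\<phi> x) = x" if "x \<in> points (btotal F)" for x using that inj by simp
  show "dvs_over B ?Q"
  proof (rule dvs_overI[OF dvs_overD(1)[OF F]])
    show "diffeological_space (btotal ?Q)" unfolding Q by (rule diffeological_image_space[OF E inj])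
    show "smooth_map (btotal ?Q) B (bproj ?Q)"
    proof (rule smooth_mapI)
      show "bproj ?Q z \<in> points B" if "z \<in> points (btotal ?Q)" for z
        unfolding Q by (rule dvs_overD(4)[OF F pt(1)]) (use that in \<open>simp add: Q\<close>)
      show "(\<lambda>u. bproj ?Q (y u)) \<in> plots B n U" if "y \<in> plots (btotal ?Q) n U" for n U y
        unfolding Q by (rule smooth_map_plot[OF dvs_overD(3)[OF F] smooth_map_plot[OF t that[unfolded Q]]])
    qed
    show "smooth_map B (btotal ?Q) (bzero ?Q)"
    proof (rule smooth_mapI)
      show "bzero ?Q b \<in> points (btotal ?Q)" if "b \<in> points B" for b
        unfolding Q points_image_space by (rule imageI[OF dvs_overD(10)[OF F that]])
      show "(\<lambda>u. bzero ?Q (y u)) \<in> plots (btotal ?Q) n U" if "y \<in> plots B n U" for n U y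
        unfolding Q by (rule smooth_map_plot[OF s smooth_map_plot[OF dvs_overD(14)[OF F] that]])
    qed
    fix b assume b: "b \<in> points B"
    have bij: "bij_betw \<phi> {x \<in> points (btotal F). bproj F x = b} {z \<in> points (btotal ?Q). bproj ?Q z = b}"
      by (rule bij_betw_byWitness[where f' = ?\<psi>]) (auto simp: Q i pt)
    show "real_vector_space_on {z \<in> points (btotal ?Q). bproj ?Q z = b} (badd ?Q) (bscale ?Q) (bzero ?Q b)"
      by (rule real_vector_space_on_bij[OF dvs_overD(5)[OF F b] bij]) (simp_all add: Q i)
  next
    fix n U x y assume x: "x \<in> plots (btotal ?Q) n U" and y: "y \<in> plots (btotal ?Q) n U"
      and e: "\<And>u. u \<in> U \<Longrightarrow> bproj ?Q (x u) = bproj ?Q (y u)"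
    show "(\<lambda>u. badd ?Q (x u) (y u)) \<in> plots (btotal ?Q) n U"
      unfolding Q by (rule smooth_map_plot[OF s dvs_overD(12)[OF F smooth_map_plot[OF t x[unfolded Q]]
          smooth_map_plot[OF t y[unfolded Q]] e[unfolded Q]]])
  next
    fix n U r x assume r: "smooth_fun n U r" and x: "x \<in> plots (btotal ?Q) n U"
    show "(\<lambda>u. bscale ?Q (r u) (x u)) \<in> plots (btotal ?Q) n U"
      unfolding Q by (rule smooth_map_plot[OF s dvs_overD(13)[OF F r smooth_map_plot[OF t x[unfolded Q]]]])
  qed
  show "vbundle_iso B F ?Q"
  proof (rule vbundle_isoI[where \<phi> = \<phi> and \<psi> = ?\<psi>])
    show "smooth_map (btotal F) (btotal ?Q) \<phi>" "smooth_map (btotal ?Q) (btotal F) ?\<psi>"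
      unfolding Q by (rule s, rule t)
  qed (simp_all add: Q i pt)
qed

lemma local_lifts_point:
  assumes "gspace_over G B P" "local_lifts B P" "b \<in> points B"
  obtains y where "y \<in> points (gtotal P)" "gproj P y = b"
proof -
  obtain W y where W: "openin (Euclidean_space 0) W" "(\<lambda>_. 0) \<in> W" "y \<in> plots (gtotal P) 0 W"
    "\<And>w. w \<in> W \<Longrightarrow> gproj P (y w) = b"
    by (rule local_liftsE[OF assms(2) plot_const[OF gspace_overD(2)[OF assms(1)] origin_space(1) assms(3)] origin_space(2)]) blast
  show ?thesis by (rule that[OF plot_point[OF gspace_overD(3)[OF assms(1)] W(3,2)] W(4)[OF W(2)]])
qed

text \<open>
  Choose a point s b over each b. Since the action is free and transitive on fibers, the projection of
  x together with its quotient by the chosen point in the same fiber determines x. The choice need not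
  be smooth; the diffeology is carried over to the image.
\<close>

lemma principal_bundle_standard:
  fixes P :: "('b, 'e, 'g) gbundle"
  assumes pb: "principal_bundle G B P"
  shows "\<exists>Q :: ('b, 'b \<times> 'g, 'g) gbundle. principal_bundle G B Q \<and> gbundle_iso G P Q"
proof -
  note P = principal_bundle_gspace_over[OF pb] and t = principal_bundle_torsor[OF pb]
  have "\<exists>y\<in>points (gtotal P). gproj P y = b" if "b \<in> points B" for b
    using local_lifts_point[OF P principal_bundle_local_lifts[OF pb] that] by metis
  then obtain s where s: "\<And>b. b \<in> points B \<Longrightarrow> s b \<in> points (gtotal P)" "\<And>b. b \<in> points B \<Longrightarrow> gproj P (s b) = b"
    by metis
  let ?\<phi> = "\<lambda>x. (gproj P x, gdiv G P (s (gproj P x)) x)"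
  have inj: "inj_on ?\<phi> (points (gtotal P))"
  proof (rule inj_onI)
    have *: "gact P (s (gproj P x)) (gdiv G P (s (gproj P x)) x) = x" if "x \<in> points (gtotal P)" for x
      using gspace_overD(5)[OF P that] by (intro gdiv(2)[OF P t]) (simp_all add: s that)
    fix x y assume x: "x \<in> points (gtotal P)" and y: "y \<in> points (gtotal P)" and e: "?\<phi> x = ?\<phi> y"
    from e have "gproj P x = gproj P y" "gdiv G P (s (gproj P x)) x = gdiv G P (s (gproj P y)) y" by auto
    with *[OF x] *[OF y] show "x = y" by metis
  qed
  show ?thesis
    using principal_bundle_iso[OF pb image_gbundle[OF P inj]] image_gbundle(2)[OF P inj] by blast
qed

section \<open>Invariance of pairings under isomorphism, and uniqueness\<close>

context
  fixes V :: "'v dvs"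
  assumes V: "diffeological_vector_space V"
begin

lemma frame_along_iso:
  assumes e: "frame_along V C f F e"
    and \<phi>: "smooth_map (btotal F) (btotal F') \<phi>" "smooth_map (btotal F') (btotal F) \<psi>"
    "\<And>x. x \<in> points (btotal F) \<Longrightarrow> \<psi> (\<phi> x) = x" "\<And>z. z \<in> points (btotal F') \<Longrightarrow> \<phi> (\<psi> z) = z"
    "\<And>x. x \<in> points (btotal F) \<Longrightarrow> bproj F' (\<phi> x) = bproj F x"
    "\<And>z. z \<in> points (btotal F') \<Longrightarrow> bproj F (\<psi> z) = bproj F' z"
    "\<And>x y. x \<in> points (btotal F) \<Longrightarrow> y \<in> points (btotal F) \<Longrightarrow> bproj F x = bproj F y \<Longrightarrow>
       \<phi> (badd F x y) = badd F' (\<phi> x) (\<phi> y)"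
    "\<And>a x. x \<in> points (btotal F) \<Longrightarrow> \<phi> (bscale F a x) = bscale F' a (\<phi> x)"
    and C: "diffeological_space C" and F': "diffeological_space (btotal F')"
  shows "frame_along V C f F' (\<lambda>c v. \<phi> (e c v))"
proof (rule frame_alongI)
  have bij: "bij_betw \<phi> {x \<in> points (btotal F). bproj F x = b} {z \<in> points (btotal F'). bproj F' z = b}" for b
    by (rule bij_betw_byWitness[where f' = \<psi>])
      (auto simp: \<phi>(3-6) smooth_map_point[OF \<phi>(1)] smooth_map_point[OF \<phi>(2)])
  show "linear_bij V F' (f c) (\<lambda>v. \<phi> (e c v))" if c: "c \<in> points C" for c
    unfolding linear_bij_def
  proof (intro conjI ballI allI)
    note l = linear_bijD[OF frame_alongD(1)[OF e c]]
    show "bij_betw (\<lambda>v. \<phi> (e c v)) (vecs V) {x \<in> points (btotal F'). bproj F' x = f c}"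
      using bij_betw_trans[OF l(1) bij] by (simp add: o_def)
    show "\<phi> (e c (vadd V v w)) = badd F' (\<phi> (e c v)) (\<phi> (e c w))" if "v \<in> vecs V" "w \<in> vecs V" for v w
      unfolding l(2)[OF that] using l(4,5) that by (intro \<phi>(7)) simp_all
    show "\<phi> (e c (vscale V a v)) = bscale F' a (\<phi> (e c v))" if "v \<in> vecs V" for a v
      unfolding l(3)[OF that] by (rule \<phi>(8)[OF l(4)[OF that]])
  qed
  show "(\<lambda>u. \<phi> (e (k u) (v u))) \<in> plots (btotal F') n U"
    if "k \<in> plots C n U" "v \<in> plots (vspace V) n U" for n U k v
    by (rule smooth_map_plot[OF \<phi>(1) frame_alongD(2)[OF e that]])
  fix n U k x assume k: "k \<in> plots C n U" and x: "x \<in> plots (btotal F') n U"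
    and xk: "\<And>u. u \<in> U \<Longrightarrow> bproj F' (x u) = f (k u)"
  have p: "bproj F (\<psi> (x u)) = f (k u)" if "u \<in> U" for u
    using \<phi>(6)[OF plot_point[OF F' x that]] xk[OF that] by simp
  show "(\<lambda>u. inv_into (vecs V) (\<lambda>v. \<phi> (e (k u) v)) (x u)) \<in> plots (vspace V) n U"
  proof (rule plot_cong[OF dvs_space[OF V] frame_alongD(3)[OF e k smooth_map_plot[OF \<phi>(2) x] p]])
    fix u assume u: "u \<in> U"
    note l = linear_bijD[OF frame_alongD(1)[OF e plot_point[OF C k u]]]
    have xu: "x u \<in> points (btotal F')" by (rule plot_point[OF F' x u])
    note i = l(6,7)[OF smooth_map_point[OF \<phi>(2) xu] p[OF u]]
    have b: "bij_betw (\<lambda>v. \<phi> (e (k u) v)) (vecs V) {z \<in> points (btotal F'). bproj F' z = f (k u)}"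
      using bij_betw_trans[OF l(1) bij] by (simp add: o_def)
    show "inv_into (vecs V) (\<lambda>v. \<phi> (e (k u) v)) (x u) = inv_into (vecs V) (e (k u)) (\<psi> (x u))"
      by (rule inv_into_f_eq[OF bij_betw_imp_inj_on[OF b] i(1)]) (simp add: i(2) \<phi>(4)[OF xu])
  qed
qed

lemma frame_pairing_vbundle_iso:
  assumes F: "dvs_over B F" and F': "dvs_over B F'" and P: "gspace_over (GL V) B P"
    and ev: "frame_pairing V B P F ev" and i: "vbundle_iso B F F'"
  shows "\<exists>ev'. frame_pairing V B P F' ev'"
  using i F
proof (rule vbundle_isoE)
  fix \<phi> \<psi>
  assume \<phi>: "smooth_map (btotal F) (btotal F') \<phi>" "smooth_map (btotal F') (btotal F) \<psi>"
    "\<And>x. x \<in> points (btotal F) \<Longrightarrow> \<psi> (\<phi> x) = x" "\<And>z. z \<in> points (btotal F') \<Longrightarrow> \<phi> (\<psi> z) = z"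
    "\<And>x. x \<in> points (btotal F) \<Longrightarrow> bproj F' (\<phi> x) = bproj F x"
    "\<And>z. z \<in> points (btotal F') \<Longrightarrow> bproj F (\<psi> z) = bproj F' z"
    "\<And>x y. x \<in> points (btotal F) \<Longrightarrow> y \<in> points (btotal F) \<Longrightarrow> bproj F x = bproj F y \<Longrightarrow>
       \<phi> (badd F x y) = badd F' (\<phi> x) (\<phi> y)"
    "\<And>a x. x \<in> points (btotal F) \<Longrightarrow> \<phi> (bscale F a x) = bscale F' a (\<phi> x)"
  have \<psi>: "\<psi> (badd F' x y) = badd F (\<psi> x) (\<psi> y)"
    if x: "x \<in> points (btotal F')" and y: "y \<in> points (btotal F')" and e: "bproj F' x = bproj F' y" for x y
  proof -
    note p = smooth_map_point[OF \<phi>(2)]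
    have e': "bproj F (\<psi> x) = bproj F (\<psi> y)" using e \<phi>(6) x y by simp
    have "badd F' x y = \<phi> (badd F (\<psi> x) (\<psi> y))" using \<phi>(7)[OF p[OF x] p[OF y] e'] \<phi>(4) x y by simp
    then show ?thesis using \<phi>(3)[OF dvs_overD(6)[OF F p[OF x] p[OF y] e']] by simp
  qed
  have \<psi>': "\<psi> (bscale F' a x) = bscale F a (\<psi> x)" if x: "x \<in> points (btotal F')" for a x
  proof -
    note p = smooth_map_point[OF \<phi>(2)]
    have "bscale F' a x = \<phi> (bscale F a (\<psi> x))" using \<phi>(8)[OF p[OF x]] \<phi>(4) x by simp
    then show ?thesis using \<phi>(3)[OF dvs_overD(8)[OF F p[OF x]]] by simp
  qed
  note E = gspace_overD(3)[OF P] and fr = frame_pairingD(1)[OF V ev]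
  have "frame_pairing V B P F' (\<lambda>y v. \<phi> (ev y v))"
  proof (rule frame_pairingI[OF V])
    show "frame_along V (gtotal P) (gproj P) F' (\<lambda>y v. \<phi> (ev y v))"
      by (rule frame_along_iso[OF fr \<phi> E dvs_overD(2)[OF F']])
    show "\<phi> (ev (gact P y g) v) = \<phi> (ev y (g v))"
      if "y \<in> points (gtotal P)" "g \<in> carrier (GL V)" "v \<in> vecs V" for y g v
      using frame_pairingD(2)[OF V ev that] by simp
    show "y = y'" if y: "y \<in> points (gtotal P)" "y' \<in> points (gtotal P)" "gproj P y = gproj P y'"
      and eq: "\<And>v. v \<in> vecs V \<Longrightarrow> \<phi> (ev y v) = \<phi> (ev y' v)" for y y'
    proof (rule frame_pairingD(3)[OF V ev y])
      fix v assume v: "v \<in> vecs V"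
      from eq[OF v] have "\<psi> (\<phi> (ev y v)) = \<psi> (\<phi> (ev y' v))" by (rule arg_cong)
      then show "ev y v = ev y' v"
        unfolding \<phi>(3)[OF linear_bijD(4)[OF frame_alongD(1)[OF fr y(1)] v]]
          \<phi>(3)[OF linear_bijD(4)[OF frame_alongD(1)[OF fr y(2)] v]] .
    qed
    fix n U p e assume p: "p \<in> plots B n U" and e: "frame_along V (domain_space n U) p F' e"
    note D = diffeological_domain_space[OF plot_open[OF gspace_overD(2)[OF P] p]]
    have "frame_along V (domain_space n U) p F (\<lambda>u v. \<psi> (e u v))"
      by (rule frame_along_iso[OF e \<phi>(2,1,4,3,6,5) \<psi> \<psi>' D dvs_overD(2)[OF F]])
    from frame_pairingD(4)[OF V ev p this] obtain y where y: "y \<in> plots (gtotal P) n U"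
      "\<And>u. u \<in> U \<Longrightarrow> gproj P (y u) = p u" "\<And>u v. u \<in> U \<Longrightarrow> v \<in> vecs V \<Longrightarrow> ev (y u) v = \<psi> (e u v)" by auto
    have "\<phi> (ev (y u) v) = e u v" if "u \<in> U" "v \<in> vecs V" for u v
      unfolding y(3)[OF that] using that by (intro \<phi>(4) linear_bijD(4)[OF frame_alongD(1)[OF e]]) simp_all
    with y show "\<exists>y\<in>plots (gtotal P) n U. \<forall>u\<in>U. gproj P (y u) = p u \<and> (\<forall>v\<in>vecs V. \<phi> (ev (y u) v) = e u v)"
      by (intro bexI[of _ y]) simp_all
  qed
  then show ?thesis by blast
qed

lemma frame_pairing_gbundle_iso:
  assumes F: "dvs_over B F" and P: "gspace_over (GL V) B P" and P': "gspace_over (GL V) B P'"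
    and ev: "frame_pairing V B P F ev" and i: "gbundle_iso (GL V) P P'"
  shows "\<exists>ev'. frame_pairing V B P' F ev'"
  using gbundle_iso_sym[OF P i]
proof (rule gbundle_isoE)
  fix \<phi> \<psi>
  assume \<phi>: "smooth_map (gtotal P') (gtotal P) \<phi>" "smooth_map (gtotal P) (gtotal P') \<psi>"
    "\<And>x. x \<in> points (gtotal P') \<Longrightarrow> \<psi> (\<phi> x) = x" "\<And>z. z \<in> points (gtotal P) \<Longrightarrow> \<phi> (\<psi> z) = z"
    "\<And>x. x \<in> points (gtotal P') \<Longrightarrow> gproj P (\<phi> x) = gproj P' x"
    "\<And>z. z \<in> points (gtotal P) \<Longrightarrow> gproj P' (\<psi> z) = gproj P z"
    "\<And>x g. x \<in> points (gtotal P') \<Longrightarrow> g \<in> carrier (GL V) \<Longrightarrow> \<phi> (gact P' x g) = gact P (\<phi> x) g"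
  note E = gspace_overD(3)[OF P] and E' = gspace_overD(3)[OF P'] and fr = frame_pairingD(1)[OF V ev]
  note p = smooth_map_point[OF \<phi>(1)]
  have "frame_pairing V B P' F (\<lambda>y. ev (\<phi> y))"
  proof (rule frame_pairingI[OF V])
    show "frame_along V (gtotal P') (gproj P') F (\<lambda>y. ev (\<phi> y))"
      by (rule frame_along_cong[OF V frame_along_compose[OF fr \<phi>(1)] E' dvs_overD(2)[OF F] refl]) (simp add: \<phi>(5))
    show "ev (\<phi> (gact P' y g)) v = ev (\<phi> y) (g v)"
      if "y \<in> points (gtotal P')" "g \<in> carrier (GL V)" "v \<in> vecs V" for y g v
      using frame_pairingD(2)[OF V ev p[OF that(1)] that(2,3)] \<phi>(7)[OF that(1,2)] by simp
    show "y = y'" if y: "y \<in> points (gtotal P')" "y' \<in> points (gtotal P')" "gproj P' y = gproj P' y'"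
      and eq: "\<And>v. v \<in> vecs V \<Longrightarrow> ev (\<phi> y) v = ev (\<phi> y') v" for y y'
    proof -
      have "\<phi> y = \<phi> y'"
        by (rule frame_pairingD(3)[OF V ev p[OF y(1)] p[OF y(2)] _ eq]) (simp_all add: \<phi>(5) y)
      then have "\<psi> (\<phi> y) = \<psi> (\<phi> y')" by (rule arg_cong)
      then show ?thesis unfolding \<phi>(3)[OF y(1)] \<phi>(3)[OF y(2)] .
    qed
    fix n U q e assume q: "q \<in> plots B n U" and e: "frame_along V (domain_space n U) q F e"
    from frame_pairingD(4)[OF V ev q e] obtain y where y: "y \<in> plots (gtotal P) n U"
      "\<And>u. u \<in> U \<Longrightarrow> gproj P (y u) = q u" "\<And>u v. u \<in> U \<Longrightarrow> v \<in> vecs V \<Longrightarrow> ev (y u) v = e u v" by auto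
    show "\<exists>y\<in>plots (gtotal P') n U. \<forall>u\<in>U. gproj P' (y u) = q u \<and> (\<forall>v\<in>vecs V. ev (\<phi> (y u)) v = e u v)"
      using smooth_map_plot[OF \<phi>(2) y(1)] y(2,3) plot_point[OF E y(1)]
      by (intro bexI[of _ "\<lambda>u. \<psi> (y u)"]) (simp_all add: \<phi>(4,6))
  qed
  then show ?thesis by blast
qed

text \<open>
  Each vector of F has the form ev y v, and the map sends it to ev' y v. The choice of y is
  immaterial, since moving y by g changes both frames by g. The map is smooth because the point y can
  be chosen locally along plots.
\<close>

lemma frame_transfer:
  assumes P: "principal_bundle (GL V) B P"
    and F: "dvs_over B F" "frame_pairing V B P F ev" and F': "dvs_over B F'" "frame_pairing V B P F' ev'"
  shows "\<exists>\<phi>. smooth_map (btotal F) (btotal F') \<phi> \<and>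
    (\<forall>y\<in>points (gtotal P). \<forall>v\<in>vecs V. \<phi> (ev y v) = ev' y v)"
proof -
  note Pg = principal_bundle_gspace_over[OF P] and Pt = principal_bundle_torsor[OF P]
    and Pl = principal_bundle_local_lifts[OF P]
  note E = gspace_overD(3)[OF Pg]
  note fr = frame_pairingD(1)[OF V F(2)] and fr' = frame_pairingD(1)[OF V F'(2)]
  define \<phi> where "\<phi> x = (let y = SOME y. y \<in> points (gtotal P) \<and> gproj P y = bproj F x
    in ev' y (inv_into (vecs V) (ev y) x))" for x
  have \<phi>: "\<phi> (ev y v) = ev' y v" if y: "y \<in> points (gtotal P)" and v: "v \<in> vecs V" for y v
  proof -
    define x where "x = ev y v"
    define y' where "y' = (SOME y. y \<in> points (gtotal P) \<and> gproj P y = bproj F x)"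
    have xp: "bproj F x = gproj P y" unfolding x_def by (rule linear_bijD(5)[OF frame_alongD(1)[OF fr y] v])
    with y have "y \<in> points (gtotal P) \<and> gproj P y = bproj F x" by simp
    then have "y' \<in> points (gtotal P) \<and> gproj P y' = bproj F x"
      unfolding y'_def by (rule someI[where P = "\<lambda>y. y \<in> points (gtotal P) \<and> gproj P y = bproj F x"])
    then have y': "y' \<in> points (gtotal P)" "gproj P y' = gproj P y" using xp by simp_all
    let ?g = "gdiv (GL V) P y' y"
    note g = gdiv[OF Pg Pt y'(1) y y'(2)]
    have "x = ev (gact P y' ?g) v" unfolding g(2) x_def ..
    also have "\<dots> = ev y' (?g v)" by (rule frame_pairingD(2)[OF V F(2) y'(1) g(1) v])
    finally have "inv_into (vecs V) (ev y') x = ?g v"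
      using linear_bijD(8)[OF frame_alongD(1)[OF fr y'(1)] GL_D(5)[OF V g(1) v]] by simp
    then have "\<phi> x = ev' y' (?g v)" unfolding \<phi>_def Let_def y'_def[symmetric] by simp
    also have "\<dots> = ev' (gact P y' ?g) v" by (rule frame_pairingD(2)[OF V F'(2) y'(1) g(1) v, symmetric])
    finally show ?thesis unfolding g(2) x_def .
  qed
  have "smooth_map (btotal F) (btotal F') \<phi>"
  proof (rule smooth_mapI)
    fix x assume x: "x \<in> points (btotal F)"
    obtain y where y: "y \<in> points (gtotal P)" "gproj P y = bproj F x"
      by (rule local_lifts_point[OF Pg Pl dvs_overD(4)[OF F(1) x]])
    note l = linear_bijD(6,7)[OF frame_alongD(1)[OF fr y(1)] x y(2)[symmetric]]
    have "\<phi> (ev y (inv_into (vecs V) (ev y) x)) \<in> points (btotal F')"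
      unfolding \<phi>[OF y(1) l(1)] by (rule linear_bijD(4)[OF frame_alongD(1)[OF fr' y(1)] l(1)])
    then show "\<phi> x \<in> points (btotal F')" unfolding l(2) .
  next
    fix n U x assume x: "x \<in> plots (btotal F) n U"
    show "(\<lambda>u. \<phi> (x u)) \<in> plots (btotal F') n U"
    proof (rule plot_local[OF dvs_overD(2)[OF F'(1)] plot_open[OF dvs_overD(2)[OF F(1)] x]])
      fix u assume u: "u \<in> U"
      obtain W y where W: "openin (Euclidean_space n) W" "u \<in> W" "W \<subseteq> U" "y \<in> plots (gtotal P) n W"
        "\<And>w. w \<in> W \<Longrightarrow> gproj P (y w) = bproj F (x w)"
        by (rule local_liftsE[OF Pl smooth_map_plot[OF dvs_overD(3)[OF F(1)] x] u]) blast
      have xW: "x \<in> plots (btotal F) n W" by (rule plot_restrict[OF dvs_overD(2)[OF F(1)] x W(1,3)])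
      have q: "(\<lambda>w. ev' (y w) (inv_into (vecs V) (ev (y w)) (x w))) \<in> plots (btotal F') n W"
        by (rule frame_alongD(2)[OF fr' W(4) frame_alongD(3)[OF fr W(4) xW]]) (simp add: W(5))
      have "\<phi> (x w) = ev' (y w) (inv_into (vecs V) (ev (y w)) (x w))" if w: "w \<in> W" for w
      proof -
        note yw = plot_point[OF E W(4) w]
        note l = linear_bijD(6,7)[OF frame_alongD(1)[OF fr yw] plot_point[OF dvs_overD(2)[OF F(1)] xW w] W(5)[OF w, symmetric]]
        show ?thesis using \<phi>[OF yw l(1)] unfolding l(2) .
      qed
      with q W(1-3) show "\<exists>W q. openin (Euclidean_space n) W \<and> u \<in> W \<and> W \<subseteq> U \<and> q \<in> plots (btotal F') n W \<and>
          (\<forall>w\<in>W. \<phi> (x w) = q w)"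
        by (intro exI[of _ W] exI[of _ "\<lambda>w. ev' (y w) (inv_into (vecs V) (ev (y w)) (x w))"]) simp
    qed
  qed
  then show ?thesis using \<phi> by (intro exI[of _ \<phi>] conjI ballI)
qed

lemma frame_pairing_vbundle_unique:
  assumes P: "principal_bundle (GL V) B P"
    and F: "dvs_over B F" "frame_pairing V B P F ev" and F': "dvs_over B F'" "frame_pairing V B P F' ev'"
  shows "vbundle_iso B F F'"
proof -
  note Pg = principal_bundle_gspace_over[OF P] and Pl = principal_bundle_local_lifts[OF P]
  note fr = frame_pairingD(1)[OF V F(2)] and fr' = frame_pairingD(1)[OF V F'(2)]
  obtain \<phi> where \<phi>: "smooth_map (btotal F) (btotal F') \<phi>"
    "\<And>y v. y \<in> points (gtotal P) \<Longrightarrow> v \<in> vecs V \<Longrightarrow> \<phi> (ev y v) = ev' y v"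
    using frame_transfer[OF P F F'] by auto
  obtain \<psi> where \<psi>: "smooth_map (btotal F') (btotal F) \<psi>"
    "\<And>y v. y \<in> points (gtotal P) \<Longrightarrow> v \<in> vecs V \<Longrightarrow> \<psi> (ev' y v) = ev y v"
    using frame_transfer[OF P F' F] by auto
  have pt: "\<exists>y v. y \<in> points (gtotal P) \<and> gproj P y = bproj F x \<and> v \<in> vecs V \<and> x = ev y v"
    if x: "x \<in> points (btotal F)" for x
  proof -
    obtain y where y: "y \<in> points (gtotal P)" "gproj P y = bproj F x"
      by (rule local_lifts_point[OF Pg Pl dvs_overD(4)[OF F(1) x]])
    note l = linear_bijD(6,7)[OF frame_alongD(1)[OF fr y(1)] x y(2)[symmetric]]
    show ?thesis using y l by (intro exI[of _ y] exI[of _ "inv_into (vecs V) (ev y) x"]) simp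
  qed
  have pt': "\<exists>y v. y \<in> points (gtotal P) \<and> v \<in> vecs V \<and> x = ev' y v"
    if x: "x \<in> points (btotal F')" for x
  proof -
    obtain y where y: "y \<in> points (gtotal P)" "gproj P y = bproj F' x"
      by (rule local_lifts_point[OF Pg Pl dvs_overD(4)[OF F'(1) x]])
    note l = linear_bijD(6,7)[OF frame_alongD(1)[OF fr' y(1)] x y(2)[symmetric]]
    show ?thesis using y l by (intro exI[of _ y] exI[of _ "inv_into (vecs V) (ev' y) x"]) simp
  qed
  show ?thesis
  proof (rule vbundle_isoI[OF \<phi>(1) \<psi>(1)])
    show "\<psi> (\<phi> x) = x" if "x \<in> points (btotal F)" for x
      using pt[OF that] by (elim exE conjE) (simp add: \<phi>(2) \<psi>(2))
    show "\<phi> (\<psi> x) = x" if "x \<in> points (btotal F')" for x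
      using pt'[OF that] by (elim exE conjE) (simp add: \<phi>(2) \<psi>(2))
    show "bproj F' (\<phi> x) = bproj F x" if "x \<in> points (btotal F)" for x
      using pt[OF that] linear_bijD(5)[OF frame_alongD(1)[OF fr']] linear_bijD(5)[OF frame_alongD(1)[OF fr]]
      by (elim exE conjE) (simp add: \<phi>(2))
    show "\<phi> (badd F x x') = badd F' (\<phi> x) (\<phi> x')"
      if x: "x \<in> points (btotal F)" "x' \<in> points (btotal F)" "bproj F x = bproj F x'" for x x'
    proof -
      obtain y v where y: "y \<in> points (gtotal P)" "gproj P y = bproj F x" "v \<in> vecs V" "x = ev y v"
        using pt[OF x(1)] by blast
      note l = linear_bijD[OF frame_alongD(1)[OF fr y(1)]] and l' = linear_bijD[OF frame_alongD(1)[OF fr' y(1)]]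
      have "bproj F x' = gproj P y" using x y by simp
      note i = l(6,7)[OF x(2) this]
      let ?v' = "inv_into (vecs V) (ev y) x'"
      have x': "x' = ev y ?v'" using i(2) by simp
      have "badd F x x' = ev y (vadd V v ?v')" unfolding l(2)[OF y(3) i(1)] i(2) y(4) ..
      then have "\<phi> (badd F x x') = badd F' (ev' y v) (ev' y ?v')"
        using \<phi>(2)[OF y(1) dvs_add[OF V y(3) i(1)]] l'(2)[OF y(3) i(1)] by simp
      also have "ev' y v = \<phi> x" unfolding y(4) by (rule \<phi>(2)[OF y(1,3), symmetric])
      also have "ev' y ?v' = \<phi> x'" using \<phi>(2)[OF y(1) i(1)] unfolding i(2) by (rule sym)
      finally show ?thesis .
    qed
    show "\<phi> (bscale F a x) = bscale F' a (\<phi> x)" if x: "x \<in> points (btotal F)" for a x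
    proof -
      obtain y v where y: "y \<in> points (gtotal P)" "gproj P y = bproj F x" "v \<in> vecs V" "x = ev y v"
        using pt[OF x] by blast
      note l = linear_bijD[OF frame_alongD(1)[OF fr y(1)]] and l' = linear_bijD[OF frame_alongD(1)[OF fr' y(1)]]
      show ?thesis
        unfolding y(4) l(3)[OF y(3), symmetric] \<phi>(2)[OF y(1) dvs_scale[OF V y(3)]] \<phi>(2)[OF y(1,3)] l'(3)[OF y(3)] ..
    qed
  qed
qed

end

section \<open>The associated vector bundle\<close>

context
  fixes V :: "'v dvs"
  assumes V: "diffeological_vector_space V"
begin

text \<open>
  For a principal bundle the universal property is automatic. Given a frame e along a plot p of the
  base, lift p locally to a plot z of P; the frames e and ev z differ by a plot k of GL(V), and the
  product of z and k is the required lift. Lifts are unique, so they glue.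
\<close>

lemma frame_pairingI_principal:
  assumes P: "principal_bundle (GL V) B P" and F: "diffeological_space (btotal F)"
    and fr: "frame_along V (gtotal P) (gproj P) F ev"
    and act: "\<And>y g v. y \<in> points (gtotal P) \<Longrightarrow> g \<in> carrier (GL V) \<Longrightarrow> v \<in> vecs V \<Longrightarrow> ev (gact P y g) v = ev y (g v)"
  shows "frame_pairing V B P F ev"
proof (rule frame_pairingI[OF V fr act])
  note Pg = principal_bundle_gspace_over[OF P] and Pt = principal_bundle_torsor[OF P]
    and Pl = principal_bundle_local_lifts[OF P]
  note E = gspace_overD(3)[OF Pg] and B = gspace_overD(2)[OF Pg]
  note L = linear_bijD[OF frame_alongD(1)[OF fr]]
  show inj: "y = y'" if y: "y \<in> points (gtotal P)" "y' \<in> points (gtotal P)" "gproj P y = gproj P y'"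
    and eq: "\<And>v. v \<in> vecs V \<Longrightarrow> ev y v = ev y' v" for y y'
  proof -
    let ?g = "gdiv (GL V) P y y'"
    note g = gdiv[OF Pg Pt y]
    have "?g = \<one>\<^bsub>GL V\<^esub>"
    proof (rule GL_ext[OF V g(1)])
      show one: "\<one>\<^bsub>GL V\<^esub> \<in> carrier (GL V)" by (rule monoid.one_closed[OF group.is_monoid[OF group_GL[OF V]]])
      fix v assume v: "v \<in> vecs V"
      have "ev y (?g v) = ev y v" unfolding act[OF y(1) g(1) v, symmetric] g(2) by (rule eq[OF v, symmetric])
      then have "inv_into (vecs V) (ev y) (ev y (?g v)) = inv_into (vecs V) (ev y) (ev y v)" by (rule arg_cong)
      then show "?g v = \<one>\<^bsub>GL V\<^esub> v" unfolding L(8)[OF y(1) v] L(8)[OF y(1) GL_D(5)[OF V g(1) v]] using v by simp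
    qed
    with g(2) gspace_overD(8)[OF Pg y(1)] show ?thesis by metis
  qed
  fix n U p e assume p: "p \<in> plots B n U" and e: "frame_along V (domain_space n U) p F e"
  have U: "openin (Euclidean_space n) U" by (rule plot_open[OF B p])
  have loc: "\<exists>W y. openin (Euclidean_space n) W \<and> u \<in> W \<and> W \<subseteq> U \<and> y \<in> plots (gtotal P) n W \<and>
      (\<forall>w\<in>W. gproj P (y w) = p w \<and> (\<forall>v\<in>vecs V. ev (y w) v = e w v))" if u: "u \<in> U" for u
  proof -
    obtain W z where W: "openin (Euclidean_space n) W" "u \<in> W" "W \<subseteq> U" "z \<in> plots (gtotal P) n W"
      "\<And>w. w \<in> W \<Longrightarrow> gproj P (z w) = p w" by (rule local_liftsE[OF Pl p u]) blast
    note D = diffeological_domain_space[OF W(1)]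
    have i: "smooth_map (domain_space n W) (domain_space n U) (\<lambda>w. w)"
      by (rule smooth_map_domainI[OF diffeological_domain_space[OF U]])
        (simp add: smooth_between_inclusion[OF U W(1,3)])
    note eW = frame_along_compose[OF e i]
    have zW: "frame_along V (domain_space n W) p F (\<lambda>w. ev (z w))"
      by (rule frame_along_cong[OF V frame_along_compose[OF fr smooth_map_domainI[OF E W(4)]] D F refl]) (simp add: W(5))
    define k where "k w = restrict (\<lambda>v. inv_into (vecs V) (ev (z w)) (e w v)) (vecs V)" for w
    have k: "k \<in> plots (gspace (GL V)) n W"
      unfolding k_def by (rule smooth_map_domainD[OF frame_change[OF V zW eW D F] W(1)])
    have "gproj P (gact P (z w) (k w)) = p w \<and> (\<forall>v\<in>vecs V. ev (gact P (z w) (k w)) v = e w v)" if w: "w \<in> W" for w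
    proof -
      note zw = plot_point[OF E W(4) w] and kw = GL_plotD(2)[OF V k w]
      have "w \<in> points (domain_space n U)" using w W(3) by auto
      note le = linear_bijD(4,5)[OF frame_alongD(1)[OF e this]]
      have "ev (gact P (z w) (k w)) v = e w v" if v: "v \<in> vecs V" for v
        unfolding act[OF zw kw v] using L(7)[OF zw le(1)[OF v]] le(2)[OF v] W(5)[OF w] v by (simp add: k_def)
      then show ?thesis using gspace_overD(10)[OF Pg zw kw] W(5)[OF w] by simp
    qed
    with W(1-3) gspace_overD(7)[OF Pg W(4) k] show ?thesis
      by (intro exI[of _ W] exI[of _ "\<lambda>w. gact P (z w) (k w)"]) simp
  qed
  have "\<exists>y. y \<in> points (gtotal P) \<and> gproj P y = p u \<and> (\<forall>v\<in>vecs V. ev y v = e u v)" if u: "u \<in> U" for u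
  proof -
    obtain W y where W: "u \<in> W" "y \<in> plots (gtotal P) n W"
      "\<forall>w\<in>W. gproj P (y w) = p w \<and> (\<forall>v\<in>vecs V. ev (y w) v = e w v)" using loc[OF u] by blast
    show ?thesis using plot_point[OF E W(2,1)] W(1,3) by (intro exI[of _ "y u"]) simp
  qed
  then obtain y where y: "\<And>u. u \<in> U \<Longrightarrow> y u \<in> points (gtotal P)" "\<And>u. u \<in> U \<Longrightarrow> gproj P (y u) = p u"
    "\<And>u v. u \<in> U \<Longrightarrow> v \<in> vecs V \<Longrightarrow> ev (y u) v = e u v" by metis
  have "y \<in> plots (gtotal P) n U"
  proof (rule plot_local[OF E U])
    fix u assume u: "u \<in> U"
    obtain W q where W: "openin (Euclidean_space n) W" "u \<in> W" "W \<subseteq> U" "q \<in> plots (gtotal P) n W"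
      "\<forall>w\<in>W. gproj P (q w) = p w \<and> (\<forall>v\<in>vecs V. ev (q w) v = e w v)" using loc[OF u] by blast
    have "y w = q w" if w: "w \<in> W" for w
    proof -
      have wU: "w \<in> U" using w W(3) by auto
      show ?thesis
        by (rule inj[OF y(1)[OF wU] plot_point[OF E W(4) w]]) (use y(2,3)[OF wU] W(5) w in simp_all)
    qed
    with W show "\<exists>W q. openin (Euclidean_space n) W \<and> u \<in> W \<and> W \<subseteq> U \<and> q \<in> plots (gtotal P) n W \<and>
        (\<forall>w\<in>W. y w = q w)" by (intro exI[of _ W] exI[of _ q]) simp
  qed
  with y(2,3) show "\<exists>y\<in>plots (gtotal P) n U. \<forall>u\<in>U. gproj P (y u) = p u \<and> (\<forall>v\<in>vecs V. ev (y u) v = e u v)"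
    by (intro bexI[of _ y]) simp_all
qed

text \<open>
  In a frame the operations of F are those of V. As plots of the base lift locally to P, frames
  exist locally along plots, so the operations are smooth.
\<close>

lemma frame_dvs_over:
  assumes P: "principal_bundle (GL V) B P" and F: "diffeological_space (btotal F)"
    and fr: "frame_along V (gtotal P) (gproj P) F ev"
    and pr: "\<And>x. x \<in> points (btotal F) \<Longrightarrow> bproj F x \<in> points B"
      "\<And>n U x. x \<in> plots (btotal F) n U \<Longrightarrow> (\<lambda>u. bproj F (x u)) \<in> plots B n U"
    and z: "\<And>y. y \<in> points (gtotal P) \<Longrightarrow> bzero F (gproj P y) = ev y (vzero V)"
  shows "dvs_over B F"
proof -
  note Pg = principal_bundle_gspace_over[OF P] and Pl = principal_bundle_local_lifts[OF P]
  note E = gspace_overD(3)[OF Pg] and B = gspace_overD(2)[OF Pg] and Vd = dvs_space[OF V]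
  note L = linear_bijD[OF frame_alongD(1)[OF fr]]
  show ?thesis
  proof (rule dvs_overI[OF B F smooth_mapI[OF pr]])
    fix b assume "b \<in> points B"
    then obtain y where y: "y \<in> points (gtotal P)" "gproj P y = b" by (rule local_lifts_point[OF Pg Pl])
    show "real_vector_space_on {x \<in> points (btotal F). bproj F x = b} (badd F) (bscale F) (bzero F b)"
      using real_vector_space_on_bij[OF dvs_real_vector_space[OF V] L(1)[OF y(1)] L(2)[OF y(1)] L(3)[OF y(1)] z[OF y(1), symmetric]]
      unfolding y(2) .
  next
    fix n U x x' assume x: "x \<in> plots (btotal F) n U" and x': "x' \<in> plots (btotal F) n U"
      and e: "\<And>u. u \<in> U \<Longrightarrow> bproj F (x u) = bproj F (x' u)"
    show "(\<lambda>u. badd F (x u) (x' u)) \<in> plots (btotal F) n U"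
    proof (rule plot_local[OF F plot_open[OF F x]])
      fix u assume "u \<in> U"
      then obtain W y where W: "openin (Euclidean_space n) W" "u \<in> W" "W \<subseteq> U" "y \<in> plots (gtotal P) n W"
        "\<And>w. w \<in> W \<Longrightarrow> gproj P (y w) = bproj F (x w)" by (rule local_liftsE[OF Pl pr(2)[OF x]]) blast
      let ?i = "\<lambda>x w. inv_into (vecs V) (ev (y w)) (x w)"
      note xW = plot_restrict[OF F x W(1,3)] and xW' = plot_restrict[OF F x' W(1,3)]
      have e1: "bproj F (x w) = gproj P (y w)" "bproj F (x' w) = gproj P (y w)" if "w \<in> W" for w
        using W(3,5) e that by auto
      note i = frame_alongD(3)[OF fr W(4) xW e1(1)] and i' = frame_alongD(3)[OF fr W(4) xW' e1(2)]
      have q: "(\<lambda>w. ev (y w) (vadd V (?i x w) (?i x' w))) \<in> plots (btotal F) n W"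
        by (rule frame_alongD(2)[OF fr W(4) dvs_add_plot[OF V i i']])
      have "badd F (x w) (x' w) = ev (y w) (vadd V (?i x w) (?i x' w))" if w: "w \<in> W" for w
      proof -
        note yw = plot_point[OF E W(4) w]
        note j = L(6,7)[OF yw plot_point[OF F xW w] e1(1)[OF w]] and j' = L(6,7)[OF yw plot_point[OF F xW' w] e1(2)[OF w]]
        show ?thesis unfolding L(2)[OF yw j(1) j'(1)] j(2) j'(2) ..
      qed
      with q W(1-3) show "\<exists>W q. openin (Euclidean_space n) W \<and> u \<in> W \<and> W \<subseteq> U \<and> q \<in> plots (btotal F) n W \<and>
          (\<forall>w\<in>W. badd F (x w) (x' w) = q w)"
        by (intro exI[of _ W] exI[of _ "\<lambda>w. ev (y w) (vadd V (?i x w) (?i x' w))"] conjI ballI)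
    qed
  next
    fix n U r x assume r: "smooth_fun n U r" and x: "x \<in> plots (btotal F) n U"
    show "(\<lambda>u. bscale F (r u) (x u)) \<in> plots (btotal F) n U"
    proof (rule plot_local[OF F plot_open[OF F x]])
      fix u assume "u \<in> U"
      then obtain W y where W: "openin (Euclidean_space n) W" "u \<in> W" "W \<subseteq> U" "y \<in> plots (gtotal P) n W"
        "\<And>w. w \<in> W \<Longrightarrow> gproj P (y w) = bproj F (x w)" by (rule local_liftsE[OF Pl pr(2)[OF x]]) blast
      let ?i = "\<lambda>w. inv_into (vecs V) (ev (y w)) (x w)"
      note xW = plot_restrict[OF F x W(1,3)]
      have rW: "smooth_fun n W r"
        using smooth_fun_compose[OF r smooth_between_inclusion[OF plot_open[OF F x] W(1,3)]] .
      note i = frame_alongD(3)[OF fr W(4) xW W(5)[symmetric]]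
      have q: "(\<lambda>w. ev (y w) (vscale V (r w) (?i w))) \<in> plots (btotal F) n W"
        by (rule frame_alongD(2)[OF fr W(4) dvs_scale_plot[OF V rW i]])
      have "bscale F (r w) (x w) = ev (y w) (vscale V (r w) (?i w))" if w: "w \<in> W" for w
      proof -
        note yw = plot_point[OF E W(4) w]
        note j = L(6,7)[OF yw plot_point[OF F xW w] W(5)[OF w, symmetric]]
        show ?thesis unfolding L(3)[OF yw j(1)] j(2) ..
      qed
      with q W(1-3) show "\<exists>W q. openin (Euclidean_space n) W \<and> u \<in> W \<and> W \<subseteq> U \<and> q \<in> plots (btotal F) n W \<and>
          (\<forall>w\<in>W. bscale F (r w) (x w) = q w)"
        by (intro exI[of _ W] exI[of _ "\<lambda>w. ev (y w) (vscale V (r w) (?i w))"] conjI ballI)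
    qed
  next
    show "smooth_map B (btotal F) (bzero F)"
    proof (rule smooth_mapI)
      fix b assume "b \<in> points B"
      then obtain y where y: "y \<in> points (gtotal P)" "gproj P y = b" by (rule local_lifts_point[OF Pg Pl])
      show "bzero F b \<in> points (btotal F)"
        using L(4)[OF y(1) dvs_zero[OF V]] z[OF y(1)] y(2) by simp
    next
      fix n U p assume p: "p \<in> plots B n U"
      show "(\<lambda>u. bzero F (p u)) \<in> plots (btotal F) n U"
      proof (rule plot_local[OF F plot_open[OF B p]])
        fix u assume "u \<in> U"
        then obtain W y where W: "openin (Euclidean_space n) W" "u \<in> W" "W \<subseteq> U" "y \<in> plots (gtotal P) n W"
          "\<And>w. w \<in> W \<Longrightarrow> gproj P (y w) = p w" by (rule local_liftsE[OF Pl p]) blast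
        have q: "(\<lambda>w. ev (y w) (vzero V)) \<in> plots (btotal F) n W"
          by (rule frame_alongD(2)[OF fr W(4) plot_const[OF Vd W(1) dvs_zero[OF V]]])
        have "bzero F (p w) = ev (y w) (vzero V)" if w: "w \<in> W" for w
          using z[OF plot_point[OF E W(4) w]] W(5)[OF w] by simp
        with q W(1-3) show "\<exists>W q. openin (Euclidean_space n) W \<and> u \<in> W \<and> W \<subseteq> U \<and> q \<in> plots (btotal F) n W \<and>
            (\<forall>w\<in>W. bzero F (p w) = q w)"
          by (intro exI[of _ W] exI[of _ "\<lambda>w. ev (y w) (vzero V)"] conjI ballI)
      qed
    qed
  qed
qed

text \<open>Writing v = g v' in place of the inverse of g applied to v makes the relation easy to compose.\<close>

lemma assoc_rel_iff:
  assumes P: "gspace_over (GL V) B P"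
  shows "((y, v), (y', v')) \<in> assoc_rel V P \<longleftrightarrow>
     y \<in> points (gtotal P) \<and> v' \<in> vecs V \<and> (\<exists>g\<in>carrier (GL V). y' = gact P y g \<and> v = g v')"
proof
  assume "((y, v), (y', v')) \<in> assoc_rel V P"
  then obtain g where g: "y' = gact P y g" "v' = inv_into (vecs V) g v" "y \<in> points (gtotal P)" "v \<in> vecs V"
    "g \<in> carrier (GL V)" unfolding assoc_rel_def by blast
  then show "y \<in> points (gtotal P) \<and> v' \<in> vecs V \<and> (\<exists>g\<in>carrier (GL V). y' = gact P y g \<and> v = g v')"
    using GL_D(6,7)[OF V g(5) g(4)] by (intro conjI bexI[of _ g]) simp_all
next
  assume "y \<in> points (gtotal P) \<and> v' \<in> vecs V \<and> (\<exists>g\<in>carrier (GL V). y' = gact P y g \<and> v = g v')"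
  then obtain g where g: "y \<in> points (gtotal P)" "v' \<in> vecs V" "g \<in> carrier (GL V)" "y' = gact P y g" "v = g v'"
    by blast
  have "v \<in> vecs V" "v' = inv_into (vecs V) g v" using GL_D(5,8)[OF V g(3) g(2)] g(5) by simp_all
  with g show "((y, v), (y', v')) \<in> assoc_rel V P" unfolding assoc_rel_def by blast
qed

lemma equiv_assoc_rel:
  assumes P: "gspace_over (GL V) B P"
  shows "equiv (points (gtotal P) \<times> vecs V) (assoc_rel V P)"
proof -
  note R = assoc_rel_iff[OF P]
  note mon = group.is_monoid[OF group_GL[OF V]]
  show ?thesis
  proof (rule equivI)
    have "y \<in> points (gtotal P) \<and> v \<in> vecs V \<and> y' \<in> points (gtotal P) \<and> v' \<in> vecs V"
      if r: "((y, v), (y', v')) \<in> assoc_rel V P" for y v y' v'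
    proof -
      from r obtain g where g: "y \<in> points (gtotal P)" "v' \<in> vecs V" "g \<in> carrier (GL V)" "y' = gact P y g" "v = g v'"
        unfolding R by blast
      then show ?thesis using gspace_overD(6)[OF P g(1,3)] GL_D(5)[OF V g(3,2)] by simp
    qed
    then show "assoc_rel V P \<subseteq> (points (gtotal P) \<times> vecs V) \<times> (points (gtotal P) \<times> vecs V)" by auto
    show "refl_on (points (gtotal P) \<times> vecs V) (assoc_rel V P)"
    proof (rule refl_onI)
      fix z assume z: "z \<in> points (gtotal P) \<times> vecs V"
      then obtain y v where yv: "z = (y, v)" "y \<in> points (gtotal P)" "v \<in> vecs V" by auto
      have "((y, v), (y, v)) \<in> assoc_rel V P"
        unfolding R using yv(2,3) gspace_overD(8)[OF P yv(2)] monoid.one_closed[OF mon]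
        by (intro conjI bexI[of _ "\<one>\<^bsub>GL V\<^esub>"]) simp_all
      then show "(z, z) \<in> assoc_rel V P" unfolding yv(1) .
    qed
    show "sym (assoc_rel V P)"
    proof (rule symI)
      fix z z' assume r: "(z, z') \<in> assoc_rel V P"
      obtain y v y' v' where zz: "z = (y, v)" "z' = (y', v')" by (metis prod.collapse)
      from r obtain g where g: "y \<in> points (gtotal P)" "v' \<in> vecs V" "g \<in> carrier (GL V)" "y' = gact P y g" "v = g v'"
        unfolding zz R by blast
      note h = group.inv_closed[OF group_GL[OF V] g(3)]
      have "gact P y' (inv\<^bsub>GL V\<^esub> g) = y"
        unfolding g(4) gspace_overD(9)[OF P g(1,3) h] group.r_inv[OF group_GL[OF V] g(3)] by (rule gspace_overD(8)[OF P g(1)])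
      moreover have "(inv\<^bsub>GL V\<^esub> g) v = v'"
        unfolding g(5) GL_inv[OF V g(3)] using GL_D(5,8)[OF V g(3,2)] by simp
      ultimately have "((y', v'), (y, v)) \<in> assoc_rel V P"
        unfolding R using gspace_overD(6)[OF P g(1,3)] g(4) GL_D(5)[OF V g(3,2)] g(5) h
        by (intro conjI bexI[of _ "inv\<^bsub>GL V\<^esub> g"]) simp_all
      then show "(z', z) \<in> assoc_rel V P" unfolding zz .
    qed
    show "trans (assoc_rel V P)"
    proof (rule transI)
      fix z z' z'' assume r: "(z, z') \<in> assoc_rel V P" and r': "(z', z'') \<in> assoc_rel V P"
      obtain y v y' v' y'' v'' where zz: "z = (y, v)" "z' = (y', v')" "z'' = (y'', v'')" by (metis prod.collapse)
      from r obtain g where g: "y \<in> points (gtotal P)" "v' \<in> vecs V" "g \<in> carrier (GL V)" "y' = gact P y g" "v = g v'"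
        unfolding zz R by blast
      from r' obtain h where h: "v'' \<in> vecs V" "h \<in> carrier (GL V)" "y'' = gact P y' h" "v' = h v''"
        unfolding zz R by blast
      have "((y, v), (y'', v'')) \<in> assoc_rel V P"
        unfolding R using g h gspace_overD(9)[OF P g(1,3) h(2)] GL_mult_apply[OF V g(3) h(2,1)]
          monoid.m_closed[OF mon g(3) h(2)]
        by (intro conjI bexI[of _ "g \<otimes>\<^bsub>GL V\<^esub> h"]) simp_all
      then show "(z, z'') \<in> assoc_rel V P" unfolding zz .
    qed
  qed
qed

text \<open>
  The operations of the associated bundle are images under the relation of sets of values computed
  from all representatives. To evaluate such an operation it is enough that all values are equivalent
  and that the expected one is among them.
\<close>

lemma equiv_Image_class:
  assumes "equiv X R" "T \<subseteq> R `` {z}" "z \<in> T"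
  shows "R `` T = R `` {z}"
proof
  show "R `` T \<subseteq> R `` {z}" using assms(1,2) by (auto elim!: equivE dest: transD)
  show "R `` {z} \<subseteq> R `` T" using assms(3) by auto
qed

definition assoc_point :: "('b, 'e, 'v \<Rightarrow> 'v) gbundle \<Rightarrow> 'e \<Rightarrow> 'v \<Rightarrow> ('e \<times> 'v) set" where
  "assoc_point P y v = assoc_rel V P `` {(y, v)}"

context
  fixes B :: "'b diffspace" and P :: "('b, 'e, 'v \<Rightarrow> 'v) gbundle"
  assumes P: "principal_bundle (GL V) B P"
begin

lemma assoc_point_eq_iff:
  assumes "y \<in> points (gtotal P)" "v \<in> vecs V" "y' \<in> points (gtotal P)" "v' \<in> vecs V"
  shows "assoc_point P y v = assoc_point P y' v' \<longleftrightarrow> (\<exists>g\<in>carrier (GL V). y' = gact P y g \<and> v = g v')"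
  unfolding assoc_point_def
  using eq_equiv_class_iff[OF equiv_assoc_rel[OF principal_bundle_gspace_over[OF P]], of "(y, v)" "(y', v')"]
    assoc_rel_iff[OF principal_bundle_gspace_over[OF P], of y v y' v'] assms by simp

lemma mem_assoc_point:
  "(y', v') \<in> assoc_point P y v \<longleftrightarrow>
     y \<in> points (gtotal P) \<and> v' \<in> vecs V \<and> (\<exists>g\<in>carrier (GL V). y' = gact P y g \<and> v = g v')"
  unfolding assoc_point_def using assoc_rel_iff[OF principal_bundle_gspace_over[OF P], of y v y' v'] by simp

lemma mem_assoc_point_self: "y \<in> points (gtotal P) \<Longrightarrow> v \<in> vecs V \<Longrightarrow> (y, v) \<in> assoc_point P y v"
  unfolding assoc_point_def
  using equiv_class_self[OF equiv_assoc_rel[OF principal_bundle_gspace_over[OF P]], of "(y, v)"] by simp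

lemma assoc_point_act:
  assumes y: "y \<in> points (gtotal P)" and g: "g \<in> carrier (GL V)" and v: "v \<in> vecs V"
  shows "assoc_point P (gact P y g) v = assoc_point P y (g v)"
proof -
  note Pg = principal_bundle_gspace_over[OF P]
  have "assoc_point P y (g v) = assoc_point P (gact P y g) v"
    unfolding assoc_point_eq_iff[OF y GL_D(5)[OF V g v] gspace_overD(6)[OF Pg y g] v] using g by blast
  then show ?thesis by (rule sym)
qed

lemma assoc_bundle_points:
  "x \<in> points (btotal (assoc_bundle V P)) \<longleftrightarrow>
     (\<exists>y\<in>points (gtotal P). \<exists>v\<in>vecs V. x = assoc_point P y v)"
  by (auto simp: assoc_bundle_def quotient_space_def quotient_def assoc_point_def)

lemma assoc_bundle_plots:
  "p \<in> plots (btotal (assoc_bundle V P)) n U \<longleftrightarrow> openin (Euclidean_space n) U \<and>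
     (\<forall>u\<in>U. \<exists>W y v. openin (Euclidean_space n) W \<and> u \<in> W \<and> W \<subseteq> U \<and> y \<in> plots (gtotal P) n W \<and>
        v \<in> plots (vspace V) n W \<and> (\<forall>w\<in>W. p w = assoc_point P (y w) (v w)))" (is "_ \<longleftrightarrow> ?R")
proof -
  have *: "(\<exists>q\<in>plots (prod_space (gtotal P) (vspace V)) n W. \<forall>w\<in>W. p w = assoc_rel V P `` {q w}) \<longleftrightarrow>
      (\<exists>y v. y \<in> plots (gtotal P) n W \<and> v \<in> plots (vspace V) n W \<and> (\<forall>w\<in>W. p w = assoc_point P (y w) (v w)))" for W
  proof
    assume "\<exists>q\<in>plots (prod_space (gtotal P) (vspace V)) n W. \<forall>w\<in>W. p w = assoc_rel V P `` {q w}"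
    then obtain q where q: "q \<in> plots (prod_space (gtotal P) (vspace V)) n W" "\<forall>w\<in>W. p w = assoc_rel V P `` {q w}"
      by blast
    then show "\<exists>y v. y \<in> plots (gtotal P) n W \<and> v \<in> plots (vspace V) n W \<and> (\<forall>w\<in>W. p w = assoc_point P (y w) (v w))"
      by (intro exI[of _ "\<lambda>w. fst (q w)"] exI[of _ "\<lambda>w. snd (q w)"]) (simp add: plots_prod_space assoc_point_def)
  next
    assume "\<exists>y v. y \<in> plots (gtotal P) n W \<and> v \<in> plots (vspace V) n W \<and> (\<forall>w\<in>W. p w = assoc_point P (y w) (v w))"
    then obtain y v where "y \<in> plots (gtotal P) n W" "v \<in> plots (vspace V) n W" "\<forall>w\<in>W. p w = assoc_point P (y w) (v w)"
      by blast
    then show "\<exists>q\<in>plots (prod_space (gtotal P) (vspace V)) n W. \<forall>w\<in>W. p w = assoc_rel V P `` {q w}"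
      by (intro bexI[of _ "\<lambda>w. (y w, v w)"]) (simp_all add: plots_prod_space assoc_point_def)
  qed
  show ?thesis
    unfolding assoc_bundle_def quotient_space_def by (simp add: *)
qed

lemma assoc_bundle_proj:
  assumes y: "y \<in> points (gtotal P)" and v: "v \<in> vecs V"
  shows "bproj (assoc_bundle V P) (assoc_point P y v) = gproj P y"
proof -
  have "(\<lambda>(y, v). gproj P y) ` assoc_point P y v = {gproj P y}"
  proof
    show "(\<lambda>(y, v). gproj P y) ` assoc_point P y v \<subseteq> {gproj P y}"
      using gspace_overD(10)[OF principal_bundle_gspace_over[OF P] y] by (auto simp: mem_assoc_point)
    show "{gproj P y} \<subseteq> (\<lambda>(y, v). gproj P y) ` assoc_point P y v"
      using mem_assoc_point_self[OF y v] by force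
  qed
  then show ?thesis by (simp add: assoc_bundle_def)
qed

lemma assoc_bundle_scale:
  assumes y: "y \<in> points (gtotal P)" and v: "v \<in> vecs V"
  shows "bscale (assoc_bundle V P) a (assoc_point P y v) = assoc_point P y (vscale V a v)"
proof -
  let ?T = "{(y', vscale V a v') | y' v'. (y', v') \<in> assoc_point P y v}"
  have "?T \<subseteq> assoc_point P y (vscale V a v)"
  proof
    fix z assume "z \<in> ?T"
    then obtain y' v' where z: "z = (y', vscale V a v')" "(y', v') \<in> assoc_point P y v" by auto
    then obtain g where g: "v' \<in> vecs V" "g \<in> carrier (GL V)" "y' = gact P y g" "v = g v'"
      unfolding mem_assoc_point by blast
    show "z \<in> assoc_point P y (vscale V a v)"
      unfolding z(1) mem_assoc_point
      using y g dvs_scale[OF V g(1)] GL_D(4)[OF V g(2,1)] by (intro conjI bexI[of _ g]) simp_all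
  qed
  moreover have "(y, vscale V a v) \<in> ?T" using mem_assoc_point_self[OF y v] by blast
  ultimately show ?thesis
    unfolding assoc_point_def
    using equiv_Image_class[OF equiv_assoc_rel[OF principal_bundle_gspace_over[OF P]]]
    by (simp add: assoc_bundle_def)
qed

lemma assoc_bundle_add:
  assumes y: "y \<in> points (gtotal P)" and v: "v \<in> vecs V" and v': "v' \<in> vecs V"
  shows "badd (assoc_bundle V P) (assoc_point P y v) (assoc_point P y v') = assoc_point P y (vadd V v v')"
proof -
  note Pg = principal_bundle_gspace_over[OF P]
  note mon = group.is_monoid[OF group_GL[OF V]]
  let ?T = "{(y1, vadd V v1 (g v1')) | y1 v1 g v1'. (y1, v1) \<in> assoc_point P y v \<and> g \<in> carrier (GL V) \<and>
    (gact P y1 g, v1') \<in> assoc_point P y v'}"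
  have "?T \<subseteq> assoc_point P y (vadd V v v')"
  proof
    fix z assume "z \<in> ?T"
    then obtain y1 v1 g v1' where z: "z = (y1, vadd V v1 (g v1'))" "(y1, v1) \<in> assoc_point P y v"
      and g: "g \<in> carrier (GL V)" and z': "(gact P y1 g, v1') \<in> assoc_point P y v'" by auto
    from z(2) obtain h where h: "v1 \<in> vecs V" "h \<in> carrier (GL V)" "y1 = gact P y h" "v = h v1"
      unfolding mem_assoc_point by blast
    from z' obtain k where k: "v1' \<in> vecs V" "k \<in> carrier (GL V)" "gact P y1 g = gact P y k" "v' = k v1'"
      unfolding mem_assoc_point by blast
    have "gact P y (h \<otimes>\<^bsub>GL V\<^esub> g) = gact P y k"
      using k(3) unfolding h(3) gspace_overD(9)[OF Pg y h(2) g] .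
    then have hgk: "h \<otimes>\<^bsub>GL V\<^esub> g = k"
      by (rule torsor_free[OF principal_bundle_torsor[OF P] y monoid.m_closed[OF mon h(2) g] k(2)])
    have gv: "g v1' \<in> vecs V" by (rule GL_D(5)[OF V g k(1)])
    have "vadd V v v' = h (vadd V v1 (g v1'))"
      unfolding GL_D(3)[OF V h(2,1) gv] GL_mult_apply[OF V h(2) g k(1), symmetric] hgk h(4) k(4) ..
    then show "z \<in> assoc_point P y (vadd V v v')"
      unfolding z(1) mem_assoc_point
      using y h dvs_add[OF V h(1) gv] by (intro conjI bexI[of _ h]) simp_all
  qed
  moreover have "(y, vadd V v v') \<in> ?T"
  proof -
    have one: "\<one>\<^bsub>GL V\<^esub> \<in> carrier (GL V)" by (rule monoid.one_closed[OF mon])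
    have "(gact P y \<one>\<^bsub>GL V\<^esub>, v') \<in> assoc_point P y v'"
      unfolding gspace_overD(8)[OF Pg y] by (rule mem_assoc_point_self[OF y v'])
    moreover have "\<one>\<^bsub>GL V\<^esub> v' = v'" using v' by simp
    ultimately show ?thesis
      using mem_assoc_point_self[OF y v] one
      by (intro CollectI exI[of _ y] exI[of _ v] exI[of _ "\<one>\<^bsub>GL V\<^esub>"] exI[of _ v']) (simp only: simp_thms)
  qed
  ultimately show ?thesis
    unfolding assoc_point_def
    using equiv_Image_class[OF equiv_assoc_rel[OF Pg]]
    by (simp add: assoc_bundle_def)
qed

lemma GL_zero: "g \<in> carrier (GL V) \<Longrightarrow> g (vzero V) = vzero V"
proof -
  assume g: "g \<in> carrier (GL V)"
  note z = dvs_zero[OF V]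
  have "g (vscale V 0 (vzero V)) = vscale V 0 (g (vzero V))" by (rule GL_D(4)[OF V g z])
  then show ?thesis
    unfolding real_vector_space_on_zero[OF dvs_real_vector_space[OF V] z]
      real_vector_space_on_zero[OF dvs_real_vector_space[OF V] GL_D(5)[OF V g z]] .
qed

lemma assoc_bundle_zero:
  assumes y: "y \<in> points (gtotal P)"
  shows "bzero (assoc_bundle V P) (gproj P y) = assoc_point P y (vzero V)"
proof -
  note Pg = principal_bundle_gspace_over[OF P]
  let ?T = "{(y', vzero V) | y'. y' \<in> points (gtotal P) \<and> gproj P y' = gproj P y}"
  have "?T \<subseteq> assoc_point P y (vzero V)"
  proof
    fix z assume "z \<in> ?T"
    then obtain y' where z: "z = (y', vzero V)" and y': "y' \<in> points (gtotal P)" "gproj P y = gproj P y'" by auto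
    note g = gdiv[OF Pg principal_bundle_torsor[OF P] y y']
    show "z \<in> assoc_point P y (vzero V)"
      unfolding z mem_assoc_point using y g dvs_zero[OF V] GL_zero[OF g(1)]
      by (intro conjI bexI[of _ "gdiv (GL V) P y y'"]) simp_all
  qed
  moreover have "(y, vzero V) \<in> ?T" using y by blast
  ultimately show ?thesis
    unfolding assoc_point_def
    using equiv_Image_class[OF equiv_assoc_rel[OF Pg]]
    by (simp add: assoc_bundle_def)
qed

lemma diffeological_assoc_bundle: "diffeological_space (btotal (assoc_bundle V P))"
  unfolding assoc_bundle_def
  using diffeological_quotient_space[OF diffeological_prod_space[OF gspace_overD(3)[OF principal_bundle_gspace_over[OF P]]
      dvs_space[OF V]]] equiv_assoc_rel[OF principal_bundle_gspace_over[OF P]] by simp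

text \<open>
  The inverse of v \<mapsto> [y, v] divides in P: a class [z, v] over the same base point is [y, k v] for
  the quotient k of z by y. As division is smooth and k acts smoothly on V, the inverse is smooth.
\<close>

lemma assoc_bundle_frame: "frame_along V (gtotal P) (gproj P) (assoc_bundle V P) (assoc_point P)"
proof -
  note Pg = principal_bundle_gspace_over[OF P] and Pt = principal_bundle_torsor[OF P]
  note E = gspace_overD(3)[OF Pg] and Vd = dvs_space[OF V] and F = diffeological_assoc_bundle
  have one: "g = \<one>\<^bsub>GL V\<^esub>" if "y \<in> points (gtotal P)" "g \<in> carrier (GL V)" "y = gact P y g" for y g
    using that gspace_overD(8)[OF Pg that(1)] monoid.one_closed[OF group.is_monoid[OF group_GL[OF V]]]
    by (intro torsor_free[OF Pt that(1,2)]) simp_all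
  have inj: "v = v'" if y: "y \<in> points (gtotal P)" and v: "v \<in> vecs V" "v' \<in> vecs V"
    and e: "assoc_point P y v = assoc_point P y v'" for y v v'
  proof -
    obtain g where g: "g \<in> carrier (GL V)" "y = gact P y g" "v = g v'"
      using e unfolding assoc_point_eq_iff[OF y v(1) y v(2)] by blast
    then show ?thesis using one[OF y g(1,2)] v(2) by simp
  qed
  have trans: "assoc_point P y' v = assoc_point P y (gdiv (GL V) P y y' v)" "gdiv (GL V) P y y' v \<in> vecs V"
    if y: "y \<in> points (gtotal P)" "y' \<in> points (gtotal P)" "gproj P y = gproj P y'" and v: "v \<in> vecs V" for y y' v
    using assoc_point_act[OF y(1) gdiv(1)[OF Pg Pt y] v] gdiv(2)[OF Pg Pt y] GL_D(5)[OF V gdiv(1)[OF Pg Pt y] v]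
    by simp_all
  have bij: "bij_betw (assoc_point P y) (vecs V) {x \<in> points (btotal (assoc_bundle V P)). bproj (assoc_bundle V P) x = gproj P y}"
    if y: "y \<in> points (gtotal P)" for y
  proof (rule bij_betwI')
    show "assoc_point P y v = assoc_point P y v' \<longleftrightarrow> v = v'" if "v \<in> vecs V" "v' \<in> vecs V" for v v'
      using inj[OF y that] by blast
    show "assoc_point P y v \<in> {x \<in> points (btotal (assoc_bundle V P)). bproj (assoc_bundle V P) x = gproj P y}"
      if "v \<in> vecs V" for v
      using assoc_bundle_proj[OF y that] y that by (auto simp: assoc_bundle_points)
    fix x assume "x \<in> {x \<in> points (btotal (assoc_bundle V P)). bproj (assoc_bundle V P) x = gproj P y}"
    then obtain y' v where x: "y' \<in> points (gtotal P)" "v \<in> vecs V" "x = assoc_point P y' v"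
      and p: "bproj (assoc_bundle V P) x = gproj P y" by (auto simp: assoc_bundle_points)
    have "gproj P y = gproj P y'" using p x assoc_bundle_proj[OF x(1,2)] by simp
    from trans[OF y x(1) this x(2)] show "\<exists>v\<in>vecs V. x = assoc_point P y v" unfolding x(3) by blast
  qed
  show ?thesis
  proof (rule frame_alongI)
    show "linear_bij V (assoc_bundle V P) (gproj P y) (assoc_point P y)" if y: "y \<in> points (gtotal P)" for y
      unfolding linear_bij_def
      by (intro conjI ballI allI bij[OF y] assoc_bundle_add[OF y, symmetric] assoc_bundle_scale[OF y, symmetric])
  next
    fix n U k v assume k: "k \<in> plots (gtotal P) n U" and v: "v \<in> plots (vspace V) n U"
    show "(\<lambda>u. assoc_point P (k u) (v u)) \<in> plots (btotal (assoc_bundle V P)) n U"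
      unfolding assoc_bundle_plots
    proof (intro conjI ballI plot_open[OF E k])
      fix u assume "u \<in> U"
      with k v plot_open[OF E k] show "\<exists>W y va. openin (Euclidean_space n) W \<and> u \<in> W \<and> W \<subseteq> U \<and> y \<in> plots (gtotal P) n W \<and>
        va \<in> plots (vspace V) n W \<and> (\<forall>w\<in>W. assoc_point P (k w) (v w) = assoc_point P (y w) (va w))"
        by (intro exI[of _ U] exI[of _ k] exI[of _ v]) simp
    qed
  next
    fix n U k x assume k: "k \<in> plots (gtotal P) n U" and x: "x \<in> plots (btotal (assoc_bundle V P)) n U"
      and kx: "\<And>u. u \<in> U \<Longrightarrow> bproj (assoc_bundle V P) (x u) = gproj P (k u)"
    show "(\<lambda>u. inv_into (vecs V) (assoc_point P (k u)) (x u)) \<in> plots (vspace V) n U"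
    proof (rule plot_local[OF Vd plot_open[OF E k]])
      fix u assume "u \<in> U"
      then obtain W y v where W: "openin (Euclidean_space n) W" "u \<in> W" "W \<subseteq> U" "y \<in> plots (gtotal P) n W"
        "v \<in> plots (vspace V) n W" "\<forall>w\<in>W. x w = assoc_point P (y w) (v w)"
        using x unfolding assoc_bundle_plots by blast
      note kW = plot_restrict[OF E k W(1,3)]
      have pr: "gproj P (k w) = gproj P (y w)" if w: "w \<in> W" for w
        using kx[of w] W(3,6) w assoc_bundle_proj[OF plot_point[OF E W(4) w] plot_point[OF Vd W(5) w]] by auto
      have d: "(\<lambda>w. gdiv (GL V) P (k w) (y w)) \<in> plots (gspace (GL V)) n W"
        by (rule gdiv_plot[OF Pg Pt kW W(4) pr])
      note q = GL_plotD(5)[OF V d W(5)]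
      have "inv_into (vecs V) (assoc_point P (k w)) (x w) = gdiv (GL V) P (k w) (y w) (v w)" if w: "w \<in> W" for w
      proof -
        note kw = plot_point[OF E kW w]
        note t = trans[OF kw plot_point[OF E W(4) w] pr[OF w] plot_point[OF Vd W(5) w]]
        have "x w = assoc_point P (k w) (gdiv (GL V) P (k w) (y w) (v w))" using W(6) w t(1) by simp
        then show ?thesis
          by (intro inv_into_f_eq[OF bij_betw_imp_inj_on[OF bij[OF kw]] t(2)]) (rule sym)
      qed
      with q W(1-3) show "\<exists>W q. openin (Euclidean_space n) W \<and> u \<in> W \<and> W \<subseteq> U \<and> q \<in> plots (vspace V) n W \<and>
          (\<forall>w\<in>W. inv_into (vecs V) (assoc_point P (k w)) (x w) = q w)"
        by (intro exI[of _ W] exI[of _ "\<lambda>w. gdiv (GL V) P (k w) (y w) (v w)"] conjI ballI)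
    qed
  qed
qed

lemma assoc_bundle_dvs_over: "dvs_over B (assoc_bundle V P)"
proof (rule frame_dvs_over[OF P diffeological_assoc_bundle assoc_bundle_frame])
  note Pg = principal_bundle_gspace_over[OF P]
  note E = gspace_overD(3)[OF Pg] and Vd = dvs_space[OF V]
  show "bproj (assoc_bundle V P) x \<in> points B" if "x \<in> points (btotal (assoc_bundle V P))" for x
    using that assoc_bundle_proj gspace_overD(5)[OF Pg] unfolding assoc_bundle_points by auto
  show "bzero (assoc_bundle V P) (gproj P y) = assoc_point P y (vzero V)" if "y \<in> points (gtotal P)" for y
    by (rule assoc_bundle_zero[OF that])
  fix n U x assume x: "x \<in> plots (btotal (assoc_bundle V P)) n U"
  show "(\<lambda>u. bproj (assoc_bundle V P) (x u)) \<in> plots B n U"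
  proof (rule plot_local[OF gspace_overD(2)[OF Pg] plot_open[OF diffeological_assoc_bundle x]])
    fix u assume "u \<in> U"
    then obtain W y v where W: "openin (Euclidean_space n) W" "u \<in> W" "W \<subseteq> U" "y \<in> plots (gtotal P) n W"
      "v \<in> plots (vspace V) n W" "\<forall>w\<in>W. x w = assoc_point P (y w) (v w)"
      using x unfolding assoc_bundle_plots by blast
    have "bproj (assoc_bundle V P) (x w) = gproj P (y w)" if w: "w \<in> W" for w
      using W(6) w assoc_bundle_proj[OF plot_point[OF E W(4) w] plot_point[OF Vd W(5) w]] by simp
    with W(1-3) smooth_map_plot[OF gspace_overD(4)[OF Pg] W(4)]
    show "\<exists>W q. openin (Euclidean_space n) W \<and> u \<in> W \<and> W \<subseteq> U \<and> q \<in> plots B n W \<and>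
        (\<forall>w\<in>W. bproj (assoc_bundle V P) (x w) = q w)"
      by (intro exI[of _ W] exI[of _ "\<lambda>w. gproj P (y w)"] conjI ballI)
  qed
qed

lemma assoc_bundle_pairing: "frame_pairing V B P (assoc_bundle V P) (assoc_point P)"
  by (rule frame_pairingI_principal[OF P diffeological_assoc_bundle assoc_bundle_frame assoc_point_act])

end


section \<open>The frame bundle\<close>

text \<open>
  A plot of the frame bundle is a frame along a plot of the base. In the same way a point is a smooth
  frame along a constant map on the one-point space, which makes constant functions plots.
\<close>

definition frame_bundle :: "'b diffspace \<Rightarrow> ('b, 'f) vbundle \<Rightarrow> ('b, 'b \<times> ('v \<Rightarrow> 'f), 'v \<Rightarrow> 'v) gbundle" where
  "frame_bundle B F =
     \<lparr>gtotal =
        \<lparr>points = {(b, \<phi>). b \<in> points B \<and> \<phi> \<in> extensional (vecs V) \<and>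
           frame_along V (domain_space 0 origin_space) (\<lambda>_. b) F (\<lambda>_. \<phi>)},
         plots = (\<lambda>n U. {p. (\<lambda>u. fst (p u)) \<in> plots B n U \<and> (\<forall>u\<in>U. snd (p u) \<in> extensional (vecs V)) \<and>
           frame_along V (domain_space n U) (\<lambda>u. fst (p u)) F (\<lambda>u. snd (p u))})\<rparr>,
      gproj = fst,
      gact = (\<lambda>z g. (fst z, compose (vecs V) (snd z) g))\<rparr>"

text \<open>A smooth map into U is restricted to the preimages of the given open sets.\<close>

lemma frame_along_local:
  assumes U: "openin (Euclidean_space n) U" and F: "diffeological_space (btotal F)"
    and loc: "\<And>u. u \<in> U \<Longrightarrow> \<exists>W. openin (Euclidean_space n) W \<and> u \<in> W \<and> W \<subseteq> U \<and> frame_along V (domain_space n W) f F e"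
  shows "frame_along V (domain_space n U) f F e"
proof (rule frame_alongI)
  note Vd = dvs_space[OF V]
  show "linear_bij V F (f u) (e u)" if "u \<in> points (domain_space n U)" for u
  proof -
    from that obtain W where "u \<in> W" "frame_along V (domain_space n W) f F e" using loc[of u] by auto
    then show ?thesis using frame_alongD(1)[of V "domain_space n W" f F e u] by simp
  qed
  fix m T h assume "h \<in> plots (domain_space n U) m T"
  then have h: "smooth_between m T n U h" by simp
  note T = smooth_between_openD(1)[OF h]
  have loc': "\<exists>W T'. openin (Euclidean_space m) T' \<and> t \<in> T' \<and> T' \<subseteq> T \<and> h \<in> plots (domain_space n W) m T' \<and>
      frame_along V (domain_space n W) f F e" if t: "t \<in> T" for t
  proof -
    obtain W where W: "openin (Euclidean_space n) W" "h t \<in> W" "W \<subseteq> U" "frame_along V (domain_space n W) f F e"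
      using loc[OF smooth_between_openD(3)[OF h t]] by blast
    let ?T = "{t \<in> T. h t \<in> W}"
    have T': "openin (Euclidean_space m) ?T" by (rule smooth_between_preimage[OF h W(1)])
    have "smooth_between m ?T n W h"
      by (rule smooth_between_range[OF smooth_between_restrict[OF h T'] W(1)]) auto
    then show ?thesis using T' t W by (intro exI[of _ W] exI[of _ ?T]) auto
  qed
  show "(\<lambda>t. e (h t) (v t)) \<in> plots (btotal F) m T" if v: "v \<in> plots (vspace V) m T" for v
  proof (rule plot_local[OF F T])
    fix t assume "t \<in> T"
    then obtain W T' where W: "openin (Euclidean_space m) T'" "t \<in> T'" "T' \<subseteq> T" "h \<in> plots (domain_space n W) m T'"
      "frame_along V (domain_space n W) f F e" using loc'[of t] by blast
    show "\<exists>W q. openin (Euclidean_space m) W \<and> t \<in> W \<and> W \<subseteq> T \<and> q \<in> plots (btotal F) m W \<and> (\<forall>w\<in>W. e (h w) (v w) = q w)"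
      using W(1-3) frame_alongD(2)[OF W(5,4) plot_restrict[OF Vd v W(1,3)]]
      by (intro exI[of _ T'] exI[of _ "\<lambda>t. e (h t) (v t)"]) simp
  qed
  fix x assume x: "x \<in> plots (btotal F) m T" and xh: "\<And>t. t \<in> T \<Longrightarrow> bproj F (x t) = f (h t)"
  show "(\<lambda>t. inv_into (vecs V) (e (h t)) (x t)) \<in> plots (vspace V) m T"
  proof (rule plot_local[OF Vd T])
    fix t assume "t \<in> T"
    then obtain W T' where W: "openin (Euclidean_space m) T'" "t \<in> T'" "T' \<subseteq> T" "h \<in> plots (domain_space n W) m T'"
      "frame_along V (domain_space n W) f F e" using loc'[of t] by blast
    have xh': "bproj F (x t) = f (h t)" if "t \<in> T'" for t using xh W(3) that by auto
    have "(\<lambda>t. inv_into (vecs V) (e (h t)) (x t)) \<in> plots (vspace V) m T'"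
      by (rule frame_alongD(3)[OF W(5,4) plot_restrict[OF F x W(1,3)]]) (rule xh')
    with W(1-3) show "\<exists>W q. openin (Euclidean_space m) W \<and> t \<in> W \<and> W \<subseteq> T \<and> q \<in> plots (vspace V) m W \<and>
        (\<forall>w\<in>W. inv_into (vecs V) (e (h w)) (x w) = q w)"
      by (intro exI[of _ T'] exI[of _ "\<lambda>t. inv_into (vecs V) (e (h t)) (x t)"]) simp
  qed
qed

context
  fixes B :: "'b diffspace" and F :: "('b, 'f) vbundle"
  assumes F: "dvs_over B F"
begin

lemma frame_bundle_simps:
  "z \<in> points (gtotal (frame_bundle B F)) \<longleftrightarrow> fst z \<in> points B \<and> snd z \<in> extensional (vecs V) \<and>
     frame_along V (domain_space 0 origin_space) (\<lambda>_. fst z) F (\<lambda>_. snd z)"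
  "p \<in> plots (gtotal (frame_bundle B F)) n U \<longleftrightarrow>
     (\<lambda>u. fst (p u)) \<in> plots B n U \<and> (\<forall>u\<in>U. snd (p u) \<in> extensional (vecs V)) \<and>
     frame_along V (domain_space n U) (\<lambda>u. fst (p u)) F (\<lambda>u. snd (p u))"
  "gproj (frame_bundle B F) z = fst z"
  "gact (frame_bundle B F) z g = (fst z, compose (vecs V) (snd z) g)"
  by (auto simp: frame_bundle_def case_prod_beta)

lemma frame_bundle_point:
  assumes p: "p \<in> plots (gtotal (frame_bundle B F)) n U" and u: "u \<in> U"
  shows "p u \<in> points (gtotal (frame_bundle B F))"
proof -
  note B = dvs_overD(1)[OF F]
  note p' = p[unfolded frame_bundle_simps(2)]
  have pB: "(\<lambda>u. fst (p u)) \<in> plots B n U" and fr: "frame_along V (domain_space n U) (\<lambda>u. fst (p u)) F (\<lambda>u. snd (p u))"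
    using p' by blast+
  note U = plot_open[OF B pB]
  have "smooth_map (domain_space 0 origin_space) (domain_space n U) (\<lambda>_. u)"
    by (rule smooth_map_domainI[OF diffeological_domain_space[OF U]])
      (simp add: smooth_between_const[OF origin_space(1) U u])
  from frame_along_compose[OF fr this] show ?thesis
    unfolding frame_bundle_simps using p' plot_point[OF B pB u] u by simp
qed

lemma diffeological_frame_bundle: "diffeological_space (gtotal (frame_bundle B F))"
proof (rule diffeological_spaceI)
  note B = dvs_overD(1)[OF F] and FT = dvs_overD(2)[OF F]
  show "openin (Euclidean_space n) U" if "p \<in> plots (gtotal (frame_bundle B F)) n U" for n U p
    using that plot_open[OF B] unfolding frame_bundle_simps by blast
  show "p u \<in> points (gtotal (frame_bundle B F))"
    if "p \<in> plots (gtotal (frame_bundle B F)) n U" "u \<in> U" for n U p u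
    by (rule frame_bundle_point[OF that])
  show "(\<lambda>_. z) \<in> plots (gtotal (frame_bundle B F)) n U"
    if U: "openin (Euclidean_space n) U" and z: "z \<in> points (gtotal (frame_bundle B F))" for n U z
  proof -
    note z' = z[unfolded frame_bundle_simps]
    have c: "smooth_map (domain_space n U) (domain_space 0 origin_space) (\<lambda>_ _. 0)"
      by (rule smooth_map_domainI[OF diffeological_domain_space[OF origin_space(1)]])
        (simp add: smooth_between_const[OF U origin_space])
    show ?thesis
      unfolding frame_bundle_simps
      using plot_const[OF B U] z' frame_along_compose[OF z'[THEN conjunct2, THEN conjunct2] c] by simp
  qed
  show "(\<lambda>w. p (h w)) \<in> plots (gtotal (frame_bundle B F)) m W"
    if p: "p \<in> plots (gtotal (frame_bundle B F)) n U" and h: "smooth_between m W n U h" for n U p m W h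
  proof -
    note p' = p[unfolded frame_bundle_simps]
    have s: "smooth_map (domain_space m W) (domain_space n U) h"
      by (rule smooth_map_domainI[OF diffeological_domain_space[OF smooth_between_openD(2)[OF h]]]) (simp add: h)
    show ?thesis
      unfolding frame_bundle_simps
      using plot_compose[OF B p'[THEN conjunct1] h] p' smooth_between_openD(3)[OF h]
        frame_along_compose[OF p'[THEN conjunct2, THEN conjunct2] s] by simp
  qed
  fix n U p
  assume U: "openin (Euclidean_space n) U"
    and l: "\<And>u. u \<in> U \<Longrightarrow> \<exists>W. openin (Euclidean_space n) W \<and> u \<in> W \<and> W \<subseteq> U \<and>
                    (\<exists>q\<in>plots (gtotal (frame_bundle B F)) n W. \<forall>w\<in>W. p w = q w)"
  have l': "\<exists>W q. openin (Euclidean_space n) W \<and> u \<in> W \<and> W \<subseteq> U \<and> (\<lambda>w. fst (q w)) \<in> plots B n W \<and>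
      (\<forall>w\<in>W. p w = q w) \<and> (\<forall>w\<in>W. snd (p w) \<in> extensional (vecs V)) \<and>
      frame_along V (domain_space n W) (\<lambda>w. fst (p w)) F (\<lambda>w. snd (p w))" if u: "u \<in> U" for u
  proof -
    obtain W q where W: "openin (Euclidean_space n) W" "u \<in> W" "W \<subseteq> U"
      "q \<in> plots (gtotal (frame_bundle B F)) n W" "\<forall>w\<in>W. p w = q w" using l[OF u] by blast
    note q = W(4)[unfolded frame_bundle_simps]
    have "frame_along V (domain_space n W) (\<lambda>w. fst (p w)) F (\<lambda>w. snd (p w))"
      by (rule frame_along_cong[OF V q[THEN conjunct2, THEN conjunct2] diffeological_domain_space[OF W(1)] FT])
        (simp_all add: W(5))
    then show ?thesis using W q by (intro exI[of _ W] exI[of _ q]) simp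
  qed
  have "(\<lambda>u. fst (p u)) \<in> plots B n U"
  proof (rule plot_local[OF B U])
    fix u assume "u \<in> U"
    from l'[OF this] obtain W q where W: "openin (Euclidean_space n) W" "u \<in> W" "W \<subseteq> U"
      "(\<lambda>w. fst (q w)) \<in> plots B n W" "\<forall>w\<in>W. p w = q w" by blast
    then show "\<exists>W q. openin (Euclidean_space n) W \<and> u \<in> W \<and> W \<subseteq> U \<and> q \<in> plots B n W \<and> (\<forall>w\<in>W. fst (p w) = q w)"
      by (intro exI[of _ W] exI[of _ "\<lambda>w. fst (q w)"]) simp
  qed
  moreover have "snd (p u) \<in> extensional (vecs V)" if "u \<in> U" for u using l'[OF that] by blast
  moreover have "frame_along V (domain_space n U) (\<lambda>w. fst (p w)) F (\<lambda>w. snd (p w))"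
    by (rule frame_along_local[OF U FT]) (use l' in blast)
  ultimately show "p \<in> plots (gtotal (frame_bundle B F)) n U" unfolding frame_bundle_simps by blast
qed

lemma frame_bundle_gspace_over: "gspace_over (GL V) B (frame_bundle B F)"
proof (rule gspace_overI[OF diffeological_group_GL[OF V] dvs_overD(1)[OF F] diffeological_frame_bundle])
  note B = dvs_overD(1)[OF F] and FT = dvs_overD(2)[OF F]
  show act: "(\<lambda>u. gact (frame_bundle B F) (y u) (k u)) \<in> plots (gtotal (frame_bundle B F)) n U"
    if y: "y \<in> plots (gtotal (frame_bundle B F)) n U" and k: "k \<in> plots (gspace (GL V)) n U" for n U y k
  proof -
    note y' = y[unfolded frame_bundle_simps]
    note U = plot_open[OF B y'[THEN conjunct1]]
    note D = diffeological_domain_space[OF U]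
    have "frame_along V (domain_space n U) (\<lambda>u. fst (y u)) F (\<lambda>u. compose (vecs V) (snd (y u)) (k u))"
      by (rule frame_along_cong[OF V frame_along_act[OF V y'[THEN conjunct2, THEN conjunct2]
            smooth_map_domainI[OF diffeological_GL[OF V] k] D FT] D FT])
        (simp_all add: compose_eq)
    then show ?thesis unfolding frame_bundle_simps using y' by (simp add: compose_extensional)
  qed
  show "gact (frame_bundle B F) z g \<in> points (gtotal (frame_bundle B F))"
    if z: "z \<in> points (gtotal (frame_bundle B F))" and g: "g \<in> carrier (GL V)" for z g
  proof -
    have "g \<in> points (gspace (GL V))" using g by simp
    note kz = act[OF plot_const[OF diffeological_frame_bundle origin_space(1) z]
      plot_const[OF diffeological_GL[OF V] origin_space(1) this]]
    show ?thesis by (rule frame_bundle_point[OF kz origin_space(2)])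
  qed
  show "gact (frame_bundle B F) z \<one>\<^bsub>GL V\<^esub> = z" if z: "z \<in> points (gtotal (frame_bundle B F))" for z
  proof -
    have "compose (vecs V) (snd z) (\<lambda>v\<in>vecs V. v) = snd z"
      by (rule extensionalityI[OF compose_extensional]) (use z in \<open>simp_all add: frame_bundle_simps compose_eq\<close>)
    then show ?thesis unfolding frame_bundle_simps by simp
  qed
  show "gact (frame_bundle B F) (gact (frame_bundle B F) z g) h = gact (frame_bundle B F) z (g \<otimes>\<^bsub>GL V\<^esub> h)"
    if g: "g \<in> carrier (GL V)" and h: "h \<in> carrier (GL V)" for z g h
  proof -
    have "compose (vecs V) (compose (vecs V) (snd z) g) h = compose (vecs V) (snd z) (g \<otimes>\<^bsub>GL V\<^esub> h)"
      by (rule extensionalityI[OF compose_extensional compose_extensional])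
        (simp add: compose_eq GL_D(5)[OF V h] GL_mult_apply[OF V g h] del: GL_simps)
    then show ?thesis unfolding frame_bundle_simps by simp
  qed
qed (simp_all add: frame_bundle_simps)

lemma frame_bundle_pairing: "frame_pairing V B (frame_bundle B F) F snd"
proof (rule frame_pairingI[OF V])
  note B = dvs_overD(1)[OF F] and FT = dvs_overD(2)[OF F]
  show "frame_along V (gtotal (frame_bundle B F)) (gproj (frame_bundle B F)) F snd"
  proof (rule frame_alongI)
    show "linear_bij V F (gproj (frame_bundle B F) z) (snd z)" if "z \<in> points (gtotal (frame_bundle B F))" for z
      using that frame_alongD(1)[of V "domain_space 0 origin_space" "\<lambda>_. fst z" F "\<lambda>_. snd z" "\<lambda>_. 0"] origin_space(2)
      by (simp add: frame_bundle_simps)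
    fix n U k assume k: "k \<in> plots (gtotal (frame_bundle B F)) n U"
    note k' = k[unfolded frame_bundle_simps]
    note U = plot_open[OF B k'[THEN conjunct1]]
    have i: "(\<lambda>u. u) \<in> plots (domain_space n U) n U" by (simp add: smooth_between_inclusion[OF U U])
    note fr = k'[THEN conjunct2, THEN conjunct2]
    show "(\<lambda>u. snd (k u) (v u)) \<in> plots (btotal F) n U" if "v \<in> plots (vspace V) n U" for v
      by (rule frame_alongD(2)[OF fr i that])
    show "(\<lambda>u. inv_into (vecs V) (snd (k u)) (x u)) \<in> plots (vspace V) n U"
      if "x \<in> plots (btotal F) n U" "\<And>u. u \<in> U \<Longrightarrow> bproj F (x u) = gproj (frame_bundle B F) (k u)" for x
      by (rule frame_alongD(3)[OF fr i that(1)]) (simp add: that(2) frame_bundle_simps)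
  qed
  show "snd (gact (frame_bundle B F) z g) v = snd z (g v)" if "v \<in> vecs V" for z g v
    using that by (simp add: frame_bundle_simps compose_eq)
  show "z = z'" if "z \<in> points (gtotal (frame_bundle B F))" "z' \<in> points (gtotal (frame_bundle B F))"
    "gproj (frame_bundle B F) z = gproj (frame_bundle B F) z'" "\<And>v. v \<in> vecs V \<Longrightarrow> snd z v = snd z' v" for z z'
  proof -
    have "snd z = snd z'"
      by (rule extensionalityI[of _ "vecs V"]) (use that in \<open>simp_all add: frame_bundle_simps\<close>)
    with that(3) show ?thesis by (simp add: frame_bundle_simps prod_eq_iff)
  qed
  fix n U p e assume p: "p \<in> plots B n U" and e: "frame_along V (domain_space n U) p F e"
  have "frame_along V (domain_space n U) p F (\<lambda>u. restrict (e u) (vecs V))"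
    by (rule frame_along_cong[OF V e diffeological_domain_space[OF plot_open[OF B p]] FT]) simp_all
  then have "(\<lambda>u. (p u, restrict (e u) (vecs V))) \<in> plots (gtotal (frame_bundle B F)) n U"
    unfolding frame_bundle_simps using p by simp
  then show "\<exists>y\<in>plots (gtotal (frame_bundle B F)) n U. \<forall>u\<in>U. gproj (frame_bundle B F) (y u) = p u \<and>
      (\<forall>v\<in>vecs V. snd (y u) v = e u v)"
    by (intro bexI[of _ "\<lambda>u. (p u, restrict (e u) (vecs V))"]) (simp_all add: frame_bundle_simps)
qed

end

end

section \<open>Pulling back partitions of unity\<close>

lemma D_open_points:
  assumes X: "diffeological_space X"
  shows "D_open X (points X)"
proof -
  have "{u \<in> U. p u \<in> points X} = U" if "p \<in> plots X n U" for p n U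
    using plot_point[OF X that] by auto
  then show ?thesis using plot_open[OF X] by (simp add: D_open_def)
qed

lemma topspace_D_topology:
  assumes X: "diffeological_space X"
  shows "topspace (D_topology X) = points X"
proof
  show "topspace (D_topology X) \<subseteq> points X"
    unfolding topspace_def openin_D_topology by (auto simp: D_open_def)
  show "points X \<subseteq> topspace (D_topology X)"
    using openin_subset[of "D_topology X" "points X"] D_open_points[OF X] by (simp add: openin_D_topology)
qed

text \<open>
  The preimage of the support is D-closed and contains the points where the pulled back function is
  positive.
\<close>

lemma D_support_pullback:
  assumes f: "smooth_map C B f" and C: "diffeological_space C" and B: "diffeological_space B"
    and c: "c \<in> D_support C (\<lambda>c. \<mu> (f c))"
  shows "c \<in> points C" "f c \<in> D_support B \<mu>"
proof -
  have c': "c \<in> points C" "\<And>T. c \<in> T \<Longrightarrow> D_open C T \<Longrightarrow> \<exists>y\<in>points C. 0 < \<mu> (f y) \<and> y \<in> T"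
    using c unfolding D_support_def in_closure_of topspace_D_topology[OF C] openin_D_topology by auto
  then show "c \<in> points C" by simp
  have "\<exists>y\<in>points B. 0 < \<mu> y \<and> y \<in> T" if T: "f c \<in> T" "D_open B T" for T
    using c'(2)[OF _ D_open_preimage[OF f C T(2)]] c'(1) T(1) smooth_map_point[OF f] by auto
  then show "f c \<in> D_support B \<mu>"
    unfolding D_support_def in_closure_of topspace_D_topology[OF B] openin_D_topology
    using smooth_map_point[OF f c'(1)] by auto
qed

lemma in_D_support:
  assumes "diffeological_space X" "x \<in> points X" "0 < \<mu> x"
  shows "x \<in> D_support X \<mu>"
  unfolding D_support_def in_closure_of using assms by (auto simp: topspace_D_topology)

text \<open>
  Composing a partition of unity with f gives one on C, but its indices have to lie in the type that
  belongs to C. Indices whose function vanishes on C are dropped, and each remaining index i is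
  mapped to a point pt i of C at which its function is positive. By local finiteness only finitely many
  indices are mapped to the same point, so they can be told apart by a natural number.
\<close>

lemma D_numerable_cover_pullback:
  fixes B :: "'b diffspace" and C :: "'c diffspace"
  assumes num: "D_numerable_cover B Triv" and f: "smooth_map C B f"
    and C: "diffeological_space C" and B: "diffeological_space B"
    and Triv: "\<And>A. Triv A \<Longrightarrow> Triv' {c \<in> points C. f c \<in> A}"
  shows "D_numerable_cover C Triv'"
proof -
  obtain I :: "('b \<times> nat) set" and A \<mu> where A: "\<forall>i\<in>I. D_open B (A i)" "(\<Union>i\<in>I. A i) = points B"
    and pu: "smooth_partition_of_unity B I \<mu>" and sup: "\<forall>i\<in>I. D_support B (\<mu> i) \<subseteq> A i"
    and tr: "\<forall>i\<in>I. Triv (A i)"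
    using num unfolding D_numerable_cover_def by (elim exE conjE)
  note fp = smooth_map_point[OF f]
  have sm: "smooth_map B real_space (\<mu> i)" and nonneg: "0 \<le> \<mu> i x" if "i \<in> I" "x \<in> points B" for i x
    using pu that unfolding smooth_partition_of_unity_def by blast+
  have lf: "\<exists>W. D_open B W \<and> x \<in> W \<and> finite {i \<in> I. W \<inter> D_support B (\<mu> i) \<noteq> {}}" if "x \<in> points B" for x
    using pu that unfolding smooth_partition_of_unity_def by blast
  have one: "(\<Sum>i | i \<in> I \<and> \<mu> i x \<noteq> 0. \<mu> i x) = 1" if "x \<in> points B" for x
    using pu that unfolding smooth_partition_of_unity_def by blast
  have insup: "x \<in> D_support B (\<mu> i)" if "i \<in> I" "x \<in> points B" "\<mu> i x \<noteq> 0" for i x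
    using nonneg[OF that(1,2)] that(3) by (intro in_D_support[OF B that(2)]) simp
  define J where "J = {i \<in> I. \<exists>c\<in>points C. \<mu> i (f c) \<noteq> 0}"
  have "\<forall>i\<in>J. \<exists>c. c \<in> points C \<and> \<mu> i (f c) \<noteq> 0" by (auto simp: J_def)
  then obtain pt where pt: "\<forall>i\<in>J. pt i \<in> points C \<and> \<mu> i (f (pt i)) \<noteq> 0" by (rule bchoice[THEN exE])
  have fin: "finite {i \<in> J. pt i = c}" for c
  proof (cases "c \<in> points C")
    case True
    obtain W where W: "f c \<in> W" "finite {i \<in> I. W \<inter> D_support B (\<mu> i) \<noteq> {}}" using lf[OF fp[OF True]] by blast
    have "{i \<in> J. pt i = c} \<subseteq> {i \<in> I. W \<inter> D_support B (\<mu> i) \<noteq> {}}"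
    proof
      fix i assume "i \<in> {i \<in> J. pt i = c}"
      then have i: "i \<in> J" "pt i = c" by simp_all
      then have "i \<in> I" "\<mu> i (f c) \<noteq> 0" using bspec[OF pt i(1)] by (simp_all add: J_def)
      with insup[OF _ fp[OF True]] W(1) show "i \<in> {i \<in> I. W \<inter> D_support B (\<mu> i) \<noteq> {}}" by blast
    qed
    then show ?thesis using W(2) by (rule finite_subset)
  next
    case False
    then have "{i \<in> J. pt i = c} = {}" using pt by auto
    then show ?thesis by (simp only: finite.emptyI)
  qed
  have "\<exists>g::'b \<times> nat \<Rightarrow> nat. inj_on g {i \<in> J. pt i = c}" for c
    using finite_imp_inj_to_nat_seg[OF fin[of c]] by blast
  then obtain g :: "'c \<Rightarrow> 'b \<times> nat \<Rightarrow> nat" where g: "\<And>c. inj_on (g c) {i \<in> J. pt i = c}" by metis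
  define r where "r i = (pt i, g (pt i) i)" for i
  have inj: "inj_on r J"
  proof (rule inj_onI)
    fix i j assume ij: "i \<in> J" "j \<in> J" and rij: "r i = r j"
    have e: "pt i = pt j" using arg_cong[OF rij, of fst] by (simp only: r_def fst_conv)
    have "g (pt i) i = g (pt j) j" using arg_cong[OF rij, of snd] by (simp only: r_def snd_conv)
    then have "g (pt j) i = g (pt j) j" unfolding e .
    then show "i = j" by (rule inj_onD[OF g]) (simp_all add: ij e)
  qed
  define h where "h = inv_into J r"
  have hr: "h (r i) = i" if "i \<in> J" for i unfolding h_def using inj that by simp
  have h: "h j \<in> J" "r (h j) = j" if "j \<in> r ` J" for j
    using that unfolding h_def by (simp_all add: inv_into_into f_inv_into_f)
  have JI: "J \<subseteq> I" by (auto simp: J_def)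
  define A' where "A' j = {c \<in> points C. f c \<in> A (h j)}" for j
  define \<nu> where "\<nu> j c = \<mu> (h j) (f c)" for j c
  have pu': "smooth_partition_of_unity C (r ` J) \<nu>"
    unfolding smooth_partition_of_unity_def
  proof (intro conjI ballI)
    fix j assume j: "j \<in> r ` J"
    then have i: "h j \<in> I" using h(1) JI by blast
    show "smooth_map C real_space (\<nu> j)"
    proof (rule smooth_mapI)
      fix n U p assume p: "p \<in> plots C n U"
      show "(\<lambda>u. \<nu> j (p u)) \<in> plots real_space n U"
      \<comment> \<open>If C is empty, there are no indices.\<close>
      proof (cases "\<exists>c. c \<in> points C")
        case True
        then obtain c where "c \<in> points C" by blast
        from smooth_map_plot[OF sm[OF i fp[OF this]] smooth_map_plot[OF f p]] show ?thesis by (simp add: \<nu>_def)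
      next
        case False
        with h(1)[OF j] show ?thesis by (auto simp: J_def)
      qed
    qed simp
    show "0 \<le> \<nu> j c" if "c \<in> points C" for c unfolding \<nu>_def by (rule nonneg[OF i fp[OF that]])
  next
    fix c assume c: "c \<in> points C"
    obtain W where W: "D_open B W" "f c \<in> W" "finite {i \<in> I. W \<inter> D_support B (\<mu> i) \<noteq> {}}" using lf[OF fp[OF c]] by blast
    let ?W = "{c \<in> points C. f c \<in> W}"
    have "{j \<in> r ` J. ?W \<inter> D_support C (\<nu> j) \<noteq> {}} \<subseteq> r ` {i \<in> I. W \<inter> D_support B (\<mu> i) \<noteq> {}}"
    proof
      fix j assume "j \<in> {j \<in> r ` J. ?W \<inter> D_support C (\<nu> j) \<noteq> {}}"
      then obtain c' where j: "j \<in> r ` J" and c': "f c' \<in> W" "c' \<in> D_support C (\<nu> j)" by blast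
      have "f c' \<in> D_support B (\<mu> (h j))"
        by (rule D_support_pullback(2)[OF f C B]) (use c'(2) in \<open>simp add: \<nu>_def [abs_def]\<close>)
      with c'(1) h(1)[OF j] JI have "h j \<in> {i \<in> I. W \<inter> D_support B (\<mu> i) \<noteq> {}}" by blast
      then have "r (h j) \<in> r ` {i \<in> I. W \<inter> D_support B (\<mu> i) \<noteq> {}}" by (rule imageI)
      then show "j \<in> r ` {i \<in> I. W \<inter> D_support B (\<mu> i) \<noteq> {}}" unfolding h(2)[OF j] .
    qed
    then have "finite {j \<in> r ` J. ?W \<inter> D_support C (\<nu> j) \<noteq> {}}"
      by (rule finite_subset[OF _ finite_imageI[OF W(3)]])
    then show "\<exists>W. D_open C W \<and> c \<in> W \<and> finite {j \<in> r ` J. W \<inter> D_support C (\<nu> j) \<noteq> {}}"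
      using D_open_preimage[OF f C W(1)] c W(2) by (intro exI[of _ ?W]) simp
    have "bij_betw r {i. i \<in> I \<and> \<mu> i (f c) \<noteq> 0} {j. j \<in> r ` J \<and> \<nu> j c \<noteq> 0}"
      unfolding bij_betw_def
    proof
      have sub: "{i. i \<in> I \<and> \<mu> i (f c) \<noteq> 0} \<subseteq> J" using c by (auto simp: J_def)
      then show "inj_on r {i. i \<in> I \<and> \<mu> i (f c) \<noteq> 0}" by (rule inj_on_subset[OF inj])
      show "r ` {i. i \<in> I \<and> \<mu> i (f c) \<noteq> 0} = {j. j \<in> r ` J \<and> \<nu> j c \<noteq> 0}"
      proof
        show "r ` {i. i \<in> I \<and> \<mu> i (f c) \<noteq> 0} \<subseteq> {j. j \<in> r ` J \<and> \<nu> j c \<noteq> 0}"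
          using sub by (auto simp: \<nu>_def hr subset_iff)
        show "{j. j \<in> r ` J \<and> \<nu> j c \<noteq> 0} \<subseteq> r ` {i. i \<in> I \<and> \<mu> i (f c) \<noteq> 0}"
          using JI by (auto simp: \<nu>_def hr)
      qed
    qed
    from sum.reindex_bij_betw[OF this, of "\<lambda>j. \<nu> j c"]
    have "(\<Sum>j | j \<in> r ` J \<and> \<nu> j c \<noteq> 0. \<nu> j c) = (\<Sum>i | i \<in> I \<and> \<mu> i (f c) \<noteq> 0. \<nu> (r i) c)" by simp
    also have "\<dots> = (\<Sum>i | i \<in> I \<and> \<mu> i (f c) \<noteq> 0. \<mu> i (f c))"
    proof (rule sum.cong[OF refl])
      fix i assume "i \<in> {i. i \<in> I \<and> \<mu> i (f c) \<noteq> 0}"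
      then have "i \<in> J" using c by (auto simp: J_def)
      then show "\<nu> (r i) c = \<mu> i (f c)" by (simp add: \<nu>_def hr)
    qed
    also have "\<dots> = 1" by (rule one[OF fp[OF c]])
    finally show "(\<Sum>j | j \<in> r ` J \<and> \<nu> j c \<noteq> 0. \<nu> j c) = 1" .
  qed
  have sup': "D_support C (\<nu> j) \<subseteq> A' j" if j: "j \<in> r ` J" for j
  proof
    fix c assume "c \<in> D_support C (\<nu> j)"
    then have "c \<in> D_support C (\<lambda>c. \<mu> (h j) (f c))" by (simp add: \<nu>_def [abs_def])
    from D_support_pullback[OF f C B this] show "c \<in> A' j"
      using sup h(1)[OF j] JI unfolding A'_def by blast
  qed
  have cov: "(\<Union>j\<in>r ` J. A' j) = points C"
  proof
    show "(\<Union>j\<in>r ` J. A' j) \<subseteq> points C" by (auto simp: A'_def)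
    show "points C \<subseteq> (\<Union>j\<in>r ` J. A' j)"
    proof
      fix c assume c: "c \<in> points C"
      have "{i. i \<in> I \<and> \<mu> i (f c) \<noteq> 0} \<noteq> {}"
      proof
        assume "{i. i \<in> I \<and> \<mu> i (f c) \<noteq> 0} = {}"
        with one[OF fp[OF c]] show False by simp
      qed
      then obtain i where i: "i \<in> I" "\<mu> i (f c) \<noteq> 0" by blast
      have iJ: "i \<in> J" using i c by (auto simp: J_def)
      have "f c \<in> A i" using insup[OF i(1) fp[OF c] i(2)] sup i(1) by blast
      then have "c \<in> A' (r i)" using c by (simp add: A'_def hr[OF iJ])
      with iJ show "c \<in> (\<Union>j\<in>r ` J. A' j)" by blast
    qed
  qed
  have op': "D_open C (A' j)" "Triv' (A' j)" if j: "j \<in> r ` J" for j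
  proof -
    have i: "h j \<in> I" using h(1)[OF j] JI by blast
    show "D_open C (A' j)" unfolding A'_def by (rule D_open_preimage[OF f C]) (use A(1) i in blast)
    show "Triv' (A' j)" unfolding A'_def by (rule Triv) (use tr i in blast)
  qed
  show ?thesis
    unfolding D_numerable_cover_def
    using op' cov pu' sup' by (intro exI[of _ "r ` J"] exI[of _ A'] exI[of _ \<nu>] conjI ballI)
qed

lemma D_numerable_cover_mono:
  assumes "D_numerable_cover B Triv" "\<And>A. Triv A \<Longrightarrow> Triv' A"
  shows "D_numerable_cover B Triv'"
proof -
  obtain I :: "('a \<times> nat) set" and A \<mu> where *: "\<forall>i\<in>I. D_open B (A i)" "(\<Union>i\<in>I. A i) = points B"
    "smooth_partition_of_unity B I \<mu>" "\<forall>i\<in>I. D_support B (\<mu> i) \<subseteq> A i" and tr: "\<forall>i\<in>I. Triv (A i)"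
    using assms(1) unfolding D_numerable_cover_def by (elim exE conjE)
  have "\<forall>i\<in>I. Triv' (A i)" using tr assms(2) by simp
  with * show ?thesis
    unfolding D_numerable_cover_def by (intro exI[of _ I] exI[of _ A] exI[of _ \<mu>] conjI)
qed

text \<open>A section s over A gives the section c \<mapsto> (c, s (f c)) over the preimage of A.\<close>

lemma trivial_gbundle_over_pullback:
  assumes P: "gspace_over G B P" "torsor_action G P" and C: "diffeological_space C" and f: "smooth_map C B f"
    and tr: "trivial_gbundle_over G B P A"
  shows "trivial_gbundle_over G C (pullback_gbundle C f P) {c \<in> points C. f c \<in> A}"
proof -
  obtain s where s: "smooth_section B P A s" by (rule trivial_gbundle_over_section[OF P(1) tr])
  then have s1: "smooth_map (sub_space B A) (gtotal P) s" by (simp add: smooth_section_def)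
  have s2: "gproj P (s b) = b" if "b \<in> points B" "b \<in> A" for b using s that by (simp add: smooth_section_def)
  let ?A = "{c \<in> points C. f c \<in> A}"
  have "smooth_section C (pullback_gbundle C f P) ?A (\<lambda>c. (c, s (f c)))"
    unfolding smooth_section_def
  proof (intro conjI ballI smooth_mapI)
    show "(c, s (f c)) \<in> points (gtotal (pullback_gbundle C f P))" if "c \<in> points (sub_space C ?A)" for c
      using that s2 smooth_map_point[OF f] smooth_map_point[OF s1] by simp
    fix n U p assume p: "p \<in> plots (sub_space C ?A) n U"
    then have pC: "p \<in> plots C n U" and pA: "\<And>u. u \<in> U \<Longrightarrow> f (p u) \<in> A" by (auto simp: plots_sub_space)
    have "(\<lambda>u. f (p u)) \<in> plots (sub_space B A) n U"
      using smooth_map_plot[OF f pC] pA by (simp add: plots_sub_space)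
    from smooth_map_plot[OF s1 this] pC
    show "(\<lambda>u. (p u, s (f (p u)))) \<in> plots (gtotal (pullback_gbundle C f P)) n U"
      unfolding plots_pullback_gbundle
      using s2 pA smooth_map_point[OF f plot_point[OF C pC]] by simp
  qed simp
  then show ?thesis by (rule section_trivial_gbundle_over[OF pullback_gspace_over[OF P(1) C f] pullback_torsor[OF P C f]])
qed

lemma D_numerable_gbundle_pullback:
  assumes P: "gspace_over G B P" "torsor_action G P" and C: "diffeological_space C" and f: "smooth_map C B f"
    and num: "D_numerable_gbundle G B P"
  shows "D_numerable_gbundle G C (pullback_gbundle C f P)"
  unfolding D_numerable_gbundle_def
  by (rule D_numerable_cover_pullback[OF num[unfolded D_numerable_gbundle_def] f C gspace_overD(2)[OF P(1)]])
    (rule trivial_gbundle_over_pullback[OF P C f])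

lemma D_numerable_gbundle_iso:
  assumes P: "gspace_over G B P" "torsor_action G P" and Q: "gspace_over G B Q" and i: "gbundle_iso G P Q"
    and num: "D_numerable_gbundle G B P"
  shows "D_numerable_gbundle G B Q"
  unfolding D_numerable_gbundle_def
  by (rule D_numerable_cover_mono[OF num[unfolded D_numerable_gbundle_def]])
    (rule trivial_gbundle_over_iso[OF P Q i])


section \<open>The correspondence on isomorphism classes\<close>

text \<open>
  The relation between bundles obtained by forgetting the pairing itself. Together with the
  isomorphism relations on both sides it induces the bijection of isomorphism classes.
\<close>

definition frame_paired :: "'v dvs \<Rightarrow> 'b diffspace \<Rightarrow> ('b, 'e, 'v \<Rightarrow> 'v) gbundle \<Rightarrow> ('b, 'f) vbundle \<Rightarrow> bool" where
  "frame_paired V B P F \<longleftrightarrow> principal_bundle (GL V) B P \<and> dvs_over B F \<and> (\<exists>ev. frame_pairing V B P F ev)"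

lemma prin_class_eq:
  assumes P: "gspace_over G B P" and i: "gbundle_iso G P Q"
  shows "prin_class G B P = prin_class G B Q"
  using gbundle_iso_trans[OF gbundle_iso_sym[OF P i]] gbundle_iso_trans[OF i]
  unfolding prin_class_def by blast

lemma prin_class_in_Prin:
  fixes P :: "('b, 'e, 'g) gbundle"
  assumes P: "principal_bundle G B P"
  shows "prin_class G B P \<in> Prin G B" "D_numerable_gbundle G B P \<Longrightarrow> prin_class G B P \<in> Prin_D G B"
    "prin_class G B P \<noteq> {}"
proof -
  note Pg = principal_bundle_gspace_over[OF P]
  obtain Q :: "('b, 'b \<times> 'g, 'g) gbundle" where Q: "principal_bundle G B Q" "gbundle_iso G P Q"
    using principal_bundle_standard[OF P] by blast
  note eq = prin_class_eq[OF Pg Q(2)]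
  show "prin_class G B P \<in> Prin G B" unfolding Prin_def eq using Q(1) by blast
  show "prin_class G B P \<in> Prin_D G B" if "D_numerable_gbundle G B P"
    unfolding Prin_D_def eq
    using Q(1) D_numerable_gbundle_iso[OF Pg principal_bundle_torsor[OF P] principal_bundle_gspace_over[OF Q(1)] Q(2) that]
    by blast
  show "prin_class G B P \<noteq> {}" unfolding prin_class_def using Q by blast
qed

lemma vb_class_eq:
  assumes F: "dvs_over B F" and F': "dvs_over B F'" and i: "vbundle_iso B F F'"
  shows "vb_class V B F = vb_class V B F'"
  using vbundle_iso_trans[OF F' F vbundle_iso_sym[OF F i]] vbundle_iso_trans[OF F F' i]
  unfolding vb_class_def by blast

context
  fixes V :: "'v dvs"
  assumes V: "diffeological_vector_space V"
begin

lemma frame_pairedD: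
  assumes "frame_paired V B P F"
  shows "principal_bundle (GL V) B P" "vector_bundle V B F" "dvs_over B F" "gspace_over (GL V) B P"
    "D_numerable_gbundle (GL V) B P \<longleftrightarrow> D_numerable_vbundle V B F"
proof -
  obtain ev where P: "principal_bundle (GL V) B P" and F: "dvs_over B F" and ev: "frame_pairing V B P F ev"
    using assms unfolding frame_paired_def by blast
  note Pg = principal_bundle_gspace_over[OF P]
  show "principal_bundle (GL V) B P" "dvs_over B F" "gspace_over (GL V) B P" by (rule P, rule F, rule Pg)
  show "vector_bundle V B F" using frame_pairing_principal_iff[OF V Pg F ev] P by simp
  show "D_numerable_gbundle (GL V) B P \<longleftrightarrow> D_numerable_vbundle V B F"
    by (rule frame_pairing_numerable_iff[OF V Pg F ev])
qed

lemma frame_paired_assoc: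
  assumes "principal_bundle (GL V) B P"
  shows "frame_paired V B P (assoc_bundle V P)"
  unfolding frame_paired_def using assms assoc_bundle_dvs_over[OF V assms] assoc_bundle_pairing[OF V assms] by blast

lemma vector_bundle_dvs_over: "vector_bundle V B F \<Longrightarrow> dvs_over B F"
  by (simp add: vector_bundle_def)

lemma frame_paired_frame_bundle:
  assumes F: "vector_bundle V B F"
  shows "frame_paired V B (frame_bundle V B F) F"
proof -
  note Fo = vector_bundle_dvs_over[OF F]
  show ?thesis
    unfolding frame_paired_def
    using frame_pairing_principal_iff[OF V frame_bundle_gspace_over[OF V Fo] Fo frame_bundle_pairing[OF V Fo]] F Fo
      frame_bundle_pairing[OF V Fo] by blast
qed

lemma frame_paired_pullback:
  assumes PF: "frame_paired V B P F" and C: "diffeological_space C" and f: "smooth_map C B f"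
  shows "frame_paired V C (pullback_gbundle C f P) (pullback_vbundle C f F)"
proof -
  obtain ev where ev: "frame_pairing V B P F ev" using PF unfolding frame_paired_def by blast
  note D = frame_pairedD[OF PF]
  show ?thesis
    unfolding frame_paired_def
    using pullback_principal_bundle[OF D(1) C f] pullback_dvs_over[OF D(3) C f]
      frame_pairing_pullback[OF V D(4,3) ev C f] by blast
qed

lemma frame_paired_iso_left:
  assumes PF: "frame_paired V B P F" and Q: "principal_bundle (GL V) B Q" and i: "gbundle_iso (GL V) P Q"
  shows "frame_paired V B Q F"
proof -
  obtain ev where ev: "frame_pairing V B P F ev" using PF unfolding frame_paired_def by blast
  note D = frame_pairedD[OF PF]
  show ?thesis
    unfolding frame_paired_def
    using Q D(3) frame_pairing_gbundle_iso[OF V D(3,4) principal_bundle_gspace_over[OF Q] ev i] by blast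
qed

lemma frame_paired_iso_right:
  assumes PF: "frame_paired V B P F" and F': "dvs_over B F'" and i: "vbundle_iso B F F'"
  shows "frame_paired V B P F'"
proof -
  obtain ev where ev: "frame_pairing V B P F ev" using PF unfolding frame_paired_def by blast
  note D = frame_pairedD[OF PF]
  show ?thesis
    unfolding frame_paired_def using D(1) F' frame_pairing_vbundle_iso[OF V D(3) F' D(4) ev i] by blast
qed

lemma frame_paired_unique_left:
  assumes PF: "frame_paired V B P F" and QF: "frame_paired V B Q F"
  shows "gbundle_iso (GL V) P Q"
proof -
  obtain ev ev' where ev: "frame_pairing V B P F ev" "frame_pairing V B Q F ev'"
    using PF QF unfolding frame_paired_def by blast
  show ?thesis by (rule frame_pairing_gbundle_unique[OF V frame_pairedD(4)[OF PF] ev(1) frame_pairedD(4)[OF QF] ev(2)])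
qed

lemma frame_paired_unique_right:
  assumes PF: "frame_paired V B P F" and PF': "frame_paired V B P F'"
  shows "vbundle_iso B F F'"
proof -
  obtain ev ev' where ev: "frame_pairing V B P F ev" "frame_pairing V B P F' ev'"
    using PF PF' unfolding frame_paired_def by blast
  show ?thesis
    by (rule frame_pairing_vbundle_unique[OF V frame_pairedD(1)[OF PF] frame_pairedD(3)[OF PF] ev(1) frame_pairedD(3)[OF PF'] ev(2)])
qed

text \<open>
  The vector x is determined by its projection and its coordinates in a frame chosen over each point
  of the base.
\<close>

lemma vector_bundle_standard:
  fixes F :: "('b, 'f) vbundle"
  assumes F: "vector_bundle V B F"
  shows "\<exists>F' :: ('b, 'b \<times> 'v) vbundle. dvs_over B F' \<and> vbundle_iso B F F'"
proof -
  note Fo = vector_bundle_dvs_over[OF F] and PF = frame_paired_frame_bundle[OF F]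
  let ?P = "frame_bundle V B F"
  obtain ev where ev: "frame_pairing V B ?P F ev" using PF unfolding frame_paired_def by blast
  note fr = frame_pairingD(1)[OF V ev]
  note L = linear_bijD[OF frame_alongD(1)[OF fr]]
  have "\<exists>y\<in>points (gtotal ?P). gproj ?P y = b" if "b \<in> points B" for b
    using local_lifts_point[OF frame_pairedD(4)[OF PF] principal_bundle_local_lifts[OF frame_pairedD(1)[OF PF]] that] by metis
  then obtain s where s: "\<And>b. b \<in> points B \<Longrightarrow> s b \<in> points (gtotal ?P)" "\<And>b. b \<in> points B \<Longrightarrow> gproj ?P (s b) = b"
    by metis
  let ?\<phi> = "\<lambda>x. (bproj F x, inv_into (vecs V) (ev (s (bproj F x))) x)"
  have inj: "inj_on ?\<phi> (points (btotal F))"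
  proof (rule inj_onI)
    have *: "ev (s (bproj F x)) (inv_into (vecs V) (ev (s (bproj F x))) x) = x" if "x \<in> points (btotal F)" for x
      using dvs_overD(4)[OF Fo that] by (intro L(7)) (simp_all add: s that)
    fix x y assume x: "x \<in> points (btotal F)" and y: "y \<in> points (btotal F)" and e: "?\<phi> x = ?\<phi> y"
    from e have "bproj F x = bproj F y"
      "inv_into (vecs V) (ev (s (bproj F x))) x = inv_into (vecs V) (ev (s (bproj F y))) y" by auto
    with *[OF x] *[OF y] show "x = y" by metis
  qed
  show ?thesis using image_vbundle[OF Fo inj] by blast
qed

lemma vb_class_in_VB:
  fixes F :: "('b, 'f) vbundle"
  assumes F: "vector_bundle V B F"
  shows "vb_class V B F \<in> VB V B" "D_numerable_vbundle V B F \<Longrightarrow> vb_class V B F \<in> VB_D V B"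
    "vb_class V B F \<noteq> {}"
proof -
  note Fo = vector_bundle_dvs_over[OF F] and PF = frame_paired_frame_bundle[OF F]
  obtain F' :: "('b, 'b \<times> 'v) vbundle" where F': "dvs_over B F'" "vbundle_iso B F F'"
    using vector_bundle_standard[OF F] by blast
  note PF' = frame_paired_iso_right[OF PF F']
  note eq = vb_class_eq[OF Fo F']
  show "vb_class V B F \<in> VB V B" unfolding VB_def eq using frame_pairedD(2)[OF PF'] by blast
  show "vb_class V B F \<in> VB_D V B" if "D_numerable_vbundle V B F"
  proof -
    have "D_numerable_vbundle V B F'" using that frame_pairedD(5)[OF PF] frame_pairedD(5)[OF PF'] by simp
    then show ?thesis unfolding VB_D_def eq using frame_pairedD(2)[OF PF'] by blast
  qed
  show "vb_class V B F \<noteq> {}" unfolding vb_class_def using frame_pairedD(2)[OF PF'] F'(2) by blast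
qed

lemma vb_class_unique:
  assumes PF: "frame_paired V B P F" and PF': "frame_paired V B P F'"
  shows "vb_class V B F = vb_class V B F'"
  by (rule vb_class_eq[OF frame_pairedD(3)[OF PF] frame_pairedD(3)[OF PF'] frame_paired_unique_right[OF PF PF']])

text \<open>
  The class of a bundle F paired with P does not depend on the representative of the class of P: any
  representative Q is paired with F as well, and F is then isomorphic to the bundle associated to Q.
\<close>

lemma assoc_prin_class:
  assumes PF: "frame_paired V B P F"
  shows "assoc V B (prin_class (GL V) B P) = vb_class V B F"
proof -
  have "vb_class V B (assoc_bundle V Q) = vb_class V B F" if "Q \<in> prin_class (GL V) B P" for Q
  proof -
    from that have Q: "principal_bundle (GL V) B Q" "gbundle_iso (GL V) P Q" by (simp_all add: prin_class_def)
    show ?thesis by (rule vb_class_unique[OF frame_paired_assoc[OF Q(1)] frame_paired_iso_left[OF PF Q]])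
  qed
  then show ?thesis
    unfolding assoc_def using prin_class_in_Prin(3)[OF frame_pairedD(1)[OF PF]] by simp
qed

lemma Prin_pullback_prin_class:
  assumes P: "principal_bundle (GL V) B P" and C: "diffeological_space C" and f: "smooth_map C B f"
  shows "Prin_pullback (GL V) C f (prin_class (GL V) B P) = prin_class (GL V) C (pullback_gbundle C f P)"
proof -
  note PF = frame_paired_assoc[OF P]
  have "prin_class (GL V) C (pullback_gbundle C f Q) = prin_class (GL V) C (pullback_gbundle C f P)"
    if "Q \<in> prin_class (GL V) B P" for Q
  proof -
    from that have Q: "principal_bundle (GL V) B Q" "gbundle_iso (GL V) P Q" by (simp_all add: prin_class_def)
    note QF = frame_paired_pullback[OF frame_paired_iso_left[OF PF Q] C f]
    show ?thesis
      by (rule prin_class_eq[OF frame_pairedD(4)[OF QF] frame_paired_unique_left[OF QF frame_paired_pullback[OF PF C f]]])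
  qed
  then show ?thesis
    unfolding Prin_pullback_def using prin_class_in_Prin(3)[OF P] by simp
qed

lemma VB_pullback_vb_class:
  assumes F: "vector_bundle V B F" and C: "diffeological_space C" and f: "smooth_map C B f"
  shows "VB_pullback V C f (vb_class V B F) = vb_class V C (pullback_vbundle C f F)"
proof -
  note PF = frame_paired_frame_bundle[OF F]
  have "vb_class V C (pullback_vbundle C f F') = vb_class V C (pullback_vbundle C f F)"
    if "F' \<in> vb_class V B F" for F'
  proof -
    from that have F': "vector_bundle V B F'" "vbundle_iso B F F'" by (simp_all add: vb_class_def)
    show ?thesis
      by (rule vb_class_unique[OF frame_paired_pullback[OF frame_paired_iso_right[OF PF vector_bundle_dvs_over[OF F'(1)] F'(2)] C f]
          frame_paired_pullback[OF PF C f]])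
  qed
  then show ?thesis
    unfolding VB_pullback_def using vb_class_in_VB(3)[OF F] by simp
qed

text \<open>
  If the bundles associated to P and P' have the same class, then P and P' are paired with one and
  the same vector bundle, so they are isomorphic.
\<close>

lemma inj_on_assoc:
  fixes B :: "'b diffspace"
  shows "inj_on (assoc V B) (Prin (GL V) B)"
proof (rule inj_onI)
  fix K K' assume "K \<in> Prin (GL V) B" "K' \<in> Prin (GL V) B" and eq: "assoc V B K = assoc V B K'"
  then obtain P P' :: "('b, 'b \<times> ('v \<Rightarrow> 'v), 'v \<Rightarrow> 'v) gbundle" where
    P: "principal_bundle (GL V) B P" "K = prin_class (GL V) B P" and
    P': "principal_bundle (GL V) B P'" "K' = prin_class (GL V) B P'" unfolding Prin_def by blast
  note PF = frame_paired_assoc[OF P(1)] and PF' = frame_paired_assoc[OF P'(1)]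
  let ?F = "assoc_bundle V P" and ?F' = "assoc_bundle V P'"
  have eq': "vb_class V B ?F = vb_class V B ?F'"
    using eq unfolding P(2) P'(2) assoc_prin_class[OF PF] assoc_prin_class[OF PF'] .
  obtain F where "F \<in> vb_class V B ?F" using vb_class_in_VB(3)[OF frame_pairedD(2)[OF PF]] by blast
  moreover from this have "F \<in> vb_class V B ?F'" unfolding eq' .
  ultimately have F: "vector_bundle V B F" "vbundle_iso B ?F F" "vbundle_iso B ?F' F"
    by (simp_all add: vb_class_def)
  note Fo = vector_bundle_dvs_over[OF F(1)]
  have "gbundle_iso (GL V) P P'"
    by (rule frame_paired_unique_left[OF frame_paired_iso_right[OF PF Fo F(2)] frame_paired_iso_right[OF PF' Fo F(3)]])
  then show "K = K'" unfolding P(2) P'(2) by (rule prin_class_eq[OF principal_bundle_gspace_over[OF P(1)]])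
qed

lemma bij_betw_assoc:
  fixes B :: "'b diffspace"
  shows "bij_betw (assoc V B) (Prin (GL V) B) (VB V B)"
    "bij_betw (assoc V B) (Prin_D (GL V) B) (VB_D V B)"
proof -
  have sub: "Prin_D (GL V) B \<subseteq> Prin (GL V) B" unfolding Prin_D_def Prin_def by blast
  have a: "assoc V B K \<in> VB V B" if "K \<in> Prin (GL V) B" for K
  proof -
    from that obtain P :: "('b, 'b \<times> ('v \<Rightarrow> 'v), 'v \<Rightarrow> 'v) gbundle" where
      P: "principal_bundle (GL V) B P" "K = prin_class (GL V) B P" unfolding Prin_def by blast
    note PF = frame_paired_assoc[OF P(1)]
    show ?thesis unfolding P(2) assoc_prin_class[OF PF] by (rule vb_class_in_VB(1)[OF frame_pairedD(2)[OF PF]])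
  qed
  have b: "assoc V B K \<in> VB_D V B" if "K \<in> Prin_D (GL V) B" for K
  proof -
    from that obtain P :: "('b, 'b \<times> ('v \<Rightarrow> 'v), 'v \<Rightarrow> 'v) gbundle" where
      P: "principal_bundle (GL V) B P" "D_numerable_gbundle (GL V) B P" "K = prin_class (GL V) B P"
      unfolding Prin_D_def by blast
    note PF = frame_paired_assoc[OF P(1)]
    show ?thesis unfolding P(3) assoc_prin_class[OF PF]
      using vb_class_in_VB(2)[OF frame_pairedD(2)[OF PF]] frame_pairedD(5)[OF PF] P(2) by blast
  qed
  have c: "\<exists>K\<in>Prin (GL V) B. assoc V B K = L" if "L \<in> VB V B" for L
  proof -
    from that obtain F :: "('b, 'b \<times> 'v) vbundle" where F: "vector_bundle V B F" "L = vb_class V B F" unfolding VB_def by blast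
    note PF = frame_paired_frame_bundle[OF F(1)]
    show ?thesis unfolding F(2) using assoc_prin_class[OF PF] prin_class_in_Prin(1)[OF frame_pairedD(1)[OF PF]] by blast
  qed
  have d: "\<exists>K\<in>Prin_D (GL V) B. assoc V B K = L" if "L \<in> VB_D V B" for L
  proof -
    from that obtain F :: "('b, 'b \<times> 'v) vbundle" where
      F: "vector_bundle V B F" "D_numerable_vbundle V B F" "L = vb_class V B F" unfolding VB_D_def by blast
    note PF = frame_paired_frame_bundle[OF F(1)]
    show ?thesis unfolding F(3)
      using assoc_prin_class[OF PF] prin_class_in_Prin(2)[OF frame_pairedD(1)[OF PF]] frame_pairedD(5)[OF PF] F(2) by blast
  qed
  show "bij_betw (assoc V B) (Prin (GL V) B) (VB V B)"
    unfolding bij_betw_def using inj_on_assoc a c by blast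
  show "bij_betw (assoc V B) (Prin_D (GL V) B) (VB_D V B)"
    unfolding bij_betw_def using inj_on_subset[OF inj_on_assoc sub] b d by blast
qed

lemma pullback_classes:
  fixes B :: "'b diffspace" and C :: "'c diffspace"
  assumes B: "diffeological_space B" and C: "diffeological_space C" and f: "smooth_map C B f"
  shows "Prin_pullback (GL V) C f \<in> Prin (GL V) B \<rightarrow> Prin (GL V) C"
    "Prin_pullback (GL V) C f \<in> Prin_D (GL V) B \<rightarrow> Prin_D (GL V) C"
    "VB_pullback V C f \<in> VB V B \<rightarrow> VB V C"
    "VB_pullback V C f \<in> VB_D V B \<rightarrow> VB_D V C"
proof -
  show "Prin_pullback (GL V) C f \<in> Prin (GL V) B \<rightarrow> Prin (GL V) C"
  proof
    fix K assume "K \<in> Prin (GL V) B"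
    then obtain P :: "('b, 'b \<times> ('v \<Rightarrow> 'v), 'v \<Rightarrow> 'v) gbundle" where
      P: "principal_bundle (GL V) B P" "K = prin_class (GL V) B P" unfolding Prin_def by blast
    show "Prin_pullback (GL V) C f K \<in> Prin (GL V) C"
      unfolding P(2) Prin_pullback_prin_class[OF P(1) C f]
      by (rule prin_class_in_Prin(1)[OF pullback_principal_bundle[OF P(1) C f]])
  qed
  show "Prin_pullback (GL V) C f \<in> Prin_D (GL V) B \<rightarrow> Prin_D (GL V) C"
  proof
    fix K assume "K \<in> Prin_D (GL V) B"
    then obtain P :: "('b, 'b \<times> ('v \<Rightarrow> 'v), 'v \<Rightarrow> 'v) gbundle" where
      P: "principal_bundle (GL V) B P" "D_numerable_gbundle (GL V) B P" "K = prin_class (GL V) B P"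
      unfolding Prin_D_def by blast
    show "Prin_pullback (GL V) C f K \<in> Prin_D (GL V) C"
      unfolding P(3) Prin_pullback_prin_class[OF P(1) C f]
      by (rule prin_class_in_Prin(2)[OF pullback_principal_bundle[OF P(1) C f]
          D_numerable_gbundle_pullback[OF principal_bundle_gspace_over[OF P(1)] principal_bundle_torsor[OF P(1)] C f P(2)]])
  qed
  show "VB_pullback V C f \<in> VB V B \<rightarrow> VB V C"
  proof
    fix L assume "L \<in> VB V B"
    then obtain F :: "('b, 'b \<times> 'v) vbundle" where F: "vector_bundle V B F" "L = vb_class V B F" unfolding VB_def by blast
    show "VB_pullback V C f L \<in> VB V C"
      unfolding F(2) VB_pullback_vb_class[OF F(1) C f]
      by (rule vb_class_in_VB(1)[OF frame_pairedD(2)[OF frame_paired_pullback[OF frame_paired_frame_bundle[OF F(1)] C f]]])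
  qed
  show "VB_pullback V C f \<in> VB_D V B \<rightarrow> VB_D V C"
  proof
    fix L assume "L \<in> VB_D V B"
    then obtain F :: "('b, 'b \<times> 'v) vbundle" where
      F: "vector_bundle V B F" "D_numerable_vbundle V B F" "L = vb_class V B F" unfolding VB_D_def by blast
    note PF = frame_paired_frame_bundle[OF F(1)]
    note PF' = frame_paired_pullback[OF PF C f]
    have "D_numerable_gbundle (GL V) B (frame_bundle V B F)" using frame_pairedD(5)[OF PF] F(2) by simp
    from D_numerable_gbundle_pullback[OF frame_pairedD(4)[OF PF] principal_bundle_torsor[OF frame_pairedD(1)[OF PF]] C f this]
    have "D_numerable_vbundle V C (pullback_vbundle C f F)" using frame_pairedD(5)[OF PF'] by simp
    then show "VB_pullback V C f L \<in> VB_D V C"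
      unfolding F(3) VB_pullback_vb_class[OF F(1) C f] by (rule vb_class_in_VB(2)[OF frame_pairedD(2)[OF PF']])
  qed
qed

lemma assoc_natural:
  fixes B :: "'b diffspace" and C :: "'c diffspace"
  assumes C: "diffeological_space C" and f: "smooth_map C B f" and K: "K \<in> Prin (GL V) B"
  shows "assoc V C (Prin_pullback (GL V) C f K) = VB_pullback V C f (assoc V B K)"
proof -
  from K obtain P :: "('b, 'b \<times> ('v \<Rightarrow> 'v), 'v \<Rightarrow> 'v) gbundle" where
    P: "principal_bundle (GL V) B P" "K = prin_class (GL V) B P" unfolding Prin_def by blast
  note PF = frame_paired_assoc[OF P(1)]
  show ?thesis
    unfolding P(2) Prin_pullback_prin_class[OF P(1) C f] assoc_prin_class[OF PF]
      assoc_prin_class[OF frame_paired_pullback[OF PF C f]] VB_pullback_vb_class[OF frame_pairedD(2)[OF PF] C f] ..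
qed

end

theorem theorem7p7:
  fixes V :: "'v dvs"
  assumes "diffeological_vector_space V"
  shows
    "(\<forall>B :: 'b diffspace. diffeological_space B \<longrightarrow>
        (\<forall>P :: ('b, 'e, 'v \<Rightarrow> 'v) gbundle. principal_bundle (GL V) B P \<longrightarrow>
           prin_class (GL V) B P \<in> Prin (GL V) B \<and>
           (D_numerable_gbundle (GL V) B P \<longrightarrow> prin_class (GL V) B P \<in> Prin_D (GL V) B) \<and>
           vector_bundle V B (assoc_bundle V P) \<and>
           assoc V B (prin_class (GL V) B P) = vb_class V B (assoc_bundle V P)) \<and>
        (\<forall>F :: ('b, 'f) vbundle. vector_bundle V B F \<longrightarrow>
           vb_class V B F \<in> VB V B \<and>
           (D_numerable_vbundle V B F \<longrightarrow> vb_class V B F \<in> VB_D V B)) \<and>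
        bij_betw (assoc V B) (Prin (GL V) B) (VB V B) \<and>
        bij_betw (assoc V B) (Prin_D (GL V) B) (VB_D V B)) \<and>
     (\<forall>(B :: 'b diffspace) (C :: 'c diffspace) f.
        diffeological_space B \<longrightarrow> diffeological_space C \<longrightarrow> smooth_map C B f \<longrightarrow>
        Prin_pullback (GL V) C f \<in> Prin (GL V) B \<rightarrow> Prin (GL V) C \<and>
        Prin_pullback (GL V) C f \<in> Prin_D (GL V) B \<rightarrow> Prin_D (GL V) C \<and>
        VB_pullback V C f \<in> VB V B \<rightarrow> VB V C \<and>
        VB_pullback V C f \<in> VB_D V B \<rightarrow> VB_D V C \<and>
        (\<forall>K\<in>Prin (GL V) B. assoc V C (Prin_pullback (GL V) C f K) =
                            VB_pullback V C f (assoc V B K)))"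
proof (intro conjI allI impI ballI)
  fix B :: "'b diffspace" and P :: "('b, 'e, 'v \<Rightarrow> 'v) gbundle"
  assume P: "principal_bundle (GL V) B P"
  note PF = frame_paired_assoc[OF assms P]
  show "prin_class (GL V) B P \<in> Prin (GL V) B" by (rule prin_class_in_Prin(1)[OF P])
  show "prin_class (GL V) B P \<in> Prin_D (GL V) B" if "D_numerable_gbundle (GL V) B P"
    by (rule prin_class_in_Prin(2)[OF P that])
  show "vector_bundle V B (assoc_bundle V P)" by (rule frame_pairedD(2)[OF assms PF])
  show "assoc V B (prin_class (GL V) B P) = vb_class V B (assoc_bundle V P)" by (rule assoc_prin_class[OF assms PF])
next
  fix B :: "'b diffspace" and F :: "('b, 'f) vbundle"
  assume F: "vector_bundle V B F"
  show "vb_class V B F \<in> VB V B" by (rule vb_class_in_VB(1)[OF assms F])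
  show "vb_class V B F \<in> VB_D V B" if "D_numerable_vbundle V B F" by (rule vb_class_in_VB(2)[OF assms F that])
next
  fix B :: "'b diffspace"
  show "bij_betw (assoc V B) (Prin (GL V) B) (VB V B)" "bij_betw (assoc V B) (Prin_D (GL V) B) (VB_D V B)"
    by (rule bij_betw_assoc[OF assms])+
next
  fix B :: "'b diffspace" and C :: "'c diffspace" and f
  assume B: "diffeological_space B" and C: "diffeological_space C" and f: "smooth_map C B f"
  show "Prin_pullback (GL V) C f \<in> Prin (GL V) B \<rightarrow> Prin (GL V) C"
    "Prin_pullback (GL V) C f \<in> Prin_D (GL V) B \<rightarrow> Prin_D (GL V) C"
    "VB_pullback V C f \<in> VB V B \<rightarrow> VB V C" "VB_pullback V C f \<in> VB_D V B \<rightarrow> VB_D V C"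
    by (rule pullback_classes[OF assms B C f])+
  show "assoc V C (Prin_pullback (GL V) C f K) = VB_pullback V C f (assoc V B K)" if "K \<in> Prin (GL V) B" for K
    by (rule assoc_natural[OF assms C f that])
qed

end
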